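(* There exist constants $A_{1}>0$, $A_{2}$ and $A_{3}$ such that for every positive integer $N$, every $\epsilon>0$ and every $\delta>0$, $$\mathbb{P}_{N}\left(\left\Vert \delta_{N}-d\sigma\right\Vert _{H_{0}^{-(2+\epsilon)}(X)}>\delta\right)\leq e^{-A_{1}N^{2}\delta^{2}+\frac{A_{2}}{\epsilon}+A_{3}}.$$
   Context: $X$ is the unit sphere in $\mathbb{R}^3$ with the Riemannian metric $g$ induced from the Euclidean metric, $dV_g$ is its area form (total mass $4\pi$) and $d\sigma=dV_g/(4\pi)$. Spherical ensemble: for a positive integer $N$, $\mathbb{P}_N$ is the probability measure on $X^N$ given by $d\mathbb{P}_N=\frac{1}{Z_N}\prod_{1\le i<j\le N}|x_i-x_j|^2\,d\sigma^{\otimes N}$, where $|\cdot|$ is the Euclidean norm on $\mathbb{R}^3$ and $Z_N$ is the normalizing constant. For a random configuration $(x_1,\dots,x_N)$ with law $\mathbb{P}_N$, $\delta_N:=\frac1N\sum_{i=1}^N\delta_{x_i}$ is the empirical measure. Sobolev spaces: $\Delta_g$ is the Laplace operator on $X$ with the sign convention making it nonnegative. For $s>0$ and $u\in C^\infty(X)$ put $\langle u,u\rangle_s:=\int_X u\,\Delta_g^s u\,dV_g$ (with $\Delta_g^s$ defined spectrally). $H_0^{-s}(X)$ is the space of distributions $\nu$ on $X$ with $\langle\nu,1\rangle=0$ and finite dual norm $$\|\nu\|_{H_0^{-s}(X)}:=\sup_{u\in C^\infty(X),\ \langle u,u\rangle_s\le 1}|\langle\nu,u\rangle|.$$ *)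

theory Defs
  imports "HOL-Analysis.Analysis"
begin

section \<open>Smooth functions on the unit sphere\<close>

abbreviation S2 :: "(real^3) set" where
  "S2 \<equiv> sphere 0 1"

primrec Ck_on :: "nat \<Rightarrow> 'a::real_normed_vector set \<Rightarrow> ('a \<Rightarrow> 'b::real_normed_vector) \<Rightarrow> bool" where
  "Ck_on 0 U f \<longleftrightarrow> continuous_on U f"
| "Ck_on (Suc k) U f \<longleftrightarrow> (\<forall>x\<in>U. f differentiable (at x)) \<and>
     (\<forall>v. Ck_on k U (\<lambda>x. frechet_derivative f (at x) v))"

text \<open>A function on the embedded submanifold \<^term>\<open>S2\<close> is smooth iff it is the restriction of
  a smooth function on an open neighbourhood.  Functions on \<^term>\<open>S2\<close> are kept extensional
  (undefined off the sphere), so that they are determined by their values on the sphere.\<close>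

definition smooth_S2 :: "(real^3 \<Rightarrow> real) set" where
  "smooth_S2 = {u \<in> extensional S2. \<exists>U F. open U \<and> S2 \<subseteq> U \<and> (\<forall>k. Ck_on k U F) \<and> (\<forall>x\<in>S2. F x = u x)}"


section \<open>Riemannian metric, area form and Laplace operator\<close>

definition partial :: "2 \<Rightarrow> (real^2 \<Rightarrow> 'b::real_normed_vector) \<Rightarrow> real^2 \<Rightarrow> 'b" where
  "partial i f p = frechet_derivative f (at p) (axis i 1)"

text \<open>The metric \<open>g\<^sub>i\<^sub>j = \<partial>\<^sub>i\<psi> \<bullet> \<partial>\<^sub>j\<psi>\<close> induced from the Euclidean one, in a local
  parametrization \<open>\<psi>\<close>, its area density \<open>sqrt (det g)\<close>, and the (nonnegative)
  Laplace--Beltrami operator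
  \<open>- 1/sqrt (det g) \<Sum>\<^sub>i \<partial>\<^sub>i (\<Sum>\<^sub>j sqrt (det g) g\<^sup>i\<^sup>j \<partial>\<^sub>j v)\<close> in that parametrization.\<close>

definition metric :: "(real^2 \<Rightarrow> real^3) \<Rightarrow> real^2 \<Rightarrow> real^2^2" where
  "metric \<psi> p = (\<chi> i j. partial i \<psi> p \<bullet> partial j \<psi> p)"

definition area_density :: "(real^2 \<Rightarrow> real^3) \<Rightarrow> real^2 \<Rightarrow> real" where
  "area_density \<psi> p = sqrt (det (metric \<psi> p))"

definition laplace_coord :: "(real^2 \<Rightarrow> real^3) \<Rightarrow> (real^2 \<Rightarrow> real) \<Rightarrow> real^2 \<Rightarrow> real" where
  "laplace_coord \<psi> v p =
     - (1 / area_density \<psi> p) *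
       (\<Sum>i\<in>UNIV. partial i
          (\<lambda>q. \<Sum>j\<in>UNIV. area_density \<psi> q * matrix_inv (metric \<psi> q) $ i $ j * partial j v q) p)"

text \<open>Inverse stereographic projection from the pole \<open>(0, 0, c)\<close>, where \<open>c = 1\<close> or \<open>c = -1\<close>:
  a bijection of the plane onto the sphere without that pole.\<close>

definition stereo :: "real \<Rightarrow> real^2 \<Rightarrow> real^3" where
  "stereo c p = vector [2 * p$1 / (1 + (norm p)\<^sup>2), 2 * p$2 / (1 + (norm p)\<^sup>2),
                        c * ((norm p)\<^sup>2 - 1) / (1 + (norm p)\<^sup>2)]"

text \<open>The image of \<^term>\<open>stereo 1\<close> is the sphere minus a point, which is a null set.\<close>

definition area_S2 :: "(real^3) measure" where
  "area_S2 = distr (density lborel (\<lambda>p. ennreal (area_density (stereo 1) p)))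
               (restrict_space borel S2) (stereo 1)"

definition sigma_S2 :: "(real^3) measure" where
  "sigma_S2 = scale_measure (ennreal (1 / (4 * pi))) area_S2"

text \<open>The two stereographic charts cover the sphere; since the Laplace operator does not depend
  on the coordinates, the second is used only at the point missed by the first.\<close>

definition laplace_S2 :: "(real^3 \<Rightarrow> real) \<Rightarrow> real^3 \<Rightarrow> real" where
  "laplace_S2 u x = (let \<psi> = (if x = axis 3 1 then stereo (-1) else stereo 1)
                     in laplace_coord \<psi> (u \<circ> \<psi>) (inv \<psi> x))"


section \<open>Spectral powers of the Laplace operator and dual Sobolev norms\<close>

definition eigenspace_S2 :: "real \<Rightarrow> (real^3 \<Rightarrow> real) set" where
  "eigenspace_S2 l = {f \<in> smooth_S2. \<forall>x\<in>S2. laplace_S2 f x = l * f x}"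

definition spectrum_S2 :: "real set" where
  "spectrum_S2 = {l. \<exists>f\<in>eigenspace_S2 l. \<exists>x\<in>S2. f x \<noteq> 0}"

text \<open>The orthogonal projection in \<open>L\<^sup>2\<close> onto an eigenspace.\<close>

definition eigenproj_S2 :: "real \<Rightarrow> (real^3 \<Rightarrow> real) \<Rightarrow> real^3 \<Rightarrow> real" where
  "eigenproj_S2 l u = (THE p. p \<in> eigenspace_S2 l \<and>
     (\<forall>f\<in>eigenspace_S2 l. (LINT x|area_S2. (u x - p x) * f x) = 0))"

text \<open>For smooth \<open>u\<close> the series converges absolutely; \<open>0 powr s = 0\<close>
  kills the constants, as it should for \<open>s > 0\<close>.\<close>

definition laplace_powr_S2 :: "real \<Rightarrow> (real^3 \<Rightarrow> real) \<Rightarrow> real^3 \<Rightarrow> real" where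
  "laplace_powr_S2 s u x = (\<Sum>\<^sub>\<infinity>l\<in>spectrum_S2. l powr s * eigenproj_S2 l u x)"

definition sobolev_form :: "real \<Rightarrow> (real^3 \<Rightarrow> real) \<Rightarrow> real" where
  "sobolev_form s u = (LINT x|area_S2. u x * laplace_powr_S2 s u x)"

text \<open>A distribution is given by its pairing with smooth functions.  The norm is
  \<open>[0, \<infinity>]\<close>-valued; it can be finite only if the distribution annihilates the constants,
  on which the Sobolev form vanishes.\<close>

definition dual_sobolev_norm :: "real \<Rightarrow> ((real^3 \<Rightarrow> real) \<Rightarrow> real) \<Rightarrow> ennreal" where
  "dual_sobolev_norm s \<nu> = (SUP u \<in> {u \<in> smooth_S2. sobolev_form s u \<le> 1}. ennreal \<bar>\<nu> u\<bar>)"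


section \<open>The spherical ensemble\<close>

definition sphere_config :: "nat \<Rightarrow> (nat \<Rightarrow> real^3) measure" where
  "sphere_config N = (\<Pi>\<^sub>M i\<in>{1..N}. sigma_S2)"

definition vandermonde_sq :: "nat \<Rightarrow> (nat \<Rightarrow> real^3) \<Rightarrow> real" where
  "vandermonde_sq N x = (\<Prod>j\<in>{1..N}. \<Prod>i\<in>{1..<j}. (norm (x i - x j))\<^sup>2)"

definition spherical_Z :: "nat \<Rightarrow> real" where
  "spherical_Z N = (LINT x|sphere_config N. vandermonde_sq N x)"

definition spherical_ensemble :: "nat \<Rightarrow> (nat \<Rightarrow> real^3) measure" where
  "spherical_ensemble N =
     density (sphere_config N) (\<lambda>x. ennreal (vandermonde_sq N x / spherical_Z N))"

text \<open>The push-forward of the uniform probability on the index set, i.e. \<open>1/N\<close> times the sum of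
  the Dirac masses at the \<open>x\<^sub>i\<close>, counted with multiplicity.\<close>

definition empirical_measure :: "nat \<Rightarrow> (nat \<Rightarrow> real^3) \<Rightarrow> (real^3) measure" where
  "empirical_measure N x = distr (uniform_count_measure {1..N}) (restrict_space borel S2) x"

definition measure_diff :: "(real^3) measure \<Rightarrow> (real^3) measure \<Rightarrow> (real^3 \<Rightarrow> real) \<Rightarrow> real" where
  "measure_diff \<mu> \<nu> u = (LINT x|\<mu>. u x) - (LINT x|\<nu>. u x)"

end

theory Submission
  imports Defs "HOL-Probability.Probability" "HOL-Real_Asymp.Real_Asymp" "Jordan_Normal_Form.Schur_Decomposition"
begin

text \<open>
  The linear statistic of a test function \<open>u\<close> is \<open>dev N x u = \<Sum>i. u (x i) - N * \<integral>u\<close>. Powers of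
  \<open>q(x, y) = (1 + x \<bullet> y) / 2\<close> are reproducing kernels of finite rank, and the operators
  \<open>avg n\<close> with kernels \<open>(n + 1) * q^n\<close> are diagonalized by the spherical harmonics; hence the
  squared dual norm is bounded, up to a constant, by \<open>1/N^2 * \<Sum>n. n powr -(2 + \<epsilon>) * QN n\<close>, where
  \<open>QN n = \<Sum>i,j. q(x i, x j)^n - N^2/(n + 1)\<close> is a sum of squares of linear statistics.

  The ensemble is determinantal with projection kernel \<open>K\<close>, \<open>|K|^2 = N^2 * q^(N - 1)\<close>. The product of
  the Laplace transforms at \<open>u\<close> and \<open>-u\<close> is \<open>det A * det B \<le> exp (tr (A * B) - N)\<close> for positive
  definite \<open>A\<close>, \<open>B\<close>, and the second factor is at least \<open>exp (-N * \<integral>u)\<close> by Jensen. This gives a bound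
  for the exponential moment of \<open>dev N x u\<close> in terms of
  \<open>\<integral>\<integral>exp (u x - u y) * N^2 * q(x, y)^(N - 1)\<close>.

  The Vandermonde density is itself at most \<open>exp (3 * N - Y/2)\<close> with \<open>Y = \<Sum>n. min (1/n) (N/n^2) * QN n\<close>,
  because \<open>1 - q \<le> exp (- \<Sum>n. q^n / n)\<close>; this settles deviations of order at least \<open>sqrt N\<close> and the
  frequencies \<open>n > N\<close>. For the other ones the exponential moment bound is averaged over a Gaussian
  field \<open>u\<close> with covariance proportional to \<open>\<Sum>n\<le>N. n powr -(2 + \<epsilon>) * q^n\<close>. Its Cameron--Martin shift
  \<open>v\<close> satisfies \<open>(v x - v y)^2 \<le> 4 * (1 - q) * Y\<close>, which is harmless where \<open>Y \<le> 12 * N\<close>, so that only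
  a quadratic form remains, and that form is controlled by the spectral decomposition.
\<close>

section \<open>The sphere in the stereographic chart\<close>

no_notation scalar_prod (infix "\<bullet>" 70)
no_notation vec_index (infixl "$" 100)
hide_const (open) Matrix.mat Matrix.vec Matrix.row Matrix.col Determinant.det
hide_fact (open) Matrix.vec_eq_iff Matrix.mat_def Matrix.vec_def Determinant.det_def


text \<open>The obstacle is the supremum over test functions inside the probability: the exponential
  moment bound holds for one \<open>u\<close> at a time. A Gaussian average replaces the supremum by
  the quadratic form \<open>X2\<close>; the price is a multiple of the trace
  \<open>\<Sum>n. n * b n\<close> with \<open>b n = n powr -(2 + \<epsilon>)\<close>, which is at
  most \<open>1 + 1/\<epsilon>\<close>, and this is the origin of \<open>A2 / \<epsilon>\<close>.
  The average alone is not enough, because the moment bound contains \<open>exp (u x - u y)\<close>,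
  which for a large shift grows exponentially and not quadratically. The level \<open>12 * N\<close>
  for \<open>Y\<close> is such that \<open>exp (3 * N - Y/2)\<close> is at most
  \<open>exp (-3 * N)\<close> beyond it. With Gaussian variance \<open>1/400\<close> the tilt gains
  \<open>X2 / 800\<close> and the quadratic remainder costs at most \<open>X2 / 1600\<close>. Of the
  threshold \<open>N^2 * \<delta>^2\<close> a factor 64 is lost in the duality and a factor 2 in
  splitting off the frequencies above \<open>N\<close>, so
  \<open>A1 = 1 / (128 * 1600)\<close>.\<close>

lemma norm2_sq: "(norm (p::real^2))\<^sup>2 = (p$1)\<^sup>2 + (p$2)\<^sup>2"
  by (simp add: norm_vec_def L2_set_def UNIV_2)

lemma inner3: "(x::real^3) \<bullet> y = x$1*y$1 + x$2*y$2 + x$3*y$3"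
  unfolding inner_vec_def sum_3 inner_real_def ..

lemma S2_coords: "x \<in> S2 \<longleftrightarrow> (x$1)\<^sup>2 + (x$2)\<^sup>2 + (x$3)\<^sup>2 = 1"
proof -
  have "x \<in> S2 \<longleftrightarrow> x \<bullet> x = 1"
    unfolding mem_sphere dist_0_norm by (rule norm_eq_1)
  then show ?thesis by (simp add: inner3 power2_eq_square)
qed

lemma vec3_eq_iff: "(x::real^3) = y \<longleftrightarrow> x$1 = y$1 \<and> x$2 = y$2 \<and> x$3 = y$3"
  by (simp add: vec_eq_iff forall_3)

lemma vec2_eq_iff: "(x::real^2) = y \<longleftrightarrow> x$1 = y$1 \<and> x$2 = y$2"
  by (simp add: vec_eq_iff forall_2)

text \<open>Half the conformal factor of the chart: \<open>stereo c\<close> scales lengths by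
  \<open>2 * conf\<close> when \<open>c\<^sup>2 = 1\<close>. Height and \<open>conf\<close>
  determine each other through the third coordinate \<open>c * (1 - 2 * conf p)\<close>.\<close>

definition conf :: "real^2 \<Rightarrow> real" where
  "conf p = 1 / (1 + (p$1)\<^sup>2 + (p$2)\<^sup>2)"

lemma conf_denom_pos: "1 + ((p::real^2)$1)\<^sup>2 + (p$2)\<^sup>2 > 0"
  by (simp add: add_pos_nonneg)

lemma conf_pos: "conf p > 0"
  by (simp add: conf_def conf_denom_pos)

lemma conf_eq: "conf p * (1 + (p$1)\<^sup>2 + (p$2)\<^sup>2) = 1"
  using conf_denom_pos[of p] by (simp add: conf_def)

lemma stereo_nth:
  "stereo c p $ 1 = 2 * p$1 * conf p" "stereo c p $ 2 = 2 * p$2 * conf p"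
  "stereo c p $ 3 = c * (1 - 2 * conf p)"
proof -
  show "stereo c p $ 3 = c * (1 - 2 * conf p)"
    using conf_denom_pos[of p] 
    by (simp add: stereo_def norm2_sq conf_def field_simps)
qed (simp_all add: stereo_def norm2_sq conf_def field_simps)

lemma stereo_axis: "stereo c p = (2 * p$1 * conf p) *\<^sub>R axis 1 1 + (2 * p$2 * conf p) *\<^sub>R axis 2 1
    + (c * (1 - 2 * conf p)) *\<^sub>R axis 3 1"
  by (simp add: vec3_eq_iff stereo_nth axis_def)

lemma has_derivative_conf:
  "(conf has_derivative (\<lambda>h. - 2 * (conf p)\<^sup>2 * (p$1 * h$1 + p$2 * h$2))) (at p)"
proof -
  have D: "((\<lambda>p::real^2. 1 + (p$1)\<^sup>2 + (p$2)\<^sup>2) has_derivative (\<lambda>h. 2 * (p$1 * h$1) + 2 * (p$2 * h$2))) (at p)"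
    by (auto intro!: derivative_eq_intros bounded_linear.has_derivative[OF bounded_linear_vec_nth])
  have "1 + (p$1)\<^sup>2 + (p$2)\<^sup>2 \<noteq> 0" using conf_denom_pos[of p] by linarith
  note inv = Deriv.has_derivative_inverse[OF this D]
  have c: "conf = (\<lambda>p. inverse (1 + (p$1)\<^sup>2 + (p$2)\<^sup>2))"
    by (simp add: fun_eq_iff conf_def inverse_eq_divide)
  have cp: "inverse (1 + (p$1)\<^sup>2 + (p$2)\<^sup>2) = conf p" by (simp add: c)
  show ?thesis 
    by (rule has_derivative_eq_rhs[OF inv[folded c, unfolded cp]]) (simp add: power2_eq_square algebra_simps)
qed

lemma has_derivative_stereo:
  "(stereo c has_derivative (\<lambda>h. (2 * h$1 * conf p - 4 * p$1 * (conf p)\<^sup>2 * (p$1 * h$1 + p$2 * h$2)) *\<^sub>R axis 1 1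
     + (2 * h$2 * conf p - 4 * p$2 * (conf p)\<^sup>2 * (p$1 * h$1 + p$2 * h$2)) *\<^sub>R axis 2 1
    + (4 * c * (conf p)\<^sup>2 * (p$1 * h$1 + p$2 * h$2)) *\<^sub>R axis 3 1)) (at p)"
proof -
  have "((\<lambda>p. (2 * p$1 * conf p) *\<^sub>R axis 1 1 + (2 * p$2 * conf p) *\<^sub>R axis 2 1
    + (c * (1 - 2 * conf p)) *\<^sub>R axis 3 1) has_derivative (\<lambda>h. (2 * h$1 * conf p - 4 * p$1 * (conf p)\<^sup>2 * (p$1 * h$1 + p$2 * h$2)) *\<^sub>R axis 1 1
     + (2 * h$2 * conf p - 4 * p$2 * (conf p)\<^sup>2 * (p$1 * h$1 + p$2 * h$2)) *\<^sub>R axis 2 1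
    + (4 * c * (conf p)\<^sup>2 * (p$1 * h$1 + p$2 * h$2)) *\<^sub>R (axis 3 1 :: real^3))) (at p)"
    apply (rule has_derivative_eq_rhs)
     apply (rule derivative_eq_intros refl bounded_linear.has_derivative[OF bounded_linear_vec_nth] has_derivative_ident has_derivative_conf)+
    apply (auto simp: fun_eq_iff algebra_simps)
    done
  then show ?thesis unfolding stereo_axis[abs_def] .
qed

lemma partial_eq: "(f has_derivative f') (at p) \<Longrightarrow> partial i f p = f' (axis i 1)"
  unfolding partial_def by (simp add: frechet_derivative_at[symmetric])

lemma partial_stereo_nth:
  "partial 1 (stereo c) p $ 1 = 2 * conf p - 4 * (p$1)\<^sup>2 * (conf p)\<^sup>2"
  "partial 1 (stereo c) p $ 2 = - 4 * p$1 * p$2 * (conf p)\<^sup>2"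
  "partial 1 (stereo c) p $ 3 = 4 * c * p$1 * (conf p)\<^sup>2"
  "partial 2 (stereo c) p $ 1 = - 4 * p$1 * p$2 * (conf p)\<^sup>2"
  "partial 2 (stereo c) p $ 2 = 2 * conf p - 4 * (p$2)\<^sup>2 * (conf p)\<^sup>2"
  "partial 2 (stereo c) p $ 3 = 4 * c * p$2 * (conf p)\<^sup>2"
  by (simp_all add: partial_eq[OF has_derivative_stereo] axis_def power2_eq_square)

lemma conf_sum_sq: "conf p * ((p$1)\<^sup>2 + (p$2)\<^sup>2) = 1 - conf p"
  using conf_eq[of p] by (simp add: algebra_simps)

text \<open>The chart is conformal. One computation with \<open>c\<^sup>2 = 1\<close> serves both
  poles; the three polynomial identities follow from \<open>c * c = 1\<close> and
  \<open>conf p * |p|^2 = 1 - conf p\<close>.\<close>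

lemma metric_stereo:
  assumes c: "c\<^sup>2 = 1"
  shows "metric (stereo c) p = (\<chi> i j. if i = j then 4 * (conf p)\<^sup>2 else 0)"
proof -
  define w a b where "w = conf p" and "a = p$1" and "b = p$2"
  have w: "w * (a\<^sup>2 + b\<^sup>2) = 1 - w" unfolding w_def a_def b_def by (rule conf_sum_sq)
  have e: "c * c = 1" using c by (simp add: power2_eq_square)
  have w2: "w*w*(a*a+b*b) = w - w*w" using w by (metis (no_types, lifting) mult.assoc mult.commute power2_eq_square right_diff_distrib mult.right_neutral)
  have 1: "(2 * w - 4 * a\<^sup>2 * w\<^sup>2)\<^sup>2 + (- 4 * a * b * w\<^sup>2)\<^sup>2 + (4 * c * a * w\<^sup>2)\<^sup>2 = 4 * w\<^sup>2"
    using e w2 by Groebner_Basis.algebra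
  have 2: "(- 4 * a * b * w\<^sup>2)\<^sup>2 + (2 * w - 4 * b\<^sup>2 * w\<^sup>2)\<^sup>2 + (4 * c * b * w\<^sup>2)\<^sup>2 = 4 * w\<^sup>2"
    using e w2 by Groebner_Basis.algebra
  have 3: "(2 * w - 4 * a\<^sup>2 * w\<^sup>2) * (- 4 * a * b * w\<^sup>2) + (- 4 * a * b * w\<^sup>2) * (2 * w - 4 * b\<^sup>2 * w\<^sup>2)
     + (4 * c * a * w\<^sup>2) * (4 * c * b * w\<^sup>2) = 0"
    using e w2 by Groebner_Basis.algebra
  show ?thesis
    unfolding metric_def using 1 2 3
    by (simp add: vec_eq_iff forall_2 inner3 partial_stereo_nth w_def a_def b_def power2_eq_square ac_simps)
qed

lemma area_density_stereo:
  assumes c: "c\<^sup>2 = 1"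
  shows "area_density (stereo c) p = 4 * (conf p)\<^sup>2"
proof -
  have "det (metric (stereo c) p) = (4 * (conf p)\<^sup>2)\<^sup>2"
    unfolding metric_stereo[OF c] by (simp add: det_2 power2_eq_square)
  then show ?thesis unfolding area_density_def by (simp only: real_sqrt_abs) simp
qed

lemma matrix_inv_unique: 
  fixes A B :: "real^2^2" assumes "A ** B = mat 1" "B ** A = mat 1" shows "matrix_inv A = B"
proof -
  have ex: "A ** matrix_inv A = mat 1 \<and> matrix_inv A ** A = mat 1"
    unfolding matrix_inv_def by (rule someI[where x = B]) (use assms in simp)
  then have "matrix_inv A = matrix_inv A ** (A ** B)" using assms by (simp add: matrix_mul_rid)
  also have "\<dots> = B" using ex by (simp only: matrix_mul_assoc matrix_mul_lid)
  finally show ?thesis .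
qed

lemma matrix_inv_metric_stereo:
  assumes c: "c\<^sup>2 = 1"
  shows "matrix_inv (metric (stereo c) p) = (\<chi> i j. if i = j then 1 / (4 * (conf p)\<^sup>2) else 0)"
proof -
  define t where "t = 4 * (conf p)\<^sup>2"
  have t: "t \<noteq> 0" using conf_pos[of p] by (simp add: t_def)
  have 1: "(\<chi> i j. if i = j then t else 0) ** (\<chi> i j. if i = j then 1 / t else 0 :: real^2^2) = mat 1"
    using t by (simp add: matrix_matrix_mult_def vec_eq_iff forall_2 sum_2 mat_def)
  have 2: "(\<chi> i j. if i = j then 1 / t else 0) ** (\<chi> i j. if i = j then t else 0 :: real^2^2) = mat 1"
    using t by (simp add: matrix_matrix_mult_def vec_eq_iff forall_2 sum_2 mat_def)
  show ?thesis unfolding metric_stereo[OF c] t_def[symmetric] by (rule matrix_inv_unique[OF 1 2])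
qed

text \<open>In dimension two the area density times the inverse of a conformal metric is the
  identity matrix, so the divergence form collapses to the flat Laplacian divided by the
  density.\<close>

lemma laplace_coord_stereo:
  assumes c: "c\<^sup>2 = 1"
  shows "laplace_coord (stereo c) v p = - (1 / (4 * (conf p)\<^sup>2)) * (partial 1 (partial 1 v) p + partial 2 (partial 2 v) p)"
proof -
  have "(\<lambda>q. \<Sum>j\<in>UNIV. area_density (stereo c) q * matrix_inv (metric (stereo c) q) $ i $ j * partial j v q) = partial i v" for i :: 2
  proof 
    fix q
    have "conf q \<noteq> 0" using conf_pos[of q] by simp
    then show "(\<Sum>j\<in>UNIV. area_density (stereo c) q * matrix_inv (metric (stereo c) q) $ i $ j * partial j v q) = partial i v q"
      using exhaust_2[of i] by (auto simp: sum_2 matrix_inv_metric_stereo[OF c] area_density_stereo[OF c])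
  qed
  then show ?thesis
    unfolding laplace_coord_def by (simp add: sum_2 area_density_stereo[OF c])
qed

lemma stereo_in_S2:
  assumes c: "c\<^sup>2 = 1"
  shows "stereo c p \<in> S2"
proof -
  have w: "conf p * ((p$1)\<^sup>2 + (p$2)\<^sup>2) = 1 - conf p" by (rule conf_sum_sq)
  have "4 * ((p$1)\<^sup>2 + (p$2)\<^sup>2) * (conf p)\<^sup>2 = 4 * conf p * (1 - conf p)"
    using w by (simp add: power2_eq_square mult.assoc[symmetric]) (simp add: algebra_simps)
  then show ?thesis unfolding S2_coords stereo_nth power_mult_distrib c
    by (simp add: algebra_simps power2_eq_square)
qed

lemma stereo_inj:
  assumes c: "c\<^sup>2 = 1"
  shows "inj (stereo c)"
proof (rule injI)
  fix p q assume eq: "stereo c p = stereo c q"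
  have c0: "c \<noteq> 0" using c by auto
  have "stereo c p $ 3 = stereo c q $ 3" using eq by simp
  then have w: "conf p = conf q" using c0 by (simp add: stereo_nth)
  have "stereo c p $ 1 = stereo c q $ 1" "stereo c p $ 2 = stereo c q $ 2" using eq by simp_all
  then show "p = q" using w conf_pos[of q] by (simp add: stereo_nth vec2_eq_iff)
qed

lemma stereo_surj:
  assumes c: "c\<^sup>2 = 1" and x: "x \<in> S2" and "x$3 \<noteq> c"
  shows "\<exists>p. stereo c p = x"
proof -
  \<comment> \<open>The third coordinate \<open>c * (1 - 2 * conf p)\<close> has to equal
    \<open>x$3\<close>, so \<open>d\<close> is \<open>2 * conf p\<close> for the point
    \<open>p\<close> sought.\<close>
  define d where "d = 1 - c * x$3"
  have cc: "c * c = 1" using c by (simp add: power2_eq_square)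
  have d0: "d \<noteq> 0"
  proof
    assume "d = 0" then have "c * x$3 = c * c" using cc by (simp add: d_def)
    then have "c * (x$3 - c) = 0" by (simp add: algebra_simps)
    then show False using assms(3) cc by auto
  qed
  have s: "(x$1)\<^sup>2 + (x$2)\<^sup>2 = d * (2 - d)"
    using x cc unfolding S2_coords d_def by Groebner_Basis.algebra
  define p :: "real^2" where "p = vector [x$1 / d, x$2 / d]"
  have "1 + (p$1)\<^sup>2 + (p$2)\<^sup>2 = 1 + ((x$1)\<^sup>2 + (x$2)\<^sup>2) / d\<^sup>2"
    by (simp add: p_def power_divide add_divide_distrib)
  also have "\<dots> = 2 / d" using d0 unfolding s by (simp add: power2_eq_square field_simps)
  finally have w: "conf p = d / 2" by (simp add: conf_def)
  have "c * (1 - d) = x$3" using cc by (simp add: d_def mult.assoc[symmetric])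
  then have "stereo c p = x"
    using d0 by (simp add: vec3_eq_iff stereo_nth w) (simp add: p_def)
  then show ?thesis ..
qed

lemma continuous_conf: "continuous_on A conf"
proof -
  have "1 + (p$1)\<^sup>2 + (p$2)\<^sup>2 \<noteq> 0" for p :: "real^2"
    using conf_denom_pos[of p] by linarith
  then show ?thesis
    unfolding conf_def[abs_def] by (intro continuous_intros ballI) 
qed

lemma continuous_stereo: "continuous_on A (stereo c)"
  unfolding stereo_axis[abs_def] by (intro continuous_intros continuous_conf)

section \<open>Integrals over the line and the plane\<close>

lemma nn_integral_FTC_real:
  fixes f F :: "real \<Rightarrow> real"
  assumes nn: "\<And>x. 0 \<le> f x" and c: "continuous_on UNIV f"
    and d: "\<And>x. (F has_real_derivative f x) (at x)"
    and A: "(F \<longlongrightarrow> A) at_bot" and B: "(F \<longlongrightarrow> B) at_top"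
  shows "(\<integral>\<^sup>+x. ennreal (f x) \<partial>lborel) = ennreal (B - A)"
proof -
  have cf: "isCont f x" for x using c by (simp add: continuous_on_eq_continuous_at)
  have A': "((F \<circ> real_of_ereal) \<longlongrightarrow> A) (at_right (-\<infinity>))"
    using A by (simp add: ereal_tendsto_simps1)
  have B': "((F \<circ> real_of_ereal) \<longlongrightarrow> B) (at_left \<infinity>)"
    using B by (simp add: ereal_tendsto_simps1)
  have i: "set_integrable lborel (einterval (-\<infinity>) \<infinity>) f"
    by (rule interval_integral_FTC_nonneg(1)[where F=F and A=A and B=B]) (use nn d cf A' B' in auto)
  have e: "(LBINT x=-\<infinity>..\<infinity>. f x) = B - A"
    by (rule interval_integral_FTC_nonneg(2)[where F=F]) (use nn d cf A' B' in auto)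
  have i': "integrable lborel f" using i by (simp add: set_integrable_def)
  have "(LINT x|lborel. f x) = B - A" using e
    by (simp add: interval_lebesgue_integral_def set_lebesgue_integral_def)
  then show ?thesis using nn_integral_eq_integral[OF i'] nn by simp
qed

lemma vector2_axis: "vector [a, b] = a *\<^sub>R (axis 1 1 :: real^2) + b *\<^sub>R axis 2 1"
  by (simp add: vec2_eq_iff axis_def)

lemma measurable_vector2: "(\<lambda>(a, b). vector [a, b] :: real^2) \<in> borel_measurable (lborel \<Otimes>\<^sub>M lborel)"
proof -
  have "continuous_on UNIV (\<lambda>z. fst z *\<^sub>R (axis 1 1 :: real^2) + snd z *\<^sub>R axis 2 1)"
    by (intro continuous_intros)
  then have "(\<lambda>z. fst z *\<^sub>R (axis 1 1 :: real^2) + snd z *\<^sub>R axis 2 1) \<in> borel_measurable (borel \<Otimes>\<^sub>M borel)"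
    unfolding borel_prod by (rule borel_measurable_continuous_onI)
  moreover have "sets (lborel \<Otimes>\<^sub>M lborel) = sets (borel \<Otimes>\<^sub>M (borel :: real measure))"
    by (rule sets_pair_measure_cong) simp_all
  ultimately show ?thesis
    by (simp add: vector2_axis case_prod_beta' cong: measurable_cong_sets)
qed

lemma Basis_real2: "(Basis :: (real^2) set) = {axis 1 1, axis 2 1}"
  by (auto simp: Basis_vec_def UNIV_2)

text \<open>Makes Fubini's theorem available on the plane; it suffices to compare boxes, which are
  products of intervals.\<close>

lemma lborel_vec2: "(lborel :: (real^2) measure) = distr (lborel \<Otimes>\<^sub>M lborel) borel (\<lambda>(a, b). vector [a, b])"
proof (rule lborel_eqI)
  fix l u :: "real^2" assume lu: "\<And>b. b \<in> Basis \<Longrightarrow> l \<bullet> b \<le> u \<bullet> b"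
  have l1: "l$1 \<le> u$1" using lu[of "axis 1 1"] by (simp add: Basis_real2 inner_axis)
  have l2: "l$2 \<le> u$2" using lu[of "axis 2 1"] by (simp add: Basis_real2 inner_axis)
  have ax: "axis 1 1 \<noteq> (axis 2 1 :: real^2)" by (simp add: axis_eq_axis)
  have pre: "(\<lambda>(a, b). vector [a, b]) -` box l u \<inter> space (lborel \<Otimes>\<^sub>M lborel) = {l$1<..<u$1} \<times> {l$2<..<u$2}"
    by (auto simp: box_def Basis_real2 inner_axis space_pair_measure)
  have "emeasure (distr (lborel \<Otimes>\<^sub>M lborel) borel (\<lambda>(a, b). vector [a, b])) (box l u)
    = emeasure (lborel \<Otimes>\<^sub>M lborel) ({l$1<..<u$1} \<times> {l$2<..<u$2})"
    using measurable_vector2 by (subst emeasure_distr) (auto simp: pre)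
  also have "\<dots> = ennreal (u$1 - l$1) * ennreal (u$2 - l$2)"
    using l1 l2 by (subst lborel.emeasure_pair_measure_Times) auto
  also have "\<dots> = ennreal ((u$1 - l$1) * (u$2 - l$2))"
    using l1 l2 by (simp add: ennreal_mult)
  finally show "emeasure (distr (lborel \<Otimes>\<^sub>M lborel) borel (\<lambda>(a, b). vector [a, b])) (box l u) = (\<Prod>b\<in>Basis. (u - l) \<bullet> b)"
    using ax by (simp add: Basis_real2 inner_axis)
qed simp

lemma nn_integral_real2:
  fixes f :: "real^2 \<Rightarrow> ennreal"
  assumes f[measurable]: "f \<in> borel_measurable borel"
  shows "(\<integral>\<^sup>+p. f p \<partial>lborel) = (\<integral>\<^sup>+b. \<integral>\<^sup>+a. f (vector [a, b]) \<partial>lborel \<partial>lborel)"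
proof -
  have m: "(\<lambda>z. f (vector [fst z, snd z])) \<in> borel_measurable (lborel \<Otimes>\<^sub>M lborel)"
    using measurable_compose[OF measurable_vector2 f] by (simp add: case_prod_beta')
  have "(\<integral>\<^sup>+p. f p \<partial>lborel) = (\<integral>\<^sup>+z. f (vector [fst z, snd z]) \<partial>(lborel \<Otimes>\<^sub>M lborel))"
    by (subst lborel_vec2, subst nn_integral_distr[OF measurable_vector2]) (simp_all add: case_prod_beta')
  also have "\<dots> = (\<integral>\<^sup>+b. \<integral>\<^sup>+a. f (vector [a, b]) \<partial>lborel \<partial>lborel)"
    using m by (subst lborel_pair.nn_integral_snd[symmetric]) (simp_all add: case_prod_beta')
  finally show ?thesis .
qed

lemma borel_measurable_conf[measurable]: "conf \<in> borel_measurable borel"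
  by (rule borel_measurable_continuous_onI[OF continuous_conf])

lemma nn_integral_inv_sq:
  assumes A: "A > 0"
  shows "(\<integral>\<^sup>+x. ennreal (1 / (A\<^sup>2 + x\<^sup>2)\<^sup>2) \<partial>lborel) = ennreal (pi / (2 * A^3))"
proof -
  have p: "A\<^sup>2 + x\<^sup>2 > 0" for x :: real using A by (simp add: add_pos_nonneg)
  then have p0: "A\<^sup>2 + x\<^sup>2 \<noteq> 0" for x :: real by (metis less_irrefl)
  have "(\<integral>\<^sup>+x. ennreal (1 / (A\<^sup>2 + x\<^sup>2)\<^sup>2) \<partial>lborel) = ennreal (pi / (4 * A^3) - (- pi / (4 * A^3)))"
  proof (rule nn_integral_FTC_real)
    show "continuous_on UNIV (\<lambda>x. 1 / (A\<^sup>2 + x\<^sup>2)\<^sup>2)"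
      using p0 by (intro continuous_intros) auto
    fix x :: real
    have e: "(1 * (2 * A\<^sup>2 * (A\<^sup>2 + x\<^sup>2)) - x * (2 * A\<^sup>2 * (2 * x))) / ((2 * A\<^sup>2 * (A\<^sup>2 + x\<^sup>2)) * (2 * A\<^sup>2 * (A\<^sup>2 + x\<^sup>2)))
       + inverse (1 + (x/A)\<^sup>2) * (1/A) / (2 * A^3) = 1 / (A\<^sup>2 + x\<^sup>2)\<^sup>2"
    proof -
      have i: "inverse (1 + (x/A)\<^sup>2) = A\<^sup>2 / (A\<^sup>2 + x\<^sup>2)"
        using A p0[of x] by (simp add: field_simps)
      show ?thesis unfolding i using A p0[of x]
        by (simp add: divide_simps) (simp add: eval_nat_numeral algebra_simps)
    qed
    have d: "((\<lambda>x. 2 * A\<^sup>2 * (A\<^sup>2 + x\<^sup>2)) has_real_derivative 2 * A\<^sup>2 * (2 * x)) (at x)"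
      by (auto intro!: derivative_eq_intros)
    have d1: "((\<lambda>x. x / (2 * A\<^sup>2 * (A\<^sup>2 + x\<^sup>2))) has_real_derivative 
       (1 * (2 * A\<^sup>2 * (A\<^sup>2 + x\<^sup>2)) - x * (2 * A\<^sup>2 * (2 * x))) / ((2 * A\<^sup>2 * (A\<^sup>2 + x\<^sup>2)) * (2 * A\<^sup>2 * (A\<^sup>2 + x\<^sup>2)))) (at x)"
      by (rule DERIV_divide[OF DERIV_ident d]) (use A p0[of x] in auto)
    have d2: "((\<lambda>x. arctan (x / A) / (2 * A^3)) has_real_derivative inverse (1 + (x/A)\<^sup>2) * (1/A) / (2 * A^3)) (at x)"
      by (rule DERIV_cdivide, rule DERIV_chain2[OF DERIV_arctan], rule DERIV_cdivide, rule DERIV_ident)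
    show "((\<lambda>x. x / (2 * A\<^sup>2 * (A\<^sup>2 + x\<^sup>2)) + arctan (x / A) / (2 * A^3)) has_real_derivative 1 / (A\<^sup>2 + x\<^sup>2)\<^sup>2) (at x)"
      using DERIV_add[OF d1 d2] unfolding e .
    show "((\<lambda>x. x / (2 * A\<^sup>2 * (A\<^sup>2 + x\<^sup>2)) + arctan (x / A) / (2 * A^3)) \<longlongrightarrow> - pi / (4 * A^3)) at_bot"
    proof -
      have e: "- pi / (4 * A^3) = - (pi * inverse (A^3) / 4)" by (simp add: field_simps)
      show ?thesis unfolding e using A by real_asymp
    qed
    show "((\<lambda>x. x / (2 * A\<^sup>2 * (A\<^sup>2 + x\<^sup>2)) + arctan (x / A) / (2 * A^3)) \<longlongrightarrow> pi / (4 * A^3)) at_top"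
    proof -
      have e: "pi / (4 * A^3) = pi * inverse (A^3) / 4" by (simp add: field_simps)
      show ?thesis unfolding e using A by real_asymp
    qed
  qed simp
  then show ?thesis by (simp add: field_simps)
qed

lemma nn_integral_inv_3half:
  assumes A: "A > 0"
  shows "(\<integral>\<^sup>+x. ennreal (1 / (sqrt (A\<^sup>2 + x\<^sup>2))^3) \<partial>lborel) = ennreal (2 / A\<^sup>2)"
proof -
  have p: "A\<^sup>2 + x\<^sup>2 > 0" for x :: real using A by (simp add: add_pos_nonneg)
  then have p0: "A\<^sup>2 + x\<^sup>2 \<noteq> 0" for x :: real by (metis less_irrefl)
  have "(\<integral>\<^sup>+x. ennreal (1 / (sqrt (A\<^sup>2 + x\<^sup>2))^3) \<partial>lborel) = ennreal (1 / A\<^sup>2 - (- 1 / A\<^sup>2))"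
  proof (rule nn_integral_FTC_real)
    show "0 \<le> 1 / (sqrt (A\<^sup>2 + x\<^sup>2))^3" for x using p[of x] by simp
    show "continuous_on UNIV (\<lambda>x. 1 / (sqrt (A\<^sup>2 + x\<^sup>2))^3)"
      using p0 by (intro continuous_intros) auto
    fix x :: real
    define s where "s = sqrt (A\<^sup>2 + x\<^sup>2)"
    have s: "s > 0" "s\<^sup>2 = A\<^sup>2 + x\<^sup>2" using p[of x] by (auto simp: s_def)
    have e: "(1 * (A\<^sup>2 * s) - x * (A\<^sup>2 * (inverse s / 2 * (2 * x)))) / ((A\<^sup>2 * s) * (A\<^sup>2 * s)) = 1 / s^3"
    proof -
      have "(1 * (A\<^sup>2 * s) - x * (A\<^sup>2 * (inverse s / 2 * (2 * x)))) = A\<^sup>2 * (s\<^sup>2 - x\<^sup>2) / s"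
        using s(1) by (simp add: field_simps power2_eq_square)
      also have "\<dots> = A\<^sup>2 * A\<^sup>2 / s" using s(2) by simp
      finally show ?thesis using s(1) A by (simp add: divide_simps power3_eq_cube)
    qed
    have d: "((\<lambda>x. sqrt (A\<^sup>2 + x\<^sup>2)) has_real_derivative inverse s / 2 * (2 * x)) (at x)"
      unfolding s_def
      by (rule DERIV_chain2[OF DERIV_real_sqrt]) (use p[of x] in \<open>auto intro!: derivative_eq_intros\<close>)
    have "((\<lambda>x. x / (A\<^sup>2 * sqrt (A\<^sup>2 + x\<^sup>2))) has_real_derivative
      (1 * (A\<^sup>2 * sqrt (A\<^sup>2 + x\<^sup>2)) - x * (A\<^sup>2 * (inverse s / 2 * (2 * x)))) / ((A\<^sup>2 * sqrt (A\<^sup>2 + x\<^sup>2)) * (A\<^sup>2 * sqrt (A\<^sup>2 + x\<^sup>2)))) (at x)"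
      by (rule DERIV_divide[OF DERIV_ident DERIV_cmult[OF d]]) (use A p0[of x] in auto)
    then show "((\<lambda>x. x / (A\<^sup>2 * sqrt (A\<^sup>2 + x\<^sup>2))) has_real_derivative 1 / (sqrt (A\<^sup>2 + x\<^sup>2))^3) (at x)"
      unfolding s_def[symmetric] e .
    show "((\<lambda>x. x / (A\<^sup>2 * sqrt (A\<^sup>2 + x\<^sup>2))) \<longlongrightarrow> - 1 / A\<^sup>2) at_bot"
    proof -
      have e: "- 1 / A\<^sup>2 = - inverse (A\<^sup>2)" by (simp add: field_simps)
      show ?thesis unfolding e using A by real_asymp
    qed
    show "((\<lambda>x. x / (A\<^sup>2 * sqrt (A\<^sup>2 + x\<^sup>2))) \<longlongrightarrow> 1 / A\<^sup>2) at_top"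
    proof -
      have e: "1 / A\<^sup>2 = inverse (A\<^sup>2)" by (simp add: field_simps)
      show ?thesis unfolding e using A by real_asymp
    qed
  qed
  then show ?thesis by simp
qed

lemma nn_integral_conf_sq: "(\<integral>\<^sup>+p. ennreal (4 * (conf p)\<^sup>2) \<partial>lborel) = ennreal (4 * pi)"
proof -
  have "(\<integral>\<^sup>+p. ennreal (4 * (conf p)\<^sup>2) \<partial>lborel)
     = (\<integral>\<^sup>+b. \<integral>\<^sup>+a. ennreal (4 * (conf (vector [a, b]))\<^sup>2) \<partial>lborel \<partial>lborel)"
    by (rule nn_integral_real2) measurable
  also have "\<dots> = (\<integral>\<^sup>+b. ennreal (2 * pi * (1 / (sqrt (1\<^sup>2 + b\<^sup>2))^3)) \<partial>lborel)"
  proof (rule nn_integral_cong)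
    fix b :: real
    define A where "A = sqrt (1 + b\<^sup>2)"
    have A: "A > 0" "A\<^sup>2 = 1 + b\<^sup>2" by (simp_all add: A_def add_pos_nonneg)
    have "(\<integral>\<^sup>+a. ennreal (4 * (conf (vector [a, b]))\<^sup>2) \<partial>lborel) = (\<integral>\<^sup>+a. ennreal 4 * ennreal (1 / (A\<^sup>2 + a\<^sup>2)\<^sup>2) \<partial>lborel)"
      by (intro nn_integral_cong) (simp add: conf_def A(2) ennreal_mult[symmetric] power_divide add_ac del: ennreal_numeral)
    also have "\<dots> = ennreal 4 * ennreal (pi / (2 * A^3))"
      by (subst nn_integral_cmult) (simp_all add: nn_integral_inv_sq[OF A(1)] del: ennreal_numeral)
    also have "\<dots> = ennreal (2 * pi * (1 / (sqrt (1\<^sup>2 + b\<^sup>2))^3))"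
      using A(1) by (simp add: ennreal_mult[symmetric] A_def del: ennreal_numeral)
    finally show "(\<integral>\<^sup>+a. ennreal (4 * (conf (vector [a, b]))\<^sup>2) \<partial>lborel) = ennreal (2 * pi * (1 / (sqrt (1\<^sup>2 + b\<^sup>2))^3))" .
  qed
  also have "\<dots> = (\<integral>\<^sup>+b. ennreal (2 * pi) * ennreal (1 / (sqrt (1\<^sup>2 + b\<^sup>2))^3) \<partial>lborel)"
    by (intro nn_integral_cong) (subst ennreal_mult[symmetric], auto)
  also have "\<dots> = ennreal (2 * pi) * ennreal 2"
    by (subst nn_integral_cmult) (use nn_integral_inv_3half[of 1] in simp_all)
  also have "\<dots> = ennreal (4 * pi)" by (subst ennreal_mult[symmetric]) auto
  finally show ?thesis .
qed

text \<open>\<open>sqrt (conf p)^3\<close> decays like \<open>|p|^-3\<close>, which is the rate of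
  the second derivatives of a smooth function in the chart. Its integrability justifies the
  integrations by parts on the plane.\<close>

lemma nn_integral_conf_3half: "(\<integral>\<^sup>+p. ennreal ((sqrt (conf p))^3) \<partial>lborel) < \<infinity>"
proof -
  have "(\<integral>\<^sup>+p. ennreal ((sqrt (conf p))^3) \<partial>lborel)
     = (\<integral>\<^sup>+b. \<integral>\<^sup>+a. ennreal ((sqrt (conf (vector [a, b])))^3) \<partial>lborel \<partial>lborel)"
    by (rule nn_integral_real2) measurable
  also have "\<dots> = (\<integral>\<^sup>+b. ennreal (2 * inverse (1 + b\<^sup>2)) \<partial>lborel)"
  proof (rule nn_integral_cong)
    fix b :: real
    define A where "A = sqrt (1 + b\<^sup>2)"
    have A: "A > 0" "A\<^sup>2 = 1 + b\<^sup>2" by (simp_all add: A_def add_pos_nonneg)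
    have "(\<integral>\<^sup>+a. ennreal ((sqrt (conf (vector [a, b])))^3) \<partial>lborel) = (\<integral>\<^sup>+a. ennreal (1 / (sqrt (A\<^sup>2 + a\<^sup>2))^3) \<partial>lborel)"
      by (intro nn_integral_cong) (simp add: conf_def A(2) real_sqrt_divide power_divide add_ac)
    also have "\<dots> = ennreal (2 / A\<^sup>2)" by (rule nn_integral_inv_3half[OF A(1)])
    also have "\<dots> = ennreal (2 * inverse (1 + b\<^sup>2))" by (simp add: A(2) inverse_eq_divide)
    finally show "(\<integral>\<^sup>+a. ennreal ((sqrt (conf (vector [a, b])))^3) \<partial>lborel) = ennreal (2 * inverse (1 + b\<^sup>2))" .
  qed
  also have "\<dots> = ennreal (pi - (- pi))"
  proof (rule nn_integral_FTC_real)
    show "continuous_on UNIV (\<lambda>b::real. 2 * inverse (1 + b\<^sup>2))"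
      by (intro continuous_intros) (auto simp: add_nonneg_eq_0_iff)
    show "((\<lambda>b. 2 * arctan b) has_real_derivative 2 * inverse (1 + b\<^sup>2)) (at b)" for b
      by (auto intro!: derivative_eq_intros)
    show "((\<lambda>b. 2 * arctan b) \<longlongrightarrow> - pi) at_bot" by real_asymp
    show "((\<lambda>b. 2 * arctan b) \<longlongrightarrow> pi) at_top" by real_asymp
  qed simp
  finally show ?thesis by (simp add: less_top[symmetric])
qed

section \<open>The area measure and its normalization\<close>

lemma measurable_stereo: "stereo 1 \<in> measurable (density lborel (\<lambda>p. ennreal (area_density (stereo 1) p))) (restrict_space borel S2)"
  by (rule measurable_restrict_space2)
    (auto intro!: borel_measurable_continuous_onI continuous_stereo stereo_in_S2[of 1, simplified] 
       simp del: mem_sphere cong: measurable_cong_sets)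

lemma sets_area_S2[simp, measurable_cong]: "sets area_S2 = sets (restrict_space borel S2)"
  by (simp add: area_S2_def)

lemma space_area_S2[simp]: "space area_S2 = S2"
  by (simp add: area_S2_def space_restrict_space)

lemma area_density_stereo1[simp]: "area_density (stereo 1) = (\<lambda>p. 4 * (conf p)\<^sup>2)"
  by (simp add: fun_eq_iff area_density_stereo)

lemma nn_integral_area_S2:
  assumes [measurable]: "f \<in> borel_measurable (restrict_space borel S2)"
  shows "(\<integral>\<^sup>+x. f x \<partial>area_S2) = (\<integral>\<^sup>+p. ennreal (4 * (conf p)\<^sup>2) * f (stereo 1 p) \<partial>lborel)"
proof -
  have m: "(\<lambda>p. f (stereo 1 p)) \<in> borel_measurable lborel"
    using measurable_compose[OF measurable_stereo assms] by (simp cong: measurable_cong_sets)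
  show ?thesis unfolding area_S2_def using m
    by (subst nn_integral_distr[OF measurable_stereo]) (simp_all add: nn_integral_density)
qed

lemma integral_area_S2:
  fixes f :: "real^3 \<Rightarrow> real"
  assumes f: "f \<in> borel_measurable (restrict_space borel S2)"
  shows "(LINT x|area_S2. f x) = (LINT p|lborel. 4 * (conf p)\<^sup>2 * f (stereo 1 p))"
proof -
  have m: "(\<lambda>p. f (stereo 1 p)) \<in> borel_measurable lborel"
    using measurable_compose[OF measurable_stereo f] by (simp cong: measurable_cong_sets)
  show ?thesis unfolding area_S2_def using m f
    by (subst integral_distr[OF measurable_stereo]) (simp_all add: integral_density)
qed

lemma emeasure_area_S2: "emeasure area_S2 S2 = ennreal (4 * pi)"
proof -
  have "emeasure area_S2 S2 = (\<integral>\<^sup>+x. 1 \<partial>area_S2)" by (simp del: sphere_def)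
  also have "\<dots> = ennreal (4 * pi)"
    by (subst nn_integral_area_S2) (simp_all add: nn_integral_conf_sq del: ennreal_mult'')
  finally show ?thesis .
qed

lemma sigma_S2_density: "sigma_S2 = density area_S2 (\<lambda>_. ennreal (1 / (4 * pi)))"
  by (rule measure_eqI) (simp_all add: sigma_S2_def emeasure_density nn_integral_cmult_indicator)

lemma sets_sigma_S2[simp, measurable_cong]: "sets sigma_S2 = sets (restrict_space borel S2)"
  by (simp add: sigma_S2_def)

lemma space_sigma_S2[simp]: "space sigma_S2 = S2"
  by (simp add: sigma_S2_density)

lemma prob_space_sigma_S2: "prob_space sigma_S2"
proof 
  have "emeasure sigma_S2 S2 = ennreal (1 / (4 * pi)) * ennreal (4 * pi)"
    by (simp add: sigma_S2_def emeasure_area_S2)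
  also have "\<dots> = 1" by (subst ennreal_mult[symmetric]) auto
  finally show "emeasure sigma_S2 (space sigma_S2) = 1" by simp
qed

interpretation sigma: prob_space sigma_S2 by (rule prob_space_sigma_S2)

lemma integral_area_sigma:
  fixes f :: "real^3 \<Rightarrow> real"
  assumes f: "f \<in> borel_measurable (restrict_space borel S2)"
  shows "(LINT x|area_S2. f x) = 4 * pi * (LINT x|sigma_S2. f x)"
proof -
  have "f \<in> borel_measurable area_S2" using f by (simp cong: measurable_cong_sets)
  then show ?thesis
    unfolding sigma_S2_density by (subst integral_density) auto
qed

lemma S2_cont_measurable:
  fixes f :: "real^3 \<Rightarrow> 'a::topological_space"
  shows "continuous_on S2 f \<Longrightarrow> f \<in> borel_measurable (restrict_space borel S2)"
  by (rule borel_measurable_continuous_on_restrict)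

lemma S2_cont_measurable_sigma:
  fixes f :: "real^3 \<Rightarrow> 'a::topological_space"
  shows "continuous_on S2 f \<Longrightarrow> f \<in> borel_measurable sigma_S2"
  using S2_cont_measurable by (simp cong: measurable_cong_sets)

lemma S2_cont_bounded:
  fixes f :: "real^3 \<Rightarrow> 'a::real_normed_vector"
  assumes "continuous_on S2 f"
  obtains B where "B > 0" "\<And>x. x \<in> S2 \<Longrightarrow> norm (f x) \<le> B"
proof -
  have "compact (f ` S2)" by (intro compact_continuous_image assms compact_sphere)
  then have "bounded (f ` S2)" by (rule compact_imp_bounded)
  then show thesis using that by (auto simp: bounded_pos simp del: mem_sphere)
qed

lemma S2_cont_integrable:
  fixes f :: "real^3 \<Rightarrow> 'a::{banach,second_countable_topology}"
  assumes f: "continuous_on S2 f"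
  shows "integrable sigma_S2 f"
proof -
  obtain B where "\<And>x. x \<in> S2 \<Longrightarrow> norm (f x) \<le> B" using S2_cont_bounded[OF f] by metis
  then show ?thesis
    by (intro sigma.integrable_const_bound[where B=B] AE_I2) (simp_all add: S2_cont_measurable_sigma f del: mem_sphere)
qed

text \<open>On the sphere this is \<open>1 - |x - y|^2 / 4\<close>, hence a number in
  \<open>[0, 1]\<close>, equal to 1 on the diagonal.\<close>

definition qk :: "real^3 \<Rightarrow> real^3 \<Rightarrow> real" where
  "qk x y = (1 + x \<bullet> y) / 2"

lemma qk_commute: "qk x y = qk y x" by (simp add: qk_def inner_commute)

lemma qk_eq_dist: 
  assumes "x \<in> S2" "y \<in> S2" shows "1 - qk x y = (norm (x - y))\<^sup>2 / 4"
proof -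
  have "x \<bullet> x = 1" "y \<bullet> y = 1" using assms by (simp_all add: norm_eq_1)
  then have "(norm (x - y))\<^sup>2 = 2 - 2 * (x \<bullet> y)"
    unfolding power2_norm_eq_inner by (simp add: inner_diff_left inner_diff_right inner_commute)
  then show ?thesis by (simp add: qk_def field_simps)
qed

lemma qk_le_1: "x \<in> S2 \<Longrightarrow> y \<in> S2 \<Longrightarrow> qk x y \<le> 1"
  using qk_eq_dist[of x y] zero_le_power2[of "norm (x - y)"] by linarith

lemma qk_nonneg: "x \<in> S2 \<Longrightarrow> y \<in> S2 \<Longrightarrow> 0 \<le> qk x y"
  using Cauchy_Schwarz_ineq2[of x y] by (simp add: qk_def)

lemma qk_self: "x \<in> S2 \<Longrightarrow> qk x x = 1"
  by (simp add: qk_def norm_eq_1)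

lemma continuous_qk[continuous_intros]: 
  "continuous_on A f \<Longrightarrow> continuous_on A g \<Longrightarrow> continuous_on A (\<lambda>x. qk (f x) (g x))"
  unfolding qk_def by (intro continuous_intros) auto

section \<open>Smooth functions near the sphere and the Laplacian in ambient coordinates\<close>

definition smooth_on :: "(real^3) set \<Rightarrow> (real^3 \<Rightarrow> real) \<Rightarrow> bool" where
  "smooth_on U f \<longleftrightarrow> (\<forall>k. Ck_on k U f)"

lemma frechet_cong_open:
  assumes "open U" "x \<in> U" "\<And>y. y \<in> U \<Longrightarrow> f y = g y" "f differentiable at x"
  shows "g differentiable at x" "frechet_derivative g (at x) = frechet_derivative f (at x)"
proof -
  from assms(4) have d: "(f has_derivative frechet_derivative f (at x)) (at x)"
    by (simp add: frechet_derivative_works)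
  then have g: "(g has_derivative frechet_derivative f (at x)) (at x)"
    by (rule has_derivative_transform_within_open[OF _ assms(1,2)]) (use assms(3) in auto)
  then show "g differentiable at x" by (auto simp: differentiable_def)
  show "frechet_derivative g (at x) = frechet_derivative f (at x)"
    using frechet_derivative_at[OF g] by simp
qed

lemma Ck_on_cong:
  assumes "open U" 
  shows "Ck_on k U f \<Longrightarrow> (\<And>y. y \<in> U \<Longrightarrow> f y = g y) \<Longrightarrow> Ck_on k U g"
proof (induction k arbitrary: f g)
  case 0
  then show ?case by (simp cong: continuous_on_cong)
next
  case (Suc k)
  have d: "f differentiable at x" if "x \<in> U" for x using Suc.prems(1) that by simp
  show ?case
  proof (simp, intro conjI ballI allI)
    fix x assume "x \<in> U" then show "g differentiable at x"
      using frechet_cong_open(1)[OF assms _ Suc.prems(2) d] by blast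
  next
    fix v
    have "Ck_on k U (\<lambda>x. frechet_derivative f (at x) v)" using Suc.prems(1) by simp
    then show "Ck_on k U (\<lambda>x. frechet_derivative g (at x) v)"
      by (rule Suc.IH) (use frechet_cong_open(2)[OF assms _ Suc.prems(2) d] in simp)
  qed
qed

lemma smooth_on_cong: "open U \<Longrightarrow> smooth_on U f \<Longrightarrow> (\<And>y. y \<in> U \<Longrightarrow> f y = g y) \<Longrightarrow> smooth_on U g"
  unfolding smooth_on_def using Ck_on_cong by blast

lemma smooth_on_differentiable: "smooth_on U f \<Longrightarrow> x \<in> U \<Longrightarrow> f differentiable at x"
  unfolding smooth_on_def by (metis Ck_on.simps(2))

lemma smooth_on_continuous: "smooth_on U f \<Longrightarrow> continuous_on U f"
  unfolding smooth_on_def by (metis Ck_on.simps(1))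

lemma smooth_on_frechet: "smooth_on U f \<Longrightarrow> smooth_on U (\<lambda>x. frechet_derivative f (at x) v)"
  unfolding smooth_on_def by (metis Ck_on.simps(2))

lemma smooth_on_deriv: "smooth_on U f \<Longrightarrow> x \<in> U \<Longrightarrow> (f has_derivative frechet_derivative f (at x)) (at x)"
  using smooth_on_differentiable frechet_derivative_works by blast

lemma Ck_on_const: "Ck_on k U (\<lambda>_. c :: real)"
  by (induction k arbitrary: c) auto

lemma smooth_on_const: "smooth_on U (\<lambda>_. c)"
  by (simp add: smooth_on_def Ck_on_const)

lemma Ck_on_linear: "bounded_linear f \<Longrightarrow> Ck_on k U (f :: real^3 \<Rightarrow> real)"
proof (cases k)
  case 0 assume "bounded_linear f" then show ?thesis using 0 
    by (simp add: linear_continuous_on)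
next
  case (Suc n) assume f: "bounded_linear f"
  then have "frechet_derivative f (at x) = f" for x
    using frechet_derivative_at[OF bounded_linear_imp_has_derivative[OF f], of x] by simp
  then show ?thesis using Suc f 
    by (auto simp: Ck_on_const intro: bounded_linear_imp_differentiable)
qed

lemma smooth_on_nth: "smooth_on U (\<lambda>x. x $ i)"
  unfolding smooth_on_def by (simp add: Ck_on_linear bounded_linear_vec_nth)

text \<open>The definition at positive order speaks of derivatives only; at the bottom, continuity
  has to come from differentiability. The product rule uses this for its undifferentiated
  factors.\<close>

lemma Ck_on_Suc_imp:
  fixes f :: "real^3 \<Rightarrow> real"
  shows "Ck_on (Suc k) U f \<Longrightarrow> Ck_on k U f"
proof (induction k arbitrary: f)
  case 0
  then have "\<forall>x\<in>U. f differentiable at x" by simp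
  then have "\<forall>x\<in>U. isCont f x" using differentiable_imp_continuous_within by blast
  then show ?case by (simp add: continuous_at_imp_continuous_on)
next
  case (Suc k)
  then have "\<forall>v. Ck_on k U (\<lambda>x. frechet_derivative f (at x) v)" 
    unfolding Ck_on.simps(2)[of "Suc k" U f] by simp
  then show ?case using Suc.prems by simp
qed

lemma Ck_on_add:
  fixes f g :: "real^3 \<Rightarrow> real"
  assumes "open U"
  shows "Ck_on k U f \<Longrightarrow> Ck_on k U g \<Longrightarrow> Ck_on k U (\<lambda>x. f x + g x)"
proof (induction k arbitrary: f g)
  case 0 then show ?case by (simp add: continuous_on_add)
next
  case (Suc k)
  have e: "frechet_derivative (\<lambda>x. f x + g x) (at x) v = frechet_derivative f (at x) v + frechet_derivative g (at x) v"
    if "x \<in> U" for x v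
  proof -
    have "((\<lambda>x. f x + g x) has_derivative (\<lambda>v. frechet_derivative f (at x) v + frechet_derivative g (at x) v)) (at x)"
      by (intro has_derivative_add) (use Suc.prems that in \<open>simp_all add: frechet_derivative_works\<close>)
    then show ?thesis by (rule frechet_derivative_at[THEN fun_cong, of _ _ _ v, symmetric])
  qed
  show ?case
  proof (simp, intro conjI ballI allI)
    fix x assume "x \<in> U" then show "(\<lambda>x. f x + g x) differentiable at x"
      by (intro differentiable_add) (use Suc.prems in simp_all)
  next
    fix v
    have "Ck_on k U (\<lambda>x. frechet_derivative f (at x) v + frechet_derivative g (at x) v)"
      by (intro Suc.IH) (use Suc.prems in simp_all)
    then show "Ck_on k U (\<lambda>x. frechet_derivative (\<lambda>x. f x + g x) (at x) v)"
      by (rule Ck_on_cong[OF assms]) (simp add: e)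
  qed
qed

lemma Ck_on_mult:
  fixes f g :: "real^3 \<Rightarrow> real"
  assumes "open U"
  shows "Ck_on k U f \<Longrightarrow> Ck_on k U g \<Longrightarrow> Ck_on k U (\<lambda>x. f x * g x)"
proof (induction k arbitrary: f g)
  case 0 then show ?case by (simp add: continuous_on_mult)
next
  case (Suc k)
  have e: "frechet_derivative (\<lambda>x. f x * g x) (at x) v = f x * frechet_derivative g (at x) v + frechet_derivative f (at x) v * g x"
    if "x \<in> U" for x v
  proof -
    have "((\<lambda>x. f x * g x) has_derivative (\<lambda>v. f x * frechet_derivative g (at x) v + frechet_derivative f (at x) v * g x)) (at x)"
      by (intro has_derivative_mult) (use Suc.prems that in \<open>simp_all add: frechet_derivative_works\<close>)
    then show ?thesis by (rule frechet_derivative_at[THEN fun_cong, of _ _ _ v, symmetric])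
  qed
  have fk: "Ck_on k U f" "Ck_on k U g" by (rule Ck_on_Suc_imp[OF Suc.prems(1)] Ck_on_Suc_imp[OF Suc.prems(2)])+
  show ?case
  proof (simp, intro conjI ballI allI)
    fix x assume "x \<in> U" then show "(\<lambda>x. f x * g x) differentiable at x"
      by (intro differentiable_mult) (use Suc.prems in simp_all)
  next
    fix v
    have "Ck_on k U (\<lambda>x. f x * frechet_derivative g (at x) v + frechet_derivative f (at x) v * g x)"
      by (intro Ck_on_add[OF assms] Suc.IH fk) (use Suc.prems in simp_all)
    then show "Ck_on k U (\<lambda>x. frechet_derivative (\<lambda>x. f x * g x) (at x) v)"
      by (rule Ck_on_cong[OF assms]) (simp add: e)
  qed
qed

lemma smooth_on_add: "open U \<Longrightarrow> smooth_on U f \<Longrightarrow> smooth_on U g \<Longrightarrow> smooth_on U (\<lambda>x. f x + g x)"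
  by (simp add: smooth_on_def Ck_on_add)

lemma smooth_on_mult: "open U \<Longrightarrow> smooth_on U f \<Longrightarrow> smooth_on U g \<Longrightarrow> smooth_on U (\<lambda>x. f x * g x)"
  by (simp add: smooth_on_def Ck_on_mult)

lemma smooth_on_sum: 
  assumes "open U" "finite I" "\<And>i. i \<in> I \<Longrightarrow> smooth_on U (f i)" 
  shows "smooth_on U (\<lambda>x. \<Sum>i\<in>I. f i x)"
  using assms(2,3) by (induction I rule: finite_induct) (simp_all add: assms(1) smooth_on_const smooth_on_add smooth_on_mult)

lemma smooth_on_prod: 
  assumes "open U" "finite I" "\<And>i. i \<in> I \<Longrightarrow> smooth_on U (f i)" 
  shows "smooth_on U (\<lambda>x. \<Prod>i\<in>I. f i x)"
  using assms(2,3) by (induction I rule: finite_induct) (simp_all add: assms(1) smooth_on_const smooth_on_add smooth_on_mult)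

definition pd :: "3 \<Rightarrow> (real^3 \<Rightarrow> real) \<Rightarrow> real^3 \<Rightarrow> real" where
  "pd i F x = frechet_derivative F (at x) (axis i 1)"

lemma smooth_on_pd: "smooth_on U F \<Longrightarrow> smooth_on U (pd i F)"
  unfolding pd_def[abs_def] by (rule smooth_on_frechet)

lemma frechet_pd: 
  assumes "F differentiable at x"
  shows "frechet_derivative F (at x) h = (\<Sum>i\<in>UNIV. pd i F x * h $ i)"
proof -
  have l: "linear (frechet_derivative F (at x))" using assms by (rule linear_frechet_derivative)
  have "h = (\<Sum>i\<in>UNIV. (h $ i) *\<^sub>R axis i 1)"
    by (simp add: vec_eq_iff axis_def if_distrib cong: if_cong)
  then have "frechet_derivative F (at x) h = frechet_derivative F (at x) (\<Sum>i\<in>UNIV. (h $ i) *\<^sub>R axis i 1)"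
    by simp
  also have "\<dots> = (\<Sum>i\<in>UNIV. pd i F x * h $ i)"
    using l by (simp add: linear_sum linear_cmul pd_def mult.commute)
  finally show ?thesis .
qed

text \<open>The nonnegative Laplacian of the unit sphere in terms of an extension \<open>F\<close>:
  minus the flat Laplacian, plus the second radial derivative, plus twice the radial derivative.
  Being free of charts, it is visibly linear and preserves smoothness.\<close>

definition slap :: "(real^3 \<Rightarrow> real) \<Rightarrow> real^3 \<Rightarrow> real" where
  "slap F x = - (\<Sum>i\<in>UNIV. pd i (pd i F) x) + (\<Sum>i\<in>UNIV. \<Sum>j\<in>UNIV. x $ i * x $ j * pd j (pd i F) x)
     + 2 * (\<Sum>i\<in>UNIV. x $ i * pd i F x)"

lemma smooth_on_slap: 
  assumes "open U" "smooth_on U F" shows "smooth_on U (slap F)"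
proof -
  have "smooth_on U (\<lambda>x. (\<Sum>i\<in>UNIV. (-1) * pd i (pd i F) x) + ((\<Sum>i\<in>UNIV. \<Sum>j\<in>UNIV. x $ i * x $ j * pd j (pd i F) x)
     + 2 * (\<Sum>i\<in>UNIV. x $ i * pd i F x)))"
    using assms by (intro smooth_on_add smooth_on_sum smooth_on_mult smooth_on_pd smooth_on_const smooth_on_nth) auto
  then show ?thesis by (rule smooth_on_cong[OF assms(1)]) (simp add: slap_def sum_negf)
qed

lemma partial_comp_stereo:
  assumes "F differentiable at (stereo c p)"
  shows "partial a (F \<circ> stereo c) p = (\<Sum>k\<in>UNIV. pd k F (stereo c p) * partial a (stereo c) p $ k)"
proof -
  have "((F \<circ> stereo c) has_derivative (frechet_derivative F (at (stereo c p)) \<circ> frechet_derivative (stereo c) (at p))) (at p)"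
    using assms has_derivative_stereo[of c p]
    by (intro diff_chain_at) (auto simp: frechet_derivative_works[symmetric] differentiable_def)
  from partial_eq[OF this, of a] show ?thesis
    using frechet_pd[OF assms] by (simp add: partial_def)
qed

text \<open>Closed forms of the pure second derivatives of the chart components, the ones that occur
  in the flat Laplacian of \<open>laplace_coord_stereo\<close>.\<close>

definition d2 :: "2 \<Rightarrow> 3 \<Rightarrow> real \<Rightarrow> real^2 \<Rightarrow> real" where
  "d2 a k c p = (if k = 3 then 4 * c * (conf p)\<^sup>2 - 16 * c * (p$a)\<^sup>2 * (conf p)^3
     else if (a = 1 \<and> k = 1) \<or> (a = 2 \<and> k = 2) then - 12 * p$a * (conf p)\<^sup>2 + 16 * (p$a)^3 * (conf p)^3
     else (let b = (if a = 1 then p$2 else p$1) in - 4 * b * (conf p)\<^sup>2 + 16 * (p$a)\<^sup>2 * b * (conf p)^3))"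

lemma has_derivative_vnth: "((\<lambda>p::real^'n. p $ i) has_derivative (\<lambda>h. h $ i)) (at p)"
  by (rule bounded_linear.has_derivative[OF bounded_linear_vec_nth has_derivative_ident])

lemma axis_simps[simp]: "axis i (1::real) $ i = 1" "i \<noteq> j \<Longrightarrow> axis i (1::real) $ j = 0"
  by (simp_all add: axis_def)

lemma partial_partial_stereo:
  "((\<lambda>p. partial 1 (stereo c) p $ 1) has_derivative (\<lambda>h. 2 * (- 2 * (conf p)\<^sup>2 * (p$1 * h$1 + p$2 * h$2)) - 8 * p$1 * h$1 * (conf p)\<^sup>2 - 8 * (p$1)\<^sup>2 * conf p * (- 2 * (conf p)\<^sup>2 * (p$1 * h$1 + p$2 * h$2)))) (at p)"
  "((\<lambda>p. partial 2 (stereo c) p $ 2) has_derivative (\<lambda>h. 2 * (- 2 * (conf p)\<^sup>2 * (p$1 * h$1 + p$2 * h$2)) - 8 * p$2 * h$2 * (conf p)\<^sup>2 - 8 * (p$2)\<^sup>2 * conf p * (- 2 * (conf p)\<^sup>2 * (p$1 * h$1 + p$2 * h$2)))) (at p)"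
  "((\<lambda>p. partial 1 (stereo c) p $ 2) has_derivative (\<lambda>h. - 4 * (h$1 * p$2 + p$1 * h$2) * (conf p)\<^sup>2 - 8 * p$1 * p$2 * conf p * (- 2 * (conf p)\<^sup>2 * (p$1 * h$1 + p$2 * h$2)))) (at p)"
  "((\<lambda>p. partial 2 (stereo c) p $ 1) has_derivative (\<lambda>h. - 4 * (h$1 * p$2 + p$1 * h$2) * (conf p)\<^sup>2 - 8 * p$1 * p$2 * conf p * (- 2 * (conf p)\<^sup>2 * (p$1 * h$1 + p$2 * h$2)))) (at p)"
  "((\<lambda>p. partial 1 (stereo c) p $ 3) has_derivative (\<lambda>h. 4 * c * h$1 * (conf p)\<^sup>2 + 8 * c * p$1 * conf p * (- 2 * (conf p)\<^sup>2 * (p$1 * h$1 + p$2 * h$2)))) (at p)"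
  "((\<lambda>p. partial 2 (stereo c) p $ 3) has_derivative (\<lambda>h. 4 * c * h$2 * (conf p)\<^sup>2 + 8 * c * p$2 * conf p * (- 2 * (conf p)\<^sup>2 * (p$1 * h$1 + p$2 * h$2)))) (at p)"
  unfolding partial_stereo_nth power2_eq_square
  by (rule has_derivative_eq_rhs, (rule has_derivative_add has_derivative_diff has_derivative_mult has_derivative_const
        has_derivative_vnth has_derivative_conf[unfolded power2_eq_square])+,
      rule ext, Groebner_Basis.algebra)+

lemma partial_d2:
  "partial a (\<lambda>p. partial a (stereo c) p $ k) p = d2 a k c p"
proof -
  note P = partial_partial_stereo[THEN partial_eq]
  note S = d2_def Let_def power2_eq_square power3_eq_cube algebra_simps
  have 1: "partial 1 (\<lambda>p. partial 1 (stereo c) p $ 1) p = d2 1 1 c p" by (subst P(1)) (simp add: S)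
  have 2: "partial 2 (\<lambda>p. partial 2 (stereo c) p $ 2) p = d2 2 2 c p" by (subst P(2)) (simp add: S)
  have 3: "partial 1 (\<lambda>p. partial 1 (stereo c) p $ 2) p = d2 1 2 c p" by (subst P(3)) (simp add: S)
  have 4: "partial 2 (\<lambda>p. partial 2 (stereo c) p $ 1) p = d2 2 1 c p" by (subst P(4)) (simp add: S)
  have 5: "partial 1 (\<lambda>p. partial 1 (stereo c) p $ 3) p = d2 1 3 c p" by (subst P(5)) (simp add: S)
  have 6: "partial 2 (\<lambda>p. partial 2 (stereo c) p $ 3) p = d2 2 3 c p" by (subst P(6)) (simp add: S)
  note E = exhaust_2[of a] exhaust_3[of k]
  show ?thesis by (insert E, elim disjE; hypsubst, rule 1 2 3 4 5 6)
qed

lemma partial_stereo_diff: "(\<lambda>p. partial a (stereo c) p $ k) differentiable at p"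
proof -
  note E = exhaust_2[of a] exhaust_3[of k]
  show ?thesis unfolding differentiable_def 
    by (insert E, elim disjE; hypsubst, rule exI, rule partial_partial_stereo)
qed

lemma neq3: "(1::3) = 2 \<longleftrightarrow> False" "(1::3) = 3 \<longleftrightarrow> False" "(2::3) = 3 \<longleftrightarrow> False"
    "(2::3) = 1 \<longleftrightarrow> False" "(3::3) = 1 \<longleftrightarrow> False" "(3::3) = 2 \<longleftrightarrow> False"
  by simp_all

lemma neq2: "(1::2) = 2 \<longleftrightarrow> False" "(2::2) = 1 \<longleftrightarrow> False" by simp_all

text \<open>The two partial derivatives divided by \<open>2 * conf p\<close> form an orthonormal
  basis of the tangent plane at \<open>x = stereo c p\<close>, so their outer products add up to the
  projection \<open>I - x x^T\<close>.\<close>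

lemma grad_stereo_sum:
  assumes c: "c\<^sup>2 = 1"
  shows "partial 1 (stereo c) p $ m * partial 1 (stereo c) p $ k + partial 2 (stereo c) p $ m * partial 2 (stereo c) p $ k
    = 4 * (conf p)\<^sup>2 * ((if m = k then 1 else 0) - stereo c p $ m * stereo c p $ k)"
proof -
  have cc: "c * c = 1" using c by (simp add: power2_eq_square)
  have w: "conf p * ((p$1) * (p$1) + (p$2) * (p$2)) = 1 - conf p" using conf_sum_sq[of p] by (simp add: power2_eq_square)
  have g11: "partial 1 (stereo c) p $ 1 * partial 1 (stereo c) p $ 1 + partial 2 (stereo c) p $ 1 * partial 2 (stereo c) p $ 1
    = 4 * (conf p)\<^sup>2 * ((if (1::3) = 1 then 1 else 0) - stereo c p $ 1 * stereo c p $ 1)"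
    unfolding partial_stereo_nth stereo_nth neq3 simp_thms if_True if_False using w cc by Groebner_Basis.algebra
  have g12: "partial 1 (stereo c) p $ 1 * partial 1 (stereo c) p $ 2 + partial 2 (stereo c) p $ 1 * partial 2 (stereo c) p $ 2
    = 4 * (conf p)\<^sup>2 * ((if (1::3) = 2 then 1 else 0) - stereo c p $ 1 * stereo c p $ 2)"
    unfolding partial_stereo_nth stereo_nth neq3 simp_thms if_True if_False using w cc by Groebner_Basis.algebra
  have g13: "partial 1 (stereo c) p $ 1 * partial 1 (stereo c) p $ 3 + partial 2 (stereo c) p $ 1 * partial 2 (stereo c) p $ 3
    = 4 * (conf p)\<^sup>2 * ((if (1::3) = 3 then 1 else 0) - stereo c p $ 1 * stereo c p $ 3)"
    unfolding partial_stereo_nth stereo_nth neq3 simp_thms if_True if_False using w cc by Groebner_Basis.algebra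
  have g21: "partial 1 (stereo c) p $ 2 * partial 1 (stereo c) p $ 1 + partial 2 (stereo c) p $ 2 * partial 2 (stereo c) p $ 1
    = 4 * (conf p)\<^sup>2 * ((if (2::3) = 1 then 1 else 0) - stereo c p $ 2 * stereo c p $ 1)"
    unfolding partial_stereo_nth stereo_nth neq3 simp_thms if_True if_False using w cc by Groebner_Basis.algebra
  have g22: "partial 1 (stereo c) p $ 2 * partial 1 (stereo c) p $ 2 + partial 2 (stereo c) p $ 2 * partial 2 (stereo c) p $ 2
    = 4 * (conf p)\<^sup>2 * ((if (2::3) = 2 then 1 else 0) - stereo c p $ 2 * stereo c p $ 2)"
    unfolding partial_stereo_nth stereo_nth neq3 simp_thms if_True if_False using w cc by Groebner_Basis.algebra
  have g23: "partial 1 (stereo c) p $ 2 * partial 1 (stereo c) p $ 3 + partial 2 (stereo c) p $ 2 * partial 2 (stereo c) p $ 3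
    = 4 * (conf p)\<^sup>2 * ((if (2::3) = 3 then 1 else 0) - stereo c p $ 2 * stereo c p $ 3)"
    unfolding partial_stereo_nth stereo_nth neq3 simp_thms if_True if_False using w cc by Groebner_Basis.algebra
  have g31: "partial 1 (stereo c) p $ 3 * partial 1 (stereo c) p $ 1 + partial 2 (stereo c) p $ 3 * partial 2 (stereo c) p $ 1
    = 4 * (conf p)\<^sup>2 * ((if (3::3) = 1 then 1 else 0) - stereo c p $ 3 * stereo c p $ 1)"
    unfolding partial_stereo_nth stereo_nth neq3 simp_thms if_True if_False using w cc by Groebner_Basis.algebra
  have g32: "partial 1 (stereo c) p $ 3 * partial 1 (stereo c) p $ 2 + partial 2 (stereo c) p $ 3 * partial 2 (stereo c) p $ 2
    = 4 * (conf p)\<^sup>2 * ((if (3::3) = 2 then 1 else 0) - stereo c p $ 3 * stereo c p $ 2)"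
    unfolding partial_stereo_nth stereo_nth neq3 simp_thms if_True if_False using w cc by Groebner_Basis.algebra
  have g33: "partial 1 (stereo c) p $ 3 * partial 1 (stereo c) p $ 3 + partial 2 (stereo c) p $ 3 * partial 2 (stereo c) p $ 3
    = 4 * (conf p)\<^sup>2 * ((if (3::3) = 3 then 1 else 0) - stereo c p $ 3 * stereo c p $ 3)"
    unfolding partial_stereo_nth stereo_nth neq3 simp_thms if_True if_False using w cc by Groebner_Basis.algebra
  note E = exhaust_3[of k] exhaust_3[of m]
  show ?thesis by (insert E, elim disjE; hypsubst, rule g11 g12 g13 g21 g22 g23 g31 g32 g33)
qed

text \<open>The coordinate functions are spherical harmonics of degree one, with eigenvalue 2; this
  is their eigenvalue equation seen through the flat Laplacian.\<close>

lemma lap_stereo: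
  assumes c: "c\<^sup>2 = 1"
  shows "d2 1 k c p + d2 2 k c p = - 8 * (conf p)\<^sup>2 * stereo c p $ k"
proof -
  have w: "conf p * ((p$1) * (p$1) + (p$2) * (p$2)) = 1 - conf p" using conf_sum_sq[of p] by (simp add: power2_eq_square)
  have g1: "d2 1 1 c p + d2 2 1 c p = - 8 * (conf p)\<^sup>2 * stereo c p $ 1"
    unfolding d2_def Let_def stereo_nth neq3 neq2 simp_thms if_True if_False using w by Groebner_Basis.algebra
  have g2: "d2 1 2 c p + d2 2 2 c p = - 8 * (conf p)\<^sup>2 * stereo c p $ 2"
    unfolding d2_def Let_def stereo_nth neq3 neq2 simp_thms if_True if_False using w by Groebner_Basis.algebra
  have g3: "d2 1 3 c p + d2 2 3 c p = - 8 * (conf p)\<^sup>2 * stereo c p $ 3"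
    unfolding d2_def Let_def stereo_nth neq3 neq2 simp_thms if_True if_False using w by Groebner_Basis.algebra
  note E = exhaust_3[of k]
  show ?thesis by (insert E, elim disjE; hypsubst, rule g1 g2 g3)
qed

lemma partial_sum_mult:
  fixes g h :: "'k::finite \<Rightarrow> real^2 \<Rightarrow> real"
  assumes "\<And>k. g k differentiable at p" "\<And>k. h k differentiable at p"
  shows "partial a (\<lambda>p. \<Sum>k\<in>UNIV. g k p * h k p) p = (\<Sum>k\<in>UNIV. partial a (g k) p * h k p + g k p * partial a (h k) p)"
    and "(\<lambda>p. \<Sum>k\<in>UNIV. g k p * h k p) differentiable at p"
proof -
  have "((\<lambda>p. \<Sum>k\<in>UNIV. g k p * h k p) has_derivative 
     (\<lambda>v. \<Sum>k\<in>UNIV. g k p * frechet_derivative (h k) (at p) v + frechet_derivative (g k) (at p) v * h k p)) (at p)"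
    using assms by (intro has_derivative_sum has_derivative_mult) (simp_all add: frechet_derivative_works)
  from partial_eq[OF this] this show "partial a (\<lambda>p. \<Sum>k\<in>UNIV. g k p * h k p) p = (\<Sum>k\<in>UNIV. partial a (g k) p * h k p + g k p * partial a (h k) p)"
    "(\<lambda>p. \<Sum>k\<in>UNIV. g k p * h k p) differentiable at p"
    by (auto simp: partial_def add.commute differentiable_def)
qed

lemma comp_stereo_diff: 
  assumes "F differentiable at (stereo c p)" shows "(\<lambda>p. F (stereo c p)) differentiable at p"
  using differentiable_chain_at[of "stereo c" p F] assms has_derivative_stereo[of c p]
  by (auto simp: o_def differentiable_def[of "stereo c"])

context
  fixes U :: "(real^3) set" and F :: "real^3 \<Rightarrow> real" and c :: real
  assumes U: "open U" "S2 \<subseteq> U" and F: "smooth_on U F" and c: "c\<^sup>2 = 1"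
begin

lemma stereo_in_U: "stereo c p \<in> U" using stereo_in_S2[OF c] U by blast

lemma partial_comp: "partial a (F \<circ> stereo c) = (\<lambda>p. \<Sum>k\<in>UNIV. pd k F (stereo c p) * partial a (stereo c) p $ k)"
  by (rule ext, rule partial_comp_stereo) (rule smooth_on_differentiable[OF F stereo_in_U])

lemma pd_comp_diff: "(\<lambda>p. pd k F (stereo c p)) differentiable at p"
  by (rule comp_stereo_diff, rule smooth_on_differentiable[OF smooth_on_pd[OF F] stereo_in_U])

lemma partial_comp_diff: "partial a (F \<circ> stereo c) differentiable at p"
  unfolding partial_comp by (rule partial_sum_mult(2)[OF pd_comp_diff partial_stereo_diff])

lemma comp_diff: "(F \<circ> stereo c) differentiable at p"
  unfolding o_def by (rule comp_stereo_diff, rule smooth_on_differentiable[OF F stereo_in_U])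

lemma partial_partial_comp: 
  "partial a (partial a (F \<circ> stereo c)) p = (\<Sum>k\<in>UNIV. (\<Sum>m\<in>UNIV. pd m (pd k F) (stereo c p) * partial a (stereo c) p $ m) * partial a (stereo c) p $ k
      + pd k F (stereo c p) * d2 a k c p)"
proof -
  have "partial a (\<lambda>p. pd k F (stereo c p)) p = (\<Sum>m\<in>UNIV. pd m (pd k F) (stereo c p) * partial a (stereo c) p $ m)" for k
    using partial_comp_stereo[OF smooth_on_differentiable[OF smooth_on_pd[OF F] stereo_in_U], of a k] by (simp add: o_def)
  then show ?thesis
    unfolding partial_comp by (subst partial_sum_mult(1)[OF pd_comp_diff partial_stereo_diff]) (simp add: partial_d2)
qed

text \<open>By the chain rule the Hessian of \<open>F\<close> is contracted with the tangential
  projection and its gradient with the Laplacian of the chart. Both carry the factor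
  \<open>4 * conf^2\<close>, which cancels the area density.\<close>

lemma laplace_coord_comp: "laplace_coord (stereo c) (F \<circ> stereo c) p = slap F (stereo c p)"
proof -
  define w where "w = 4 * (conf p)\<^sup>2"
  have w: "w \<noteq> 0" using conf_pos[of p] by (simp add: w_def)
  define H where "H m k = pd m (pd k F) (stereo c p)" for m k
  define G where "G k = pd k F (stereo c p)" for k
  define A where "A a m = partial a (stereo c) p $ m" for a m
  define x where "x = stereo c p"
  have A: "A 1 m * A 1 k + A 2 m * A 2 k = w * ((if m = k then 1 else 0) - x $ m * x $ k)" for m k
    unfolding A_def w_def x_def by (rule grad_stereo_sum[OF c])
  have D: "d2 1 k c p + d2 2 k c p = - 2 * w * x $ k" for k
    using lap_stereo[OF c, of k p] by (simp add: w_def x_def)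
  have s1: "(\<Sum>m\<in>UNIV. H m k * A 1 m) * A 1 k + (\<Sum>m\<in>UNIV. H m k * A 2 m) * A 2 k = (\<Sum>m\<in>UNIV. H m k * (A 1 m * A 1 k + A 2 m * A 2 k))" for k
    by (simp only: sum_distrib_right sum.distrib[symmetric] distrib_left mult.assoc)
  have s2: "(\<Sum>m\<in>UNIV. H m k * (w * ((if m = k then 1 else 0) - x $ m * x $ k))) = w * (H k k - (\<Sum>m\<in>UNIV. x $ k * x $ m * H m k))" for k
  proof -
    have "(\<Sum>m\<in>UNIV. H m k * (w * ((if m = k then 1 else 0) - x $ m * x $ k))) = (\<Sum>m\<in>UNIV. (if m = k then w * H m k else 0) - w * (x $ k * x $ m * H m k))"
      by (intro sum.cong refl) (auto simp: algebra_simps)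
    then show ?thesis by (simp add: sum_subtractf sum_distrib_left right_diff_distrib)
  qed
  have "partial 1 (partial 1 (F \<circ> stereo c)) p + partial 2 (partial 2 (F \<circ> stereo c)) p
    = (\<Sum>k\<in>UNIV. (\<Sum>m\<in>UNIV. H m k * (A 1 m * A 1 k + A 2 m * A 2 k)) + G k * (d2 1 k c p + d2 2 k c p))"
    unfolding partial_partial_comp H_def[symmetric] G_def[symmetric] A_def[symmetric]
    unfolding sum.distrib[symmetric] by (intro sum.cong refl) (simp only: s1[symmetric] distrib_left[of "G _"] add_ac)
  also have "\<dots> = (\<Sum>k\<in>UNIV. (\<Sum>m\<in>UNIV. H m k * (w * ((if m = k then 1 else 0) - x $ m * x $ k))) + G k * (- 2 * w * x $ k))"
    by (simp only: A D)
  also have "\<dots> = - w * slap F x"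
    unfolding slap_def H_def[folded x_def, symmetric] G_def[folded x_def, symmetric]
    unfolding s2 by (simp add: right_diff_distrib distrib_left sum_subtractf sum.distrib sum_distrib_left sum_negf mult_ac)
  finally show ?thesis
    using w unfolding laplace_coord_stereo[OF c] w_def[symmetric] by (simp add: x_def)
qed

end

lemma inv_stereo: "c\<^sup>2 = 1 \<Longrightarrow> inv_into UNIV (stereo c) (stereo c p) = p"
  by (rule inv_f_f[OF stereo_inj])

text \<open>Either chart yields the chart-free expression, so the change of chart at the pole leaves
  no trace in what follows.\<close>

lemma laplace_S2_slap:
  assumes U: "open U" "S2 \<subseteq> U" and F: "smooth_on U F" and Fu: "\<And>x. x \<in> S2 \<Longrightarrow> F x = u x" and x: "x \<in> S2"
  shows "laplace_S2 u x = slap F x"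
proof -
  define c :: real where "c = (if x = axis 3 1 then -1 else 1)"
  have c: "c\<^sup>2 = 1" by (simp add: c_def)
  have "x $ 3 \<noteq> c"
  proof
    assume x3: "x $ 3 = c"
    then have "(x$1)\<^sup>2 + (x$2)\<^sup>2 = 0" using x c unfolding S2_coords by simp
    then have "x$1 = 0" "x$2 = 0" by (simp_all add: sum_power2_eq_zero_iff)
    then show False using x3 unfolding c_def by (auto simp: vec3_eq_iff axis_def split: if_splits)
  qed
  then obtain p where p: "stereo c p = x" using stereo_surj[OF c x] by blast
  have uF: "u \<circ> stereo c = F \<circ> stereo c" using Fu stereo_in_S2[OF c] by (simp add: fun_eq_iff del: mem_sphere)
  have "laplace_S2 u x = laplace_coord (stereo c) (u \<circ> stereo c) (inv_into UNIV (stereo c) x)"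
    by (simp add: laplace_S2_def c_def Let_def)
  also have "\<dots> = slap F x"
    unfolding uF p[symmetric] inv_stereo[OF c] by (rule laplace_coord_comp[OF U F c])
  finally show ?thesis .
qed

lemma smooth_S2_iff: "u \<in> smooth_S2 \<longleftrightarrow> u \<in> extensional S2 \<and> (\<exists>U F. open U \<and> S2 \<subseteq> U \<and> smooth_on U F \<and> (\<forall>x\<in>S2. F x = u x))"
  by (simp add: smooth_S2_def smooth_on_def)

lemma smooth_S2E:
  assumes "u \<in> smooth_S2"
  obtains U F where "open U" "S2 \<subseteq> U" "smooth_on U F" "\<And>x. x \<in> S2 \<Longrightarrow> F x = u x"
  using assms unfolding smooth_S2_iff by blast

lemma smooth_S2I:
  assumes "open U" "S2 \<subseteq> U" "smooth_on U F" 
  shows "restrict F S2 \<in> smooth_S2"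
  unfolding smooth_S2_iff using assms by (auto intro!: exI[of _ U] exI[of _ F] simp del: mem_sphere)

lemma smooth_S2_laplace:
  assumes "u \<in> smooth_S2" shows "restrict (laplace_S2 u) S2 \<in> smooth_S2"
proof -
  obtain U F where U: "open U" "S2 \<subseteq> U" "smooth_on U F" "\<And>x. x \<in> S2 \<Longrightarrow> F x = u x"
    using smooth_S2E[OF assms] by metis
  have "restrict (laplace_S2 u) S2 = restrict (slap F) S2"
    using laplace_S2_slap[OF U] by (auto simp: restrict_def fun_eq_iff simp del: mem_sphere)
  then show ?thesis using smooth_S2I[OF U(1,2) smooth_on_slap[OF U(1,3)]] by simp
qed

lemma smooth_S2_continuous: 
  assumes "u \<in> smooth_S2" shows "continuous_on S2 u"
proof -
  obtain U F where U: "open U" "S2 \<subseteq> U" "smooth_on U F" "\<And>x. x \<in> S2 \<Longrightarrow> F x = u x"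
    using smooth_S2E[OF assms] by metis
  have "continuous_on S2 F" using smooth_on_continuous[OF U(3)] U(2) continuous_on_subset by blast
  then show ?thesis by (rule continuous_on_eq) (use U(4) in auto)
qed

section \<open>Green's formula on the sphere\<close>

lemma integral_line_zero:
  fixes f g :: "real \<Rightarrow> real"
  assumes d: "\<And>x. (f has_real_derivative g x) (at x)" and cg: "continuous_on UNIV g"
    and fb: "\<And>x. \<bar>f x\<bar> \<le> C / (1 + x\<^sup>2)" and gb: "\<And>x. \<bar>g x\<bar> \<le> C * (1 / (sqrt (1 + x\<^sup>2))^3)"
  shows "(LINT x|lborel. g x) = 0"
proof -
  have C: "C \<ge> 0" using fb[of 0] by simp
  have gm: "g \<in> borel_measurable borel" by (rule borel_measurable_continuous_onI[OF cg])
  have "integrable lborel (\<lambda>x::real. 1 / (sqrt (1 + x\<^sup>2))^3)"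
    using nn_integral_inv_3half[of 1]
    by (intro integrableI_nonneg) (auto simp: less_top[symmetric] ennreal_mult_less_top)
  then have "integrable lborel (\<lambda>x::real. C * (1 / (sqrt (1 + x\<^sup>2))^3))" by (rule integrable_mult_right)
  then have gi: "integrable lborel g"
    by (rule Bochner_Integration.integrable_bound) (use gm gb C in \<open>auto intro!: AE_I2\<close>)
  have l: "((\<lambda>x::real. C / (1 + x\<^sup>2)) \<longlongrightarrow> 0) at_top" "((\<lambda>x::real. C / (1 + x\<^sup>2)) \<longlongrightarrow> 0) at_bot"
    by real_asymp+
  have f0: "(f \<longlongrightarrow> 0) at_top" "(f \<longlongrightarrow> 0) at_bot"
    by (rule Lim_null_comparison[OF _ l(1)] Lim_null_comparison[OF _ l(2)], use fb in simp)+
  have "(LBINT x=-\<infinity>..\<infinity>. g x) = 0 - 0"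
  proof (rule interval_integral_FTC_integrable)
    show "set_integrable lborel (einterval (-\<infinity>) \<infinity>) g" using gi by (simp add: set_integrable_def)
    show "((f \<circ> real_of_ereal) \<longlongrightarrow> 0) (at_right (-\<infinity>))" using f0 by (simp add: ereal_tendsto_simps1)
    show "((f \<circ> real_of_ereal) \<longlongrightarrow> 0) (at_left \<infinity>)" using f0 by (simp add: ereal_tendsto_simps1)
    show "(f has_vector_derivative g x) (at x)" for x using d by (simp add: has_real_derivative_iff_has_vector_derivative)
    show "isCont g x" for x using cg by (simp add: continuous_on_eq_continuous_at)
  qed simp
  then show ?thesis by (simp add: interval_lebesgue_integral_def set_lebesgue_integral_def)
qed

lemma sqrt_conf: "(sqrt (conf p))\<^sup>2 = conf p" "sqrt (conf p) \<le> 1" "sqrt (conf p) > 0"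
proof -
  show "(sqrt (conf p))\<^sup>2 = conf p" "sqrt (conf p) > 0" using conf_pos[of p] by auto
  have "conf p \<le> 1" using conf_eq[of p] conf_pos[of p] conf_denom_pos[of p]
    unfolding conf_def by (simp add: divide_le_eq add_increasing)
  then show "sqrt (conf p) \<le> 1" by simp
qed

lemma nth_sqrt_conf: 
  fixes i :: 2
  shows "\<bar>p $ i\<bar> * sqrt (conf p) \<le> 1"
proof -
  have "conf p * (p$i)\<^sup>2 \<le> 1"
  proof -
    have "(p$i)\<^sup>2 \<le> (p$1)\<^sup>2 + (p$2)\<^sup>2" using exhaust_2[of i] by auto
    then have "conf p * (p$i)\<^sup>2 \<le> conf p * ((p$1)\<^sup>2 + (p$2)\<^sup>2)" using conf_pos[of p] by simp
    also have "\<dots> \<le> 1" using conf_sum_sq[of p] conf_pos[of p] by simp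
    finally show ?thesis .
  qed
  then have "(\<bar>p $ i\<bar> * sqrt (conf p))\<^sup>2 \<le> 1" using sqrt_conf(1)[of p] by (simp add: power_mult_distrib mult.commute)
  then have "\<bar>\<bar>p $ i\<bar> * sqrt (conf p)\<bar> \<le> 1" by (simp only: abs_square_le_1)
  then show ?thesis by linarith
qed

lemma abs_le_absI: "\<bar>x\<bar> \<le> a \<Longrightarrow> \<bar>y\<bar> \<le> b \<Longrightarrow> \<bar>x + y\<bar> \<le> a + (b::real)" by linarith

context
  fixes r :: real and a b :: real
  assumes r: "0 < r" "r \<le> 1" and a: "\<bar>a\<bar> * r \<le> 1" and b: "\<bar>b\<bar> * r \<le> 1"
begin

text \<open>Each factor \<open>a\<close> or \<open>b\<close> is absorbed by one power of
  \<open>r\<close>. In the applications \<open>r = sqrt (conf p)\<close> and \<open>a\<close>,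
  \<open>b\<close> are the coordinates of \<open>p\<close>.\<close>

lemma mono_bound: 
  assumes "i + j + m \<le> n"
  shows "\<bar>a ^ i * b ^ j * r ^ n\<bar> \<le> r ^ m"
proof -
  have e: "\<bar>a ^ i * b ^ j * r ^ n\<bar> = (\<bar>a\<bar> * r) ^ i * (\<bar>b\<bar> * r) ^ j * r ^ (n - i - j)"
  proof -
    have "r ^ n = r ^ i * r ^ j * r ^ (n - i - j)" using assms by (simp flip: power_add)
    then show ?thesis using r by (simp add: abs_mult power_abs power_mult_distrib)
  qed
  have "(\<bar>a\<bar> * r) ^ i * (\<bar>b\<bar> * r) ^ j * r ^ (n - i - j) \<le> 1 * 1 * r ^ m"
    using assms r a b by (intro mult_mono power_le_one power_decreasing) auto
  then show ?thesis using e by simp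
qed

end

lemma partial_stereo_bound:
  assumes c: "c\<^sup>2 = 1"
  shows "\<bar>partial i (stereo c) p $ k\<bar> \<le> 6 * conf p"
proof -
  define r where "r = sqrt (conf p)"
  have r: "0 < r" "r \<le> 1" "conf p = r\<^sup>2" using sqrt_conf[of p] by (auto simp: r_def)
  have c1: "\<bar>c\<bar> = 1" using c by (simp add: abs_square_eq_1)
  have ab: "\<bar>p$1\<bar> * r \<le> 1" "\<bar>p$2\<bar> * r \<le> 1" using nth_sqrt_conf by (auto simp: r_def)
  note M = mono_bound[OF r(1,2) ab]
  have m1: "\<bar>(p$1)^2 * r^4\<bar> \<le> r^2" using M[of 2 0 2 4] by simp
  have m2: "\<bar>(p$2)^2 * r^4\<bar> \<le> r^2" using M[of 0 2 2 4] by simp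
  have m3: "\<bar>p$1 * p$2 * r^4\<bar> \<le> r^2" using M[of 1 1 2 4] by simp
  have m4: "\<bar>p$1 * r^4\<bar> \<le> r^2" using M[of 1 0 2 4] by simp
  have m5: "\<bar>p$2 * r^4\<bar> \<le> r^2" using M[of 0 1 2 4] by simp
  have q: "(r\<^sup>2)\<^sup>2 = r^4" by simp
  have r2: "r\<^sup>2 \<ge> 0" by simp
  have g: "\<bar>2 * r\<^sup>2 - 4 * (p$1)\<^sup>2 * (r\<^sup>2)\<^sup>2\<bar> \<le> 6 * r\<^sup>2" "\<bar>2 * r\<^sup>2 - 4 * (p$2)\<^sup>2 * (r\<^sup>2)\<^sup>2\<bar> \<le> 6 * r\<^sup>2"
    "\<bar>- 4 * p$1 * p$2 * (r\<^sup>2)\<^sup>2\<bar> \<le> 6 * r\<^sup>2"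
    using m1 m2 m3 r2 unfolding q by linarith+
  have h: "\<bar>4 * c * p$1 * (r\<^sup>2)\<^sup>2\<bar> \<le> 6 * r\<^sup>2" "\<bar>4 * c * p$2 * (r\<^sup>2)\<^sup>2\<bar> \<le> 6 * r\<^sup>2"
  proof -
    have "\<bar>4 * c * t * r^4\<bar> = 4 * \<bar>t * r^4\<bar>" for t using c1 by (simp add: abs_mult)
    then show "\<bar>4 * c * p$1 * (r\<^sup>2)\<^sup>2\<bar> \<le> 6 * r\<^sup>2" "\<bar>4 * c * p$2 * (r\<^sup>2)\<^sup>2\<bar> \<le> 6 * r\<^sup>2"
      using m4 m5 r2 unfolding q by simp_all
  qed
  note E = exhaust_2[of i] exhaust_3[of k]
  show ?thesis unfolding r(3)
    by (insert E, elim disjE; hypsubst, unfold partial_stereo_nth r(3), (rule g h)+)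
qed

lemma d2_bound:
  assumes c: "c\<^sup>2 = 1"
  shows "\<bar>d2 i k c p\<bar> \<le> 28 * (sqrt (conf p))^3"
proof -
  define r where "r = sqrt (conf p)"
  have r: "0 < r" "r \<le> 1" "conf p = r\<^sup>2" using sqrt_conf[of p] by (auto simp: r_def)
  have c1: "\<bar>c\<bar> = 1" using c by (simp add: abs_square_eq_1)
  have ab: "\<bar>p$1\<bar> * r \<le> 1" "\<bar>p$2\<bar> * r \<le> 1" using nth_sqrt_conf by (auto simp: r_def)
  have q: "(r\<^sup>2)\<^sup>2 = r^4" "(r\<^sup>2)^3 = r^6" by (simp_all flip: power_mult)
  have G: "\<bar>- 12 * a * (r\<^sup>2)\<^sup>2 + 16 * a^3 * (r\<^sup>2)^3\<bar> \<le> 28 * r^3"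
    "\<bar>- 4 * b * (r\<^sup>2)\<^sup>2 + 16 * a\<^sup>2 * b * (r\<^sup>2)^3\<bar> \<le> 28 * r^3"
    "\<bar>4 * c * (r\<^sup>2)\<^sup>2 - 16 * c * a\<^sup>2 * (r\<^sup>2)^3\<bar> \<le> 28 * r^3"
    if a: "\<bar>a\<bar> * r \<le> 1" and b: "\<bar>b\<bar> * r \<le> 1" for a b
  proof -
    note M = mono_bound[OF r(1,2) a b]
    have m: "\<bar>a * r^4\<bar> \<le> r^3" "\<bar>a^3 * r^6\<bar> \<le> r^3" "\<bar>b * r^4\<bar> \<le> r^3" "\<bar>a\<^sup>2 * b * r^6\<bar> \<le> r^3"
      "\<bar>r^4\<bar> \<le> r^3" "\<bar>a\<^sup>2 * r^6\<bar> \<le> r^3"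
      using M[of 1 0 3 4] M[of 3 0 3 6] M[of 0 1 3 4] M[of 2 1 3 6] M[of 0 0 3 4] M[of 2 0 3 6] by simp_all
    have r3: "r^3 \<ge> 0" using r by simp
    show "\<bar>- 12 * a * (r\<^sup>2)\<^sup>2 + 16 * a^3 * (r\<^sup>2)^3\<bar> \<le> 28 * r^3" 
      "\<bar>- 4 * b * (r\<^sup>2)\<^sup>2 + 16 * a\<^sup>2 * b * (r\<^sup>2)^3\<bar> \<le> 28 * r^3" unfolding q using m r3 by linarith+
    have "4 * c * r^4 - 16 * c * a\<^sup>2 * r^6 = c * (4 * r^4 - 16 * (a\<^sup>2 * r^6))" by (simp add: algebra_simps)
    then have "\<bar>4 * c * r^4 - 16 * c * a\<^sup>2 * r^6\<bar> = \<bar>4 * r^4 - 16 * (a\<^sup>2 * r^6)\<bar>" using c1 by (simp add: abs_mult)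
    also have "\<dots> \<le> 28 * r^3" using m r3 by linarith
    finally show "\<bar>4 * c * (r\<^sup>2)\<^sup>2 - 16 * c * a\<^sup>2 * (r\<^sup>2)^3\<bar> \<le> 28 * r^3" unfolding q .
  qed
  note G12 = G[OF ab] and G21 = G[OF ab(2) ab(1)]
  note E = exhaust_2[of i] exhaust_3[of k]
  show ?thesis unfolding r_def[symmetric]
    by (insert E, elim disjE; hypsubst, unfold d2_def Let_def neq3 neq2 simp_thms if_True if_False r(3), (rule G12 G21)+)
qed

lemma continuous_partial_stereo: "continuous_on A (\<lambda>p. partial a (stereo c) p $ k)"
  using partial_stereo_diff differentiable_imp_continuous_within
  by (intro continuous_at_imp_continuous_on) blast

lemma continuous_on_if_fixed: "continuous_on A f \<Longrightarrow> continuous_on A g \<Longrightarrow> continuous_on A (\<lambda>x. if P then f x else g x)"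
  by (cases P) simp_all

lemma continuous_d2: "continuous_on A (d2 a k c)"
proof -
  have "continuous_on A (\<lambda>p. d2 a k c p)"
    unfolding d2_def Let_def by (intro continuous_on_if_fixed continuous_intros continuous_conf)
  then show ?thesis by simp
qed

text \<open>The first and second derivatives of the chart decay like \<open>|p|^-2\<close> and
  \<open>|p|^-3\<close>, while \<open>F\<close> and its ambient derivatives are bounded on the
  compact sphere.\<close>

lemma decay:
  assumes U: "open U" "S2 \<subseteq> U" and F: "smooth_on U F" and c: "c\<^sup>2 = 1"
  obtains C where "\<And>p. \<bar>F (stereo c p)\<bar> \<le> C" "\<And>a p. \<bar>partial a (F \<circ> stereo c) p\<bar> \<le> C * conf p"
    "\<And>a p. \<bar>partial a (partial a (F \<circ> stereo c)) p\<bar> \<le> C * (sqrt (conf p))^3"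
proof -
  have cont: "continuous_on S2 G" if "smooth_on U G" for G
    using smooth_on_continuous[OF that] U(2) continuous_on_subset by blast
  have bd: "\<exists>B. \<forall>p. \<bar>G (stereo c p)\<bar> \<le> B" if "smooth_on U G" for G
    using S2_cont_bounded[OF cont[OF that]] stereo_in_S2[OF c] by (metis real_norm_def)
  obtain B0 where B0: "\<And>p. \<bar>F (stereo c p)\<bar> \<le> B0" using bd[OF F] by blast
  have "\<forall>k. \<exists>B. \<forall>p. \<bar>pd k F (stereo c p)\<bar> \<le> B" using bd[OF smooth_on_pd[OF F]] by blast
  then obtain B1 where B1: "\<And>k p. \<bar>pd k F (stereo c p)\<bar> \<le> B1 k" by metis
  have "\<forall>k m. \<exists>B. \<forall>p. \<bar>pd m (pd k F) (stereo c p)\<bar> \<le> B" using bd[OF smooth_on_pd[OF smooth_on_pd[OF F]]] by blast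
  then obtain B2 where B2: "\<And>k m p. \<bar>pd m (pd k F) (stereo c p)\<bar> \<le> B2 k m" by metis
  have B1n: "B1 k \<ge> 0" for k using B1[of k 0] by linarith
  have B2n: "B2 k m \<ge> 0" for k m using B2[of m k 0] by linarith
  define C1 where "C1 = (\<Sum>k\<in>UNIV. B1 k * 6)"
  define C2 where "C2 = (\<Sum>k\<in>UNIV. (\<Sum>m\<in>UNIV. B2 k m * 6) * 6 + B1 k * 28)"
  have b1: "\<bar>partial a (F \<circ> stereo c) p\<bar> \<le> C1 * conf p" for a p
  proof -
    have "\<bar>partial a (F \<circ> stereo c) p\<bar> \<le> (\<Sum>k\<in>UNIV. \<bar>pd k F (stereo c p) * partial a (stereo c) p $ k\<bar>)"
      unfolding partial_comp[OF U F c] by (rule sum_abs)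
    also have "\<dots> \<le> (\<Sum>k\<in>UNIV. B1 k * (6 * conf p))"
      unfolding abs_mult by (intro sum_mono mult_mono B1 partial_stereo_bound[OF c] B1n) auto
    also have "\<dots> = C1 * conf p" by (simp add: C1_def sum_distrib_right mult.assoc)
    finally show ?thesis .
  qed
  have b2: "\<bar>partial a (partial a (F \<circ> stereo c)) p\<bar> \<le> C2 * (sqrt (conf p))^3" for a p
  proof -
    define r where "r = sqrt (conf p)"
    have r: "0 < r" "r \<le> 1" "conf p = r\<^sup>2" using sqrt_conf[of p] by (auto simp: r_def)
    have r43: "6 * r\<^sup>2 * (6 * r\<^sup>2) \<le> 6 * 6 * r^3"
    proof -
      have "r^4 \<le> r^3" using r by (intro power_decreasing) auto
      then show ?thesis by (simp flip: power_add)
    qed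
    have t: "\<bar>(\<Sum>m\<in>UNIV. pd m (pd k F) (stereo c p) * partial a (stereo c) p $ m) * partial a (stereo c) p $ k
      + pd k F (stereo c p) * d2 a k c p\<bar> \<le> ((\<Sum>m\<in>UNIV. B2 k m * 6) * 6 + B1 k * 28) * r^3" for k
    proof -
      have i: "\<bar>\<Sum>m\<in>UNIV. pd m (pd k F) (stereo c p) * partial a (stereo c) p $ m\<bar> \<le> (\<Sum>m\<in>UNIV. B2 k m * (6 * r\<^sup>2))"
        by (rule order_trans[OF sum_abs], unfold abs_mult)
          (intro sum_mono mult_mono B2 partial_stereo_bound[OF c, of _ p, unfolded r(3)] B2n, auto)
      have "\<bar>(\<Sum>m\<in>UNIV. pd m (pd k F) (stereo c p) * partial a (stereo c) p $ m) * partial a (stereo c) p $ k\<bar>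
        \<le> (\<Sum>m\<in>UNIV. B2 k m * (6 * r\<^sup>2)) * (6 * r\<^sup>2)"
        unfolding abs_mult by (intro mult_mono i partial_stereo_bound[OF c, of _ p, unfolded r(3)] sum_nonneg mult_nonneg_nonneg B2n) auto
      also have "\<dots> = (\<Sum>m\<in>UNIV. B2 k m) * (6 * r\<^sup>2 * (6 * r\<^sup>2))" by (simp only: sum_distrib_right mult.assoc)
      also have "\<dots> \<le> (\<Sum>m\<in>UNIV. B2 k m) * (6 * 6 * r^3)" 
        by (intro mult_left_mono r43 sum_nonneg B2n)
      also have "\<dots> = (\<Sum>m\<in>UNIV. B2 k m * 6) * 6 * r^3" by (simp only: sum_distrib_right mult.assoc)
      finally have "\<bar>(\<Sum>m\<in>UNIV. pd m (pd k F) (stereo c p) * partial a (stereo c) p $ m) * partial a (stereo c) p $ k\<bar>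
        \<le> (\<Sum>m\<in>UNIV. B2 k m * 6) * 6 * r^3" .
      moreover have "\<bar>pd k F (stereo c p) * d2 a k c p\<bar> \<le> B1 k * (28 * r^3)"
        unfolding abs_mult r_def by (intro mult_mono B1 d2_bound[OF c] B1n) auto
      ultimately show ?thesis unfolding distrib_right mult.assoc by (rule abs_le_absI)
    qed
    have "\<bar>partial a (partial a (F \<circ> stereo c)) p\<bar> \<le> (\<Sum>k\<in>UNIV. ((\<Sum>m\<in>UNIV. B2 k m * 6) * 6 + B1 k * 28) * r^3)"
      unfolding partial_partial_comp[OF U F c] by (rule order_trans[OF sum_abs]) (intro sum_mono t)
    also have "\<dots> = C2 * r^3" by (simp only: C2_def sum_distrib_right)
    finally show ?thesis by (simp add: r_def)
  qed
  define C where "C = max B0 (max C1 C2)"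
  show thesis
  proof (rule that[of C])
    show "\<bar>F (stereo c p)\<bar> \<le> C" for p using B0[of p] by (simp add: C_def)
    show "\<bar>partial a (F \<circ> stereo c) p\<bar> \<le> C * conf p" for a p
      by (rule order_trans[OF b1 mult_right_mono]) (simp_all add: C_def less_imp_le[OF conf_pos])
    show "\<bar>partial a (partial a (F \<circ> stereo c)) p\<bar> \<le> C * (sqrt (conf p))^3" for a p
      by (rule order_trans[OF b2 mult_right_mono]) (simp_all add: C_def less_imp_le[OF conf_pos])
  qed
qed

lemma continuous_partial_partial:
  assumes U: "open U" "S2 \<subseteq> U" and F: "smooth_on U F" and c: "c\<^sup>2 = 1"
  shows "continuous_on A (partial a (partial a (F \<circ> stereo c)))"
proof -
  have k: "continuous_on A (\<lambda>p. G (stereo c p))" if "smooth_on U G" for G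
  proof (rule continuous_on_compose2[OF _ continuous_stereo])
    show "continuous_on U G" by (rule smooth_on_continuous[OF that])
    show "stereo c ` A \<subseteq> U" using stereo_in_U[OF U F c] by auto
  qed
  have "continuous_on A (\<lambda>p. partial a (partial a (F \<circ> stereo c)) p)"
    unfolding partial_partial_comp[OF U F c]
    by (intro continuous_intros k smooth_on_pd F continuous_partial_stereo continuous_d2)
  then show ?thesis by simp
qed

lemma integral_real2:
  fixes g :: "real^2 \<Rightarrow> real"
  assumes "integrable lborel g"
  shows "(LINT p|lborel. g p) = (LINT b|lborel. LINT a|lborel. g (vector [a, b]))"
    "(LINT p|lborel. g p) = (LINT a|lborel. LINT b|lborel. g (vector [a, b]))"
proof -
  have gm: "g \<in> borel_measurable borel" using assms by simp
  have e: "(LINT p|lborel. g p) = (LINT z|(lborel \<Otimes>\<^sub>M lborel). g (vector [fst z, snd z]))"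
    by (subst lborel_vec2, subst integral_distr[OF measurable_vector2 gm]) (simp add: case_prod_beta')
  have i: "integrable (lborel \<Otimes>\<^sub>M lborel) (\<lambda>z. g (vector [fst z, snd z]))"
  proof -
    have "integrable (distr (lborel \<Otimes>\<^sub>M lborel) borel (\<lambda>(a, b). vector [a, b])) g"
      using assms by (simp only: lborel_vec2[symmetric])
    then show ?thesis unfolding integrable_distr_eq[OF measurable_vector2 gm] by (simp add: case_prod_beta')
  qed
  then have i': "integrable (lborel \<Otimes>\<^sub>M lborel) (case_prod (\<lambda>a b. g (vector [a, b])))"
    by (simp add: case_prod_beta')
  show "(LINT p|lborel. g p) = (LINT b|lborel. LINT a|lborel. g (vector [a, b]))"
    unfolding e lborel_pair.integral_snd[OF i'] by (simp add: case_prod_beta')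
  show "(LINT p|lborel. g p) = (LINT a|lborel. LINT b|lborel. g (vector [a, b]))"
    unfolding e lborel_pair.integral_fst[OF i'] by (simp add: case_prod_beta')
qed

lemma partial_line:
  assumes "\<And>p. G differentiable at p"
  shows "((\<lambda>x. G (vector [x, b])) has_real_derivative partial 1 G (vector [x, b])) (at x)"
    "((\<lambda>x. G (vector [b, x])) has_real_derivative partial 2 G (vector [b, x])) (at x)"
proof -
  have d: "(G has_derivative frechet_derivative G (at p)) (at p)" for p
    using assms by (simp add: frechet_derivative_works)
  then have lin: "linear (frechet_derivative G (at p))" for p using has_derivative_linear by blast
  have v1: "((\<lambda>x. vector [x, b] :: real^2) has_derivative (\<lambda>h. h *\<^sub>R axis 1 1)) (at x)"
    unfolding vector2_axis by (auto intro!: derivative_eq_intros)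
  have v2: "((\<lambda>x. vector [b, x] :: real^2) has_derivative (\<lambda>h. h *\<^sub>R axis 2 1)) (at x)"
    unfolding vector2_axis by (auto intro!: derivative_eq_intros)
  have s: "frechet_derivative G (at p) (h *\<^sub>R v) = frechet_derivative G (at p) v * h" for p h v
    using lin by (simp add: linear_cmul)
  from diff_chain_at[OF v1 d] show "((\<lambda>x. G (vector [x, b])) has_real_derivative partial 1 G (vector [x, b])) (at x)"
    by (simp add: has_field_derivative_def o_def s partial_def)
  from diff_chain_at[OF v2 d] show "((\<lambda>x. G (vector [b, x])) has_real_derivative partial 2 G (vector [b, x])) (at x)"
    by (simp add: has_field_derivative_def o_def s partial_def)
qed

lemma integrable_decay:
  assumes "g \<in> borel_measurable borel" and "\<And>p. \<bar>g p\<bar> \<le> C * (sqrt (conf p))^3"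
  shows "integrable lborel g"
proof (rule Bochner_Integration.integrable_bound)
  have "integrable lborel (\<lambda>p. (sqrt (conf p))^3)"
    using nn_integral_conf_3half by (intro integrableI_nonneg) (auto intro!: AE_I2 less_imp_le[OF conf_pos])
  then show "integrable lborel (\<lambda>p. C * (sqrt (conf p))^3)" by (rule integrable_mult_right)
  show "AE p in lborel. norm (g p) \<le> norm (C * (sqrt (conf p))^3)"
    using assms(2) by (intro AE_I2) (metis abs_ge_self order_trans real_norm_def)
qed (use assms(1) in simp)

text \<open>Fubini's theorem is applied with the direction of the derivative as the inner integral,
  where the fundamental theorem of calculus gives zero because \<open>G\<close> vanishes at
  infinity.\<close>

lemma integral_partial_zero:
  assumes d: "\<And>p. G differentiable at p" and cg: "continuous_on UNIV (partial a G)"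
    and Gb: "\<And>p. \<bar>G p\<bar> \<le> C * conf p" and gb: "\<And>p. \<bar>partial a G p\<bar> \<le> C * (sqrt (conf p))^3"
  shows "integrable lborel (partial a G)" "(LINT p|lborel. partial a G p) = 0"
proof -
  have m: "partial a G \<in> borel_measurable borel" by (rule borel_measurable_continuous_onI[OF cg])
  show i: "integrable lborel (partial a G)" by (rule integrable_decay[OF m gb])
  have C: "C \<ge> 0" 
  proof -
    have "0 \<le> C * conf 0" using Gb[of 0] abs_ge_zero[of "G 0"] by linarith
    then show ?thesis using conf_pos[of 0] by (simp add: zero_le_mult_iff)
  qed
  have w: "conf p \<le> 1 / (1 + (p $ i)\<^sup>2)" for p and i :: 2
    unfolding conf_def using exhaust_2[of i] by (intro divide_left_mono mult_pos_pos conf_denom_pos) (auto simp: add_pos_nonneg)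
  have b1: "\<bar>G p\<bar> \<le> C / (1 + (p $ i)\<^sup>2)" for p i
    using order_trans[OF Gb mult_left_mono[OF w[of p i] C]] by simp
  have b2: "\<bar>partial a G p\<bar> \<le> C * (1 / (sqrt (1 + (p $ i)\<^sup>2))^3)" for p i
  proof -
    have "(sqrt (conf p))^3 \<le> (sqrt (1 / (1 + (p $ i)\<^sup>2)))^3"
      using w[of p i] conf_pos[of p] by (intro power_mono) auto
    also have "\<dots> = 1 / (sqrt (1 + (p $ i)\<^sup>2))^3" by (simp add: real_sqrt_divide power_divide)
    finally show ?thesis using order_trans[OF gb mult_left_mono[OF _ C]] by blast
  qed
  have cl1: "continuous_on UNIV (\<lambda>x. partial a G (vector [x, b]))" for b
    by (rule continuous_on_compose2[OF cg]) (auto simp: vector2_axis intro!: continuous_intros)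
  have cl2: "continuous_on UNIV (\<lambda>x. partial a G (vector [b, x]))" for b
    by (rule continuous_on_compose2[OF cg]) (auto simp: vector2_axis intro!: continuous_intros)
  consider (1) "a = 1" | (2) "a = 2" using exhaust_2[of a] by blast
  then show "(LINT p|lborel. partial a G p) = 0"
  proof cases
    case 1
    have "(LINT x|lborel. partial a G (vector [x, b])) = 0" for b
      by (rule integral_line_zero[where f="\<lambda>x. G (vector [x, b])" and C=C])
        (rule partial_line(1)[OF d, of b, folded 1] cl1 b1[of "vector [x, b]" 1 for x, unfolded vector_2] b2[of "vector [x, b]" 1 for x, unfolded vector_2])+
    then show ?thesis unfolding integral_real2(1)[OF i] by simp
  next
    case 2
    have "(LINT x|lborel. partial a G (vector [b, x])) = 0" for b
      by (rule integral_line_zero[where f="\<lambda>x. G (vector [b, x])" and C=C])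
        (rule partial_line(2)[OF d, of b, folded 2] cl2 b1[of "vector [b, x]" 2 for x, unfolded vector_2] b2[of "vector [b, x]" 2 for x, unfolded vector_2])+
    then show ?thesis unfolding integral_real2(2)[OF i] by simp
  qed
qed

text \<open>The difference is the derivative of \<open>f * \<partial>h - h * \<partial>f\<close>,
  which decays like \<open>conf p\<close>; hence the point of the sphere missed by the chart
  contributes no boundary term.\<close>

lemma green_partial:
  assumes U: "open U" "S2 \<subseteq> U" and F: "smooth_on U F"
    and V: "open V" "S2 \<subseteq> V" and H: "smooth_on V H" and c: "c\<^sup>2 = 1"
  defines "f \<equiv> F \<circ> stereo c" and "h \<equiv> H \<circ> stereo c"
  shows "(LINT p|lborel. f p * partial a (partial a h) p - h p * partial a (partial a f) p) = 0"
    "integrable lborel (\<lambda>p. f p * partial a (partial a h) p)"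
proof -
  obtain C1 where C1: "\<And>p. \<bar>f p\<bar> \<le> C1" "\<And>a p. \<bar>partial a f p\<bar> \<le> C1 * conf p"
    "\<And>a p. \<bar>partial a (partial a f) p\<bar> \<le> C1 * (sqrt (conf p))^3"
  proof (rule decay[OF U F c])
    fix C assume "\<And>p. \<bar>F (stereo c p)\<bar> \<le> C" "\<And>a p. \<bar>partial a (F \<circ> stereo c) p\<bar> \<le> C * conf p"
      "\<And>a p. \<bar>partial a (partial a (F \<circ> stereo c)) p\<bar> \<le> C * (sqrt (conf p))^3"
    then show thesis using that[of C] unfolding f_def o_apply by blast
  qed
  obtain C2 where C2: "\<And>p. \<bar>h p\<bar> \<le> C2" "\<And>a p. \<bar>partial a h p\<bar> \<le> C2 * conf p"
    "\<And>a p. \<bar>partial a (partial a h) p\<bar> \<le> C2 * (sqrt (conf p))^3"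
  proof (rule decay[OF V H c])
    fix C assume "\<And>p. \<bar>H (stereo c p)\<bar> \<le> C" "\<And>a p. \<bar>partial a (H \<circ> stereo c) p\<bar> \<le> C * conf p"
      "\<And>a p. \<bar>partial a (partial a (H \<circ> stereo c)) p\<bar> \<le> C * (sqrt (conf p))^3"
    then show thesis using that[of C] unfolding h_def o_apply by blast
  qed
  have C1n: "C1 \<ge> 0" and C2n: "C2 \<ge> 0" using C1(1)[of 0] C2(1)[of 0] by linarith+
  have fd: "f differentiable at p" "h differentiable at p" for p
    unfolding f_def h_def by (rule comp_diff[OF U F c] comp_diff[OF V H c])+
  have fd': "partial a f differentiable at p" "partial a h differentiable at p" for p
    unfolding f_def h_def by (rule partial_comp_diff[OF U F c] partial_comp_diff[OF V H c])+
  have fc: "continuous_on UNIV f" "continuous_on UNIV h"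
    using fd differentiable_imp_continuous_within by (intro continuous_at_imp_continuous_on; blast)+
  have pc: "continuous_on UNIV (partial a (partial a f))" "continuous_on UNIV (partial a (partial a h))"
    unfolding f_def h_def by (rule continuous_partial_partial[OF U F c] continuous_partial_partial[OF V H c])+
  define G where "G p = f p * partial a h p - h p * partial a f p" for p
  have Gd: "(G has_derivative (\<lambda>v. (f p * frechet_derivative (partial a h) (at p) v + frechet_derivative f (at p) v * partial a h p)
      - (h p * frechet_derivative (partial a f) (at p) v + frechet_derivative h (at p) v * partial a f p))) (at p)" for p
    unfolding G_def using fd fd' by (intro has_derivative_diff has_derivative_mult) (simp_all add: frechet_derivative_works)
  have pG: "partial a G = (\<lambda>p. f p * partial a (partial a h) p - h p * partial a (partial a f) p)"
    using partial_eq[OF Gd, of a] by (simp add: fun_eq_iff partial_def)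
  have "(LINT p|lborel. partial a G p) = 0"
  proof (rule integral_partial_zero(2)[where C="2 * C1 * C2"])
    show "G differentiable at p" for p using Gd differentiable_def by blast
    show "continuous_on UNIV (partial a G)" unfolding pG by (intro continuous_intros fc pc)
    fix p
    have k: "\<bar>f p * y - h p * z\<bar> \<le> 2 * C1 * C2 * w" if "\<bar>y\<bar> \<le> C2 * w" "\<bar>z\<bar> \<le> C1 * w" "w \<ge> 0" for y z w
    proof -
      have "\<bar>f p * y\<bar> \<le> C1 * (C2 * w)" "\<bar>h p * z\<bar> \<le> C2 * (C1 * w)"
        unfolding abs_mult by (intro mult_mono C1(1) C2(1) that C1n C2n, simp)+
      then show ?thesis by (simp add: algebra_simps)
    qed
    show "\<bar>G p\<bar> \<le> 2 * C1 * C2 * conf p" unfolding G_def by (rule k[OF C2(2) C1(2)]) (rule less_imp_le[OF conf_pos])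
    show "\<bar>partial a G p\<bar> \<le> 2 * C1 * C2 * (sqrt (conf p))^3" unfolding pG 
      by (rule k[OF C2(3) C1(3)]) (use conf_pos[of p] in simp)
  qed
  then show "(LINT p|lborel. f p * partial a (partial a h) p - h p * partial a (partial a f) p) = 0"
    unfolding pG .
  show "integrable lborel (\<lambda>p. f p * partial a (partial a h) p)"
  proof (rule integrable_decay[where C="C1 * C2"])
    show "(\<lambda>p. f p * partial a (partial a h) p) \<in> borel_measurable borel"
      by (rule borel_measurable_continuous_onI) (intro continuous_intros fc pc)
    show "\<bar>f p * partial a (partial a h) p\<bar> \<le> C1 * C2 * (sqrt (conf p))^3" for p
      using mult_mono[OF C1(1)[of p] C2(3)[of a p] C1n] by (simp add: abs_mult mult.assoc)
  qed
qed

text \<open>The area density cancels the factor of the Laplacian in the chart, and what remains is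
  Green's formula for the flat Laplacian, one direction at a time.\<close>

theorem green_S2:
  assumes u: "u \<in> smooth_S2" and v: "v \<in> smooth_S2"
  shows "(LINT x|sigma_S2. u x * laplace_S2 v x) = (LINT x|sigma_S2. laplace_S2 u x * v x)"
proof -
  obtain U F where U: "open U" "S2 \<subseteq> U" "smooth_on U F" "\<And>x. x \<in> S2 \<Longrightarrow> F x = u x"
    using smooth_S2E[OF u] by metis
  obtain V H where V: "open V" "S2 \<subseteq> V" "smooth_on V H" "\<And>x. x \<in> S2 \<Longrightarrow> H x = v x"
    using smooth_S2E[OF v] by metis
  define f h where "f = F \<circ> stereo 1" and "h = H \<circ> stereo 1"
  have c: "(1::real)\<^sup>2 = 1" by simp
  have key: "(LINT x|area_S2. u x * laplace_S2 v x) = - (LINT p|lborel. f p * partial 1 (partial 1 h) p + f p * partial 2 (partial 2 h) p)"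
    if "u \<in> smooth_S2" "v \<in> smooth_S2" and V: "open V" "S2 \<subseteq> V" "smooth_on V H" "\<And>x. x \<in> S2 \<Longrightarrow> H x = v x" 
      and U: "\<And>x. x \<in> S2 \<Longrightarrow> F x = u x" and "f = F \<circ> stereo 1" "h = H \<circ> stereo 1" for u v V H F f h
  proof -
    have "continuous_on S2 (\<lambda>x. u x * restrict (laplace_S2 v) S2 x)"
      using that(1) smooth_S2_laplace[OF that(2)] by (intro continuous_intros smooth_S2_continuous)
    then have "continuous_on S2 (\<lambda>x. u x * laplace_S2 v x)" by (rule continuous_on_eq) simp
    then have m: "(\<lambda>x. u x * laplace_S2 v x) \<in> borel_measurable (restrict_space borel S2)" by (rule S2_cont_measurable)
    have E: "4 * (conf p)\<^sup>2 * (u (stereo 1 p) * laplace_S2 v (stereo 1 p)) = - (f p * partial 1 (partial 1 h) p + f p * partial 2 (partial 2 h) p)" for p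
    proof -
      have "laplace_S2 v (stereo 1 p) = laplace_coord (stereo 1) h p"
        unfolding that(9) laplace_coord_comp[OF V(1-3) c] by (rule laplace_S2_slap[OF V(1-4) stereo_in_S2[OF c]])
      then have L: "4 * (conf p)\<^sup>2 * laplace_S2 v (stereo 1 p) = - (partial 1 (partial 1 h) p + partial 2 (partial 2 h) p)"
        using conf_pos[of p] by (simp add: laplace_coord_stereo[OF c])
      have "4 * (conf p)\<^sup>2 * (u (stereo 1 p) * laplace_S2 v (stereo 1 p)) = u (stereo 1 p) * (4 * (conf p)\<^sup>2 * laplace_S2 v (stereo 1 p))"
        by (simp only: mult_ac)
      also have "\<dots> = - (f p * partial 1 (partial 1 h) p + f p * partial 2 (partial 2 h) p)"
        unfolding L that(8) o_apply U[OF stereo_in_S2[OF c], of p] by (simp only: mult_minus_right distrib_left)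
      finally show ?thesis .
    qed
    show ?thesis unfolding integral_area_S2[OF m] E by (rule Bochner_Integration.integral_minus)
  qed
  have k1: "(LINT x|area_S2. u x * laplace_S2 v x) = - (LINT p|lborel. f p * partial 1 (partial 1 h) p + f p * partial 2 (partial 2 h) p)"
    by (rule key[OF u v V U(4) f_def h_def])
  have k2: "(LINT x|area_S2. v x * laplace_S2 u x) = - (LINT p|lborel. h p * partial 1 (partial 1 f) p + h p * partial 2 (partial 2 f) p)"
    by (rule key[OF v u U V(4) h_def f_def])
  note g = green_partial[OF U(1-3) V(1-3) c, folded f_def h_def] 
  note g' = green_partial[OF V(1-3) U(1-3) c, folded f_def h_def] 
  have eq: "(LINT p|lborel. f p * partial a (partial a h) p) = (LINT p|lborel. h p * partial a (partial a f) p)" for a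
    using g(1)[of a] by (subst (asm) Bochner_Integration.integral_diff[OF g(2) g'(2)]) simp
  have "(LINT x|area_S2. u x * laplace_S2 v x) = - ((LINT p|lborel. f p * partial 1 (partial 1 h) p) + (LINT p|lborel. f p * partial 2 (partial 2 h) p))"
    by (rule trans[OF k1], rule arg_cong[where f=uminus], rule Bochner_Integration.integral_add) (rule g(2))+
  also have "\<dots> = - ((LINT p|lborel. h p * partial 1 (partial 1 f) p) + (LINT p|lborel. h p * partial 2 (partial 2 f) p))"
    by (simp only: eq)
  also have "\<dots> = (LINT x|area_S2. v x * laplace_S2 u x)"
    by (rule trans[OF _ k2[symmetric]], rule arg_cong[where f=uminus], rule Bochner_Integration.integral_add[symmetric]) (rule g'(2))+
  finally have "(LINT x|area_S2. u x * laplace_S2 v x) = (LINT x|area_S2. v x * laplace_S2 u x)" .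
  moreover have m: "(\<lambda>x. u x * laplace_S2 v x) \<in> borel_measurable (restrict_space borel S2)"
    if "u \<in> smooth_S2" "v \<in> smooth_S2" for u v
  proof -
    have "continuous_on S2 (\<lambda>x. u x * restrict (laplace_S2 v) S2 x)"
      using that(1) smooth_S2_laplace[OF that(2)] by (intro continuous_intros smooth_S2_continuous)
    then have "continuous_on S2 (\<lambda>x. u x * laplace_S2 v x)" by (rule continuous_on_eq) simp
    then show ?thesis by (rule S2_cont_measurable)
  qed
  ultimately show ?thesis
    unfolding integral_area_sigma[OF m[OF u v]] integral_area_sigma[OF m[OF v u]] by (simp add: mult.commute)
qed

section \<open>Averaging operators and spherical harmonics\<close>

text \<open>The coordinates of \<open>(1, x) / sqrt 2\<close>, so that \<open>qk x y\<close> is an inner product of such vectors.\<close>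

definition hatc :: "3 option \<Rightarrow> real^3 \<Rightarrow> real" where
  "hatc a x = (case a of None \<Rightarrow> 1 | Some i \<Rightarrow> x $ i) / sqrt 2"

lemma sum_UNIV_option: "(\<Sum>a\<in>UNIV. f a) = f None + (\<Sum>i\<in>UNIV. f (Some i))" for f :: "'k::finite option \<Rightarrow> real"
  unfolding UNIV_option_conv by (subst sum.insert) (auto simp: sum.reindex)

lemma qk_hatc: "qk x y = (\<Sum>a\<in>UNIV. hatc a x * hatc a y)"
  unfolding sum_UNIV_option by (simp add: qk_def hatc_def inner_vec_def add_divide_distrib sum_divide_distrib)

definition featset :: "nat \<Rightarrow> (nat \<Rightarrow> 3 option) set" where
  "featset n = PiE {..<n} (\<lambda>_. UNIV)"

definition feat :: "nat \<Rightarrow> (nat \<Rightarrow> 3 option) \<Rightarrow> real^3 \<Rightarrow> real" where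
  "feat n f x = (\<Prod>i<n. hatc (f i) x)"

lemma finite_featset: "finite (featset n)"
  unfolding featset_def by (intro finite_PiE) auto

text \<open>The \<open>n\<close>-th power of an inner product is the inner product of the
  \<open>n\<close>-fold tensor powers; the numbers \<open>feat n f x\<close> are the coordinates of
  the tensor power of the vector \<open>hatc\<close>.\<close>

lemma qk_power_feat: "qk x y ^ n = (\<Sum>f\<in>featset n. feat n f x * feat n f y)"
proof -
  have "qk x y ^ n = (\<Prod>i<n. \<Sum>a\<in>UNIV. hatc a x * hatc a y)" by (simp add: qk_hatc)
  also have "\<dots> = (\<Sum>f\<in>featset n. \<Prod>i<n. hatc (f i) x * hatc (f i) y)"
    unfolding featset_def by (rule prod_sum_PiE) auto
  finally show ?thesis by (simp add: feat_def prod.distrib)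
qed

lemma smooth_hatc: "smooth_on UNIV (hatc a)"
proof (cases a)
  case None then show ?thesis by (simp add: hatc_def[abs_def] smooth_on_const)
next
  case (Some i)
  have "smooth_on UNIV (\<lambda>x. (1 / sqrt 2) * x $ i)" by (intro smooth_on_mult smooth_on_const smooth_on_nth) simp
  then show ?thesis by (rule smooth_on_cong[OF open_UNIV]) (simp add: hatc_def Some)
qed

lemma smooth_feat: "smooth_on UNIV (feat n f)"
  unfolding feat_def[abs_def] by (intro smooth_on_prod smooth_hatc) auto

lemma continuous_feat: "continuous_on A (feat n f)"
  using smooth_on_continuous[OF smooth_feat] continuous_on_subset by blast

lemma pd_cmult_sum:
  assumes U: "open U" "x \<in> U" and F: "\<And>j. j \<in> J \<Longrightarrow> smooth_on U (F j)" and J: "finite J"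
  shows "pd i (\<lambda>x. \<Sum>j\<in>J. c j * F j x) x = (\<Sum>j\<in>J. c j * pd i (F j) x)"
proof -
  have "((\<lambda>x. \<Sum>j\<in>J. c j * F j x) has_derivative (\<lambda>v. \<Sum>j\<in>J. c j * frechet_derivative (F j) (at x) v)) (at x)"
    by (intro has_derivative_sum has_derivative_mult_right smooth_on_deriv[OF F U(2)])
  then show ?thesis unfolding pd_def by (rule frechet_derivative_at[THEN fun_cong, of _ _ _ "axis i 1", symmetric])
qed

lemma pd_cong_open:
  assumes "open U" "x \<in> U" "\<And>y. y \<in> U \<Longrightarrow> f y = g y" "smooth_on U f"
  shows "pd i g x = pd i f x"
  unfolding pd_def using frechet_cong_open(2)[OF assms(1-3) smooth_on_differentiable[OF assms(4,2)]] by simp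

lemma smooth_cmult_sum:
  assumes "open U" "finite J" "\<And>j. j \<in> J \<Longrightarrow> smooth_on U (F j)"
  shows "smooth_on U (\<lambda>x. \<Sum>j\<in>J. c j * F j x)"
  by (intro smooth_on_sum smooth_on_mult smooth_on_const assms)

lemma slap_cmult_sum:
  assumes U: "open U" "x \<in> U" and F: "\<And>j. j \<in> J \<Longrightarrow> smooth_on U (F j)" and J: "finite J"
  shows "slap (\<lambda>x. \<Sum>j\<in>J. c j * F j x) x = (\<Sum>j\<in>J. c j * slap (F j) x)"
proof -
  define G where "G = (\<lambda>x. \<Sum>j\<in>J. c j * F j x)"
  have sG: "smooth_on U (pd i G)" for i unfolding G_def
    by (intro smooth_on_pd smooth_cmult_sum U J F)
  have 1: "pd i G y = (\<Sum>j\<in>J. c j * pd i (F j) y)" if "y \<in> U" for i y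
    unfolding G_def by (rule pd_cmult_sum[OF U(1) that F J])
  have 2: "pd k (pd i G) x = (\<Sum>j\<in>J. c j * pd k (pd i (F j)) x)" for i k
  proof -
    have "pd k (\<lambda>y. \<Sum>j\<in>J. c j * pd i (F j) y) x = pd k (pd i G) x"
      by (rule pd_cong_open[OF U 1 sG])
    moreover have "pd k (\<lambda>y. \<Sum>j\<in>J. c j * pd i (F j) y) x = (\<Sum>j\<in>J. c j * pd k (pd i (F j)) x)"
      by (rule pd_cmult_sum[OF U _ J]) (rule smooth_on_pd[OF F])
    ultimately show ?thesis by simp
  qed
  have e: "c j * slap (F j) x = - (\<Sum>i\<in>UNIV. c j * pd i (pd i (F j)) x) 
      + (\<Sum>i\<in>UNIV. \<Sum>k\<in>UNIV. x $ i * x $ k * (c j * pd k (pd i (F j)) x)) + 2 * (\<Sum>i\<in>UNIV. x $ i * (c j * pd i (F j) x))" for j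
    unfolding slap_def distrib_left mult_minus_right sum_distrib_left by (simp add: mult_ac)
  have "slap G x = - (\<Sum>i\<in>UNIV. \<Sum>j\<in>J. c j * pd i (pd i (F j)) x) 
      + (\<Sum>i\<in>UNIV. \<Sum>k\<in>UNIV. \<Sum>j\<in>J. x $ i * x $ k * (c j * pd k (pd i (F j)) x)) + 2 * (\<Sum>i\<in>UNIV. \<Sum>j\<in>J. x $ i * (c j * pd i (F j) x))"
    unfolding slap_def 2 1[OF U(2)] sum_distrib_left ..
  also have "(\<Sum>i\<in>UNIV. \<Sum>j\<in>J. c j * pd i (pd i (F j)) x) = (\<Sum>j\<in>J. \<Sum>i\<in>UNIV. c j * pd i (pd i (F j)) x)" by (rule sum.swap)
  also have "(\<Sum>i\<in>UNIV. \<Sum>j\<in>J. x $ i * (c j * pd i (F j) x)) = (\<Sum>j\<in>J. \<Sum>i\<in>UNIV. x $ i * (c j * pd i (F j) x))" by (rule sum.swap)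
  also have "(\<Sum>i\<in>UNIV. \<Sum>k\<in>UNIV. \<Sum>j\<in>J. x $ i * x $ k * (c j * pd k (pd i (F j)) x)) = (\<Sum>j\<in>J. \<Sum>i\<in>UNIV. \<Sum>k\<in>UNIV. x $ i * x $ k * (c j * pd k (pd i (F j)) x))"
    by (subst sum.swap[of _ _ UNIV], subst sum.swap) (rule refl)
  finally show ?thesis unfolding e G_def by (simp only: sum.distrib sum_negf sum_distrib_left)
qed

lemma pd_qk_power: "pd i (\<lambda>y. c * qk x y ^ n) = (\<lambda>y. (c * real n * (x $ i / 2)) * qk x y ^ (n - 1))"
proof
  fix y
  have "((\<lambda>y. qk x y) has_derivative (\<lambda>v. (x \<bullet> v) / 2)) (at y)"
    unfolding qk_def by (auto intro!: derivative_eq_intros)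
  then have "((\<lambda>y. c * qk x y ^ n) has_derivative (\<lambda>v. c * (real n * ((x \<bullet> v) / 2) * qk x y ^ (n - 1)))) (at y)"
    by (intro has_derivative_mult_right has_derivative_power)
  then show "pd i (\<lambda>y. c * qk x y ^ n) y = (c * real n * (x $ i / 2)) * qk x y ^ (n - 1)"
    unfolding pd_def by (subst frechet_derivative_at[symmetric], assumption) (simp add: inner_axis)
qed

lemma qk_inner: "(\<Sum>i\<in>UNIV. y $ i * x $ i) = 2 * qk x y - 1"
proof -
  have "(\<Sum>i\<in>UNIV. y $ i * x $ i) = x \<bullet> y" by (simp add: inner_vec_def mult.commute)
  then show ?thesis by (simp add: qk_def field_simps)
qed

text \<open>For fixed \<open>x\<close> the function depends only on the height
  \<open>x \<bullet> y\<close>, where the Laplacian is Legendre's operator. That it maps a power of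
  \<open>qk\<close> to a combination of two powers drives all recursions below.\<close>

lemma slap_qk_power:
  assumes x: "x \<in> S2" and y: "y \<in> S2"
  shows "slap (\<lambda>y. qk x y ^ n) y = real n * (real n + 1) * qk x y ^ n - real n * real n * qk x y ^ (n - 1)"
proof -
  define q where "q = qk x y"
  have p1: "pd i (\<lambda>y. qk x y ^ n) = (\<lambda>y. (real n * (x $ i / 2)) * qk x y ^ (n - 1))" for i
    using pd_qk_power[of i 1 x n] by simp
  have p2: "pd j (pd i (\<lambda>y. qk x y ^ n)) y = (real n * (x $ i / 2)) * real (n - 1) * (x $ j / 2) * q ^ (n - 2)" for i j
    unfolding p1 pd_qk_power by (simp add: q_def numeral_2_eq_2)
  have xx: "(\<Sum>i\<in>UNIV. x $ i * x $ i) = 1" using x by (simp add: norm_eq_1 inner_vec_def)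
  have yx: "(\<Sum>i\<in>UNIV. y $ i * x $ i) = 2 * q - 1" unfolding q_def by (rule qk_inner)
  have s1: "(\<Sum>i\<in>UNIV. pd i (pd i (\<lambda>y. qk x y ^ n)) y) = (real n * real (n - 1) / 4) * q ^ (n - 2)"
  proof -
    have "(\<Sum>i\<in>UNIV. pd i (pd i (\<lambda>y. qk x y ^ n)) y) = (\<Sum>i\<in>UNIV. (real n * real (n - 1) / 4) * q ^ (n - 2) * (x $ i * x $ i))"
      unfolding p2 by (intro sum.cong refl) (simp add: field_simps)
    then show ?thesis unfolding sum_distrib_left[symmetric] xx by simp
  qed
  have s2: "(\<Sum>i\<in>UNIV. \<Sum>j\<in>UNIV. y $ i * y $ j * pd j (pd i (\<lambda>y. qk x y ^ n)) y) = (real n * real (n - 1) / 4) * q ^ (n - 2) * (2 * q - 1)\<^sup>2"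
  proof -
    have "(\<Sum>i\<in>UNIV. \<Sum>j\<in>UNIV. y $ i * y $ j * pd j (pd i (\<lambda>y. qk x y ^ n)) y) = (\<Sum>i\<in>UNIV. \<Sum>j\<in>UNIV. (real n * real (n - 1) / 4) * q ^ (n - 2) * ((y $ i * x $ i) * (y $ j * x $ j)))"
      unfolding p2 by (intro sum.cong refl) (simp add: field_simps)
    also have "\<dots> = (real n * real (n - 1) / 4) * q ^ (n - 2) * ((\<Sum>i\<in>UNIV. y $ i * x $ i) * (\<Sum>j\<in>UNIV. y $ j * x $ j))"
      by (subst sum_product) (simp only: sum_distrib_left)
    finally show ?thesis unfolding yx power2_eq_square .
  qed
  have s3: "(\<Sum>i\<in>UNIV. y $ i * pd i (\<lambda>y. qk x y ^ n) y) = (real n / 2) * q ^ (n - 1) * (2 * q - 1)"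
  proof -
    have "(\<Sum>i\<in>UNIV. y $ i * pd i (\<lambda>y. qk x y ^ n) y) = (\<Sum>i\<in>UNIV. (real n / 2) * q ^ (n - 1) * (y $ i * x $ i))"
      unfolding p1 q_def by (intro sum.cong refl) simp
    then show ?thesis unfolding sum_distrib_left[symmetric] yx .
  qed
  have comb: "- a + a * S + 2 * (m / 2 * Q * T) = a * (S - 1) + m * Q * T" for a S m Q T :: real
    by (simp add: right_diff_distrib)
  have "slap (\<lambda>y. qk x y ^ n) y = (real n * real (n - 1) / 4) * q ^ (n - 2) * ((2 * q - 1)\<^sup>2 - 1) + real n * q ^ (n - 1) * (2 * q - 1)"
    unfolding slap_def s1 s2 s3 by (rule comb)
  also have "\<dots> = real n * (real n + 1) * q ^ n - real n * real n * q ^ (n - 1)"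
  \<comment> \<open>The cases 0 and 1 stand apart because of the truncated exponent
    \<open>n - 2\<close>; from 2 on the claim is a polynomial identity.\<close>
  proof (cases n)
    case (Suc m)
    show ?thesis
    proof (cases m)
      case (Suc k)
      have e: "n = Suc (Suc k)" using \<open>n = Suc m\<close> Suc by simp
      define r Q where "r = real k" and "Q = q ^ k"
      have s: "(2 * q - 1)\<^sup>2 - 1 = 4 * (q * q - q)" by (simp add: power2_eq_square algebra_simps)
      have t: "real n = r + 2" "real (n - 1) = r + 1" "q ^ (n - 2) = Q" "q ^ (n - 1) = q * Q" "q ^ n = q * (q * Q)"
        by (simp_all add: e r_def Q_def)
      have h: "(r + 2) * (r + 1) / 4 * Q * (4 * (q * q - q)) = (r + 2) * (r + 1) * Q * (q * q - q)" by simp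
      show ?thesis unfolding t s h by Groebner_Basis.algebra
    qed (simp add: \<open>n = Suc m\<close> algebra_simps)
  qed simp
  finally show ?thesis unfolding q_def .
qed

lemma smooth_qk_power: "smooth_on UNIV (\<lambda>y. qk x y ^ n)"
proof -
  have "smooth_on UNIV (\<lambda>y. \<Sum>f\<in>featset n. feat n f x * feat n f y)"
    by (intro smooth_cmult_sum finite_featset smooth_feat) auto
  then show ?thesis by (simp add: qk_power_feat)
qed

text \<open>The factor \<open>n + 1\<close> turns \<open>qk x y ^ n\<close> into a probability
  density in \<open>y\<close>, as \<open>avg_one\<close> shows, and these densities concentrate at
  \<open>x\<close> as \<open>n\<close> grows.\<close>

definition avg :: "nat \<Rightarrow> (real^3 \<Rightarrow> real) \<Rightarrow> real^3 \<Rightarrow> real" where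
  "avg n u x = (real n + 1) * (LINT y|sigma_S2. qk x y ^ n * u y)"

definition acoef :: "nat \<Rightarrow> (real^3 \<Rightarrow> real) \<Rightarrow> (nat \<Rightarrow> 3 option) \<Rightarrow> real" where
  "acoef n u f = (LINT y|sigma_S2. feat n f y * u y)"

lemma avg_feat:
  assumes u: "continuous_on S2 u"
  shows "avg n u x = (\<Sum>f\<in>featset n. ((real n + 1) * acoef n u f) * feat n f x)"
proof -
  have "(LINT y|sigma_S2. qk x y ^ n * u y) = (LINT y|sigma_S2. (\<Sum>f\<in>featset n. feat n f x * (feat n f y * u y)))"
    unfolding qk_power_feat by (simp add: sum_distrib_right mult.assoc)
  also have "\<dots> = (\<Sum>f\<in>featset n. feat n f x * acoef n u f)"
    unfolding acoef_def 
    by (subst Bochner_Integration.integral_sum) 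
       (auto intro!: integrable_mult_right S2_cont_integrable continuous_intros continuous_feat u)
  finally show ?thesis by (simp add: avg_def sum_distrib_left mult_ac)
qed

lemma smooth_avg: "continuous_on S2 u \<Longrightarrow> smooth_on UNIV (avg n u)"
proof -
  assume u: "continuous_on S2 u"
  have "avg n u = (\<lambda>x. \<Sum>f\<in>featset n. ((real n + 1) * acoef n u f) * feat n f x)"
    using avg_feat[OF u] by blast
  then show ?thesis by (simp only:) (intro smooth_cmult_sum finite_featset smooth_feat, auto)
qed

lemma continuous_avg: "continuous_on S2 u \<Longrightarrow> continuous_on A (avg n u)"
  using smooth_on_continuous[OF smooth_avg] continuous_on_subset by blast

text \<open>Integrates the two-term formula for the Laplacian of \<open>qk^n\<close>. The
  normalization by \<open>n + 1\<close> gives the lower term the same coefficient as the leading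
  one; at \<open>n = 0\<close>, where \<open>n - 1\<close> is truncated, both coefficients
  vanish.\<close>

lemma avg_identity:
  assumes u: "continuous_on S2 u" and x: "x \<in> S2"
    and v: "\<And>y. y \<in> S2 \<Longrightarrow> v y = (real n * (real n + 1) * qk x y ^ n - real n * real n * qk x y ^ (n - 1)) * u y"
  shows "(real n + 1) * (LINT y|sigma_S2. v y) = real n * (real n + 1) * (avg n u x - avg (n - 1) u x)"
proof -
  have i: "integrable sigma_S2 (\<lambda>y. c * (qk x y ^ k * u y))" for c k
    by (intro integrable_mult_right S2_cont_integrable continuous_intros u)
  have "(LINT y|sigma_S2. v y) = (LINT y|sigma_S2. real n * (real n + 1) * (qk x y ^ n * u y) - real n * real n * (qk x y ^ (n - 1) * u y))"
    by (intro Bochner_Integration.integral_cong refl) (use v in \<open>simp add: algebra_simps\<close>)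
  also have "\<dots> = real n * (real n + 1) * (LINT y|sigma_S2. qk x y ^ n * u y) - real n * real n * (LINT y|sigma_S2. qk x y ^ (n - 1) * u y)"
    by (subst Bochner_Integration.integral_diff[OF i i]) simp
  finally have V: "(LINT y|sigma_S2. v y) = \<dots>" .
  have b: "real n * avg (n - 1) u x = real n * (real n * (LINT y|sigma_S2. qk x y ^ (n - 1) * u y))"
    by (cases n) (simp_all add: avg_def add.commute)
  have "real n * (real n + 1) * (avg n u x - avg (n - 1) u x) = (real n + 1) * (real n * avg n u x - real n * avg (n - 1) u x)"
    by (simp add: algebra_simps)
  also have "\<dots> = (real n + 1) * (LINT y|sigma_S2. v y)"
    unfolding b V by (simp add: avg_def algebra_simps)
  finally show ?thesis by simp
qed

lemma slap_avg:
  assumes u: "continuous_on S2 u" and x: "x \<in> S2"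
  shows "slap (avg n u) x = real n * (real n + 1) * (avg n u x - avg (n - 1) u x)"
proof -
  have s: "slap (avg n u) x = (\<Sum>f\<in>featset n. ((real n + 1) * acoef n u f) * slap (feat n f) x)"
    unfolding avg_feat[OF u, abs_def] by (intro slap_cmult_sum[where U=UNIV] finite_featset smooth_feat) auto
  have q: "slap (\<lambda>z. qk y z ^ n) x = (\<Sum>f\<in>featset n. feat n f y * slap (feat n f) x)" for y
    unfolding qk_power_feat by (intro slap_cmult_sum[where U=UNIV] finite_featset smooth_feat) auto
  have "(LINT y|sigma_S2. slap (\<lambda>z. qk y z ^ n) x * u y) = (LINT y|sigma_S2. (\<Sum>f\<in>featset n. slap (feat n f) x * (feat n f y * u y)))"
    unfolding q sum_distrib_right by (simp add: mult_ac)
  also have "\<dots> = (\<Sum>f\<in>featset n. slap (feat n f) x * acoef n u f)"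
    unfolding acoef_def 
    by (subst Bochner_Integration.integral_sum) 
       (auto intro!: integrable_mult_right S2_cont_integrable continuous_intros continuous_feat u)
  finally have "slap (avg n u) x = (real n + 1) * (LINT y|sigma_S2. slap (\<lambda>z. qk y z ^ n) x * u y)"
    unfolding s by (simp add: sum_distrib_left mult_ac)
  also have "\<dots> = real n * (real n + 1) * (avg n u x - avg (n - 1) u x)"
    by (rule avg_identity[OF u x]) (simp add: slap_qk_power[OF _ x] qk_commute[of x] del: mem_sphere)
  finally show ?thesis .
qed

lemma laplace_S2_smooth_on_UNIV:
  "smooth_on UNIV F \<Longrightarrow> x \<in> S2 \<Longrightarrow> laplace_S2 (restrict F S2) x = slap F x"
  by (rule laplace_S2_slap[of UNIV]) auto

text \<open>Green's formula moves the Laplacian onto the kernel. Together with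
  \<open>slap_avg\<close> this shows that averaging commutes with the Laplacian.\<close>

lemma avg_laplace:
  assumes u: "u \<in> smooth_S2" and x: "x \<in> S2"
  shows "avg n (laplace_S2 u) x = real n * (real n + 1) * (avg n u x - avg (n - 1) u x)"
proof -
  define v where "v = restrict (\<lambda>y. qk x y ^ n) S2"
  have v: "v \<in> smooth_S2" unfolding v_def by (rule smooth_S2I[OF open_UNIV _ smooth_qk_power]) simp
  have "avg n (laplace_S2 u) x = (real n + 1) * (LINT y|sigma_S2. v y * laplace_S2 u y)"
    unfolding avg_def by (intro arg_cong2[where f=times] Bochner_Integration.integral_cong refl) (simp add: v_def)
  also have "\<dots> = (real n + 1) * (LINT y|sigma_S2. laplace_S2 v y * u y)"
    by (simp only: green_S2[OF v u])
  also have "\<dots> = real n * (real n + 1) * (avg n u x - avg (n - 1) u x)"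
    by (rule avg_identity[OF smooth_S2_continuous[OF u] x])
      (simp add: v_def laplace_S2_smooth_on_UNIV[OF smooth_qk_power] slap_qk_power[OF x] del: mem_sphere)
  finally show ?thesis .
qed

text \<open>The Laplacian kills constants, so the recursion makes the average of 1 independent of
  \<open>n\<close>. This evaluates the integrals of \<open>qk^n\<close> without any computation in
  the chart.\<close>

lemma avg_one: 
  assumes x: "x \<in> S2" shows "avg n (\<lambda>_. 1) x = 1"
proof (induction n)
  case 0 show ?case by (simp add: avg_def sigma.prob_space[simplified])
next
  case (Suc n)
  define u where "u = restrict (\<lambda>_::real^3. 1::real) S2"
  have u: "u \<in> smooth_S2" unfolding u_def by (rule smooth_S2I[OF open_UNIV _ smooth_on_const]) simp
  have "pd i (\<lambda>_. 1) = (\<lambda>_. 0)" "pd i (\<lambda>_. 0) = (\<lambda>_. 0)" for i by (simp_all add: pd_def fun_eq_iff)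
  then have "slap (\<lambda>_. 1) y = 0" for y by (simp add: slap_def)
  then have l: "laplace_S2 u y = 0" if "y \<in> S2" for y
    unfolding u_def using laplace_S2_smooth_on_UNIV[OF smooth_on_const that] by simp
  have "avg (Suc n) (laplace_S2 u) x = (real (Suc n) + 1) * (LINT y|sigma_S2. 0)"
    unfolding avg_def by (intro arg_cong2[where f=times] Bochner_Integration.integral_cong refl) (simp add: l del: mem_sphere)
  then have "avg (Suc n) u x = avg n u x" unfolding avg_laplace[OF u x] by simp
  moreover have "avg k u x = avg k (\<lambda>_. 1) x" for k
    unfolding avg_def by (intro arg_cong2[where f=times] Bochner_Integration.integral_cong refl) (simp add: u_def)
  ultimately show ?case using Suc by simp
qed

lemma integral_qk_power: "x \<in> S2 \<Longrightarrow> (LINT y|sigma_S2. qk x y ^ n) = 1 / (real n + 1)"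
  using avg_one[of x n] by (simp add: avg_def field_simps)

lemma avg_sym:
  assumes u: "continuous_on S2 u" and v: "continuous_on S2 v"
  shows "(LINT x|sigma_S2. avg n u x * v x) = (LINT x|sigma_S2. u x * avg n v x)"
proof -
  have k: "(LINT x|sigma_S2. avg n u x * v x) = (\<Sum>f\<in>featset n. (real n + 1) * acoef n u f * acoef n v f)"
    if u: "continuous_on S2 u" and v: "continuous_on S2 v" for u v
  proof -
    have "(LINT x|sigma_S2. avg n u x * v x) = (LINT x|sigma_S2. (\<Sum>f\<in>featset n. ((real n + 1) * acoef n u f) * (feat n f x * v x)))"
      unfolding avg_feat[OF u] sum_distrib_right by (simp add: mult_ac)
    also have "\<dots> = (\<Sum>f\<in>featset n. (real n + 1) * acoef n u f * acoef n v f)"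
      unfolding acoef_def[of n v]
      by (subst Bochner_Integration.integral_sum) 
         (auto intro!: integrable_mult_right S2_cont_integrable continuous_intros continuous_feat v)
    finally show ?thesis .
  qed
  have "(LINT x|sigma_S2. u x * avg n v x) = (LINT x|sigma_S2. avg n v x * u x)" by (simp only: mult.commute)
  then show ?thesis unfolding k[OF u v] k[OF v u] by (simp add: mult_ac)
qed

lemma avg_tendsto:
  assumes u: "continuous_on S2 u" and x: "x \<in> S2"
  shows "(\<lambda>n. avg n u x) \<longlonglongrightarrow> u x"
proof (rule LIMSEQ_I)
  fix r :: real assume r: "r > 0"
  obtain B where B: "B > 0" "\<And>y. y \<in> S2 \<Longrightarrow> norm (u y) \<le> B" using S2_cont_bounded[OF u] by blast
  obtain d where d: "d > 0" "\<And>y. y \<in> S2 \<Longrightarrow> dist y x < d \<Longrightarrow> dist (u y) (u x) < r / 2"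
    using u[unfolded continuous_on_iff, rule_format, OF x, of "r / 2"] r by auto
  define K where "K = 8 * B / d\<^sup>2"
  have K: "K > 0" using B d by (simp add: K_def)
  \<comment> \<open>Continuity handles the points near \<open>x\<close>. At distance at least
    \<open>d\<close> one has \<open>1 - qk x y \<ge> d^2 / 4\<close>, so the crude bound
    \<open>2 * B\<close> is at most \<open>K * (1 - qk x y)\<close>. The mean of
    \<open>1 - qk\<close> under the averaging density is \<open>1 / (n + 2)\<close>.\<close>
  have pt: "\<bar>u y - u x\<bar> \<le> r / 2 + K * (1 - qk x y)" if y: "y \<in> S2" for y
  proof (cases "dist y x < d")
    case True
    then have "\<bar>u y - u x\<bar> \<le> r / 2" using d(2)[OF y] by (simp add: dist_real_def)
    moreover have "K * (1 - qk x y) \<ge> 0" using K qk_le_1[OF x y] by simp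
    ultimately show ?thesis by linarith
  next
    case False
    then have "d\<^sup>2 \<le> (norm (x - y))\<^sup>2" using d(1) by (intro power_mono) (auto simp: dist_norm norm_minus_commute)
    then have "K * (d\<^sup>2 / 4) \<le> K * (1 - qk x y)" using K unfolding qk_eq_dist[OF x y] by simp
    moreover have "K * (d\<^sup>2 / 4) = 2 * B" using d by (simp add: K_def)
    moreover have "\<bar>u y - u x\<bar> \<le> 2 * B" using B(2)[OF y] B(2)[OF x] by (simp add: abs_le_iff)
    ultimately show ?thesis using r by linarith
  qed
  have b: "\<bar>avg n u x - u x\<bar> \<le> r / 2 + K * (1 / (real n + 2))" for n
  proof -
    have i: "integrable sigma_S2 (\<lambda>y. qk x y ^ k * g y)" if "continuous_on S2 g" for g k
      by (intro S2_cont_integrable continuous_intros that)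
    have "(LINT y|sigma_S2. qk x y ^ n * (u y - u x)) = (LINT y|sigma_S2. qk x y ^ n * u y - qk x y ^ n * u x)"
      by (simp only: right_diff_distrib)
    also have "\<dots> = (LINT y|sigma_S2. qk x y ^ n * u y) - (LINT y|sigma_S2. qk x y ^ n * u x)"
      by (rule Bochner_Integration.integral_diff[OF i[OF u] i[OF continuous_on_const]])
    also have "(LINT y|sigma_S2. qk x y ^ n * u x) = 1 / (real n + 1) * u x"
      using integral_qk_power[OF x, of n] by simp
    finally have D: "(LINT y|sigma_S2. qk x y ^ n * (u y - u x)) = (LINT y|sigma_S2. qk x y ^ n * u y) - 1 / (real n + 1) * u x" .
    have "(real n + 1) * (1 / (real n + 1) * u x) = u x" by simp
    then have "avg n u x - u x = (real n + 1) * (LINT y|sigma_S2. qk x y ^ n * (u y - u x))"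
      unfolding D avg_def by (simp only: right_diff_distrib)
    then have "\<bar>avg n u x - u x\<bar> = (real n + 1) * \<bar>LINT y|sigma_S2. qk x y ^ n * (u y - u x)\<bar>" by (simp add: abs_mult)
    also have "\<dots> \<le> (real n + 1) * (LINT y|sigma_S2. qk x y ^ n * (r / 2 + K * (1 - qk x y)))"
    proof (rule mult_left_mono)
      have "\<bar>LINT y|sigma_S2. qk x y ^ n * (u y - u x)\<bar> \<le> (LINT y|sigma_S2. \<bar>qk x y ^ n * (u y - u x)\<bar>)"
        by (rule integral_abs_bound)
      also have "\<dots> \<le> (LINT y|sigma_S2. qk x y ^ n * (r / 2 + K * (1 - qk x y)))"
      proof (rule integral_mono)
        show "\<bar>qk x y ^ n * (u y - u x)\<bar> \<le> qk x y ^ n * (r / 2 + K * (1 - qk x y))" if "y \<in> space sigma_S2" for y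
          using that pt[of y] qk_nonneg[OF x, of y] by (simp add: abs_mult mult_left_mono del: mem_sphere)
      qed (intro S2_cont_integrable continuous_intros u)+
      finally show "\<bar>LINT y|sigma_S2. qk x y ^ n * (u y - u x)\<bar> \<le> (LINT y|sigma_S2. qk x y ^ n * (r / 2 + K * (1 - qk x y)))" .
    qed simp
    also have "(LINT y|sigma_S2. qk x y ^ n * (r / 2 + K * (1 - qk x y))) = (LINT y|sigma_S2. qk x y ^ n * (r / 2 + K) - qk x y ^ Suc n * K)"
      by (simp add: algebra_simps)
    also have "\<dots> = (LINT y|sigma_S2. qk x y ^ n * (r / 2 + K)) - (LINT y|sigma_S2. qk x y ^ Suc n * K)"
      by (rule Bochner_Integration.integral_diff[OF i i]) (rule continuous_on_const)+
    also have "(LINT y|sigma_S2. qk x y ^ n * (r / 2 + K)) = (r / 2 + K) / (real n + 1)"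
      using integral_qk_power[OF x, of n] by simp
    also have "(LINT y|sigma_S2. qk x y ^ Suc n * K) = K / (real n + 2)"
    proof -
      have "(LINT y|sigma_S2. qk x y ^ Suc n * K) = (LINT y|sigma_S2. qk x y ^ Suc n) * K" by (rule integral_mult_left_zero)
      also have "\<dots> = K / (real n + 2)" unfolding integral_qk_power[OF x] by simp
      finally show ?thesis .
    qed
    also have "(real n + 1) * ((r / 2 + K) / (real n + 1) - K / (real n + 2)) = r / 2 + K * (1 / (real n + 2))"
    proof -
      have "(real n + 1) * ((r / 2 + K) / (real n + 1)) = r / 2 + K" by simp
      moreover have "(real n + 1) * (K / (real n + 2)) = K - K * (1 / (real n + 2))" by (simp add: field_simps)
      ultimately show ?thesis unfolding right_diff_distrib by simp
    qed
    finally show ?thesis .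
  qed
  have "(\<lambda>n. K * (1 / (real n + 2))) \<longlonglongrightarrow> 0" by real_asymp
  then have "\<exists>M. \<forall>n\<ge>M. norm (K * (1 / (real n + 2)) - 0) < r / 2"
    by (rule LIMSEQ_D) (use r in simp)
  then obtain M where M: "\<forall>n\<ge>M. norm (K * (1 / (real n + 2)) - 0) < r / 2" by blast
  show "\<exists>M. \<forall>n\<ge>M. norm (avg n u x - u x) < r"
  proof (intro exI allI impI)
    fix n assume "n \<ge> M"
    then have "\<bar>K * (1 / (real n + 2))\<bar> < r / 2" using M by (simp only: real_norm_def diff_zero)
    then show "norm (avg n u x - u x) < r" using b[of n] unfolding real_norm_def by linarith
  qed
qed

section \<open>Eigenvalues, spectral projections and the spectrum\<close>

definition lam :: "nat \<Rightarrow> real" where "lam l = real l * (real l + 1)"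

text \<open>The eigenvalue of \<open>avg n\<close> on the harmonics of degree \<open>l\<close>.\<close>

definition mc :: "nat \<Rightarrow> nat \<Rightarrow> real" where
  "mc n l = (\<Prod>i<l. (real n - real i) / (real n + 2 + real i))"

lemma lam_nonneg: "lam l \<ge> 0" by (simp add: lam_def)

lemma lam_mono: "k \<le> l \<Longrightarrow> lam k \<le> lam l" unfolding lam_def by (intro mult_mono) auto

lemma lam_less: "k < l \<Longrightarrow> lam k < lam l" unfolding lam_def by (intro mult_strict_mono) auto

lemma lam_inj: "inj lam"
  by (rule injI) (metis lam_less linorder_neqE_nat less_irrefl)

lemma mc_zero: "n < l \<Longrightarrow> mc n l = 0"
  unfolding mc_def by (intro prod_zero bexI[of _ n]) auto

lemma mc_pos: "l \<le> n \<Longrightarrow> mc n l > 0"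
  unfolding mc_def by (intro prod_pos ballI divide_pos_pos) auto

lemma mc_le_1: "l \<le> n \<Longrightarrow> mc n l \<le> 1"
  unfolding mc_def by (intro prod_le_1 ballI conjI) (auto simp: divide_le_eq)

text \<open>This is the recursion of \<open>avg n\<close> read off on a single harmonic with
  eigenvalue \<open>lam l\<close>. Here it is proved from the product formula; later it identifies
  \<open>mc n l\<close> as the eigenvalue of \<open>avg n\<close>.\<close>

lemma mc_rec: "mc n l * ((real n + 1) * (real n + 2)) = mc (Suc n) l * ((real n + 1) * (real n + 2) - lam l)"
proof (induction l)
  case 0 show ?case by (simp add: mc_def lam_def)
next
  case (Suc l)
  define k r M M' where "k = real n" and "r = real l" and "M = mc n l" and "M' = mc (Suc n) l"
  have d: "k + 2 + r \<noteq> 0" "k + 3 + r \<noteq> 0" by (simp_all add: k_def r_def)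
  have m: "mc n (Suc l) = M * ((k - r) / (k + 2 + r))" "mc (Suc n) (Suc l) = M' * ((k + 1 - r) / (k + 3 + r))"
    by (simp_all add: mc_def M_def M'_def k_def r_def add_ac)
  have IH: "M * ((k + 1) * (k + 2)) = M' * ((k + 1 - r) * (k + 2 + r))"
  proof -
    have "(k + 1) * (k + 2) - r * (r + 1) = (k + 1 - r) * (k + 2 + r)" by (simp add: algebra_simps)
    then show ?thesis using Suc by (simp add: M_def M'_def k_def r_def lam_def)
  qed
  have "mc n (Suc l) * ((k + 1) * (k + 2)) = (k - r) / (k + 2 + r) * (M * ((k + 1) * (k + 2)))" unfolding m by (simp only: mult_ac)
  also have "\<dots> = M' * (k + 1 - r) * (k - r)" unfolding IH using d by (simp add: field_simps)
  also have "\<dots> = M' * ((k + 1 - r) / (k + 3 + r)) * ((k - r) * (k + 3 + r))" using d by (simp add: field_simps)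
  also have "(k - r) * (k + 3 + r) = (k + 1) * (k + 2) - (r + 1) * (r + 2)" by (simp add: algebra_simps)
  finally show ?case unfolding m(2)[symmetric] by (simp add: k_def r_def lam_def add_ac)
qed

lemma mc_tendsto: "(\<lambda>n. mc n l) \<longlonglongrightarrow> 1"
proof -
  have "(\<lambda>n. (real n - real i) / (real n + 2 + real i)) \<longlonglongrightarrow> 1" for i by real_asymp
  then have "(\<lambda>n. \<Prod>i<l. (real n - real i) / (real n + 2 + real i)) \<longlonglongrightarrow> (\<Prod>i<l. 1)" by (intro tendsto_prod)
  then show ?thesis unfolding mc_def by simp
qed

text \<open>By the recursion the step from \<open>k\<close> to \<open>k + 1\<close> raises
  \<open>mc\<close> by at most \<open>lam l / ((k + 1) * (k + 2))\<close>. These increments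
  telescope, and the limit is 1.\<close>

lemma mc_lower:
  assumes "l \<le> n" shows "mc n l \<ge> 1 - lam l / (real n + 1)"
proof -
  define b where "b k = mc k l + lam l / (real k + 1)" for k
  have s: "b (Suc k) \<le> b k" if "l \<le> k" for k
  proof -
    define D where "D = (real k + 1) * (real k + 2)"
    have D: "D > 0" by (simp add: D_def)
    have "mc k l = mc (Suc k) l * (1 - lam l / D)"
    proof -
      have "mc k l * D = mc (Suc k) l * (D - lam l)" using mc_rec[of k l] by (simp add: D_def)
      then have "mc k l = mc (Suc k) l * (D - lam l) / D" using D by (simp add: eq_divide_eq)
      then show ?thesis using D by (simp add: diff_divide_distrib right_diff_distrib)
    qed
    moreover have "mc (Suc k) l * (lam l / D) \<le> 1 * (lam l / D)"
      using mc_le_1[of l "Suc k"] that D lam_nonneg[of l] by (intro mult_right_mono) auto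
    ultimately have "mc k l \<ge> mc (Suc k) l - lam l / D" by (simp add: right_diff_distrib)
    moreover have "lam l / D = lam l / (real k + 1) - lam l / (real k + 2)"
      unfolding D_def by (simp add: field_simps)
    ultimately show ?thesis by (simp add: b_def add_ac)
  qed
  have d: "b (n + k) \<le> b n" for k
  proof (induction k)
    case (Suc k) then show ?case using s[of "n + k"] assms by simp
  qed simp
  have "b \<longlonglongrightarrow> 1 + 0" unfolding b_def[abs_def]
    by (intro tendsto_add mc_tendsto) real_asymp
  then have "(\<lambda>k. b (n + k)) \<longlonglongrightarrow> 1" using LIMSEQ_ignore_initial_segment[of b 1 n] by (simp add: add.commute)
  then have "1 \<le> b n" by (rule LIMSEQ_le_const2) (use d in blast)
  then show ?thesis by (simp add: b_def)
qed

text \<open>The system is triangular with positive diagonal \<open>mc l l\<close>. It serves to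
  carry identities from all averages over to all projections.\<close>

lemma mc_unique:
  assumes "\<And>n. (\<Sum>k\<le>n. mc n k * S k) = (\<Sum>k\<le>n. mc n k * S' k)"
  shows "S l = S' l"
proof (induction l rule: less_induct)
  case (less l)
  have split: "(\<Sum>k\<le>l. mc l k * f k) = (\<Sum>k<l. mc l k * f k) + mc l l * f l" for f
    by (simp add: lessThan_Suc_atMost[symmetric])
  have "(\<Sum>k<l. mc l k * S k) = (\<Sum>k<l. mc l k * S' k)" using less by simp
  then have "mc l l * S l = mc l l * S' l" using assms[of l] unfolding split by simp
  then show ?case using mc_pos[of l l] by simp
qed

text \<open>In the applications \<open>a n\<close> is an average and \<open>S k\<close> the effect
  of the Laplacian on the component \<open>t k\<close>. Inserting \<open>mc_rec\<close> into the
  difference \<open>a n - a (n - 1)\<close> and comparing coefficients gives the eigenvalue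
  equation.\<close>

lemma mc_solve:
  assumes a: "\<And>n. a n = (\<Sum>k\<le>n. mc n k * t k)"
    and B: "\<And>n. real n * (real n + 1) * (a n - a (n - 1)) = (\<Sum>k\<le>n. mc n k * S k)"
  shows "S l = lam l * t l"
proof (rule mc_unique[where S=S and S'="\<lambda>k. lam k * t k"])
  fix n
  show "(\<Sum>k\<le>n. mc n k * S k) = (\<Sum>k\<le>n. mc n k * (lam k * t k))"
  proof (cases n)
    case 0 then show ?thesis using B[of 0] by (simp add: lam_def)
  next
    case (Suc p)
    have ap: "a p = (\<Sum>k\<le>n. mc p k * t k)" unfolding a Suc by (simp add: mc_zero)
    define D where "D = (real p + 1) * (real p + 2)"
    have r: "mc p k * D = mc n k * (D - lam k)" for k using mc_rec[of p k] by (simp add: D_def Suc)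
    have "(\<Sum>k\<le>n. mc n k * S k) = D * (a n - a p)" using B[of n] by (simp add: Suc D_def add_ac mult_ac)
    also have "\<dots> = (\<Sum>k\<le>n. D * (mc n k * t k) - D * (mc p k * t k))"
      unfolding ap a[of n] right_diff_distrib sum_distrib_left sum_subtractf ..
    also have "\<dots> = (\<Sum>k\<le>n. mc n k * (lam k * t k))"
    proof (intro sum.cong refl)
      fix k
      have "D * (mc p k * t k) = (mc p k * D) * t k" by (simp only: mult_ac)
      then show "D * (mc n k * t k) - D * (mc p k * t k) = mc n k * (lam k * t k)"
        unfolding r by (simp add: algebra_simps)
    qed
    finally show ?thesis .
  qed
qed

text \<open>The component of degree \<open>l\<close>, found by forward substitution in the
  triangular system of \<open>avg_proj\<close>; no basis of the harmonics has to be chosen.\<close>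

fun proj :: "nat \<Rightarrow> (real^3 \<Rightarrow> real) \<Rightarrow> real^3 \<Rightarrow> real" where
  "proj l u x = (avg l u x - (\<Sum>k<l. mc l k * proj k u x)) / mc l l"

declare proj.simps[simp del]

lemma avg_proj: "avg n u x = (\<Sum>k\<le>n. mc n k * proj k u x)"
proof -
  have "mc n n * proj n u x = avg n u x - (\<Sum>k<n. mc n k * proj k u x)"
    using mc_pos[of n n] by (subst proj.simps) simp
  then show ?thesis by (simp add: lessThan_Suc_atMost[symmetric])
qed

lemma smooth_proj: 
  assumes u: "continuous_on S2 u" shows "smooth_on UNIV (proj l u)"
proof (induction l rule: less_induct)
  case (less l)
  have "smooth_on UNIV (\<lambda>x. (1 / mc l l) * (avg l u x + (\<Sum>k<l. (- mc l k) * proj k u x)))"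
    by (intro smooth_on_mult smooth_on_add smooth_on_const smooth_avg u smooth_cmult_sum less) auto
  then show ?case by (rule smooth_on_cong[OF open_UNIV]) (simp add: proj.simps[of l] sum_negf)
qed

lemma continuous_proj: "continuous_on S2 u \<Longrightarrow> continuous_on A (proj l u)"
  using smooth_on_continuous[OF smooth_proj] continuous_on_subset by blast

lemma slap_proj:
  assumes u: "continuous_on S2 u" and x: "x \<in> S2"
  shows "slap (proj l u) x = lam l * proj l u x"
proof (rule mc_solve[where a="\<lambda>n. avg n u x" and t="\<lambda>k. proj k u x" and S="\<lambda>k. slap (proj k u) x"])
  show "avg n u x = (\<Sum>k\<le>n. mc n k * proj k u x)" for n by (rule avg_proj)
  fix n
  have "slap (avg n u) x = slap (\<lambda>x. \<Sum>k\<le>n. mc n k * proj k u x) x" by (simp add: avg_proj[abs_def])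
  also have "\<dots> = (\<Sum>k\<le>n. mc n k * slap (proj k u) x)"
    by (rule slap_cmult_sum[where U=UNIV]) (auto intro: smooth_proj u)
  finally show "real n * (real n + 1) * (avg n u x - avg (n - 1) u x) = (\<Sum>k\<le>n. mc n k * slap (proj k u) x)"
    using slap_avg[OF u x, of n] by simp
qed

lemma proj_laplace:
  assumes u: "u \<in> smooth_S2" and x: "x \<in> S2"
  shows "proj l (laplace_S2 u) x = lam l * proj l u x"
  by (rule mc_solve[where a="\<lambda>n. avg n u x" and t="\<lambda>k. proj k u x" and S="\<lambda>k. proj k (laplace_S2 u) x"]) (simp_all add: avg_proj[symmetric] avg_laplace[OF u x])

lemma avg_cong: "(\<And>y. y \<in> S2 \<Longrightarrow> u y = v y) \<Longrightarrow> avg n u x = avg n v x"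
  unfolding avg_def by (intro arg_cong2[where f=times] Bochner_Integration.integral_cong refl) simp

lemma proj_cong: 
  assumes "\<And>y. y \<in> S2 \<Longrightarrow> u y = v y" shows "proj l u x = proj l v x"
proof (rule mc_unique[where S="\<lambda>k. proj k u x" and S'="\<lambda>k. proj k v x"])
  show "(\<Sum>k\<le>n. mc n k * proj k u x) = (\<Sum>k\<le>n. mc n k * proj k v x)" for n
    unfolding avg_proj[symmetric] by (rule avg_cong) (rule assms)
qed

lemma avg_diff:
  assumes "continuous_on S2 u" "continuous_on S2 v"
  shows "avg n (\<lambda>y. u y - v y) x = avg n u x - avg n v x"
proof -
  have i: "integrable sigma_S2 (\<lambda>y. qk x y ^ n * g y)" if "continuous_on S2 g" for g
    by (intro S2_cont_integrable continuous_intros that)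
  have "(LINT y|sigma_S2. qk x y ^ n * (u y - v y)) = (LINT y|sigma_S2. qk x y ^ n * u y - qk x y ^ n * v y)"
    by (simp only: right_diff_distrib)
  also have "\<dots> = (LINT y|sigma_S2. qk x y ^ n * u y) - (LINT y|sigma_S2. qk x y ^ n * v y)"
    by (rule Bochner_Integration.integral_diff[OF i i]) (rule assms)+
  finally show ?thesis by (simp only: avg_def right_diff_distrib)
qed

lemma proj_diff:
  assumes "continuous_on S2 u" "continuous_on S2 v"
  shows "proj l (\<lambda>y. u y - v y) x = proj l u x - proj l v x"
  by (rule mc_unique[where S="\<lambda>k. proj k (\<lambda>y. u y - v y) x" and S'="\<lambda>k. proj k u x - proj k v x"])
    (simp add: avg_proj[symmetric] avg_diff[OF assms] right_diff_distrib sum_subtractf)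

lemma integral_sum_mult:
  fixes v :: "real^3 \<Rightarrow> real"
  assumes "continuous_on S2 v" "\<And>k. k \<in> J \<Longrightarrow> continuous_on S2 (F k)"
  shows "(LINT x|sigma_S2. (\<Sum>k\<in>J. c k * F k x) * v x) = (\<Sum>k\<in>J. c k * (LINT x|sigma_S2. F k x * v x))"
proof -
  have i: "integrable sigma_S2 (\<lambda>x. c k * (F k x * v x))" if "k \<in> J" for k
    by (intro integrable_mult_right S2_cont_integrable continuous_intros assms that)
  have "(LINT x|sigma_S2. (\<Sum>k\<in>J. c k * F k x) * v x) = (LINT x|sigma_S2. (\<Sum>k\<in>J. c k * (F k x * v x)))"
    by (simp only: sum_distrib_right mult.assoc)
  also have "\<dots> = (\<Sum>k\<in>J. LINT x|sigma_S2. c k * (F k x * v x))"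
    by (rule Bochner_Integration.integral_sum) (rule i)
  finally show ?thesis by simp
qed

lemma proj_sym:
  assumes u: "continuous_on S2 u" and v: "continuous_on S2 v"
  shows "(LINT x|sigma_S2. proj l u x * v x) = (LINT x|sigma_S2. u x * proj l v x)"
proof (rule mc_unique[where S="\<lambda>k. LINT x|sigma_S2. proj k u x * v x" and S'="\<lambda>k. LINT x|sigma_S2. u x * proj k v x"])
  fix n
  have k: "(\<Sum>k\<le>n. mc n k * (LINT x|sigma_S2. proj k u x * v x)) = (LINT x|sigma_S2. avg n u x * v x)" 
    if "continuous_on S2 u" "continuous_on S2 v" for u v
    unfolding avg_proj by (rule integral_sum_mult[symmetric]) (intro that continuous_proj)+
  have "(\<Sum>k\<le>n. mc n k * (LINT x|sigma_S2. u x * proj k v x)) = (LINT x|sigma_S2. avg n v x * u x)"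
    using k[OF v u] by (simp only: mult.commute)
  also have "\<dots> = (LINT x|sigma_S2. avg n u x * v x)"
    using avg_sym[OF u v, of n] by (simp only: mult.commute)
  finally show "(\<Sum>k\<le>n. mc n k * (LINT x|sigma_S2. proj k u x * v x)) = (\<Sum>k\<le>n. mc n k * (LINT x|sigma_S2. u x * proj k v x))"
    using k[OF u v] by simp
qed

lemma proj_in_eigenspace:
  assumes u: "continuous_on S2 u"
  shows "restrict (proj l u) S2 \<in> eigenspace_S2 (lam l)"
  unfolding eigenspace_S2_def
  using smooth_S2I[OF open_UNIV _ smooth_proj[OF u]] laplace_S2_smooth_on_UNIV[OF smooth_proj[OF u]] slap_proj[OF u]
  by (auto simp del: mem_sphere)

lemma eigen_avg_rec:
  assumes f: "f \<in> eigenspace_S2 \<mu>" and x: "x \<in> S2"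
  shows "\<mu> * avg n f x = real n * (real n + 1) * (avg n f x - avg (n - 1) f x)"
proof -
  have s: "f \<in> smooth_S2" and e: "\<And>y. y \<in> S2 \<Longrightarrow> laplace_S2 f y = \<mu> * f y"
    using f by (auto simp: eigenspace_S2_def)
  have "avg n (laplace_S2 f) x = avg n (\<lambda>y. \<mu> * f y) x" by (rule avg_cong) (rule e)
  also have "\<dots> = \<mu> * avg n f x" by (simp add: avg_def mult.left_commute)
  finally show ?thesis using avg_laplace[OF s x] by simp
qed

lemma eigenspace_smooth: "f \<in> eigenspace_S2 \<mu> \<Longrightarrow> f \<in> smooth_S2"
  by (simp add: eigenspace_S2_def)

lemma eigenspace_continuous: "f \<in> eigenspace_S2 \<mu> \<Longrightarrow> continuous_on S2 f"
  by (rule smooth_S2_continuous[OF eigenspace_smooth])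

text \<open>For such a \<open>\<mu>\<close> the recursion forces every average of \<open>f\<close>
  at \<open>x\<close> to vanish, one \<open>n\<close> after the other, while the averages converge
  to \<open>f x\<close>.\<close>

lemma eigenspace_trivial:
  assumes f: "f \<in> eigenspace_S2 \<mu>" and x: "x \<in> S2" and mu: "\<mu> \<notin> range lam"
  shows "f x = 0"
proof -
  have "avg n f x = 0" for n
  proof (induction n)
    case 0
    have "\<mu> \<noteq> 0" using mu by (auto simp: lam_def image_iff dest: spec[of _ 0])
    then show ?case using eigen_avg_rec[OF f x, of 0] by simp
  next
    case (Suc n)
    have "\<mu> * avg (Suc n) f x = lam (Suc n) * avg (Suc n) f x"
      using eigen_avg_rec[OF f x, of "Suc n"] Suc by (simp add: lam_def)
    then show ?case using mu by auto
  qed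
  then have "(\<lambda>n. avg n f x) \<longlonglongrightarrow> 0" by simp
  then show ?thesis using LIMSEQ_unique avg_tendsto[OF eigenspace_continuous[OF f] x] by blast
qed

text \<open>The recursion in \<open>n\<close> degenerates only at the index \<open>l\<close>: there
  it makes \<open>avg (l - 1) f x\<close> zero and hence all lower averages. Above \<open>l\<close>
  the solutions are the multiples of \<open>mc n l\<close>, and convergence to \<open>f x\<close>
  determines the multiple.\<close>

lemma eigenspace_avg:
  assumes f: "f \<in> eigenspace_S2 (lam l)" and x: "x \<in> S2"
  shows "avg n f x = mc n l * f x"
proof -
  define a where "a n = avg n f x" for n
  have rec: "(lam (Suc n) - lam l) * a (Suc n) = lam (Suc n) * a n" for n
    using eigen_avg_rec[OF f x, of "Suc n"] by (simp add: a_def lam_def algebra_simps)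
  have mrec: "(lam (Suc n) - lam l) * mc (Suc n) l = lam (Suc n) * mc n l" for n
    using mc_rec[of n l] by (simp add: lam_def algebra_simps)
  have lp: "lam (Suc n) > 0" for n by (simp add: lam_def)
  have low: "a (l - Suc i) = 0" if "i < l" for i using that
  proof (induction i)
    case 0
    then obtain p where p: "l = Suc p" by (cases l) auto
    have "lam (Suc p) * a p = 0" using rec[of p] unfolding p by simp
    then show ?case using lp[of p] p by simp
  next
    case (Suc i)
    have e: "l - Suc i = Suc (l - Suc (Suc i))" using Suc.prems by simp
    have "lam (Suc (l - Suc (Suc i))) * a (l - Suc (Suc i)) = 0"
      using rec[of "l - Suc (Suc i)"] Suc unfolding e[symmetric] by simp
    then show ?case using lp by (metis mult_eq_0_iff less_irrefl)
  qed
  define c where "c = a l / mc l l"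
  have high: "a (l + i) = c * mc (l + i) l" for i
  proof (induction i)
    case 0 then show ?case using mc_pos[of l l] by (simp add: c_def)
  next
    case (Suc i)
    have p: "lam (Suc (l + i)) - lam l > 0" using lam_less[of l "Suc (l + i)"] by simp
    have "(lam (Suc (l + i)) - lam l) * a (Suc (l + i)) = (lam (Suc (l + i)) - lam l) * (c * mc (Suc (l + i)) l)"
      unfolding rec Suc using mrec[of "l + i"] by (simp only: mult_ac)
    then show ?case using p by simp
  qed
  have "a \<longlonglongrightarrow> f x" unfolding a_def by (rule avg_tendsto[OF eigenspace_continuous[OF f] x])
  then have "(\<lambda>i. a (i + l)) \<longlonglongrightarrow> f x" by (rule LIMSEQ_ignore_initial_segment)
  moreover have "(\<lambda>i. a (i + l)) \<longlonglongrightarrow> c * 1"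
    unfolding add.commute[of _ l] high
    by (intro tendsto_intros) (use LIMSEQ_ignore_initial_segment[OF mc_tendsto, of l l] in \<open>simp add: add.commute\<close>)
  ultimately have c: "c = f x" using LIMSEQ_unique by fastforce
  show ?thesis
  proof (cases "n < l")
    case True
    then have "a n = 0" using low[of "l - Suc n"] by simp
    then show ?thesis using mc_zero[OF True] by (simp add: a_def)
  next
    case False
    then show ?thesis using high[of "n - l"] c by (simp add: a_def)
  qed
qed

lemma proj_eigen:
  assumes f: "f \<in> eigenspace_S2 (lam l)" and x: "x \<in> S2"
  shows "proj k f x = (if k = l then f x else 0)"
proof (rule mc_unique[where S="\<lambda>k. proj k f x" and S'="\<lambda>k. if k = l then f x else 0"])
  fix n
  have "(\<Sum>k\<le>n. mc n k * (if k = l then f x else 0)) = (if l \<le> n then mc n l * f x else 0)"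
    by (simp add: if_distrib[of "\<lambda>t. mc n _ * t"] cong: if_cong)
  then show "(\<Sum>k\<le>n. mc n k * proj k f x) = (\<Sum>k\<le>n. mc n k * (if k = l then f x else 0))"
    using eigenspace_avg[OF f x, of n] by (simp add: avg_proj[symmetric] mc_zero)
qed

lemma proj_proj:
  assumes u: "continuous_on S2 u" and x: "x \<in> S2"
  shows "proj k (proj l u) x = (if k = l then proj l u x else 0)"
proof -
  have "proj k (proj l u) x = proj k (restrict (proj l u) S2) x" by (rule proj_cong) simp
  then show ?thesis using proj_eigen[OF proj_in_eigenspace[OF u] x, of k l] x by simp
qed

text \<open>Each average of the nonnegative function \<open>w * w\<close> is at most
  \<open>n + 1\<close> times its integral, hence zero; the averages converge to
  \<open>w x * w x\<close>.\<close>

lemma S2_zero: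
  fixes w :: "real^3 \<Rightarrow> real"
  assumes w: "continuous_on S2 w" and z: "(LINT x|sigma_S2. w x * w x) = 0" and x: "x \<in> S2"
  shows "w x = 0"
proof -
  have c: "continuous_on S2 (\<lambda>y. w y * w y)" by (intro continuous_intros w)
  have "avg n (\<lambda>y. w y * w y) x = 0" for n
  proof -
    have "(LINT y|sigma_S2. qk x y ^ n * (w y * w y)) \<le> (LINT y|sigma_S2. w y * w y)"
    proof (rule integral_mono)
      fix y assume "y \<in> space sigma_S2"
      then have "y \<in> S2" by (simp only: space_sigma_S2)
      then have "0 \<le> qk x y ^ n" "qk x y ^ n \<le> 1" using qk_nonneg[OF x, of y] qk_le_1[OF x, of y] by (simp_all add: power_le_one)
      then show "qk x y ^ n * (w y * w y) \<le> w y * w y" by (intro mult_left_le_one_le) auto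
    qed (intro S2_cont_integrable continuous_intros w)+
    moreover have "(LINT y|sigma_S2. qk x y ^ n * (w y * w y)) \<ge> 0"
    proof (rule Bochner_Integration.integral_nonneg)
      fix y assume "y \<in> space sigma_S2"
      then have "0 \<le> qk x y" using qk_nonneg[OF x, of y] by (simp only: space_sigma_S2)
      then show "0 \<le> qk x y ^ n * (w y * w y)" by simp
    qed
    ultimately show ?thesis using z by (simp add: avg_def)
  qed
  then have "(\<lambda>n. avg n (\<lambda>y. w y * w y) x) \<longlonglongrightarrow> 0" by simp
  then have "w x * w x = 0" using LIMSEQ_unique avg_tendsto[OF c x] by blast
  then show ?thesis by simp
qed

text \<open>Existence: \<open>u - proj l u\<close> is orthogonal to the eigenspace because
  \<open>proj l\<close> is symmetric and fixes its elements. Uniqueness: for another candidate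
  \<open>p\<close>, testing with the projection of \<open>u - p\<close> shows that this projection
  has norm zero.\<close>

lemma eigenproj_proj:
  assumes u: "continuous_on S2 u"
  shows "eigenproj_S2 (lam l) u = restrict (proj l u) S2"
  unfolding eigenproj_S2_def
proof (rule the_equality)
  have cp: "continuous_on S2 (proj l u)" by (rule continuous_proj[OF u])
  have area0: "(LINT x|area_S2. g x) = 0 \<longleftrightarrow> (LINT x|sigma_S2. g x) = 0" if "continuous_on S2 g" for g :: "real^3 \<Rightarrow> real"
    using integral_area_sigma[OF S2_cont_measurable[OF that]] by simp
  have ca: "continuous_on S2 (\<lambda>x. (u x - p x) * f x)" if "continuous_on S2 p" "continuous_on S2 f" for p f
    by (intro continuous_intros u that)
  show "restrict (proj l u) S2 \<in> eigenspace_S2 (lam l) \<and>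
    (\<forall>f\<in>eigenspace_S2 (lam l). (LINT x|area_S2. (u x - restrict (proj l u) S2 x) * f x) = 0)"
  proof (intro conjI ballI proj_in_eigenspace u)
    fix f assume f: "f \<in> eigenspace_S2 (lam l)"
    note cf = eigenspace_continuous[OF f]
    have "(LINT x|sigma_S2. u x * f x) = (LINT x|sigma_S2. u x * proj l f x)"
      by (rule Bochner_Integration.integral_cong) (simp_all add: proj_eigen[OF f] del: mem_sphere)
    also have "\<dots> = (LINT x|sigma_S2. proj l u x * f x)" by (rule proj_sym[OF u cf, symmetric])
    finally have e: "(LINT x|sigma_S2. u x * f x) = (LINT x|sigma_S2. proj l u x * f x)" .
    have "(LINT x|sigma_S2. (u x - restrict (proj l u) S2 x) * f x) = (LINT x|sigma_S2. u x * f x - proj l u x * f x)"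
      by (rule Bochner_Integration.integral_cong) (simp_all add: left_diff_distrib)
    also have "\<dots> = 0"
      by (subst Bochner_Integration.integral_diff) (auto intro!: S2_cont_integrable continuous_intros u cf cp simp: e)
    finally show "(LINT x|area_S2. (u x - restrict (proj l u) S2 x) * f x) = 0"
      unfolding area0[OF ca[OF eigenspace_continuous[OF proj_in_eigenspace[OF u]] cf]] .
  qed
next
  fix p assume p: "p \<in> eigenspace_S2 (lam l) \<and> (\<forall>f\<in>eigenspace_S2 (lam l). (LINT x|area_S2. (u x - p x) * f x) = 0)"
  have pe: "p \<in> eigenspace_S2 (lam l)" using p by blast
  note cp = eigenspace_continuous[OF pe]
  define d where "d = (\<lambda>x. u x - p x)"
  have cd: "continuous_on S2 d" unfolding d_def by (intro continuous_intros u cp)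
  define w where "w = proj l d"
  have cw: "continuous_on S2 w" unfolding w_def by (rule continuous_proj[OF cd])
  have "(LINT x|area_S2. d x * restrict (proj l d) S2 x) = 0"
    using p proj_in_eigenspace[OF cd, of l] unfolding d_def by blast
  moreover have "continuous_on S2 (\<lambda>x. d x * restrict (proj l d) S2 x)"
    by (intro continuous_intros cd eigenspace_continuous[OF proj_in_eigenspace[OF cd]])
  ultimately have "(LINT x|sigma_S2. d x * restrict (proj l d) S2 x) = 0"
    using integral_area_sigma[OF S2_cont_measurable] by simp
  moreover have "(LINT x|sigma_S2. d x * restrict (proj l d) S2 x) = (LINT x|sigma_S2. d x * proj l w x)"
    by (rule Bochner_Integration.integral_cong) (simp_all add: w_def proj_proj[OF cd] del: mem_sphere)
  ultimately have "(LINT x|sigma_S2. w x * w x) = 0"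
    using proj_sym[OF cd cw, of l] by (simp add: w_def[symmetric])
  then have "w x = 0" if "x \<in> S2" for x by (rule S2_zero[OF cw _ that])
  then have "proj l u x = p x" if "x \<in> S2" for x
    using proj_diff[OF u cp, of l x] proj_eigen[OF pe that, of l] that by (simp add: w_def d_def del: mem_sphere)
  moreover have "p \<in> extensional S2" using eigenspace_smooth[OF pe] by (simp add: smooth_S2_iff)
  ultimately show "p = restrict (proj l u) S2"
    by (auto simp: fun_eq_iff restrict_def extensional_def simp del: mem_sphere)
qed

lemma spectrum_subset: "spectrum_S2 \<subseteq> range lam"
  unfolding spectrum_S2_def using eigenspace_trivial by blast

section \<open>Linear statistics and the Sobolev norm\<close>

definition l2 :: "(real^3 \<Rightarrow> real) \<Rightarrow> real" where "l2 u = (LINT x|sigma_S2. u x * u x)"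

lemma l2_nonneg: "l2 u \<ge> 0" unfolding l2_def by (rule Bochner_Integration.integral_nonneg) simp

lemma integral_sigma_cong: "(\<And>x. x \<in> S2 \<Longrightarrow> f x = g x) \<Longrightarrow> (LINT x|sigma_S2. f x) = (LINT x|sigma_S2. g x)"
  by (rule Bochner_Integration.integral_cong) simp_all

lemma proj_inner:
  assumes u: "continuous_on S2 u"
  shows "(LINT x|sigma_S2. proj k u x * proj l u x) = (if k = l then LINT x|sigma_S2. u x * proj l u x else 0)"
proof -
  have "(LINT x|sigma_S2. proj k u x * proj l u x) = (LINT x|sigma_S2. u x * proj k (proj l u) x)"
    by (rule proj_sym[OF u continuous_proj[OF u]])
  also have "\<dots> = (LINT x|sigma_S2. u x * (if k = l then proj l u x else 0))"
    by (rule integral_sigma_cong) (simp only: proj_proj[OF u])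
  finally show ?thesis by simp
qed

lemma l2_proj: "continuous_on S2 u \<Longrightarrow> l2 (proj l u) = (LINT x|sigma_S2. u x * proj l u x)"
  unfolding l2_def by (simp add: proj_inner)

lemma l2_proj_le:
  assumes u: "continuous_on S2 u" shows "l2 (proj l u) \<le> l2 u"
proof -
  note cp = continuous_proj[OF u, of S2 l]
  have i: "integrable sigma_S2 (\<lambda>x. u x * u x)" "integrable sigma_S2 (\<lambda>x. 2 * (u x * proj l u x))" "integrable sigma_S2 (\<lambda>x. proj l u x * proj l u x)"
    by (intro S2_cont_integrable continuous_intros u cp)+
  have "0 \<le> (LINT x|sigma_S2. (u x - proj l u x) * (u x - proj l u x))" by (rule Bochner_Integration.integral_nonneg) simp
  also have "\<dots> = (LINT x|sigma_S2. (u x * u x - 2 * (u x * proj l u x)) + proj l u x * proj l u x)"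
    by (rule integral_sigma_cong) (simp add: algebra_simps)
  also have "\<dots> = (LINT x|sigma_S2. u x * u x - 2 * (u x * proj l u x)) + (LINT x|sigma_S2. proj l u x * proj l u x)"
    by (rule Bochner_Integration.integral_add[OF Bochner_Integration.integrable_diff[OF i(1,2)] i(3)])
  also have "(LINT x|sigma_S2. u x * u x - 2 * (u x * proj l u x)) = (LINT x|sigma_S2. u x * u x) - (LINT x|sigma_S2. 2 * (u x * proj l u x))"
    by (rule Bochner_Integration.integral_diff[OF i(1,2)])
  finally show ?thesis using l2_proj[OF u, of l] by (simp add: l2_def)
qed

lemma avg_of_proj:
  assumes u: "continuous_on S2 u" and x: "x \<in> S2"
  shows "avg n (proj l u) x = mc n l * proj l u x"
proof -
  have "avg n (proj l u) x = avg n (restrict (proj l u) S2) x" by (rule avg_cong) simp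
  then show ?thesis using eigenspace_avg[OF proj_in_eigenspace[OF u] x, of n l] x by simp
qed

lemma mc_half:
  assumes "real k + 1 \<ge> 2 * lam l" "l \<le> k" shows "mc k l \<ge> 1 / 2"
proof -
  have "lam l / (real k + 1) \<le> 1 / 2" using assms by (simp add: divide_le_eq)
  then show ?thesis using mc_lower[OF assms(2)] by linarith
qed

text \<open>For \<open>n = 2 * lam l\<close> the average reproduces at least half of a harmonic of
  degree \<open>l\<close>, and its kernel is bounded by \<open>n + 1\<close>. An \<open>L^2\<close>
  bound thus becomes a pointwise bound with polynomial loss.\<close>

lemma proj_sup:
  assumes u: "continuous_on S2 u" and x: "x \<in> S2"
  shows "\<bar>proj l u x\<bar> \<le> 4 * (lam l + 1) * (1 + l2 u)"
proof -
  note cp = continuous_proj[OF u, of S2 l]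
  define n where "n = 2 * (l * (l + 1))"
  have n: "real n = 2 * lam l" by (simp add: n_def lam_def algebra_simps)
  have ln: "l \<le> n" by (simp add: n_def)
  have m: "mc n l \<ge> 1 / 2" by (rule mc_half) (simp_all add: n ln)
  have "\<bar>LINT y|sigma_S2. qk x y ^ n * proj l u y\<bar> \<le> (LINT y|sigma_S2. \<bar>qk x y ^ n * proj l u y\<bar>)"
    by (rule integral_abs_bound)
  also have "\<dots> \<le> (LINT y|sigma_S2. 1 + proj l u y * proj l u y)"
  proof (rule integral_mono)
    fix y assume "y \<in> space sigma_S2"
    then have y: "y \<in> S2" by (simp only: space_sigma_S2)
    have "\<bar>qk x y ^ n\<bar> \<le> 1" using qk_nonneg[OF x y] qk_le_1[OF x y] by (simp add: power_le_one)
    then have "\<bar>qk x y ^ n * proj l u y\<bar> \<le> 1 * \<bar>proj l u y\<bar>" unfolding abs_mult by (rule mult_right_mono) simp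
    also have "\<dots> \<le> 1 + proj l u y * proj l u y"
    proof -
      have "0 \<le> (\<bar>proj l u y\<bar> - 1)\<^sup>2" by simp
      also have "\<dots> = \<bar>proj l u y\<bar> * \<bar>proj l u y\<bar> - 2 * \<bar>proj l u y\<bar> + 1" by (simp add: power2_eq_square algebra_simps)
      finally show ?thesis by (simp add: abs_mult_self_eq)
    qed
    finally show "\<bar>qk x y ^ n * proj l u y\<bar> \<le> 1 + proj l u y * proj l u y" .
  qed (intro S2_cont_integrable continuous_intros cp)+
  also have "\<dots> = 1 + l2 (proj l u)"
    unfolding l2_def by (subst Bochner_Integration.integral_add) (auto intro!: S2_cont_integrable continuous_intros cp simp: sigma.prob_space[simplified])
  also have "\<dots> \<le> 1 + l2 u" using l2_proj_le[OF u] by simp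
  finally have b: "\<bar>LINT y|sigma_S2. qk x y ^ n * proj l u y\<bar> \<le> 1 + l2 u" .
  have "(1 / 2) * \<bar>proj l u x\<bar> \<le> mc n l * \<bar>proj l u x\<bar>" using m by (rule mult_right_mono) simp
  also have "\<dots> = \<bar>avg n (proj l u) x\<bar>" using m by (simp add: avg_of_proj[OF u x] abs_mult)
  also have "\<dots> = (real n + 1) * \<bar>LINT y|sigma_S2. qk x y ^ n * proj l u y\<bar>" by (simp add: avg_def abs_mult)
  also have "\<dots> \<le> (real n + 1) * (1 + l2 u)" by (rule mult_left_mono[OF b]) simp
  also have "\<dots> \<le> (2 * (lam l + 1)) * (1 + l2 u)" using l2_nonneg[of u] by (intro mult_right_mono) (simp_all add: n)
  finally show ?thesis by (simp add: algebra_simps)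
qed

text \<open>Projecting the \<open>j\<close>-fold Laplacian of \<open>u\<close> multiplies by
  \<open>lam l ^ j\<close>, and this iterate is again smooth, so \<open>proj_sup\<close> applies to
  it; its norm enters \<open>C\<close>.\<close>

lemma proj_decay:
  assumes u: "u \<in> smooth_S2"
  shows "\<exists>C. \<forall>l. \<forall>x\<in>S2. lam l ^ j * \<bar>proj l u x\<bar> \<le> C * (lam l + 1)"
  using u
proof (induction j arbitrary: u)
  case 0
  show ?case
  proof (intro exI allI ballI)
    fix l x assume "x \<in> S2"
    then show "lam l ^ 0 * \<bar>proj l u x\<bar> \<le> (4 * (1 + l2 u)) * (lam l + 1)"
      using proj_sup[OF smooth_S2_continuous[OF 0], of x l] by (simp only: power_0 mult_1_left mult_ac)
  qed
next
  case (Suc j)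
  define v where "v = restrict (laplace_S2 u) S2"
  obtain C where C: "\<And>l x. x \<in> S2 \<Longrightarrow> lam l ^ j * \<bar>proj l v x\<bar> \<le> C * (lam l + 1)"
    using Suc.IH[OF smooth_S2_laplace[OF Suc.prems]] unfolding v_def by blast
  have e: "proj l v x = lam l * proj l u x" if "x \<in> S2" for l x
  proof -
    have "proj l v x = proj l (laplace_S2 u) x" unfolding v_def by (rule proj_cong) simp
    then show ?thesis using proj_laplace[OF Suc.prems that] by simp
  qed
  show ?case
  proof (intro exI allI ballI)
    fix l x assume x: "x \<in> S2"
    show "lam l ^ Suc j * \<bar>proj l u x\<bar> \<le> C * (lam l + 1)"
      using C[OF x, of l] lam_nonneg[of l] unfolding e[OF x] by (simp add: abs_mult mult_ac)
  qed
qed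

lemma proj_powr_bound:
  assumes u: "u \<in> smooth_S2"
  obtains C where "\<And>l x. x \<in> S2 \<Longrightarrow> \<bar>lam l powr s * proj l u x\<bar> \<le> C * inverse (real l ^ 2)"
proof -
  \<comment> \<open>Of the three additional powers one pays for the factor \<open>lam l + 1\<close>
    in \<open>proj_decay\<close>, and two provide the summable decay.\<close>
  define j where "j = nat \<lceil>\<bar>s\<bar>\<rceil> + 3"
  obtain C where C: "\<And>l x. x \<in> S2 \<Longrightarrow> lam l ^ j * \<bar>proj l u x\<bar> \<le> C * (lam l + 1)"
    using proj_decay[OF u, of j] by blast
  have C0: "C \<ge> 0"
  proof -
    have "axis 1 1 \<in> S2" by simp
    from C[OF this, of 0] show ?thesis by (simp add: lam_def j_def power_0_left)
  qed
  show thesis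
  proof (rule that)
    fix l x assume x: "x \<in> S2"
    show "\<bar>lam l powr s * proj l u x\<bar> \<le> (2 * C) * inverse (real l ^ 2)"
    proof (cases "l = 0")
      case True then show ?thesis by (simp add: lam_def)
    next
      case False
      define L where "L = lam l"
      have L1: "L \<ge> real l" "real l \<ge> 1" using False by (simp_all add: L_def lam_def)
      then have L: "L \<ge> 1" by linarith
      have "L powr s \<le> L powr real (j - 3)"
        using L unfolding j_def by (intro powr_mono) (simp_all, linarith)
      also have "\<dots> = L ^ (j - 3)" using L by (simp add: powr_realpow)
      finally have p: "L powr s \<le> L ^ (j - 3)" .
      have "L ^ 3 * (L ^ (j - 3) * \<bar>proj l u x\<bar>) = L ^ j * \<bar>proj l u x\<bar>"
        by (simp add: j_def power_add)
      also have "\<dots> \<le> C * (L + 1)" using C[OF x, of l] by (simp add: L_def)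
      also have "\<dots> \<le> C * (2 * L)" using C0 L by (intro mult_left_mono) auto
      finally have "L ^ 3 * (L ^ (j - 3) * \<bar>proj l u x\<bar>) \<le> L * (2 * C)" by (simp add: mult_ac)
      then have "L * (L\<^sup>2 * (L ^ (j - 3) * \<bar>proj l u x\<bar>)) \<le> L * (2 * C)" by (simp add: power3_eq_cube power2_eq_square mult_ac)
      then have q: "L\<^sup>2 * (L ^ (j - 3) * \<bar>proj l u x\<bar>) \<le> 2 * C" using L by (subst (asm) mult_le_cancel_left_pos) auto
      have "\<bar>lam l powr s * proj l u x\<bar> = L powr s * \<bar>proj l u x\<bar>" by (simp add: abs_mult L_def)
      also have "\<dots> \<le> L ^ (j - 3) * \<bar>proj l u x\<bar>" by (rule mult_right_mono[OF p]) simp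
      also have "\<dots> \<le> 2 * C / L\<^sup>2" using q L by (simp add: le_divide_eq mult_ac)
      also have "\<dots> \<le> 2 * C / (real l)\<^sup>2" using C0 L1 by (intro divide_left_mono power_mono) auto
      finally show ?thesis by (simp add: inverse_eq_divide)
    qed
  qed
qed

lemma summable_inverse_sq: "summable (\<lambda>l. C * inverse (real l ^ 2))"
  by (intro summable_mult inverse_power_summable) simp

lemma laplace_powr_S2_eq:
  assumes u: "u \<in> smooth_S2" and x: "x \<in> S2"
  shows "laplace_powr_S2 s u x = (\<Sum>l. lam l powr s * proj l u x)"
proof -
  note cu = smooth_S2_continuous[OF u]
  obtain C where C: "\<And>l x. x \<in> S2 \<Longrightarrow> \<bar>lam l powr s * proj l u x\<bar> \<le> C * inverse (real l ^ 2)"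
    using proj_powr_bound[OF u] by blast
  have sn: "summable (\<lambda>l. norm (lam l powr s * proj l u x))"
    by (rule summable_comparison_test[OF _ summable_inverse_sq[of C]]) (use C[OF x] in auto)
  have ep: "eigenproj_S2 (lam l) u x = proj l u x" for l using eigenproj_proj[OF cu, of l] x by simp
  \<comment> \<open>If \<open>lam l\<close> lies outside the spectrum, its eigenfunctions vanish on
    the sphere and so does the projection. The sum may therefore run over all of
    \<open>range lam\<close>.\<close>
  have z: "eigenproj_S2 t u x = 0" if "t \<in> range lam - spectrum_S2" for t
  proof -
    from that have "t \<in> range lam" by simp
    then obtain l where l: "t = lam l" by (rule imageE)
    have "restrict (proj l u) S2 \<in> eigenspace_S2 t" unfolding l by (rule proj_in_eigenspace[OF cu])
    then have "restrict (proj l u) S2 x = 0" using that x unfolding spectrum_S2_def by blast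
    then show ?thesis unfolding l ep using x by simp
  qed
  have "laplace_powr_S2 s u x = (\<Sum>\<^sub>\<infinity>t\<in>range lam. t powr s * eigenproj_S2 t u x)"
    unfolding laplace_powr_S2_def
    by (rule infsum_cong_neutral) (use z spectrum_subset in auto)
  also have "\<dots> = infsum (\<lambda>l. lam l powr s * proj l u x) UNIV"
    by (subst infsum_reindex[OF lam_inj]) (simp add: o_def ep)
  also have "\<dots> = (\<Sum>l. lam l powr s * proj l u x)"
    by (rule infsumI, rule norm_summable_imp_has_sum[OF sn], rule summable_sums, rule summable_norm_cancel[OF sn])
  finally show ?thesis .
qed

text \<open>The rapid decay of the projections allows integration term by term, and partial sums
  bound the series from below since its terms are nonnegative. The factor \<open>4 * pi\<close> is
  the mass of the area relative to \<open>sigma_S2\<close>.\<close>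

lemma sobolev_form_ge:
  assumes u: "u \<in> smooth_S2"
  shows "4 * pi * (\<Sum>l\<le>n. lam l powr s * l2 (proj l u)) \<le> sobolev_form s u"
proof -
  note cu = smooth_S2_continuous[OF u]
  obtain C where C: "\<And>l x. x \<in> S2 \<Longrightarrow> \<bar>lam l powr s * proj l u x\<bar> \<le> C * inverse (real l ^ 2)"
    using proj_powr_bound[OF u] by blast
  obtain B where B: "B > 0" "\<And>x. x \<in> S2 \<Longrightarrow> norm (u x) \<le> B" using S2_cont_bounded[OF cu] by blast
  define f where "f l x = u x * (lam l powr s * proj l u x)" for l x
  have cf: "continuous_on S2 (f l)" for l unfolding f_def by (intro continuous_intros cu continuous_proj)
  have fb: "norm (f l x) \<le> (B * C) * inverse (real l ^ 2)" if "x \<in> S2" for l x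
    unfolding f_def real_norm_def abs_mult[of "u x"] mult.assoc
    using B(2)[OF that] C[OF that, of l] B(1) by (intro mult_mono) auto
  have si: "summable (\<lambda>l. LINT x|sigma_S2. norm (f l x))"
  proof (rule summable_comparison_test[OF _ summable_inverse_sq[of "B * C"]], intro exI allI impI)
    fix l
    have "(LINT x|sigma_S2. norm (f l x)) \<le> (LINT x|sigma_S2. (B * C) * inverse (real l ^ 2))"
      by (rule integral_mono) (use fb in \<open>auto intro!: S2_cont_integrable continuous_intros cf simp del: mem_sphere\<close>)
    moreover have "(LINT x|sigma_S2. norm (f l x)) \<ge> 0" by (rule Bochner_Integration.integral_nonneg) simp
    ultimately show "norm (LINT x|sigma_S2. norm (f l x)) \<le> (B * C) * inverse (real l ^ 2)"
      using sigma.prob_space by simp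
  qed
  have sp: "summable (\<lambda>l. norm (f l x))" if "x \<in> S2" for x
    by (rule summable_comparison_test[OF _ summable_inverse_sq[of "B * C"]]) (use fb[OF that] in auto)
  have isum: "(\<lambda>l. LINT x|sigma_S2. f l x) sums (LINT x|sigma_S2. (\<Sum>l. f l x))"
  proof (rule sums_integral)
    show "integrable sigma_S2 (f l)" for l by (rule S2_cont_integrable[OF cf])
    show "AE x in sigma_S2. summable (\<lambda>l. norm (f l x))" by (rule AE_I2) (simp only: space_sigma_S2 sp)
    show "summable (\<lambda>l. LINT x|sigma_S2. norm (f l x))" by (rule si)
  qed
  have fl: "(LINT x|sigma_S2. f l x) = lam l powr s * l2 (proj l u)" for l
  proof -
    have "(LINT x|sigma_S2. f l x) = (LINT x|sigma_S2. lam l powr s * (u x * proj l u x))"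
      by (rule integral_sigma_cong) (simp add: f_def)
    then show ?thesis by (simp add: l2_proj[OF cu])
  qed
  have m: "(\<lambda>x. \<Sum>l. f l x) \<in> borel_measurable (restrict_space borel S2)"
    by (intro borel_measurable_suminf S2_cont_measurable cf)
  have e: "u x * laplace_powr_S2 s u x = (\<Sum>l. f l x)" if "x \<in> S2" for x
  proof -
    have "summable (\<lambda>l. norm (lam l powr s * proj l u x))"
      by (rule summable_comparison_test[OF _ summable_inverse_sq[of C]]) (use C[OF that] in auto)
    then show ?thesis unfolding laplace_powr_S2_eq[OF u that] f_def by (rule suminf_mult[OF summable_norm_cancel, symmetric])
  qed
  have "sobolev_form s u = (LINT x|area_S2. (\<Sum>l. f l x))"
    unfolding sobolev_form_def by (rule Bochner_Integration.integral_cong) (simp_all only: space_area_S2 e)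
  also have "\<dots> = 4 * pi * (\<Sum>l. lam l powr s * l2 (proj l u))"
    unfolding integral_area_sigma[OF m] using sums_unique[OF isum] by (simp add: fl)
  finally have sf: "sobolev_form s u = 4 * pi * (\<Sum>l. lam l powr s * l2 (proj l u))" .
  have "(\<Sum>l\<le>n. lam l powr s * l2 (proj l u)) \<le> (\<Sum>l. lam l powr s * l2 (proj l u))"
    using sums_summable[OF isum] unfolding fl 
    by (intro sum_le_suminf) (auto intro!: mult_nonneg_nonneg l2_nonneg)
  then show ?thesis unfolding sf by simp
qed

section \<open>Deviations, reproducing kernels and duality\<close>

definition dev :: "nat \<Rightarrow> (nat \<Rightarrow> real^3) \<Rightarrow> (real^3 \<Rightarrow> real) \<Rightarrow> real" where
  "dev N x u = (\<Sum>i\<in>{1..N}. u (x i)) - real N * (LINT y|sigma_S2. u y)"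

definition QN :: "nat \<Rightarrow> (nat \<Rightarrow> real^3) \<Rightarrow> nat \<Rightarrow> real" where
  "QN N x n = (\<Sum>i\<in>{1..N}. \<Sum>j\<in>{1..N}. qk (x i) (x j) ^ n) - (real N)\<^sup>2 / (real n + 1)"

lemma dev_sum:
  assumes "\<And>j. j \<in> J \<Longrightarrow> continuous_on S2 (F j)"
  shows "dev N x (\<lambda>y. \<Sum>j\<in>J. c j * F j y) = (\<Sum>j\<in>J. c j * dev N x (F j))"
proof -
  have "(LINT y|sigma_S2. (\<Sum>j\<in>J. c j * F j y)) = (\<Sum>j\<in>J. c j * (LINT y|sigma_S2. F j y))"
    using integral_sum_mult[of "\<lambda>_. 1" J F c] assms by simp
  moreover have "(\<Sum>i\<in>{1..N}. \<Sum>j\<in>J. c j * F j (x i)) = (\<Sum>j\<in>J. c j * (\<Sum>i\<in>{1..N}. F j (x i)))"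
    by (subst sum.swap) (simp add: sum_distrib_left)
  ultimately show ?thesis
    unfolding dev_def by (simp add: right_diff_distrib sum_subtractf sum_distrib_left mult_ac)
qed

lemma dev_cong: "(\<And>y. y \<in> S2 \<Longrightarrow> f y = g y) \<Longrightarrow> (\<And>i. i \<in> {1..N} \<Longrightarrow> x i \<in> S2) \<Longrightarrow> dev N x f = dev N x g"
  unfolding dev_def by (intro arg_cong2[where f=minus] sum.cong arg_cong2[where f=times] integral_sigma_cong refl) auto

context
  fixes N :: nat and x :: "nat \<Rightarrow> real^3"
  assumes xS: "\<And>i. i \<in> {1..N} \<Longrightarrow> x i \<in> S2"
begin

text \<open>When the squares are expanded, the cross terms and the squared means reduce to the
  integral of \<open>qk z y ^ n\<close> over \<open>y\<close>, which is \<open>1 / (n + 1)\<close>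
  for every \<open>z\<close> on the sphere.\<close>

lemma QN_feat: "QN N x n = (\<Sum>f\<in>featset n. (dev N x (feat n f))\<^sup>2)"
proof -
  define m where "m f = (LINT y|sigma_S2. feat n f y)" for f
  have s1: "(\<Sum>f\<in>featset n. feat n f z * m f) = 1 / (real n + 1)" if "z \<in> S2" for z
  proof -
    have "(\<Sum>f\<in>featset n. feat n f z * m f) = (LINT y|sigma_S2. qk z y ^ n)"
      unfolding m_def qk_power_feat
      using integral_sum_mult[of "\<lambda>_. 1" "featset n" "\<lambda>f. feat n f" "\<lambda>f. feat n f z"] continuous_feat by simp
    then show ?thesis using integral_qk_power[OF that] by simp
  qed
  have s2: "(\<Sum>f\<in>featset n. m f * m f) = 1 / (real n + 1)"
  proof -
    have "(\<Sum>f\<in>featset n. m f * m f) = (LINT z|sigma_S2. (\<Sum>f\<in>featset n. m f * feat n f z))"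
      using integral_sum_mult[of "\<lambda>_. 1" "featset n" "\<lambda>f. feat n f" m] continuous_feat by (simp add: m_def)
    also have "\<dots> = (LINT z|sigma_S2. 1 / (real n + 1))"
      by (rule integral_sigma_cong) (use s1 in \<open>simp add: mult.commute\<close>)
    finally show ?thesis using sigma.prob_space by simp
  qed
  define P where "P f = (\<Sum>i\<in>{1..N}. feat n f (x i))" for f
  have "(\<Sum>f\<in>featset n. (dev N x (feat n f))\<^sup>2) = (\<Sum>f\<in>featset n. P f * P f - 2 * real N * (P f * m f) + (real N)\<^sup>2 * (m f * m f))"
    unfolding dev_def P_def[symmetric] m_def[symmetric] by (intro sum.cong refl) (simp add: power2_eq_square algebra_simps)
  also have "\<dots> = (\<Sum>f\<in>featset n. P f * P f) - 2 * real N * (\<Sum>f\<in>featset n. P f * m f) + (real N)\<^sup>2 * (\<Sum>f\<in>featset n. m f * m f)"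
    by (simp add: sum.distrib sum_subtractf sum_distrib_left)
  also have "(\<Sum>f\<in>featset n. P f * m f) = (\<Sum>i\<in>{1..N}. (\<Sum>f\<in>featset n. feat n f (x i) * m f))"
    unfolding P_def sum_distrib_right by (rule sum.swap)
  also have "\<dots> = real N * (1 / (real n + 1))" using xS by (simp add: s1 del: mem_sphere)
  also have "(\<Sum>f\<in>featset n. P f * P f) = (\<Sum>i\<in>{1..N}. \<Sum>j\<in>{1..N}. qk (x i) (x j) ^ n)"
    unfolding P_def sum_product qk_power_feat
    by (subst sum.swap, rule sum.cong[OF refl], rule sum.swap)
  finally show ?thesis unfolding s2 by (simp add: QN_def power2_eq_square)
qed

lemma QN_nonneg: "QN N x n \<ge> 0"
  unfolding QN_feat by (intro sum_nonneg) simp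

lemma dev_avg: "continuous_on S2 h \<Longrightarrow> dev N x (avg n h) = (real n + 1) * (\<Sum>f\<in>featset n. acoef n h f * dev N x (feat n f))"
proof -
  assume h: "continuous_on S2 h"
  have "dev N x (avg n h) = dev N x (\<lambda>y. \<Sum>f\<in>featset n. ((real n + 1) * acoef n h f) * feat n f y)"
    by (simp only: avg_feat[OF h, abs_def])
  also have "\<dots> = (\<Sum>f\<in>featset n. ((real n + 1) * acoef n h f) * dev N x (feat n f))"
    by (rule dev_sum) (rule continuous_feat)
  finally show ?thesis by (simp only: sum_distrib_left mult.assoc)
qed

lemma sum_acoef_sq: "continuous_on S2 h \<Longrightarrow> (\<Sum>f\<in>featset n. (acoef n h f)\<^sup>2) = (LINT y|sigma_S2. avg n h y * h y) / (real n + 1)"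
proof -
  assume h: "continuous_on S2 h"
  have "(LINT y|sigma_S2. avg n h y * h y) = (\<Sum>f\<in>featset n. ((real n + 1) * acoef n h f) * (LINT y|sigma_S2. feat n f y * h y))"
    unfolding avg_feat[OF h] by (rule integral_sum_mult[OF h continuous_feat])
  then show ?thesis by (simp add: acoef_def[symmetric] power2_eq_square sum_distrib_left[symmetric] mult.assoc)
qed

text \<open>Cauchy--Schwarz in the reproducing kernel Hilbert space of the kernel with coefficients \<open>b\<close>.\<close>

lemma dev_kernel_le:
  assumes h: "continuous_on S2 h" and K: "finite K" and b: "\<And>k. k \<in> K \<Longrightarrow> b k \<ge> 0"
  shows "(dev N x (\<lambda>y. \<Sum>k\<in>K. (b k / (real k + 1)) * avg k h y))\<^sup>2
    \<le> (\<Sum>k\<in>K. b k * QN N x k) * (LINT y|sigma_S2. (\<Sum>k\<in>K. (b k / (real k + 1)) * avg k h y) * h y)"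
proof -
  define I where "I = Sigma K featset"
  have fI: "finite I" unfolding I_def using K finite_featset by auto
  define A where "A z = sqrt (b (fst z)) * dev N x (feat (fst z) (snd z))" for z
  define B where "B z = sqrt (b (fst z)) * acoef (fst z) h (snd z)" for z
  have e: "dev N x (\<lambda>y. \<Sum>k\<in>K. (b k / (real k + 1)) * avg k h y) = (\<Sum>z\<in>I. A z * B z)"
  proof -
    have "dev N x (\<lambda>y. \<Sum>k\<in>K. (b k / (real k + 1)) * avg k h y) = (\<Sum>k\<in>K. (b k / (real k + 1)) * dev N x (avg k h))"
      by (rule dev_sum) (rule continuous_avg[OF h])
    also have "\<dots> = (\<Sum>k\<in>K. \<Sum>f\<in>featset k. A (k, f) * B (k, f))"
    proof (rule sum.cong[OF refl])
      fix k assume k: "k \<in> K"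
      have "sqrt (b k) * sqrt (b k) = b k" using b[OF k] by simp
      moreover have "A (k, f) * B (k, f) = (sqrt (b k) * sqrt (b k)) * (acoef k h f * dev N x (feat k f))" for f
        unfolding A_def B_def fst_conv snd_conv by (simp only: mult_ac)
      ultimately have "A (k, f) * B (k, f) = b k * (acoef k h f * dev N x (feat k f))" for f by simp
      then show "(b k / (real k + 1)) * dev N x (avg k h) = (\<Sum>f\<in>featset k. A (k, f) * B (k, f))"
        by (simp add: dev_avg[OF h] sum_distrib_left[symmetric])
    qed
    also have "\<dots> = (\<Sum>z\<in>I. A z * B z)" unfolding I_def using K finite_featset by (subst sum.Sigma) auto
    finally show ?thesis .
  qed
  have a: "(\<Sum>z\<in>I. (A z)\<^sup>2) = (\<Sum>k\<in>K. b k * QN N x k)"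
  proof -
    have "(\<Sum>z\<in>I. (A z)\<^sup>2) = (\<Sum>k\<in>K. \<Sum>f\<in>featset k. (A (k, f))\<^sup>2)" unfolding I_def using K finite_featset by (subst sum.Sigma) auto
    also have "\<dots> = (\<Sum>k\<in>K. b k * QN N x k)"
      by (rule sum.cong[OF refl]) (simp add: A_def power_mult_distrib b QN_feat sum_distrib_left)
    finally show ?thesis .
  qed
  have b': "(\<Sum>z\<in>I. (B z)\<^sup>2) = (LINT y|sigma_S2. (\<Sum>k\<in>K. (b k / (real k + 1)) * avg k h y) * h y)"
  proof -
    have "(\<Sum>z\<in>I. (B z)\<^sup>2) = (\<Sum>k\<in>K. \<Sum>f\<in>featset k. (B (k, f))\<^sup>2)" unfolding I_def using K finite_featset by (subst sum.Sigma) auto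
    also have "\<dots> = (\<Sum>k\<in>K. (b k / (real k + 1)) * (LINT y|sigma_S2. avg k h y * h y))"
      by (rule sum.cong[OF refl]) (simp add: B_def power_mult_distrib b sum_distrib_left[symmetric] sum_acoef_sq[OF h])
    also have "\<dots> = (LINT y|sigma_S2. (\<Sum>k\<in>K. (b k / (real k + 1)) * avg k h y) * h y)"
      by (rule integral_sum_mult[symmetric]) (intro h continuous_avg)+
    finally show ?thesis .
  qed
  have "(\<Sum>z\<in>I. A z * B z)\<^sup>2 \<le> (\<Sum>z\<in>I. (A z)\<^sup>2) * (\<Sum>z\<in>I. (B z)\<^sup>2)" by (rule Cauchy_Schwarz_ineq_sum)
  then show ?thesis unfolding e a b' .
qed

end

lemma avg_sum:
  assumes "\<And>j. j \<in> J \<Longrightarrow> continuous_on S2 (F j)"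
  shows "avg k (\<lambda>y. \<Sum>j\<in>J. c j * F j y) x = (\<Sum>j\<in>J. c j * avg k (F j) x)"
proof -
  have q: "continuous_on S2 (\<lambda>y. qk x y ^ k)" by (intro continuous_intros)
  have "(LINT y|sigma_S2. qk x y ^ k * (\<Sum>j\<in>J. c j * F j y)) = (\<Sum>j\<in>J. c j * (LINT y|sigma_S2. qk x y ^ k * F j y))"
    using integral_sum_mult[OF q, of J F c] assms by (simp only: mult.commute)
  then show ?thesis unfolding avg_def by (simp only: sum_distrib_left mult.left_commute)
qed

lemma integral_avg: "continuous_on S2 u \<Longrightarrow> (LINT x|sigma_S2. avg n u x) = (LINT x|sigma_S2. u x)"
proof -
  assume u: "continuous_on S2 u"
  have "(LINT x|sigma_S2. avg n u x) = (LINT x|sigma_S2. u x * avg n (\<lambda>_. 1) x)"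
    using avg_sym[OF u continuous_on_const, of n 1] by simp
  also have "\<dots> = (LINT x|sigma_S2. u x)" by (rule integral_sigma_cong) (simp only: avg_one mult_1_right)
  finally show ?thesis .
qed

lemma proj_0: "proj 0 u x = (LINT y|sigma_S2. u y)"
  by (subst proj.simps) (simp add: avg_def mc_def)

lemma dev_add_const: "continuous_on S2 G \<Longrightarrow> dev N x (\<lambda>y. c + G y) = dev N x G"
proof -
  assume G: "continuous_on S2 G"
  have "(LINT y|sigma_S2. c + G y) = (LINT y|sigma_S2. c) + (LINT y|sigma_S2. G y)"
    by (rule Bochner_Integration.integral_add) (intro S2_cont_integrable continuous_intros G)+
  then show ?thesis using sigma.prob_space by (simp add: dev_def sum.distrib algebra_simps)
qed

text \<open>The left side is the eigenvalue, on harmonics of degree \<open>l\<close>, of the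
  operator with kernel \<open>\<Sum>k. k powr -(2 + e) * qk^k\<close>. Only the block
  \<open>2 * L \<le> k < 4 * L\<close> with \<open>L = lam l\<close> is kept: there
  \<open>mc k l \<ge> 1/2\<close>, so each of its \<open>2 * L\<close> terms is at least
  \<open>(4 * L) powr -(2 + e) / (8 * L)\<close>.\<close>

lemma kernel_eigenvalue_ge:
  assumes l: "1 \<le> l" and e: "0 \<le> e" "e \<le> 1" and M: "4 * (l * (l + 1)) \<le> M"
  shows "(\<Sum>k\<in>{1..M}. (real k powr - (2 + e) / (real k + 1)) * mc k l) \<ge> lam l powr - (2 + e) / 256"
proof -
  define L where "L = l * (l + 1)"
  have L: "L \<ge> 2" "real L = lam l" "l \<le> L" 
  proof -
    show "L \<ge> 2" using mult_le_mono[of 1 l 2 "l + 1"] l by (simp add: L_def)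
  qed (simp_all add: L_def lam_def algebra_simps)
  have Lp: "real L > 0" using L by simp
  have t: "(real (4 * L) powr - (2 + e) / real (4 * L)) * (1 / 2) \<le> (real k powr - (2 + e) / (real k + 1)) * mc k l"
    if k: "k \<in> {2 * L..<4 * L}" for k
  proof (rule mult_mono)
    have k0: "real k > 0" "real k \<le> real (4 * L)" "real k + 1 \<le> real (4 * L)" using k L by auto
    have "real (4 * L) powr - (2 + e) \<le> real k powr - (2 + e)" using k0 e by (intro powr_mono2') auto
    then show "real (4 * L) powr - (2 + e) / real (4 * L) \<le> real k powr - (2 + e) / (real k + 1)"
      using k0 by (intro frac_le) auto
    show "1 / 2 \<le> mc k l" by (rule mc_half) (use k L in \<open>auto simp: L(2)[symmetric]\<close>)
  qed (use Lp in auto)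
  have nn: "(real k powr - (2 + e) / (real k + 1)) * mc k l \<ge> 0" for k
    using mc_pos[of l k] mc_zero[of k l] by (cases "l \<le> k") auto
  \<comment> \<open>The bound \<open>e \<le> 1\<close> enters here. With the factor
    \<open>1/4\<close> that the block sum leaves, this gives the constant 256.\<close>
  have p4: "(4::real) powr - (2 + e) \<ge> 1 / 64"
  proof -
    have "(4::real) powr - 3 \<le> 4 powr - (2 + e)" using e by (intro powr_mono) auto
    moreover have "(4::real) powr - 3 = 1 / 64" by (simp add: powr_minus powr_numeral)
    ultimately show ?thesis by simp
  qed
  have "lam l powr - (2 + e) / 256 = (1 / 64) * real L powr - (2 + e) / 4" by (simp add: L(2))
  also have "\<dots> \<le> (4 powr - (2 + e)) * real L powr - (2 + e) / 4" using p4 by (intro divide_right_mono mult_right_mono) auto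
  also have "\<dots> = real (4 * L) powr - (2 + e) / 4" by (simp add: powr_mult)
  also have "\<dots> = (\<Sum>k\<in>{2 * L..<4 * L}. (real (4 * L) powr - (2 + e) / real (4 * L)) * (1 / 2))"
    using Lp by (simp add: field_simps)
  also have "\<dots> \<le> (\<Sum>k\<in>{2 * L..<4 * L}. (real k powr - (2 + e) / (real k + 1)) * mc k l)"
    by (rule sum_mono) (rule t)
  also have "\<dots> \<le> (\<Sum>k\<in>{1..M}. (real k powr - (2 + e) / (real k + 1)) * mc k l)"
  proof (rule sum_mono2)
    have "4 * L \<le> M" using M by (simp only: L_def)
    then show "{2 * L..<4 * L} \<subseteq> {1..M}" using L(1) by auto
  qed (use nn in auto)
  finally show ?thesis .
qed

text \<open>The function \<open>h\<close> is chosen so that the kernel operator maps it to the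
  mean-free part of \<open>avg n u\<close>. Cauchy-Schwarz then separates \<open>S\<close> from a
  quadratic form in \<open>u\<close>, which the eigenvalue bound compares with the Sobolev form.
  Working with \<open>avg n u\<close> keeps all sums finite; \<open>n\<close> tends to infinity at
  the end.\<close>

theorem dev_sobolev_le:
  assumes u: "u \<in> smooth_S2" and ep: "\<epsilon> > 0" and sf: "sobolev_form (2 + \<epsilon>) u \<le> 1"
    and xS: "\<And>i. i \<in> {1..N} \<Longrightarrow> x i \<in> S2"
    and S: "\<And>M. (\<Sum>k\<in>{1..M}. real k powr - (2 + min \<epsilon> 1) * QN N x k) \<le> S"
  shows "(dev N x u)\<^sup>2 \<le> 64 * S"
proof -
  define e where "e = min \<epsilon> 1"
  have e: "0 \<le> e" "e \<le> 1" "e \<le> \<epsilon>" using ep by (auto simp: e_def)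
  note cu = smooth_S2_continuous[OF u]
  define b where "b k = real k powr - (2 + e)" for k :: nat
  have S0: "S \<ge> 0" using S[of 0] by simp
  have main: "(dev N x (avg n u))\<^sup>2 \<le> 64 * S" for n
  proof -
    define M where "M = 4 * (n * (n + 1))"
    define g where "g l = (\<Sum>k\<in>{1..M}. (b k / (real k + 1)) * mc k l)" for l
    have g: "g l \<ge> lam l powr - (2 + e) / 256" "g l > 0" if l: "l \<in> {1..n}" for l
    proof -
      show gl: "g l \<ge> lam l powr - (2 + e) / 256"

      proof -
        have "l * (l + 1) \<le> n * (n + 1)" using l by (intro mult_le_mono) auto
        then show ?thesis unfolding g_def b_def M_def using l by (intro kernel_eigenvalue_ge e) simp_all
      qed
      have "lam l > 0" using l by (auto simp: lam_def)
      then have "lam l powr - (2 + e) / 256 > 0" by simp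
      then show "g l > 0" using gl by linarith
    qed
    \<comment> \<open>\<open>g l\<close> is the eigenvalue of the kernel operator on degree
      \<open>l\<close>; dividing by it inverts the operator there, and \<open>mc n l\<close> makes
      the result a component of \<open>avg n u\<close>.\<close>
    define c where "c l = mc n l / g l" for l
    define h where "h = (\<lambda>y. \<Sum>l\<in>{1..n}. c l * proj l u y)"
    have ch: "continuous_on S2 h" unfolding h_def by (intro continuous_intros continuous_proj cu)
    define H where "H = (\<lambda>y. \<Sum>k\<in>{1..M}. (b k / (real k + 1)) * avg k h y)"
    have cH: "continuous_on S2 H" unfolding H_def by (intro continuous_intros continuous_avg ch)
    have Hy: "H y = (\<Sum>l\<in>{1..n}. mc n l * proj l u y)" if y: "y \<in> S2" for y
    proof -
      have "H y = (\<Sum>k\<in>{1..M}. \<Sum>l\<in>{1..n}. (b k / (real k + 1)) * (c l * (mc k l * proj l u y)))"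
        unfolding H_def h_def by (simp only: avg_sum continuous_proj[OF cu] avg_of_proj[OF cu y] sum_distrib_left)
      also have "\<dots> = (\<Sum>l\<in>{1..n}. \<Sum>k\<in>{1..M}. (b k / (real k + 1)) * (c l * (mc k l * proj l u y)))" by (rule sum.swap)
      also have "\<dots> = (\<Sum>l\<in>{1..n}. mc n l * proj l u y)"
      proof (rule sum.cong[OF refl])
        fix l assume l: "l \<in> {1..n}"
        have "(\<Sum>k\<in>{1..M}. (b k / (real k + 1)) * (c l * (mc k l * proj l u y))) = g l * (c l * proj l u y)"
          unfolding g_def sum_distrib_right by (simp add: mult_ac)
        also have "\<dots> = mc n l * proj l u y" using g(2)[OF l] by (simp add: c_def)
        finally show "(\<Sum>k\<in>{1..M}. (b k / (real k + 1)) * (c l * (mc k l * proj l u y))) = mc n l * proj l u y" .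
      qed
      finally show ?thesis .
    qed
    have avgH: "avg n u y = (LINT y|sigma_S2. u y) + H y" if y: "y \<in> S2" for y
    proof -
      have "{..n} = insert 0 {1..n}" by auto
      then have "avg n u y = mc n 0 * proj 0 u y + (\<Sum>l\<in>{1..n}. mc n l * proj l u y)" unfolding avg_proj by simp
      then show ?thesis by (simp add: Hy[OF y] proj_0 mc_def)
    qed
    have d1: "dev N x (avg n u) = dev N x H"
    proof -
      have "dev N x (avg n u) = dev N x (\<lambda>y. (LINT y|sigma_S2. u y) + H y)" by (rule dev_cong, erule avgH, erule xS)
      then show ?thesis by (simp only: dev_add_const[OF cH])
    qed
    have "(dev N x H)\<^sup>2 \<le> (\<Sum>k\<in>{1..M}. b k * QN N x k) * (LINT y|sigma_S2. H y * h y)"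
      unfolding H_def by (rule dev_kernel_le[OF _ ch]) (erule xS, auto simp: b_def)
    also have "\<dots> \<le> S * 64"
    proof (rule mult_mono)
      show "(\<Sum>k\<in>{1..M}. b k * QN N x k) \<le> S" using S[of M] by (simp add: b_def e_def)
      have "(LINT y|sigma_S2. H y * h y) = (LINT y|sigma_S2. (\<Sum>l\<in>{1..n}. mc n l * proj l u y) * h y)"
        by (rule integral_sigma_cong) (simp only: Hy)
      also have "\<dots> = (\<Sum>l\<in>{1..n}. mc n l * (LINT y|sigma_S2. proj l u y * h y))"
        by (rule integral_sum_mult[OF ch continuous_proj[OF cu]])
      also have "\<dots> = (\<Sum>l\<in>{1..n}. mc n l * (c l * l2 (proj l u)))"
      proof (rule sum.cong[OF refl])
        fix l assume l: "l \<in> {1..n}"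
        have "(LINT y|sigma_S2. proj l u y * h y) = (LINT y|sigma_S2. h y * proj l u y)" by (simp only: mult.commute)
        also have "\<dots> = (\<Sum>k\<in>{1..n}. c k * (LINT y|sigma_S2. proj k u y * proj l u y))"
          unfolding h_def by (rule integral_sum_mult) (rule continuous_proj[OF cu])+
        also have "\<dots> = (\<Sum>k\<in>{1..n}. if k = l then c k * l2 (proj l u) else 0)"
          by (rule sum.cong[OF refl]) (simp add: proj_inner[OF cu] l2_proj[OF cu])
        also have "\<dots> = c l * l2 (proj l u)" using l by simp
        finally show "mc n l * (LINT y|sigma_S2. proj l u y * h y) = mc n l * (c l * l2 (proj l u))" by simp
      qed
      also have "\<dots> \<le> (\<Sum>l\<in>{1..n}. 256 * (lam l powr (2 + \<epsilon>) * l2 (proj l u)))"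
      proof (rule sum_mono)
        fix l assume l: "l \<in> {1..n}"
        have lam1: "lam l \<ge> 1"
        proof -
          have "(1::real) \<le> lam 1" by (simp add: lam_def)
          also have "\<dots> \<le> lam l" using l by (intro lam_mono) simp
          finally show ?thesis .
        qed
        have m: "0 \<le> mc n l" "mc n l \<le> 1" using mc_pos[of l n] mc_le_1[of l n] l by auto
        have "mc n l * c l = (mc n l * mc n l) * (1 / g l)" by (simp add: c_def)
        also have "\<dots> \<le> 1 * (1 / (lam l powr - (2 + e) / 256))"
          using m g[OF l] lam1 by (intro mult_mono divide_left_mono mult_le_one mult_pos_pos) auto
        also have "\<dots> = 256 * lam l powr (2 + e)" unfolding powr_minus using lam1 by (simp add: field_simps)
        also have "\<dots> \<le> 256 * lam l powr (2 + \<epsilon>)" using lam1 e by (intro mult_left_mono powr_mono) auto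
        finally have "mc n l * c l * l2 (proj l u) \<le> 256 * lam l powr (2 + \<epsilon>) * l2 (proj l u)"
          by (rule mult_right_mono) (rule l2_nonneg)
        then show "mc n l * (c l * l2 (proj l u)) \<le> 256 * (lam l powr (2 + \<epsilon>) * l2 (proj l u))" by (simp only: mult.assoc)
      qed
      also have "\<dots> = 256 * (\<Sum>l\<in>{1..n}. lam l powr (2 + \<epsilon>) * l2 (proj l u))" by (simp only: sum_distrib_left)
      also have "\<dots> \<le> 256 * (\<Sum>l\<le>n. lam l powr (2 + \<epsilon>) * l2 (proj l u))"
        by (intro mult_left_mono sum_mono2) (auto intro!: mult_nonneg_nonneg l2_nonneg)
      \<comment> \<open>The Sobolev form is computed with the area, so the loss 256 of the
        eigenvalue bound is divided by \<open>4 * pi\<close>.\<close>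
      also have "\<dots> \<le> 256 * (1 / (4 * pi))"
      proof -
        have "4 * pi * (\<Sum>l\<le>n. lam l powr (2 + \<epsilon>) * l2 (proj l u)) \<le> 1" using sobolev_form_ge[OF u, where n=n and s="2 + \<epsilon>"] sf by linarith
        then show ?thesis by (simp add: field_simps)
      qed
      also have "\<dots> \<le> 64" using pi_gt3 by (simp add: field_simps)
      finally show "(LINT y|sigma_S2. H y * h y) \<le> 64" .
      show "0 \<le> S" by (rule S0)
      have "(LINT y|sigma_S2. H y * h y) = (\<Sum>k\<in>{1..M}. (b k / (real k + 1)) * (LINT y|sigma_S2. avg k h y * h y))"
        unfolding H_def by (rule integral_sum_mult[OF ch continuous_avg[OF ch]])
      also have "\<dots> \<ge> 0"
      proof (intro sum_nonneg mult_nonneg_nonneg)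
        fix k
        have "(LINT y|sigma_S2. avg k h y * h y) = (real k + 1) * (\<Sum>f\<in>featset k. (acoef k h f)\<^sup>2)"
          proof -
            have "(\<Sum>f\<in>featset k. (acoef k h f)\<^sup>2) = (LINT y|sigma_S2. avg k h y * h y) / (real k + 1)"
              by (rule sum_acoef_sq[where N=N and x=x, OF _ ch]) (erule xS)
            then show ?thesis by simp
          qed
        also have "\<dots> \<ge> 0" by (intro mult_nonneg_nonneg sum_nonneg) auto
        finally show "0 \<le> (LINT y|sigma_S2. avg k h y * h y)" .
      qed (auto simp: b_def)
      finally show "0 \<le> (LINT y|sigma_S2. H y * h y)" .
    qed
    finally show ?thesis unfolding d1 by simp
  qed
  have "(\<lambda>n. dev N x (avg n u)) \<longlonglongrightarrow> dev N x u"
    unfolding dev_def integral_avg[OF cu] by (intro tendsto_intros avg_tendsto[OF cu] xS)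
  then have "(\<lambda>n. (dev N x (avg n u))\<^sup>2) \<longlonglongrightarrow> (dev N x u)\<^sup>2" by (intro tendsto_intros)
  then show ?thesis by (rule LIMSEQ_le_const2) (use main in blast)
qed

section \<open>A determinant inequality\<close>

definition mtrace :: "complex Matrix.mat \<Rightarrow> complex" where
  "mtrace M = (\<Sum>i<dim_row M. M $$ (i, i))"

lemma mtrace_comm:
  assumes A: "A \<in> carrier_mat n n" and B: "B \<in> carrier_mat n n"
  shows "mtrace (A * B) = mtrace (B * A)"
proof -
  have "mtrace (A * B) = (\<Sum>i<n. \<Sum>j<n. A $$ (i, j) * B $$ (j, i))"
    using A B by (simp add: mtrace_def scalar_prod_def atLeast0LessThan)
  also have "\<dots> = (\<Sum>j<n. \<Sum>i<n. B $$ (j, i) * A $$ (i, j))"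
    by (subst sum.swap) (simp add: mult.commute)
  also have "\<dots> = mtrace (B * A)"
    using A B by (simp add: mtrace_def scalar_prod_def atLeast0LessThan)
  finally show ?thesis .
qed

lemma mtrace_similar:
  assumes "similar_mat_wit A B P Q" and A: "A \<in> carrier_mat n n"
  shows "mtrace A = mtrace B"
proof -
  have w: "B \<in> carrier_mat n n" "P \<in> carrier_mat n n" "Q \<in> carrier_mat n n" "Q * P = 1\<^sub>m n" "A = P * B * Q"
    using similar_mat_witD2[OF A assms(1)] by auto
  have "mtrace A = mtrace (P * (B * Q))" using w by (simp add: assoc_mult_mat[of P n n B n Q n])
  also have "\<dots> = mtrace (B * Q * P)" by (rule mtrace_comm) (use w in auto)
  also have "B * Q * P = B" using w by (simp add: assoc_mult_mat[of B n n Q n P n])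
  finally show ?thesis .
qed

definition posdef :: "nat \<Rightarrow> complex Matrix.mat \<Rightarrow> bool" where
  "posdef n A \<longleftrightarrow> (\<forall>v \<in> carrier_vec n. v \<noteq> 0\<^sub>v n \<longrightarrow> (\<exists>r>0. (A *\<^sub>v v) \<bullet>c v = complex_of_real r))"

text \<open>With \<open>A B v = e v\<close> and \<open>w = B v\<close>, pairing with
  \<open>w\<close> gives \<open>\<langle>A w, w\<rangle> = e * \<langle>v, w\<rangle>\<close>, and
  both pairings are positive.\<close>

lemma eigenvalue_posdef_prod:
  assumes A: "A \<in> carrier_mat n n" and B: "B \<in> carrier_mat n n"
    and pA: "posdef n A" and pB: "posdef n B" and e: "eigenvalue (A * B) e"
  shows "\<exists>r>0. e = complex_of_real r"
proof -
  obtain v where v: "v \<in> carrier_vec n" "v \<noteq> 0\<^sub>v n" "(A * B) *\<^sub>v v = e \<cdot>\<^sub>v v"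
    using e A B unfolding eigenvalue_def eigenvector_def by auto
  define w where "w = B *\<^sub>v v"
  have w: "w \<in> carrier_vec n" using B v by (simp add: w_def)
  have Aw: "A *\<^sub>v w = e \<cdot>\<^sub>v v" 
    unfolding w_def using assoc_mult_mat_vec[OF A B v(1)] v(3) by simp
  obtain r where r: "r > 0" "w \<bullet>c v = complex_of_real r" using pB v unfolding posdef_def w_def by blast
  have "v \<bullet>c w = conjugate (w \<bullet>c v)" using v(1) w
    by (simp add: scalar_prod_def mult.commute sum_conjugate)
  then have vw: "v \<bullet>c w = complex_of_real r" by (simp add: r)
  have "w \<noteq> 0\<^sub>v n" using r v(1) by auto
  then obtain s where s: "s > 0" "(A *\<^sub>v w) \<bullet>c w = complex_of_real s" using pA w unfolding posdef_def by blast
  have "complex_of_real s = e * complex_of_real r"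
    using s(2) v(1) w unfolding Aw by (simp add: vw)
  then have "e = complex_of_real (s / r)" using r(1) by (simp add: field_simps)
  then show ?thesis using r s by (intro exI[of _ "s / r"]) simp
qed

lemma prod_list_pos: "(\<And>e. e \<in> set es \<Longrightarrow> e > 0) \<Longrightarrow> prod_list es > (0::real)"
  by (induction es) auto

text \<open>The inequality \<open>t \<le> exp (t - 1)\<close>, factor by factor; this form of the
  inequality of means keeps the trace in the exponent.\<close>

lemma prod_list_le_exp:
  fixes es :: "real list"
  assumes "\<And>e. e \<in> set es \<Longrightarrow> e > 0"
  shows "prod_list es \<le> exp (sum_list es - length es)"
  using assms
proof (induction es)
  case (Cons e es)
  have "e \<le> exp (e - 1)" using exp_ge_add_one_self[of "e - 1"] by simp
  moreover have "prod_list es \<ge> 0" using prod_list_pos[of es] Cons.prems by (auto intro: less_imp_le)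
  ultimately have "e * prod_list es \<le> exp (e - 1) * exp (sum_list es - length es)"
    using Cons by (intro mult_mono) (auto intro: less_imp_le)
  then show ?case by (simp add: exp_add[symmetric] algebra_simps)
qed simp

text \<open>The eigenvalues of a product of positive definite matrices are positive, so that the
  inequality of arithmetic and geometric means applies to them.\<close>

lemma det_mult_posdef_le:
  assumes A: "A \<in> carrier_mat n n" and B: "B \<in> carrier_mat n n"
    and pA: "posdef n A" and pB: "posdef n B"
  shows "cmod (Determinant.det A * Determinant.det B) \<le> exp (Re (mtrace (A * B)) - n)"
proof -
  have AB: "A * B \<in> carrier_mat n n" using A B by simp
  obtain es where es: "char_poly (A * B) = (\<Prod>a\<leftarrow>es. [:- a, 1:])" "length es = n"
    using char_poly_factorized[OF AB] by blast
  \<comment> \<open>Schur's triangular form displays the eigenvalues on the diagonal, so that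
    determinant and trace are their product and sum.\<close>
  obtain C P Q where C: "schur_decomposition (A * B) es = (C, P, Q)" by (cases "schur_decomposition (A * B) es") auto
  have sC: "similar_mat_wit (A * B) C P Q" "upper_triangular C" "diag_mat C = es"
    using schur_decomposition[OF AB es(1) C] by auto
  have Cc: "C \<in> carrier_mat n n" using similar_mat_witD2[OF AB sC(1)] by auto
  have "\<exists>r>0. e = complex_of_real r" if "e \<in> set es" for e
  proof -
    have "poly (char_poly (A * B)) e = 0" unfolding es(1) using that
      by (auto simp: poly_prod_list prod_list_zero_iff)
    then have "eigenvalue (A * B) e" using eigenvalue_root_char_poly[OF AB] by blast
    then show ?thesis by (rule eigenvalue_posdef_prod[OF A B pA pB])
  qed
  then obtain r where r: "\<And>e. e \<in> set es \<Longrightarrow> r e > 0 \<and> e = complex_of_real (r e)" by metis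
  define rs where "rs = map r es"
  have rs: "es = map complex_of_real rs" unfolding rs_def using r by (simp add: map_idI)
  have rspos: "e > 0" if "e \<in> set rs" for e using that r by (auto simp: rs_def)
  have "Determinant.det A * Determinant.det B = Determinant.det (A * B)" by (rule det_mult[OF A B, symmetric])
  also have "\<dots> = Determinant.det C" using det_similar sC(1) unfolding similar_mat_def by blast
  also have "\<dots> = prod_list es" using det_upper_triangular[OF sC(2) Cc] sC(3) by simp
  also have "\<dots> = complex_of_real (prod_list rs)" unfolding rs by (induction rs) auto
  finally have d: "Determinant.det A * Determinant.det B = complex_of_real (prod_list rs)" .
  have "mtrace (A * B) = mtrace C" by (rule mtrace_similar[OF sC(1) AB])
  also have "\<dots> = sum_list (diag_mat C)"
    using Cc by (simp add: mtrace_def diag_mat_def interv_sum_list_conv_sum_set_nat atLeast0LessThan)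
  also have "\<dots> = complex_of_real (sum_list rs)" unfolding sC(3) rs by (induction rs) auto
  finally have t: "Re (mtrace (A * B)) = sum_list rs" by simp
  have "prod_list rs \<ge> 0" using prod_list_pos[of rs] rspos by (simp add: less_imp_le)
  then have "cmod (Determinant.det A * Determinant.det B) = prod_list rs" unfolding d by simp
  also have "\<dots> \<le> exp (sum_list rs - length rs)" by (rule prod_list_le_exp) (rule rspos)
  finally show ?thesis using es(2) unfolding t by (simp add: rs_def)
qed

section \<open>The determinantal structure of the ensemble\<close>

text \<open>In the chart these are the rotations of the sphere about the polar axis. They preserve
  \<open>conf\<close> and Lebesgue measure, which is what the orthogonality of the monomials rests
  on.\<close>

definition rot2 :: "real \<Rightarrow> real^2 \<Rightarrow> real^2" where
  "rot2 t p = vector [cos t * p$1 - sin t * p$2, sin t * p$1 + cos t * p$2]"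

lemma norm_rot2: "norm (rot2 t p) = norm p"
proof -
  have "(norm (rot2 t p))\<^sup>2 = ((cos t)\<^sup>2 + (sin t)\<^sup>2) * ((p$1)\<^sup>2 + (p$2)\<^sup>2)"
    unfolding norm2_sq rot2_def vector_2 by Groebner_Basis.algebra
  also have "\<dots> = (norm p)\<^sup>2" unfolding norm2_sq by simp
  finally show ?thesis by simp
qed

lemma linear_rot2: "linear (rot2 t)"
  by (rule linearI) (simp_all add: rot2_def vec2_eq_iff algebra_simps)

lemma rot2_inverse: "rot2 (-t) (rot2 t p) = p"
proof -
  have s: "cos t * cos t + sin t * sin t = 1" using sin_cos_squared_add2[of t] by (simp add: power2_eq_square)
  have "cos t * (cos t * a - sin t * b) + sin t * (sin t * a + cos t * b) = a"
    "- sin t * (cos t * a - sin t * b) + cos t * (sin t * a + cos t * b) = b" for a b :: real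
    using s by Groebner_Basis.algebra+
  then show ?thesis by (simp add: rot2_def vec2_eq_iff)
qed

lemma measurable_rot2: "rot2 t \<in> borel_measurable borel"
  by (rule borel_measurable_continuous_onI) (use linear_rot2 linear_continuous_on linear_conv_bounded_linear in blast)

lemma distr_rot2: "distr lborel borel (rot2 t) = (lborel :: (real^2) measure)"
proof (rule lborel_eqI[symmetric])
  fix l u :: "real^2" assume lu: "\<And>b. b \<in> Basis \<Longrightarrow> l \<bullet> b \<le> u \<bullet> b"
  have pre: "rot2 t -` box l u = rot2 (-t) ` box l u"
  proof (intro equalityI subsetI)
    fix p assume "p \<in> rot2 t -` box l u"
    then show "p \<in> rot2 (-t) ` box l u" using rot2_inverse[of t p] by (intro image_eqI[of _ _ "rot2 t p"]) auto
  next
    fix p assume "p \<in> rot2 (-t) ` box l u"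
    then show "p \<in> rot2 t -` box l u" using rot2_inverse[of "-t"] by auto
  qed
  have o: "orthogonal_transformation (rot2 (-t))"
    unfolding orthogonal_transformation using linear_rot2 norm_rot2 by blast
  have lm: "rot2 (-t) ` box l u \<in> lmeasurable" by (rule measurable_orthogonal_image[OF o]) simp
  have m: "rot2 (-t) ` box l u \<in> sets borel"
    using measurable_sets[OF measurable_rot2, of "box l u" t] unfolding pre by simp
  have "emeasure (distr lborel borel (rot2 t)) (box l u) = emeasure lborel (rot2 (-t) ` box l u)"
    by (subst emeasure_distr) (simp_all add: measurable_rot2 pre)
  also have "\<dots> = emeasure lebesgue (rot2 (-t) ` box l u)" using m by simp
  also have "\<dots> = ennreal (measure lebesgue (rot2 (-t) ` box l u))" by (rule emeasure_eq_measure2[OF lm])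
  also have "\<dots> = ennreal (measure lebesgue (box l u))" by (subst measure_orthogonal_image[OF o]) simp_all
  also have "\<dots> = (\<Prod>b\<in>Basis. (u - l) \<bullet> b)" using lu by (simp add: inner_diff_left prod_nonneg)
  finally show "emeasure (distr lborel borel (rot2 t)) (box l u) = (\<Prod>b\<in>Basis. (u - l) \<bullet> b)" .
qed simp

text \<open>Unit spinors: \<open>(sa x, sb x)\<close> is a point of the unit sphere of \<open>\<complex>\<^sup>2\<close> over \<open>x\<close> under the Hopf map.\<close>

definition sa :: "real^3 \<Rightarrow> complex" where
  "sa x = (if x$3 = 1 then 1 else Complex (x$1) (x$2) / complex_of_real (sqrt (2 * (1 - x$3))))"

definition sb :: "real^3 \<Rightarrow> complex" where
  "sb x = (if x$3 = 1 then 0 else complex_of_real (sqrt ((1 - x$3) / 2)))"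

lemma S2_third: 
  assumes "x \<in> S2" shows "x$3 \<le> 1" "x$3 = 1 \<Longrightarrow> x$1 = 0 \<and> x$2 = 0"
proof -
  have e: "(x$1)\<^sup>2 + (x$2)\<^sup>2 + (x$3)\<^sup>2 = 1" using assms unfolding S2_coords .
  then have "(x$3)\<^sup>2 \<le> 1" using zero_le_power2[of "x$1"] zero_le_power2[of "x$2"] by linarith
  then show "x$3 \<le> 1" by (metis abs_le_square_iff abs_one one_power2 abs_le_D1)
  show "x$3 = 1 \<Longrightarrow> x$1 = 0 \<and> x$2 = 0" using e by (simp add: sum_power2_eq_zero_iff)
qed

lemma spinor_norms:
  assumes x: "x \<in> S2" shows "(cmod (sa x))\<^sup>2 = (1 + x$3) / 2" "(cmod (sb x))\<^sup>2 = (1 - x$3) / 2"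
proof -
  have e: "(x$1)\<^sup>2 + (x$2)\<^sup>2 = (1 - x$3) * (1 + x$3)" using x unfolding S2_coords by (simp add: algebra_simps power2_eq_square)
  show "(cmod (sb x))\<^sup>2 = (1 - x$3) / 2" using S2_third(1)[OF x] by (simp add: sb_def)
  show "(cmod (sa x))\<^sup>2 = (1 + x$3) / 2"
  proof (cases "x$3 = 1")
    case False
    then have p: "1 - x$3 > 0" using S2_third(1)[OF x] by simp
    have k: "a * b / (2 * a) = b / 2" if "a \<noteq> 0" for a b :: real using that by simp
    have "(cmod (sa x))\<^sup>2 = ((x$1)\<^sup>2 + (x$2)\<^sup>2) / (2 * (1 - x$3))"
      using False p by (simp add: sa_def norm_divide power_divide cmod_power2)
    then show ?thesis unfolding e using p by (simp only: k)
  qed (simp add: sa_def)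
qed

lemma spinor_cnj:
  assumes "x \<in> S2" 
  shows "sa x * cnj (sa x) = complex_of_real ((1 + x$3) / 2)" "sb x * cnj (sb x) = complex_of_real ((1 - x$3) / 2)"
  by (simp_all only: complex_norm_square[symmetric] spinor_norms[OF assms])

lemma spinor_unit: 
  assumes "x \<in> S2" shows "sa x * cnj (sa x) + sb x * cnj (sb x) = 1"
proof -
  have "(1 + x$3) / 2 + (1 - x$3) / 2 = (1::real)" by (simp add: field_simps)
  then show ?thesis by (simp only: spinor_cnj[OF assms] of_real_add[symmetric] of_real_1)
qed

lemma spinor_le_1: "x \<in> S2 \<Longrightarrow> cmod (sa x) \<le> 1" "x \<in> S2 \<Longrightarrow> cmod (sb x) \<le> 1"
proof -
  assume x: "x \<in> S2"
  have s: "(cmod (sa x))\<^sup>2 + (cmod (sb x))\<^sup>2 = 1" using spinor_norms[OF x] by simp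
  then have "(cmod (sa x))\<^sup>2 \<le> 1" "(cmod (sb x))\<^sup>2 \<le> 1"
    using zero_le_power2[of "cmod (sa x)"] zero_le_power2[of "cmod (sb x)"] by linarith+
  then show "cmod (sa x) \<le> 1" "cmod (sb x) \<le> 1" by (simp_all add: power_le_one_iff abs_square_le_1[of "cmod _", simplified])
qed

text \<open>The squared modulus of the inner product of two unit spinors is the transition
  probability of the corresponding points. The moduli of the components know only the heights; the
  first two coordinates enter through \<open>cross\<close>.\<close>

lemma qk_spinor:
  assumes x: "x \<in> S2" and y: "y \<in> S2"
  shows "complex_of_real (qk x y) = (sa x * cnj (sa y) + sb x * cnj (sb y)) * cnj (sa x * cnj (sa y) + sb x * cnj (sb y))"
proof -
  have cross: "sa x * cnj (sa y) * cnj (sb x) * sb y + cnj (sa x) * sa y * sb x * cnj (sb y) = complex_of_real ((x$1*y$1 + x$2*y$2) / 2)"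
  proof (cases "x$3 = 1 \<or> y$3 = 1")
    case True
    then show ?thesis using S2_third(2)[OF x] S2_third(2)[OF y] by (auto simp: sb_def)
  next
    case False
    define r s where "r = sqrt (1 - x$3)" and "s = sqrt (1 - y$3)"
    have rs: "r > 0" "s > 0" using False S2_third(1)[OF x] S2_third(1)[OF y] by (auto simp: r_def s_def)
    define X Y where "X = Complex (x$1) (x$2)" and "Y = Complex (y$1) (y$2)"
    have ab: "sa x = X / complex_of_real (sqrt 2 * r)" "sa y = Y / complex_of_real (sqrt 2 * s)"
      "sb x = complex_of_real (r / sqrt 2)" "sb y = complex_of_real (s / sqrt 2)"
      using False unfolding sa_def sb_def r_def s_def X_def Y_def real_sqrt_mult real_sqrt_divide by auto
    have n: "complex_of_real r \<noteq> 0" "complex_of_real s \<noteq> 0" "complex_of_real (sqrt 2) \<noteq> 0" using rs by simp_all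
    have q: "complex_of_real (sqrt 2) * complex_of_real (sqrt 2) = 2" by (simp flip: of_real_mult)
    have k: "P / (c * a) * (R / (c * b)) * (a / c) * (b / c) = P * R / 4" if "c * c = 2" "a \<noteq> 0" "b \<noteq> 0" for P R a b c :: complex
    proof -
      have c0: "c \<noteq> 0" using that by auto
      have "(c * c) * (c * c) = 4" using that by simp
      then have "c * (c * (c * c)) = 4" by (simp add: mult.assoc)
      then show ?thesis using that c0 by (simp add: field_simps)
    qed
    have "sa x * cnj (sa y) * cnj (sb x) * sb y + cnj (sa x) * sa y * sb x * cnj (sb y) = X * cnj Y / 4 + cnj X * Y / 4"
      unfolding ab complex_cnj_divide complex_cnj_complex_of_real of_real_mult of_real_divide complex_cnj_mult
      by (simp only: k[OF q n(1) n(2)])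
    also have "\<dots> = complex_of_real ((x$1*y$1 + x$2*y$2) / 2)"
      by (simp add: X_def Y_def complex_eq_iff field_simps)
    finally show ?thesis .
  qed
  have na: "sa z * cnj (sa z) = complex_of_real ((1 + z$3) / 2)" "sb z * cnj (sb z) = complex_of_real ((1 - z$3) / 2)" if "z \<in> S2" for z
    using spinor_cnj[OF that] by simp_all
  have "(sa x * cnj (sa y) + sb x * cnj (sb y)) * cnj (sa x * cnj (sa y) + sb x * cnj (sb y))
    = (sa x * cnj (sa x)) * (sa y * cnj (sa y)) + (sb x * cnj (sb x)) * (sb y * cnj (sb y)) + (sa x * cnj (sa y) * cnj (sb x) * sb y + cnj (sa x) * sa y * sb x * cnj (sb y))"
    by (simp add: algebra_simps)
  also have "\<dots> = complex_of_real ((1 + x$3) / 2 * ((1 + y$3) / 2) + (1 - x$3) / 2 * ((1 - y$3) / 2) + (x$1*y$1 + x$2*y$2) / 2)"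
    unfolding na[OF x] na[OF y] cross by simp
  also have "(1 + x$3) / 2 * ((1 + y$3) / 2) + (1 - x$3) / 2 * ((1 - y$3) / 2) + (x$1*y$1 + x$2*y$2) / 2 = qk x y"
    by (simp add: qk_def inner3 field_simps)
  finally show ?thesis by simp
qed

text \<open>Lagrange's identity: squared inner product plus squared determinant is the product of
  the squared norms, which is 1 for unit spinors.\<close>

lemma one_minus_qk_spinor:
  assumes x: "x \<in> S2" and y: "y \<in> S2"
  shows "1 - qk x y = (cmod (sa x * sb y - sb x * sa y))\<^sup>2"
proof -
  have "complex_of_real (qk x y) + (sa x * sb y - sb x * sa y) * cnj (sa x * sb y - sb x * sa y)
     = (sa x * cnj (sa x) + sb x * cnj (sb x)) * (sa y * cnj (sa y) + sb y * cnj (sb y))"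
    unfolding qk_spinor[OF x y] by (simp add: algebra_simps)
  also have "\<dots> = 1" by (simp only: spinor_unit[OF x] spinor_unit[OF y] mult_1)
  finally have "complex_of_real (qk x y + (cmod (sa x * sb y - sb x * sa y))\<^sup>2) = complex_of_real 1"
    by (simp only: of_real_add of_real_1 complex_norm_square)
  then have "qk x y + (cmod (sa x * sb y - sb x * sa y))\<^sup>2 = 1" by (simp only: of_real_eq_iff)
  then show ?thesis by simp
qed

lemma measurable_spinor[measurable]: "sa \<in> borel_measurable borel" "sb \<in> borel_measurable borel"
proof -
  have [measurable]: "(\<lambda>x::real^3. x $ i) \<in> borel_measurable borel" for i
    by (rule borel_measurable_continuous_onI) (intro continuous_intros)
  have C: "Complex a b = complex_of_real a + \<i> * complex_of_real b" for a b by (simp add: complex_eq_iff)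
  show "sa \<in> borel_measurable borel" unfolding sa_def[abs_def] C by measurable
  show "sb \<in> borel_measurable borel" unfolding sb_def[abs_def] by measurable
qed

lemma spinor_stereo: 
  "sa (stereo 1 p) = Complex (p$1) (p$2) * complex_of_real (sqrt (conf p))" "sb (stereo 1 p) = complex_of_real (sqrt (conf p))"
proof -
  define r where "r = sqrt (conf p)"
  have r: "r > 0" "conf p = r * r" using conf_pos[of p] by (auto simp: r_def)
  have 3: "stereo 1 p $ 3 \<noteq> 1" "1 - stereo 1 p $ 3 = 2 * (r * r)" using r by (simp_all add: stereo_nth)
  have "sqrt (2 * (2 * (r * r))) = 2 * r" using r by (simp add: real_sqrt_mult)
  then show "sa (stereo 1 p) = Complex (p$1) (p$2) * complex_of_real (sqrt (conf p))"
    using 3(1) r(1) unfolding sa_def 3(2) r_def[symmetric] by (simp add: stereo_nth r(2) complex_eq_iff field_simps)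
  show "sb (stereo 1 p) = complex_of_real (sqrt (conf p))"
    using 3(1) r(1) unfolding sb_def 3(2) r_def[symmetric] by simp
qed

lemma measurable_cnj[measurable]: "cnj \<in> borel_measurable borel"
  by (intro borel_measurable_continuous_onI continuous_intros)

section \<open>Determinantal ensembles of orthonormal systems with constant density\<close>

locale onsys = 
  fixes N :: nat and s :: "nat \<Rightarrow> real^3 \<Rightarrow> complex"
  assumes s_meas: "\<And>k. k < N \<Longrightarrow> s k \<in> borel_measurable sigma_S2"
    and s_bdd: "\<And>k. k < N \<Longrightarrow> \<exists>B. \<forall>x\<in>S2. cmod (s k x) \<le> B"
    and s_on: "\<And>j k. j < N \<Longrightarrow> k < N \<Longrightarrow> (LINT x|sigma_S2. s j x * cnj (s k x)) = (if j = k then 1 else 0)"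
    and s_density: "\<And>x. x \<in> S2 \<Longrightarrow> (\<Sum>k<N. s k x * cnj (s k x)) = of_nat N"
begin

definition gram :: "(real^3 \<Rightarrow> real) \<Rightarrow> complex Matrix.mat" where
  "gram f = Matrix.mat N N (\<lambda>(j, k). LINT x|sigma_S2. complex_of_real (f x) * (s j x * cnj (s k x)))"

text \<open>Configurations are indexed from 1 and matrices from 0, hence the shift. The squared
  modulus of the determinant, divided by \<open>N!\<close>, is the density of the ensemble.\<close>

definition smat :: "(nat \<Rightarrow> real^3) \<Rightarrow> complex Matrix.mat" where
  "smat x = Matrix.mat N N (\<lambda>(i, j). s j (x (Suc i)))"

lemma gram_carrier: "gram f \<in> carrier_mat N N" by (simp add: gram_def)

lemma integrable_s:
  assumes f: "continuous_on S2 f" and jk: "j < N" "k < N"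
  shows "integrable sigma_S2 (\<lambda>x. complex_of_real (f x) * (s j x * cnj (s k x)))"
proof -
  obtain B where B: "B > 0" "\<And>x. x \<in> S2 \<Longrightarrow> norm (f x) \<le> B" using S2_cont_bounded[OF f] by blast
  obtain Bj where Bj: "\<And>x. x \<in> S2 \<Longrightarrow> cmod (s j x) \<le> Bj" using s_bdd[OF jk(1)] by blast
  obtain Bk where Bk: "\<And>x. x \<in> S2 \<Longrightarrow> cmod (s k x) \<le> Bk" using s_bdd[OF jk(2)] by blast
  have "axis 1 1 \<in> S2" by simp
  then have Bn: "Bj \<ge> 0" "Bk \<ge> 0" using Bj Bk norm_ge_zero order_trans by blast+
  show ?thesis
  proof (rule sigma.integrable_const_bound[where B="B * (Bj * Bk)"])
    show "AE x in sigma_S2. cmod (complex_of_real (f x) * (s j x * cnj (s k x))) \<le> B * (Bj * Bk)"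
    proof (rule AE_I2)
      fix x assume "x \<in> space sigma_S2"
      then have x: "x \<in> S2" by (simp only: space_sigma_S2)
      show "cmod (complex_of_real (f x) * (s j x * cnj (s k x))) \<le> B * (Bj * Bk)"
        unfolding norm_mult complex_mod_cnj norm_of_real using B(2)[OF x] Bj[OF x] Bk[OF x] B(1) Bn
        by (intro mult_mono) auto
    qed
    note [measurable] = s_meas[OF jk(1)] s_meas[OF jk(2)] measurable_compose[OF s_meas[OF jk(2)] measurable_cnj] S2_cont_measurable_sigma[OF f]
    show "(\<lambda>x. complex_of_real (f x) * (s j x * cnj (s k x))) \<in> borel_measurable sigma_S2" by measurable
  qed
qed

sublocale PS: product_sigma_finite "\<lambda>_::nat. sigma_S2" by standard

definition perms :: "(nat \<Rightarrow> nat) set" where "perms = {p. p permutes {0..<N}}"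

lemma finite_perms: "finite perms" and card_perms: "card perms = fact N"
  unfolding perms_def by (simp_all add: finite_permutations card_permutations)

lemma perms_lt: "p \<in> perms \<Longrightarrow> i < N \<Longrightarrow> p i < N"
  unfolding perms_def using permutes_in_image[of p "{0..<N}" i] by auto

lemma perms_lt': "p \<in> perms \<Longrightarrow> i \<in> {1..N} \<Longrightarrow> p (i - 1) < N"
  by (rule perms_lt) auto

lemma shift_prod: "(\<Prod>i=0..<N. g i (x (Suc i))) = (\<Prod>i\<in>{1..N}. g (i - 1) (x i))" for g :: "nat \<Rightarrow> 'b \<Rightarrow> 'c::comm_monoid_mult"
  by (rule prod.reindex_bij_witness[of _ "\<lambda>i. i - 1" Suc]) auto

definition sgnc :: "(nat \<Rightarrow> nat) \<Rightarrow> complex" where "sgnc p = signof p"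

lemma sgnc_props: "cnj (sgnc p) = sgnc p" "sgnc p * sgnc p = 1"
  by (simp_all add: sgnc_def sign_def)

lemma det_smat: "Determinant.det (smat x) = (\<Sum>p\<in>perms. sgnc p * (\<Prod>i\<in>{1..N}. s (p (i - 1)) (x i)))"
proof -
  have "Determinant.det (smat x) = (\<Sum>p\<in>perms. sgnc p * (\<Prod>i=0..<N. smat x $$ (i, p i)))"
    unfolding perms_def sgnc_def by (rule det_def'[of _ N]) (simp add: smat_def)
  also have "\<dots> = (\<Sum>p\<in>perms. sgnc p * (\<Prod>i=0..<N. s (p i) (x (Suc i))))"
    by (intro sum.cong arg_cong2[where f=times] prod.cong refl) (simp add: smat_def perms_lt)
  finally show ?thesis by (simp only: shift_prod[of "\<lambda>i. s (_ i)"])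
qed

text \<open>Andreief's identity with its own test function at each index: both determinants are
  expanded over permutations and every product is integrated coordinate by coordinate. Equal
  functions \<open>f i\<close> lead to Laplace transforms, a single nonconstant one to the first
  moment.\<close>

lemma andreief:
  assumes f: "\<And>i. i \<in> {1..N} \<Longrightarrow> continuous_on S2 (f i)"
  shows "integrable (sphere_config N) (\<lambda>x. complex_of_real ((\<Prod>i\<in>{1..N}. f i (x i)) * (cmod (Determinant.det (smat x)))\<^sup>2))"
    "(LINT x|sphere_config N. complex_of_real ((\<Prod>i\<in>{1..N}. f i (x i)) * (cmod (Determinant.det (smat x)))\<^sup>2))
     = (\<Sum>p\<in>perms. \<Sum>q\<in>perms. sgnc p * sgnc q * (\<Prod>i\<in>{1..N}. LINT y|sigma_S2. complex_of_real (f i y) * (s (p (i - 1)) y * cnj (s (q (i - 1)) y))))"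
proof -
  define g where "g p q i y = complex_of_real (f i y) * (s (p (i - 1)) y * cnj (s (q (i - 1)) y))" for p q :: "nat \<Rightarrow> nat" and i y
  have e: "complex_of_real ((\<Prod>i\<in>{1..N}. f i (x i)) * (cmod (Determinant.det (smat x)))\<^sup>2)
    = (\<Sum>p\<in>perms. \<Sum>q\<in>perms. sgnc p * sgnc q * (\<Prod>i\<in>{1..N}. g p q i (x i)))" for x
  proof -
    have "complex_of_real ((\<Prod>i\<in>{1..N}. f i (x i)) * (cmod (Determinant.det (smat x)))\<^sup>2)
      = (\<Prod>i\<in>{1..N}. complex_of_real (f i (x i))) * (Determinant.det (smat x) * cnj (Determinant.det (smat x)))"
      by (simp only: of_real_mult of_real_prod complex_norm_square)
    also have "\<dots> = (\<Prod>i\<in>{1..N}. complex_of_real (f i (x i))) * (\<Sum>p\<in>perms. \<Sum>q\<in>perms. (sgnc p * (\<Prod>i\<in>{1..N}. s (p (i - 1)) (x i))) * (sgnc q * (\<Prod>i\<in>{1..N}. cnj (s (q (i - 1)) (x i)))))"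
      unfolding det_smat by (simp only: cnj_sum complex_cnj_mult cnj_prod sgnc_props sum_product)
    also have "\<dots> = (\<Sum>p\<in>perms. \<Sum>q\<in>perms. sgnc p * sgnc q * (\<Prod>i\<in>{1..N}. g p q i (x i)))"
      unfolding sum_distrib_left g_def prod.distrib by (intro sum.cong refl) (simp only: mult_ac)
    finally show ?thesis .
  qed
  have gi: "integrable sigma_S2 (g p q i)" if "p \<in> perms" "q \<in> perms" "i \<in> {1..N}" for p q i
    unfolding g_def by (rule integrable_s[OF f[OF that(3)] perms_lt'[OF that(1,3)] perms_lt'[OF that(2,3)]])
  have pi: "integrable (sphere_config N) (\<lambda>x. \<Prod>i\<in>{1..N}. g p q i (x i))" if "p \<in> perms" "q \<in> perms" for p q
    unfolding sphere_config_def by (rule PS.product_integrable_prod) (use gi that in auto)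
  have pe: "(LINT x|sphere_config N. (\<Prod>i\<in>{1..N}. g p q i (x i))) = (\<Prod>i\<in>{1..N}. (LINT y|sigma_S2. g p q i y))" if "p \<in> perms" "q \<in> perms" for p q
    unfolding sphere_config_def by (rule PS.product_integral_prod) (use gi that in auto)
  show "integrable (sphere_config N) (\<lambda>x. complex_of_real ((\<Prod>i\<in>{1..N}. f i (x i)) * (cmod (Determinant.det (smat x)))\<^sup>2))"
    unfolding e by (intro Bochner_Integration.integrable_sum integrable_mult_right pi)
  have "(LINT x|sphere_config N. complex_of_real ((\<Prod>i\<in>{1..N}. f i (x i)) * (cmod (Determinant.det (smat x)))\<^sup>2))
    = (\<Sum>p\<in>perms. LINT x|sphere_config N. (\<Sum>q\<in>perms. sgnc p * sgnc q * (\<Prod>i\<in>{1..N}. g p q i (x i))))"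
    unfolding e by (rule Bochner_Integration.integral_sum) (intro Bochner_Integration.integrable_sum integrable_mult_right pi)
  also have "\<dots> = (\<Sum>p\<in>perms. \<Sum>q\<in>perms. LINT x|sphere_config N. sgnc p * sgnc q * (\<Prod>i\<in>{1..N}. g p q i (x i)))"
    by (rule sum.cong[OF refl], rule Bochner_Integration.integral_sum) (intro integrable_mult_right pi)
  also have "\<dots> = (\<Sum>p\<in>perms. \<Sum>q\<in>perms. sgnc p * sgnc q * (\<Prod>i\<in>{1..N}. LINT y|sigma_S2. g p q i y))"
    by (intro sum.cong refl) (simp only: pe integral_mult_right_zero)
  finally show "(LINT x|sphere_config N. complex_of_real ((\<Prod>i\<in>{1..N}. f i (x i)) * (cmod (Determinant.det (smat x)))\<^sup>2))
     = (\<Sum>p\<in>perms. \<Sum>q\<in>perms. sgnc p * sgnc q * (\<Prod>i\<in>{1..N}. LINT y|sigma_S2. complex_of_real (f i y) * (s (p (i - 1)) y * cnj (s (q (i - 1)) y))))"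
    unfolding g_def .
qed

text \<open>For fixed \<open>p\<close> the sum over \<open>q\<close> is the determinant of the Gram
  matrix with its rows permuted by \<open>p\<close>. The two signs of \<open>p\<close> cancel, so
  the \<open>N!\<close> choices of \<open>p\<close> contribute equally.\<close>

lemma integral_prod_det:
  assumes f: "continuous_on S2 f"
  shows "(LINT x|sphere_config N. complex_of_real ((\<Prod>i\<in>{1..N}. f (x i)) * (cmod (Determinant.det (smat x)))\<^sup>2)) = fact N * Determinant.det (gram f)"
proof -
  define G where "G = gram f"
  have G: "G \<in> carrier_mat N N" unfolding G_def by (rule gram_carrier)
  have Gjk: "(LINT y|sigma_S2. complex_of_real (f y) * (s j y * cnj (s k y))) = G $$ (j, k)" if "j < N" "k < N" for j k
    using that by (simp add: G_def gram_def)
  have "(LINT x|sphere_config N. complex_of_real ((\<Prod>i\<in>{1..N}. f (x i)) * (cmod (Determinant.det (smat x)))\<^sup>2))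
     = (\<Sum>p\<in>perms. \<Sum>q\<in>perms. sgnc p * sgnc q * (\<Prod>i\<in>{1..N}. LINT y|sigma_S2. complex_of_real (f y) * (s (p (i - 1)) y * cnj (s (q (i - 1)) y))))"
    by (rule andreief(2)[of "\<lambda>_. f"]) (rule f)
  also have "\<dots> = (\<Sum>p\<in>perms. \<Sum>q\<in>perms. sgnc p * sgnc q * (\<Prod>i\<in>{1..N}. G $$ (p (i - 1), q (i - 1))))"
    by (intro sum.cong arg_cong2[where f=times] prod.cong refl Gjk) (erule (1) perms_lt')+
  also have "\<dots> = (\<Sum>p\<in>perms. \<Sum>q\<in>perms. sgnc p * sgnc q * (\<Prod>i=0..<N. G $$ (p i, q i)))"
    by (simp only: shift_prod[of "\<lambda>i _. G $$ (_ i, _ i)", symmetric])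
  also have "\<dots> = (\<Sum>p\<in>perms. Determinant.det G)"
  proof (rule sum.cong[OF refl])
    fix p assume p: "p \<in> perms"
    have "sgnc p * Determinant.det G = Determinant.det (Matrix.mat N N (\<lambda>(i, j). G $$ (p i, j)))"
      unfolding sgnc_def using p by (intro det_permute_rows[OF G, symmetric]) (simp add: perms_def)
    also have "\<dots> = (\<Sum>q\<in>perms. sgnc q * (\<Prod>i=0..<N. Matrix.mat N N (\<lambda>(i, j). G $$ (p i, j)) $$ (i, q i)))"
      unfolding perms_def sgnc_def by (rule det_def'[of _ N]) simp
    also have "\<dots> = (\<Sum>q\<in>perms. sgnc q * (\<Prod>i=0..<N. G $$ (p i, q i)))"
      by (intro sum.cong arg_cong2[where f=times] prod.cong refl) (simp add: perms_lt)
    finally have "sgnc p * (sgnc p * Determinant.det G) = (\<Sum>q\<in>perms. sgnc p * sgnc q * (\<Prod>i=0..<N. G $$ (p i, q i)))"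
      by (simp only: sum_distrib_left mult.assoc)
    then show "(\<Sum>q\<in>perms. sgnc p * sgnc q * (\<Prod>i=0..<N. G $$ (p i, q i))) = Determinant.det G"
      using sgnc_props(2)[of p] by (simp add: mult.assoc[symmetric])
  qed
  also have "\<dots> = fact N * Determinant.det G" by (simp add: card_perms)
  finally show ?thesis unfolding G_def .
qed

text \<open>Only one index carries \<open>u\<close>; orthonormality at the others forces
  \<open>p\<close> and \<open>q\<close> to agree off that index, hence everywhere. The surviving
  diagonal terms add up to the constant density \<open>N\<close>.\<close>

lemma integral_linear_det:
  assumes u: "continuous_on S2 u"
  shows "(LINT x|sphere_config N. complex_of_real ((\<Sum>i\<in>{1..N}. u (x i)) * (cmod (Determinant.det (smat x)))\<^sup>2))
    = complex_of_real (fact N * (real N * (LINT y|sigma_S2. u y)))"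
    "integrable (sphere_config N) (\<lambda>x. complex_of_real ((\<Sum>i\<in>{1..N}. u (x i)) * (cmod (Determinant.det (smat x)))\<^sup>2))"
proof -
  define fi where "fi j i = (if i = j then u else (\<lambda>_. 1))" for i j :: nat
  have cf: "continuous_on S2 (fi j i)" for i j using u by (simp add: fi_def)
  have pf: "(\<Prod>i\<in>{1..N}. fi j i (x i)) = u (x j)" if "j \<in> {1..N}" for j x
  proof -
    have "(\<Prod>i\<in>{1..N}. fi j i (x i)) = (\<Prod>i\<in>{1..N}. if i = j then u (x i) else 1)" by (intro prod.cong) (auto simp: fi_def)
    then show ?thesis using that by simp
  qed
  define U where "U k = (LINT y|sigma_S2. complex_of_real (u y) * (s k y * cnj (s k y)))" for k
  have one: "(LINT x|sphere_config N. complex_of_real (u (x j) * (cmod (Determinant.det (smat x)))\<^sup>2)) = (\<Sum>p\<in>perms. U (p (j - 1)))"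
    "integrable (sphere_config N) (\<lambda>x. complex_of_real (u (x j) * (cmod (Determinant.det (smat x)))\<^sup>2))" if j: "j \<in> {1..N}" for j
  proof -
    show "integrable (sphere_config N) (\<lambda>x. complex_of_real (u (x j) * (cmod (Determinant.det (smat x)))\<^sup>2))"
      using andreief(1)[of "fi j", OF cf] unfolding pf[OF j] .
    have I: "(LINT y|sigma_S2. complex_of_real (fi j i y) * (s (p (i - 1)) y * cnj (s (q (i - 1)) y))) = (if p (i - 1) = q (i - 1) then 1 else 0)"
      if "i \<in> {1..N}" "i \<noteq> j" "p \<in> perms" "q \<in> perms" for i p q
    proof -
      have "p (i - 1) < N" "q (i - 1) < N" using perms_lt'[OF that(3,1)] perms_lt'[OF that(4,1)] .
      then show ?thesis using that s_on[of "p (i - 1)" "q (i - 1)"] by (simp add: fi_def)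
    qed
    have z: "sgnc p * sgnc q * (\<Prod>i\<in>{1..N}. LINT y|sigma_S2. complex_of_real (fi j i y) * (s (p (i - 1)) y * cnj (s (q (i - 1)) y)))
        = (if q = p then U (p (j - 1)) else 0)" if p: "p \<in> perms" and q: "q \<in> perms" for p q
    proof (cases "q = p")
      case True
      have "(\<Prod>i\<in>{1..N}. LINT y|sigma_S2. complex_of_real (fi j i y) * (s (p (i - 1)) y * cnj (s (q (i - 1)) y)))
        = (\<Prod>i\<in>{1..N}. if i = j then U (p (i - 1)) else 1)"
      proof (rule prod.cong[OF refl])
        fix i assume i: "i \<in> {1..N}"
        show "(LINT y|sigma_S2. complex_of_real (fi j i y) * (s (p (i - 1)) y * cnj (s (q (i - 1)) y))) = (if i = j then U (p (i - 1)) else 1)"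
          using I[OF i _ p q] True by (auto simp: fi_def U_def)
      qed
      then show ?thesis using j True by (simp add: sgnc_props)
    next
      case False
      have "\<exists>i\<in>{1..N}. i \<noteq> j \<and> p (i - 1) \<noteq> q (i - 1)"
      proof (rule ccontr)
        assume "\<not> ?thesis"
        then have eq: "p k = q k" if "k < N" "k \<noteq> j - 1" for k
        proof -
          have "Suc k \<in> {1..N}" "Suc k \<noteq> j" using that by auto
          then show ?thesis using \<open>\<not> (\<exists>i\<in>{1..N}. i \<noteq> j \<and> p (i - 1) \<noteq> q (i - 1))\<close> by fastforce
        qed
        have pp: "p permutes {0..<N}" "q permutes {0..<N}" using p q by (auto simp: perms_def)
        have ne: "p k = q k" if "k \<noteq> j - 1" for k
          using eq[of k] that pp by (cases "k < N") (auto simp: permutes_def)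
        have "p (j - 1) = q (j - 1)"
        proof (rule ccontr)
          assume a: "p (j - 1) \<noteq> q (j - 1)"
          obtain k where k: "q k = p (j - 1)" using permutes_surj[OF pp(2)] by (metis surjD)
          then have "k \<noteq> j - 1" using a by auto
          then have "p k = p (j - 1)" using ne k by simp
          then show False using permutes_inj[OF pp(1)] \<open>k \<noteq> j - 1\<close> by (auto dest: injD)
        qed
        then have "q = p" using ne by (intro ext) metis
        then show False using False by simp
      qed
      then obtain i where i: "i \<in> {1..N}" "i \<noteq> j" "p (i - 1) \<noteq> q (i - 1)" by blast
      have "(\<Prod>i\<in>{1..N}. LINT y|sigma_S2. complex_of_real (fi j i y) * (s (p (i - 1)) y * cnj (s (q (i - 1)) y))) = 0"
        by (rule prod_zero) (use i I[OF i(1,2) p q] in auto)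
      then show ?thesis using False by simp
    qed
    have "(LINT x|sphere_config N. complex_of_real (u (x j) * (cmod (Determinant.det (smat x)))\<^sup>2))
      = (\<Sum>p\<in>perms. \<Sum>q\<in>perms. sgnc p * sgnc q * (\<Prod>i\<in>{1..N}. LINT y|sigma_S2. complex_of_real (fi j i y) * (s (p (i - 1)) y * cnj (s (q (i - 1)) y))))"
      using andreief(2)[of "fi j", OF cf] unfolding pf[OF j] .
    also have "\<dots> = (\<Sum>p\<in>perms. \<Sum>q\<in>perms. if q = p then U (p (j - 1)) else 0)"
      by (intro sum.cong refl z)
    also have "\<dots> = (\<Sum>p\<in>perms. U (p (j - 1)))" by (rule sum.cong[OF refl]) (simp add: finite_perms)
    finally show "(LINT x|sphere_config N. complex_of_real (u (x j) * (cmod (Determinant.det (smat x)))\<^sup>2)) = (\<Sum>p\<in>perms. U (p (j - 1)))" .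
  qed
  have e: "complex_of_real ((\<Sum>i\<in>{1..N}. u (x i)) * (cmod (Determinant.det (smat x)))\<^sup>2)
    = (\<Sum>i\<in>{1..N}. complex_of_real (u (x i) * (cmod (Determinant.det (smat x)))\<^sup>2))" for x
    by (simp only: sum_distrib_right of_real_sum)
  show "integrable (sphere_config N) (\<lambda>x. complex_of_real ((\<Sum>i\<in>{1..N}. u (x i)) * (cmod (Determinant.det (smat x)))\<^sup>2))"
    unfolding e by (rule Bochner_Integration.integrable_sum) (rule one(2))
  have Us: "(\<Sum>k<N. U k) = complex_of_real (real N * (LINT y|sigma_S2. u y))"
  proof -
    have "(\<Sum>k<N. U k) = (LINT y|sigma_S2. (\<Sum>k<N. complex_of_real (u y) * (s k y * cnj (s k y))))"
      unfolding U_def by (rule Bochner_Integration.integral_sum[symmetric]) (auto intro!: integrable_s u)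
    also have "\<dots> = (LINT y|sigma_S2. complex_of_real (real N * u y))"
      by (rule Bochner_Integration.integral_cong[OF refl])
        (simp only: space_sigma_S2 sum_distrib_left[symmetric] s_density of_real_mult of_real_of_nat_eq mult.commute)
    finally show ?thesis by simp
  qed
  have "(LINT x|sphere_config N. complex_of_real ((\<Sum>i\<in>{1..N}. u (x i)) * (cmod (Determinant.det (smat x)))\<^sup>2))
    = (\<Sum>i\<in>{1..N}. \<Sum>p\<in>perms. U (p (i - 1)))"
    proof -
    have "(LINT x|sphere_config N. complex_of_real ((\<Sum>i\<in>{1..N}. u (x i)) * (cmod (Determinant.det (smat x)))\<^sup>2))
      = (\<Sum>i\<in>{1..N}. (LINT x|sphere_config N. complex_of_real (u (x i) * (cmod (Determinant.det (smat x)))\<^sup>2)))"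
      unfolding e by (rule Bochner_Integration.integral_sum) (rule one(2))
    also have "\<dots> = (\<Sum>i\<in>{1..N}. \<Sum>p\<in>perms. U (p (i - 1)))" by (intro sum.cong refl one(1))
    finally show ?thesis .
  qed
  also have "\<dots> = (\<Sum>p\<in>perms. \<Sum>i\<in>{1..N}. U (p (i - 1)))" by (rule sum.swap)
  also have "\<dots> = (\<Sum>p\<in>perms. \<Sum>k<N. U k)"
  proof (rule sum.cong[OF refl])
    fix p assume p: "p \<in> perms"
    have "(\<Sum>i\<in>{1..N}. U (p (i - 1))) = (\<Sum>k\<in>{0..<N}. U (p k))"
      by (rule sum.reindex_bij_witness[of _ Suc "\<lambda>i. i - 1"]) auto
    also have "\<dots> = (\<Sum>k\<in>{0..<N}. U k)"
      using p by (intro sum.permute[symmetric, unfolded o_def]) (simp add: perms_def)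
    finally show "(\<Sum>i\<in>{1..N}. U (p (i - 1))) = (\<Sum>k<N. U k)" by (simp add: atLeast0LessThan)
  qed
  also have "\<dots> = complex_of_real (fact N * (real N * (LINT y|sigma_S2. u y)))" by (simp add: Us card_perms)
  finally show "(LINT x|sphere_config N. complex_of_real ((\<Sum>i\<in>{1..N}. u (x i)) * (cmod (Determinant.det (smat x)))\<^sup>2))
    = complex_of_real (fact N * (real N * (LINT y|sigma_S2. u y)))" .
qed

end

context onsys
begin

lemma prod_det_real:
  assumes f: "continuous_on S2 f"
  shows "integrable (sphere_config N) (\<lambda>x. (\<Prod>i\<in>{1..N}. f (x i)) * (cmod (Determinant.det (smat x)))\<^sup>2)"
    "complex_of_real (LINT x|sphere_config N. (\<Prod>i\<in>{1..N}. f (x i)) * (cmod (Determinant.det (smat x)))\<^sup>2) = fact N * Determinant.det (gram f)"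
proof -
  show "integrable (sphere_config N) (\<lambda>x. (\<Prod>i\<in>{1..N}. f (x i)) * (cmod (Determinant.det (smat x)))\<^sup>2)"
    using andreief(1)[of "\<lambda>_. f", OF f] unfolding complex_of_real_integrable_eq .
  show "complex_of_real (LINT x|sphere_config N. (\<Prod>i\<in>{1..N}. f (x i)) * (cmod (Determinant.det (smat x)))\<^sup>2) = fact N * Determinant.det (gram f)"
    unfolding integral_prod_det[OF f, symmetric] by (rule integral_complex_of_real[symmetric])
qed

lemma linear_det_real:
  assumes u: "continuous_on S2 u"
  shows "integrable (sphere_config N) (\<lambda>x. (\<Sum>i\<in>{1..N}. u (x i)) * (cmod (Determinant.det (smat x)))\<^sup>2)"
    "(LINT x|sphere_config N. (\<Sum>i\<in>{1..N}. u (x i)) * (cmod (Determinant.det (smat x)))\<^sup>2) = fact N * (real N * (LINT y|sigma_S2. u y))"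
proof -
  show "integrable (sphere_config N) (\<lambda>x. (\<Sum>i\<in>{1..N}. u (x i)) * (cmod (Determinant.det (smat x)))\<^sup>2)"
    using integral_linear_det(2)[OF u] unfolding complex_of_real_integrable_eq .
  have "complex_of_real (LINT x|sphere_config N. (\<Sum>i\<in>{1..N}. u (x i)) * (cmod (Determinant.det (smat x)))\<^sup>2) = complex_of_real (fact N * (real N * (LINT y|sigma_S2. u y)))"
    unfolding integral_linear_det(1)[OF u, symmetric] by (rule integral_complex_of_real[symmetric])
  then show "(LINT x|sphere_config N. (\<Sum>i\<in>{1..N}. u (x i)) * (cmod (Determinant.det (smat x)))\<^sup>2) = fact N * (real N * (LINT y|sigma_S2. u y))"
    by (simp only: of_real_eq_iff)
qed

lemma gram_quadratic:
  assumes f: "continuous_on S2 f"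
  shows "(\<Sum>j<N. \<Sum>k<N. w j * cnj (w k) * gram f $$ (j, k))
    = complex_of_real (LINT x|sigma_S2. f x * (cmod (\<Sum>j<N. w j * s j x))\<^sup>2)"
    "integrable sigma_S2 (\<lambda>x. f x * (cmod (\<Sum>j<N. w j * s j x))\<^sup>2)"
proof -
  have e: "complex_of_real (f x * (cmod (\<Sum>j<N. w j * s j x))\<^sup>2)
    = (\<Sum>j<N. \<Sum>k<N. w j * cnj (w k) * (complex_of_real (f x) * (s j x * cnj (s k x))))" for x
  proof -
    have "complex_of_real (f x * (cmod (\<Sum>j<N. w j * s j x))\<^sup>2)
      = complex_of_real (f x) * ((\<Sum>j<N. w j * s j x) * (\<Sum>k<N. cnj (w k) * cnj (s k x)))"
      by (simp only: of_real_mult complex_norm_square cnj_sum complex_cnj_mult)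
    also have "\<dots> = (\<Sum>j<N. \<Sum>k<N. w j * cnj (w k) * (complex_of_real (f x) * (s j x * cnj (s k x))))"
      by (subst sum_product, unfold sum_distrib_left, intro sum.cong refl, simp only: mult_ac)
    finally show ?thesis .
  qed
  have I: "integrable sigma_S2 (\<lambda>x. w j * cnj (w k) * (complex_of_real (f x) * (s j x * cnj (s k x))))" if "j < N" "k < N" for j k
    by (intro integrable_mult_right integrable_s f that)
  have I2: "integrable sigma_S2 (\<lambda>x. \<Sum>j<N. \<Sum>k<N. w j * cnj (w k) * (complex_of_real (f x) * (s j x * cnj (s k x))))"
    by (intro Bochner_Integration.integrable_sum I) auto
  then show "integrable sigma_S2 (\<lambda>x. f x * (cmod (\<Sum>j<N. w j * s j x))\<^sup>2)"
    unfolding e[symmetric] complex_of_real_integrable_eq .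
  have "complex_of_real (LINT x|sigma_S2. f x * (cmod (\<Sum>j<N. w j * s j x))\<^sup>2)
    = (LINT x|sigma_S2. (\<Sum>j<N. \<Sum>k<N. w j * cnj (w k) * (complex_of_real (f x) * (s j x * cnj (s k x)))))"
    unfolding e[symmetric] by (rule integral_complex_of_real[symmetric])
  also have "\<dots> = (\<Sum>j<N. (LINT x|sigma_S2. (\<Sum>k<N. w j * cnj (w k) * (complex_of_real (f x) * (s j x * cnj (s k x))))))"
    by (rule Bochner_Integration.integral_sum) (intro Bochner_Integration.integrable_sum I, auto)
  also have "\<dots> = (\<Sum>j<N. \<Sum>k<N. (LINT x|sigma_S2. w j * cnj (w k) * (complex_of_real (f x) * (s j x * cnj (s k x)))))"
    by (rule sum.cong[OF refl], rule Bochner_Integration.integral_sum) (intro I, auto)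
  also have "\<dots> = (\<Sum>j<N. \<Sum>k<N. w j * cnj (w k) * gram f $$ (j, k))"
    by (intro sum.cong refl) (simp only: integral_mult_right_zero, simp add: gram_def)
  finally show "(\<Sum>j<N. \<Sum>k<N. w j * cnj (w k) * gram f $$ (j, k))
    = complex_of_real (LINT x|sigma_S2. f x * (cmod (\<Sum>j<N. w j * s j x))\<^sup>2)" by simp
qed

lemma gram_one: "gram (\<lambda>_. 1) = 1\<^sub>m N"
  by (rule eq_matI) (auto simp: gram_def s_on)

lemma integral_det: "(LINT x|sphere_config N. (cmod (Determinant.det (smat x)))\<^sup>2) = fact N"
proof -
  have "complex_of_real (LINT x|sphere_config N. (cmod (Determinant.det (smat x)))\<^sup>2) = complex_of_real (fact N)"
    using prod_det_real(2)[of "\<lambda>_. 1"] by (simp add: gram_one)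
  then show ?thesis by (simp only: of_real_eq_iff)
qed

lemma integrable_det: "integrable (sphere_config N) (\<lambda>x. (cmod (Determinant.det (smat x)))\<^sup>2)"
  using prod_det_real(1)[of "\<lambda>_. 1"] by simp

text \<open>The quadratic form is the integral of \<open>exp u\<close> against the squared modulus
  of a linear combination of the \<open>s j\<close>. Since \<open>u\<close> is bounded,
  orthonormality leaves a positive multiple of the squared norm of the coefficients.\<close>

lemma posdef_gram:
  assumes u: "continuous_on S2 u" shows "posdef N (gram (\<lambda>x. exp (u x)))"
  unfolding posdef_def
proof (intro ballI impI)
  fix v :: "complex Matrix.vec" assume v: "v \<in> carrier_vec N" "v \<noteq> 0\<^sub>v N"
  define w where "w j = cnj (vec_index v j)" for j
  have ce: "continuous_on S2 (\<lambda>x. exp (u x))" by (intro continuous_intros u)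
  obtain B where B: "B > 0" "\<And>x. x \<in> S2 \<Longrightarrow> norm (u x) \<le> B" using S2_cont_bounded[OF u] by blast
  define r where "r = (LINT x|sigma_S2. exp (u x) * (cmod (\<Sum>j<N. w j * s j x))\<^sup>2)"
  have "(gram (\<lambda>x. exp (u x)) *\<^sub>v v) \<bullet>c v = (\<Sum>j<N. \<Sum>k<N. w j * cnj (w k) * gram (\<lambda>x. exp (u x)) $$ (j, k))"
  proof -
    have "(gram (\<lambda>x. exp (u x)) *\<^sub>v v) \<bullet>c v = (\<Sum>j\<in>{0..<N}. (\<Sum>k\<in>{0..<N}. gram (\<lambda>x. exp (u x)) $$ (j, k) * vec_index v k) * cnj (vec_index v j))"
      using v(1) gram_carrier[of "\<lambda>x. exp (u x)"] by (simp add: scalar_prod_def)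
    also have "\<dots> = (\<Sum>j<N. \<Sum>k<N. w j * cnj (w k) * gram (\<lambda>x. exp (u x)) $$ (j, k))"
      unfolding atLeast0LessThan sum_distrib_right by (intro sum.cong refl) (simp add: w_def)
    finally show ?thesis .
  qed
  also have "\<dots> = complex_of_real r" unfolding r_def by (rule gram_quadratic(1)[OF ce])
  finally have 1: "(gram (\<lambda>x. exp (u x)) *\<^sub>v v) \<bullet>c v = complex_of_real r" .
  have q1: "(LINT x|sigma_S2. 1 * (cmod (\<Sum>j<N. w j * s j x))\<^sup>2) = (\<Sum>j<N. (cmod (w j))\<^sup>2)"
  proof -
    have "complex_of_real (LINT x|sigma_S2. 1 * (cmod (\<Sum>j<N. w j * s j x))\<^sup>2) = (\<Sum>j<N. \<Sum>k<N. w j * cnj (w k) * gram (\<lambda>_. 1) $$ (j, k))"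
      by (rule gram_quadratic(1)[symmetric]) (rule continuous_on_const)
    also have "\<dots> = (\<Sum>j<N. \<Sum>k<N. if k = j then w j * cnj (w j) else 0)"
      by (intro sum.cong refl) (simp add: gram_one)
    also have "\<dots> = complex_of_real (\<Sum>j<N. (cmod (w j))\<^sup>2)" by (simp only: of_real_sum complex_norm_square) simp
    finally show ?thesis by (simp only: of_real_eq_iff)
  qed
  obtain j where j: "j < N" "vec_index v j \<noteq> 0"
    using v by (metis eq_vecI carrier_vecD index_zero_vec(1) index_zero_vec(2))
  have "0 < (cmod (w j))\<^sup>2" using j by (simp add: w_def)
  also have "\<dots> \<le> (\<Sum>j<N. (cmod (w j))\<^sup>2)" by (rule member_le_sum) (use j in auto)
  finally have "0 < exp (- B) * (LINT x|sigma_S2. 1 * (cmod (\<Sum>j<N. w j * s j x))\<^sup>2)" unfolding q1 by simp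
  also have "\<dots> = (LINT x|sigma_S2. exp (- B) * (1 * (cmod (\<Sum>j<N. w j * s j x))\<^sup>2))" by (rule integral_mult_right_zero[symmetric])
  also have "\<dots> \<le> r" unfolding r_def
  proof (rule integral_mono)
    show "integrable sigma_S2 (\<lambda>x. exp (- B) * (1 * (cmod (\<Sum>j<N. w j * s j x))\<^sup>2))"
      by (intro integrable_mult_right gram_quadratic(2)) (rule continuous_on_const)
    show "integrable sigma_S2 (\<lambda>x. exp (u x) * (cmod (\<Sum>j<N. w j * s j x))\<^sup>2)" by (rule gram_quadratic(2)[OF ce])
    fix x assume "x \<in> space sigma_S2"
    then have "x \<in> S2" by (simp only: space_sigma_S2)
    from B(2)[OF this] have "- B \<le> u x" by (simp add: abs_le_iff)
    then show "exp (- B) * (1 * (cmod (\<Sum>j<N. w j * s j x))\<^sup>2) \<le> exp (u x) * (cmod (\<Sum>j<N. w j * s j x))\<^sup>2"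
      by (intro mult_mono) auto
  qed
  finally show "\<exists>r>0. (gram (\<lambda>x. exp (u x)) *\<^sub>v v) \<bullet>c v = complex_of_real r" using 1 by blast
qed

lemma trace_gram:
  assumes f: "continuous_on S2 f" and g: "continuous_on S2 g"
    and K: "\<And>x y. x \<in> S2 \<Longrightarrow> y \<in> S2 \<Longrightarrow> (\<Sum>k<N. s k x * cnj (s k y)) * cnj (\<Sum>k<N. s k x * cnj (s k y)) = complex_of_real (\<kappa> x y)"
  shows "mtrace (gram f * gram g) = complex_of_real (LINT x|sigma_S2. (LINT y|sigma_S2. f x * g y * \<kappa> x y))"
proof -
  have d: "dim_row (gram f) = N" "dim_col (gram g) = N" "dim_row (gram g) = N" "dim_col (gram f) = N" by (simp_all add: gram_def)
  define F where "F j k x = complex_of_real (f x) * (s j x * cnj (s k x))" for j k x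
  define G where "G j k x = complex_of_real (g x) * (s j x * cnj (s k x))" for j k x
  have IF: "integrable sigma_S2 (F j k)" and IG: "integrable sigma_S2 (G j k)" if "j < N" "k < N" for j k
    unfolding F_def G_def by (intro integrable_s f g that)+
  have "mtrace (gram f * gram g) = (\<Sum>j<N. \<Sum>k<N. (LINT x|sigma_S2. F j k x) * (LINT y|sigma_S2. G k j y))"
    unfolding mtrace_def by (simp add: d scalar_prod_def atLeast0LessThan) (intro sum.cong refl, simp add: gram_def F_def G_def)
  also have "\<dots> = (\<Sum>j<N. \<Sum>k<N. (LINT x|sigma_S2. F j k x * (LINT y|sigma_S2. G k j y)))"
    by (simp only: integral_mult_left_zero)
  also have "\<dots> = (\<Sum>j<N. (LINT x|sigma_S2. (\<Sum>k<N. F j k x * (LINT y|sigma_S2. G k j y))))"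
    by (rule sum.cong[OF refl], rule Bochner_Integration.integral_sum[symmetric]) (intro integrable_mult_left IF, auto)
  also have "\<dots> = (LINT x|sigma_S2. (\<Sum>j<N. \<Sum>k<N. F j k x * (LINT y|sigma_S2. G k j y)))"
    by (rule Bochner_Integration.integral_sum[symmetric]) (intro Bochner_Integration.integrable_sum integrable_mult_left IF, auto)
  also have "\<dots> = (LINT x|sigma_S2. complex_of_real (LINT y|sigma_S2. f x * g y * \<kappa> x y))"
  proof (rule Bochner_Integration.integral_cong[OF refl])
    fix x assume "x \<in> space sigma_S2"
    then have x: "x \<in> S2" by (simp only: space_sigma_S2)
    have "(\<Sum>j<N. \<Sum>k<N. F j k x * (LINT y|sigma_S2. G k j y)) = (\<Sum>j<N. \<Sum>k<N. (LINT y|sigma_S2. F j k x * G k j y))"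
      by (simp only: integral_mult_right_zero)
    also have "\<dots> = (\<Sum>j<N. (LINT y|sigma_S2. (\<Sum>k<N. F j k x * G k j y)))"
      by (rule sum.cong[OF refl], rule Bochner_Integration.integral_sum[symmetric]) (intro integrable_mult_right IG, auto)
    also have "\<dots> = (LINT y|sigma_S2. (\<Sum>j<N. \<Sum>k<N. F j k x * G k j y))"
      by (rule Bochner_Integration.integral_sum[symmetric]) (intro Bochner_Integration.integrable_sum integrable_mult_right IG, auto)
    also have "\<dots> = (LINT y|sigma_S2. complex_of_real (f x * g y * \<kappa> x y))"
    proof (rule Bochner_Integration.integral_cong[OF refl])
      fix y assume "y \<in> space sigma_S2"
      then have y: "y \<in> S2" by (simp only: space_sigma_S2)
      have "(\<Sum>j<N. \<Sum>k<N. F j k x * G k j y) = complex_of_real (f x * g y) * ((\<Sum>k<N. s k x * cnj (s k y)) * (\<Sum>k<N. cnj (s k x) * s k y))"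
        unfolding of_real_mult F_def G_def by (subst sum_product, unfold sum_distrib_left, intro sum.cong refl, simp only: mult_ac)
      also have "(\<Sum>k<N. cnj (s k x) * s k y) = cnj (\<Sum>k<N. s k x * cnj (s k y))" by simp
      finally show "(\<Sum>j<N. \<Sum>k<N. F j k x * G k j y) = complex_of_real (f x * g y * \<kappa> x y)" by (simp only: K[OF x y] of_real_mult)
    qed
    also have "\<dots> = complex_of_real (LINT y|sigma_S2. f x * g y * \<kappa> x y)" by (rule integral_complex_of_real)
    finally show "(\<Sum>j<N. \<Sum>k<N. F j k x * (LINT y|sigma_S2. G k j y)) = complex_of_real (LINT y|sigma_S2. f x * g y * \<kappa> x y)" .
  qed
  also have "\<dots> = complex_of_real (LINT x|sigma_S2. (LINT y|sigma_S2. f x * g y * \<kappa> x y))" by (rule integral_complex_of_real)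
  finally show ?thesis .
qed

lemma exp_moment_det:
  assumes u: "continuous_on S2 u"
    and K: "\<And>x y. x \<in> S2 \<Longrightarrow> y \<in> S2 \<Longrightarrow> (\<Sum>k<N. s k x * cnj (s k y)) * cnj (\<Sum>k<N. s k x * cnj (s k y)) = complex_of_real (\<kappa> x y)"
  shows "integrable (sphere_config N) (\<lambda>x. exp (dev N x u) * (cmod (Determinant.det (smat x)))\<^sup>2)"
    "(LINT x|sphere_config N. exp (dev N x u) * (cmod (Determinant.det (smat x)))\<^sup>2)
     \<le> fact N * exp ((LINT x|sigma_S2. (LINT y|sigma_S2. exp (u x) * exp (- u y) * \<kappa> x y)) - real N)"
proof -
  define a where "a = real N * (LINT y|sigma_S2. u y)"
  define W where "W x = (cmod (Determinant.det (smat x)))\<^sup>2" for x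
  define J where "J f = (LINT x|sphere_config N. (\<Prod>i\<in>{1..N}. f (x i)) * W x)" for f :: "real^3 \<Rightarrow> real"
  have Wn: "W x \<ge> 0" for x by (simp add: W_def)
  have cu: "continuous_on S2 (\<lambda>x. - u x)" by (intro continuous_intros u)
  have ce: "continuous_on S2 (\<lambda>x. exp (u x))" "continuous_on S2 (\<lambda>x. exp (- u x))" by (intro continuous_intros u)+
  note I = prod_det_real(1)[OF ce(1), folded W_def] prod_det_real(1)[OF ce(2), folded W_def]
  have P: "complex_of_real (J (\<lambda>x. exp (u x))) = fact N * Determinant.det (gram (\<lambda>x. exp (u x)))"
    "complex_of_real (J (\<lambda>x. exp (- u x))) = fact N * Determinant.det (gram (\<lambda>x. exp (- u x)))"
    unfolding J_def W_def by (rule prod_det_real(2)[OF ce(1)], rule prod_det_real(2)[OF ce(2)])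
  define T where "T = (LINT x|sigma_S2. (LINT y|sigma_S2. exp (u x) * exp (- u y) * \<kappa> x y))"
  have "cmod (Determinant.det (gram (\<lambda>x. exp (u x))) * Determinant.det (gram (\<lambda>x. exp (- u x))))
    \<le> exp (Re (mtrace (gram (\<lambda>x. exp (u x)) * gram (\<lambda>x. exp (- u x)))) - N)"
    by (rule det_mult_posdef_le[OF gram_carrier gram_carrier posdef_gram[OF u] posdef_gram[OF cu]])
  also have "\<dots> = exp (T - N)" by (simp only: trace_gram[OF ce K] T_def Re_complex_of_real)
  finally have "cmod (Determinant.det (gram (\<lambda>x. exp (u x))) * Determinant.det (gram (\<lambda>x. exp (- u x)))) \<le> exp (T - N)" .
  moreover have "complex_of_real (J (\<lambda>x. exp (u x)) * J (\<lambda>x. exp (- u x))) = fact N * fact N * (Determinant.det (gram (\<lambda>x. exp (u x))) * Determinant.det (gram (\<lambda>x. exp (- u x))))"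
    by (simp only: of_real_mult P mult_ac)
  then have "\<bar>J (\<lambda>x. exp (u x)) * J (\<lambda>x. exp (- u x))\<bar> = fact N * fact N * cmod (Determinant.det (gram (\<lambda>x. exp (u x))) * Determinant.det (gram (\<lambda>x. exp (- u x))))"
    by (metis norm_of_real norm_mult norm_fact)
  ultimately have JJ: "J (\<lambda>x. exp (u x)) * J (\<lambda>x. exp (- u x)) \<le> fact N * fact N * exp (T - N)"
  proof -
    assume c: "cmod (Determinant.det (gram (\<lambda>x. exp (u x))) * Determinant.det (gram (\<lambda>x. exp (- u x)))) \<le> exp (T - N)"
      and e: "\<bar>J (\<lambda>x. exp (u x)) * J (\<lambda>x. exp (- u x))\<bar> = fact N * fact N * cmod (Determinant.det (gram (\<lambda>x. exp (u x))) * Determinant.det (gram (\<lambda>x. exp (- u x))))"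
    have "J (\<lambda>x. exp (u x)) * J (\<lambda>x. exp (- u x)) \<le> \<bar>J (\<lambda>x. exp (u x)) * J (\<lambda>x. exp (- u x))\<bar>" by (rule abs_ge_self)
    also have "\<dots> \<le> fact N * fact N * exp (T - N)" unfolding e by (intro mult_left_mono c) simp
    finally show ?thesis .
  qed
  have pe: "(\<Prod>i\<in>{1..N}. exp (v (x i))) = exp (\<Sum>i\<in>{1..N}. v (x i))" for v :: "real^3 \<Rightarrow> real" and x by (simp add: exp_sum)
  \<comment> \<open>Jensen's inequality in tangent form: \<open>exp (- S)\<close> lies above its
    tangent at the mean \<open>a\<close> of the linear statistic, and the integral of the tangent is
    explicit by the first moment.\<close>
  have "fact N * exp (- a) = (LINT x|sphere_config N. exp (- a) * (1 + a) * W x - exp (- a) * ((\<Sum>i\<in>{1..N}. u (x i)) * W x))"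
  proof -
    have 1: "integrable (sphere_config N) (\<lambda>x. exp (- a) * (1 + a) * W x)" unfolding W_def by (intro integrable_mult_right integrable_det)
    have 2: "integrable (sphere_config N) (\<lambda>x. exp (- a) * ((\<Sum>i\<in>{1..N}. u (x i)) * W x))" unfolding W_def by (intro integrable_mult_right linear_det_real[OF u])
    show ?thesis
      unfolding Bochner_Integration.integral_diff[OF 1 2] integral_mult_right_zero integral_det[folded W_def] linear_det_real(2)[OF u, folded W_def] a_def[symmetric]
      by (simp add: algebra_simps)
  qed
  also have "\<dots> \<le> J (\<lambda>x. exp (- u x))" unfolding J_def
  proof (rule integral_mono)
    show "integrable (sphere_config N) (\<lambda>x. exp (- a) * (1 + a) * W x - exp (- a) * ((\<Sum>i\<in>{1..N}. u (x i)) * W x))"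
      unfolding W_def by (intro Bochner_Integration.integrable_diff integrable_mult_right integrable_det linear_det_real[OF u])
    show "integrable (sphere_config N) (\<lambda>x. (\<Prod>i\<in>{1..N}. exp (- u (x i))) * W x)" by (rule I)
    fix x
    define S where "S = (\<Sum>i\<in>{1..N}. u (x i))"
    have "exp (- a) * (1 + (a - S)) \<le> exp (- a) * exp (a - S)" by (intro mult_left_mono exp_ge_add_one_self) auto
    also have "\<dots> = exp (- S)" by (simp add: exp_add[symmetric])
    finally have "exp (- a) * (1 + (a - S)) * W x \<le> exp (- S) * W x" by (intro mult_right_mono Wn)
    then show "exp (- a) * (1 + a) * W x - exp (- a) * ((\<Sum>i\<in>{1..N}. u (x i)) * W x) \<le> (\<Prod>i\<in>{1..N}. exp (- u (x i))) * W x"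
      using pe[of "\<lambda>y. - u y" x] by (simp add: S_def sum_negf algebra_simps)
  qed
  finally have Jm: "fact N * exp (- a) \<le> J (\<lambda>x. exp (- u x))" .
  have Jp: "0 \<le> J (\<lambda>x. exp (u x))" unfolding J_def by (intro Bochner_Integration.integral_nonneg mult_nonneg_nonneg prod_nonneg Wn) auto
  have "fact N * (exp (- a) * J (\<lambda>x. exp (u x))) \<le> J (\<lambda>x. exp (u x)) * J (\<lambda>x. exp (- u x))"
    using mult_left_mono[OF Jm Jp] by (simp only: mult_ac)
  also have "\<dots> \<le> fact N * (fact N * exp (T - N))" using JJ by (simp only: mult.assoc)
  finally have F: "exp (- a) * J (\<lambda>x. exp (u x)) \<le> fact N * exp (T - N)" by simp
  have de: "exp (dev N x u) * W x = exp (- a) * ((\<Prod>i\<in>{1..N}. exp (u (x i))) * W x)" for x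
    unfolding pe dev_def a_def by (simp add: exp_diff exp_minus field_simps)
  show "integrable (sphere_config N) (\<lambda>x. exp (dev N x u) * (cmod (Determinant.det (smat x)))\<^sup>2)"
    unfolding W_def[symmetric] de by (intro integrable_mult_right I)
  show "(LINT x|sphere_config N. exp (dev N x u) * (cmod (Determinant.det (smat x)))\<^sup>2)
     \<le> fact N * exp ((LINT x|sigma_S2. (LINT y|sigma_S2. exp (u x) * exp (- u y) * \<kappa> x y)) - real N)"
    unfolding W_def[symmetric] de T_def[symmetric] integral_mult_right_zero using F unfolding J_def .
qed

end

section \<open>The orthonormal system of the spherical ensemble\<close>

lemma integral_sigma_stereo:
  fixes f :: "real^3 \<Rightarrow> complex"
  assumes f: "f \<in> borel_measurable (restrict_space borel S2)"
  shows "(LINT x|sigma_S2. f x) = (LINT p|lborel. ((conf p)\<^sup>2 / pi) *\<^sub>R f (stereo 1 p))"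
proof -
  have m: "(\<lambda>p. f (stereo 1 p)) \<in> borel_measurable lborel"
    using measurable_compose[OF measurable_stereo f] by (simp cong: measurable_cong_sets)
  have fa: "f \<in> borel_measurable area_S2" using f by (simp cong: measurable_cong_sets)
  have "(LINT x|sigma_S2. f x) = (LINT x|area_S2. (1 / (4 * pi)) *\<^sub>R f x)"
    unfolding sigma_S2_density using fa by (subst integral_density) auto
  also have "\<dots> = (1 / (4 * pi)) *\<^sub>R (LINT x|area_S2. f x)" by simp
  also have "(LINT x|area_S2. f x) = (LINT p|lborel. (4 * (conf p)\<^sup>2) *\<^sub>R f (stereo 1 p))"
    unfolding area_S2_def using m f
    by (subst integral_distr[OF measurable_stereo]) (simp_all add: integral_density)
  also have "(1 / (4 * pi)) *\<^sub>R \<dots> = (LINT p|lborel. (1 / (4 * pi)) *\<^sub>R ((4 * (conf p)\<^sup>2) *\<^sub>R f (stereo 1 p)))"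
    by (rule integral_scaleR_right[symmetric])
  finally show ?thesis by simp
qed

text \<open>In the chart this is \<open>z^j\<close> times a power of \<open>conf\<close>: the
  polynomials of degree at most \<open>M\<close> in the plane, written homogeneously in the spinor
  so that no pole is exceptional.\<close>

definition smono :: "nat \<Rightarrow> nat \<Rightarrow> real^3 \<Rightarrow> complex" where
  "smono M j x = sa x ^ j * sb x ^ (M - j)"

lemma measurable_smono[measurable]: "smono M j \<in> borel_measurable borel"
  unfolding smono_def[abs_def] by measurable

lemma measurable_smono_S2: "smono M j \<in> borel_measurable (restrict_space borel S2)"
  by (rule measurable_restrict_space1) measurable

lemma smono_le_1: "x \<in> S2 \<Longrightarrow> cmod (smono M j x) \<le> 1"
  unfolding smono_def norm_mult norm_power by (intro mult_le_one power_le_one spinor_le_1) auto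

lemma integrable_smono2: "integrable sigma_S2 (\<lambda>x. smono M j x * cnj (smono M k x))"
proof (rule sigma.integrable_const_bound[where B=1])
  note [measurable] = measurable_smono_S2
  show "AE x in sigma_S2. cmod (smono M j x * cnj (smono M k x)) \<le> 1"
  proof (rule AE_I2)
    fix x assume "x \<in> space sigma_S2"
    then have x: "x \<in> S2" by (simp only: space_sigma_S2)
    show "cmod (smono M j x * cnj (smono M k x)) \<le> 1"
      unfolding norm_mult complex_mod_cnj by (intro mult_le_one smono_le_1 x norm_ge_zero)
  qed
  have "(\<lambda>x. smono M j x * cnj (smono M k x)) \<in> borel_measurable borel" by measurable
  then have "(\<lambda>x. smono M j x * cnj (smono M k x)) \<in> borel_measurable (restrict_space borel S2)" by (rule measurable_restrict_space1)
  then show "(\<lambda>x. smono M j x * cnj (smono M k x)) \<in> borel_measurable sigma_S2" by (simp cong: measurable_cong_sets)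
qed

lemma smono_stereo:
  assumes "j \<le> M" 
  shows "smono M j (stereo 1 p) = Complex (p$1) (p$2) ^ j * complex_of_real (sqrt (conf p) ^ M)"
proof -
  have "complex_of_real (sqrt (conf p)) ^ j * complex_of_real (sqrt (conf p)) ^ (M - j) = complex_of_real (sqrt (conf p) ^ M)"
    using assms by (simp add: power_add[symmetric])
  then show ?thesis unfolding smono_def spinor_stereo power_mult_distrib by (simp only: mult.assoc)
qed

text \<open>Rotating the chart by \<open>pi / (j - k)\<close> changes the sign of the integrand.\<close>

lemma smono_orthogonal:
  assumes jk: "j \<le> M" "k \<le> M" "j \<noteq> k"
  shows "(LINT x|sigma_S2. smono M j x * cnj (smono M k x)) = 0"
proof -
  define t where "t = pi / (real j - real k)"
  define h where "h p = ((conf p)\<^sup>2 / pi) *\<^sub>R (smono M j (stereo 1 p) * cnj (smono M k (stereo 1 p)))" for p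
  have h: "h p = Complex (p$1) (p$2) ^ j * cnj (Complex (p$1) (p$2)) ^ k * complex_of_real ((conf p)\<^sup>2 / pi * (sqrt (conf p) ^ M * sqrt (conf p) ^ M))" for p
    unfolding h_def smono_stereo[OF jk(1)] smono_stereo[OF jk(2)] by (simp add: scaleR_conv_of_real)
  have "(\<lambda>p::real^2. Complex (p$1) (p$2)) = (\<lambda>p. complex_of_real (p$1) + \<i> * complex_of_real (p$2))"
    by (rule ext) (simp add: complex_eq_iff)
  moreover have "(\<lambda>p::real^2. complex_of_real (p$1) + \<i> * complex_of_real (p$2)) \<in> borel_measurable borel"
    by (intro borel_measurable_continuous_onI continuous_intros)
  ultimately have [measurable]: "(\<lambda>p::real^2. Complex (p$1) (p$2)) \<in> borel_measurable borel" by simp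
  have [measurable]: "conf \<in> borel_measurable borel" by (rule borel_measurable_continuous_onI[OF continuous_conf])
  have hm: "h \<in> borel_measurable borel" unfolding h[abs_def] by measurable
  have I: "(LINT x|sigma_S2. smono M j x * cnj (smono M k x)) = (LINT p|lborel. h p)"
    unfolding h_def by (rule integral_sigma_stereo) (rule measurable_restrict_space1, measurable)
  have C: "conf (rot2 t p) = conf p" for p
    using norm_rot2[of t p] conf_def by (simp add: conf_def norm2_sq[symmetric])
  have Z: "Complex (rot2 t p $ 1) (rot2 t p $ 2) = cis t * Complex (p$1) (p$2)" for p
    by (simp add: rot2_def complex_eq_iff)
  have cis1: "cis t ^ j * cnj (cis t) ^ k = -1"
  proof -
    have "cis t ^ j * cnj (cis t) ^ k = cis (real j * t + real k * (- t))"
      unfolding cis_cnj Complex.DeMoivre cis_mult ..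
    also have "real j * t + real k * (- t) = pi"
    proof -
      have "real j * t + real k * (- t) = (real j - real k) * t" by (simp add: algebra_simps)
      then show ?thesis using jk(3) by (simp add: t_def)
    qed
    finally show ?thesis by simp
  qed
  have "h (rot2 t p) = (cis t ^ j * cnj (cis t) ^ k) * h p" for p
    unfolding h C Z power_mult_distrib complex_cnj_mult by (simp only: mult_ac)
  then have hr: "h (rot2 t p) = - h p" for p by (simp add: cis1)
  have "(LINT p|lborel. h p) = (LINT p|distr lborel borel (rot2 t). h p)" by (simp only: distr_rot2)
  also have "\<dots> = (LINT p|lborel. h (rot2 t p))"
    by (rule integral_distr) (use measurable_rot2 hm in \<open>simp_all cong: measurable_cong_sets\<close>)
  also have "\<dots> = - (LINT p|lborel. h p)" by (simp only: hr integral_minus)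
  finally have "(LINT p|lborel. h p) + (LINT p|lborel. h p) = 0" by (simp only: add.right_inverse add.commute[of _ "- _"] eq_neg_iff_add_eq_0)
  then show ?thesis unfolding I by simp
qed

lemma spinor_binomial:
  "(sa x * cnj (sa y) + sb x * cnj (sb y)) ^ M = (\<Sum>j\<le>M. of_nat (M choose j) * (smono M j x * cnj (smono M j y)))"
  unfolding binomial_ring smono_def by (intro sum.cong refl) (simp add: power_mult_distrib mult_ac)

text \<open>Two expansions in the numbers \<open>|smono M j y|^2\<close> are compared: the binomial
  expansion of 1, and that of the integral of \<open>qk^M\<close>, in which orthogonality leaves the
  diagonal. Their difference is a power of \<open>conf\<close> times a polynomial in
  \<open>|z|^2\<close> that vanishes on a half line, so its coefficients \<open>c j\<close> are
  zero.\<close>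

lemma smono_norm:
  assumes j: "j \<le> M"
  shows "(LINT x|sigma_S2. smono M j x * cnj (smono M j x)) = 1 / (of_nat (M + 1) * of_nat (M choose j))"
proof -
  define d where "d j = (LINT x|sigma_S2. (cmod (smono M j x))\<^sup>2)" for j
  define C where "C j = real (M choose j)" for j
  have D: "(LINT x|sigma_S2. smono M j x * cnj (smono M j x)) = complex_of_real (d j)" for j
    unfolding d_def complex_norm_square[symmetric] by (rule integral_complex_of_real)
  have main: "(\<Sum>j\<le>M. (C j * (C j * d j - 1 / real (M + 1))) * (cmod (smono M j y))\<^sup>2) = 0" if y: "y \<in> S2" for y
  proof -
    have "complex_of_real (1 / (real M + 1)) = complex_of_real (LINT x|sigma_S2. qk x y ^ M)"
    proof -
      have "(LINT x|sigma_S2. qk y x ^ M) = 1 / (real M + 1)" by (rule integral_qk_power[OF y])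
      then show ?thesis by (simp only: qk_commute[of _ y])
    qed
    also have "\<dots> = (LINT x|sigma_S2. complex_of_real (qk x y ^ M))" by (rule integral_complex_of_real[symmetric])
    also have "\<dots> = (LINT x|sigma_S2. (\<Sum>j\<le>M. \<Sum>k\<le>M. (of_nat (M choose j) * of_nat (M choose k) * (cnj (smono M j y) * smono M k y)) * (smono M j x * cnj (smono M k x))))"
    proof (rule Bochner_Integration.integral_cong[OF refl])
      fix x assume "x \<in> space sigma_S2"
      then have x: "x \<in> S2" by (simp only: space_sigma_S2)
      have "complex_of_real (qk x y ^ M) = (sa x * cnj (sa y) + sb x * cnj (sb y)) ^ M * cnj ((sa x * cnj (sa y) + sb x * cnj (sb y)) ^ M)"
        unfolding of_real_power qk_spinor[OF x y] power_mult_distrib complex_cnj_power ..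
      also have "\<dots> = (\<Sum>j\<le>M. of_nat (M choose j) * (smono M j x * cnj (smono M j y))) * (\<Sum>k\<le>M. of_nat (M choose k) * (cnj (smono M k x) * smono M k y))"
        unfolding spinor_binomial cnj_sum complex_cnj_mult complex_cnj_cnj complex_cnj_of_nat ..
      also have "\<dots> = (\<Sum>j\<le>M. \<Sum>k\<le>M. (of_nat (M choose j) * of_nat (M choose k) * (cnj (smono M j y) * smono M k y)) * (smono M j x * cnj (smono M k x)))"
        by (subst sum_product, intro sum.cong refl, simp only: mult_ac)
      finally show "complex_of_real (qk x y ^ M) = (\<Sum>j\<le>M. \<Sum>k\<le>M. (of_nat (M choose j) * of_nat (M choose k) * (cnj (smono M j y) * smono M k y)) * (smono M j x * cnj (smono M k x)))" .
    qed
    also have "\<dots> = (\<Sum>j\<le>M. (LINT x|sigma_S2. (\<Sum>k\<le>M. (of_nat (M choose j) * of_nat (M choose k) * (cnj (smono M j y) * smono M k y)) * (smono M j x * cnj (smono M k x)))))"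
      by (rule Bochner_Integration.integral_sum) (intro Bochner_Integration.integrable_sum integrable_mult_right integrable_smono2)
    also have "\<dots> = (\<Sum>j\<le>M. \<Sum>k\<le>M. (LINT x|sigma_S2. (of_nat (M choose j) * of_nat (M choose k) * (cnj (smono M j y) * smono M k y)) * (smono M j x * cnj (smono M k x))))"
      by (rule sum.cong[OF refl], rule Bochner_Integration.integral_sum) (intro integrable_mult_right integrable_smono2)
    also have "\<dots> = (\<Sum>j\<le>M. \<Sum>k\<le>M. if k = j then (of_nat (M choose j) * of_nat (M choose j) * (cnj (smono M j y) * smono M j y)) * complex_of_real (d j) else 0)"
      by (intro sum.cong refl) (auto simp: D smono_orthogonal)
    also have "\<dots> = (\<Sum>j\<le>M. (of_nat (M choose j) * of_nat (M choose j) * (cnj (smono M j y) * smono M j y)) * complex_of_real (d j))"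
      by (intro sum.cong refl) simp
    also have "\<dots> = complex_of_real (\<Sum>j\<le>M. C j * C j * d j * (cmod (smono M j y))\<^sup>2)"
      unfolding of_real_sum by (intro sum.cong refl) (simp only: of_real_mult complex_norm_square C_def of_real_of_nat_eq mult_ac)
    finally have 1: "1 / (real M + 1) = (\<Sum>j\<le>M. C j * C j * d j * (cmod (smono M j y))\<^sup>2)" by (simp only: of_real_eq_iff)
    have "complex_of_real 1 = (sa y * cnj (sa y) + sb y * cnj (sb y)) ^ M" by (simp only: spinor_unit[OF y] power_one of_real_1)
    also have "\<dots> = complex_of_real (\<Sum>j\<le>M. C j * (cmod (smono M j y))\<^sup>2)"
      unfolding spinor_binomial of_real_sum by (intro sum.cong refl) (simp only: of_real_mult complex_norm_square C_def of_real_of_nat_eq)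
    finally have 2: "1 = (\<Sum>j\<le>M. C j * (cmod (smono M j y))\<^sup>2)" by (simp only: of_real_eq_iff)
    have "(\<Sum>j\<le>M. (C j * (C j * d j - 1 / real (M + 1))) * (cmod (smono M j y))\<^sup>2)
      = (\<Sum>j\<le>M. C j * C j * d j * (cmod (smono M j y))\<^sup>2 - 1 / real (M + 1) * (C j * (cmod (smono M j y))\<^sup>2))"
      by (intro sum.cong refl) (simp only: left_diff_distrib right_diff_distrib mult_ac)
    also have "\<dots> = 1 / (real M + 1) - 1 / real (M + 1) * 1"
      unfolding sum_subtractf sum_distrib_left[symmetric] 1[symmetric] 2[symmetric] ..
    finally show ?thesis by simp
  qed
  define c where "c j = C j * (C j * d j - 1 / real (M + 1))" for j
  have c0: "(\<Sum>j\<le>M. c j * s ^ j) = 0" if s: "s \<ge> 0" for s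
  proof -
    \<comment> \<open>At a chart point with \<open>|z|^2 = s\<close> all terms share the factor
      \<open>conf p ^ M\<close>, which can be cancelled.\<close>
    define p :: "real^2" where "p = vector [sqrt s, 0]"
    have p: "p$1 = sqrt s" "p$2 = 0" by (simp_all add: p_def)
    have cp: "conf p > 0" by (rule conf_pos)
    have sq: "(cmod (smono M j (stereo 1 p)))\<^sup>2 = s ^ j * conf p ^ M" if "j \<le> M" for j
    proof -
      have "(cmod (smono M j (stereo 1 p)))\<^sup>2 = ((cmod (Complex (p$1) (p$2)))\<^sup>2) ^ j * ((sqrt (conf p))\<^sup>2) ^ M"
        unfolding smono_stereo[OF that] norm_mult norm_power norm_of_real power_mult_distrib
        by (simp add: power_mult[symmetric] mult.commute power_even_abs)
      also have "(cmod (Complex (p$1) (p$2)))\<^sup>2 = s" using s by (simp add: p cmod_power2)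
      finally show ?thesis using cp by simp
    qed
    have "stereo 1 p \<in> S2" by (rule stereo_in_S2) simp
    from main[OF this] have "(\<Sum>j\<le>M. c j * (s ^ j * conf p ^ M)) = 0"
      by (simp add: c_def sq)
    then have "(\<Sum>j\<le>M. c j * s ^ j) * conf p ^ M = 0" by (simp only: sum_distrib_right mult.assoc)
    then show ?thesis using cp by simp
  qed
  have "\<not> finite {s. (\<Sum>j\<le>M. c j * s ^ j) = 0}"
  proof
    assume "finite {s. (\<Sum>j\<le>M. c j * s ^ j) = 0}"
    then have "finite {0::real..}" by (rule finite_subset[rotated]) (auto intro: c0)
    then show False by (simp add: infinite_Ici)
  qed
  then have "c j = 0" using polyfun_finite_roots[of c M] j by blast
  moreover have "C j > 0" using j by (simp add: C_def)
  ultimately have "C j * d j = 1 / real (M + 1)" by (simp add: c_def)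
  moreover have "d j = (C j * d j) / C j" using \<open>C j > 0\<close> by simp
  ultimately have "d j = 1 / (real (M + 1) * C j)" by simp
  then show ?thesis unfolding D by (simp add: C_def)
qed

text \<open>By \<open>smono_norm\<close> with \<open>M = N - 1\<close> the monomial has squared norm
  \<open>1 / (N * (N - 1 choose k))\<close>; the prefactor normalizes it. The same weights make the
  kernel a binomial expansion.\<close>

definition sph :: "nat \<Rightarrow> nat \<Rightarrow> real^3 \<Rightarrow> complex" where
  "sph N k x = complex_of_real (sqrt (real N * real ((N - 1) choose k))) * smono (N - 1) k x"

lemma sph_kernel:
  assumes N: "N \<ge> 1"
  shows "(\<Sum>k<N. sph N k x * cnj (sph N k y)) = of_nat N * (sa x * cnj (sa y) + sb x * cnj (sb y)) ^ (N - 1)"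
proof -
  have s: "complex_of_real (sqrt (real N * real ((N - 1) choose k))) * complex_of_real (sqrt (real N * real ((N - 1) choose k))) = of_nat N * of_nat ((N - 1) choose k)" for k
    by (simp add: of_real_mult[symmetric] del: of_real_mult) simp
  have "{..<N} = {..N - 1}" using N by auto
  then have "(\<Sum>k<N. sph N k x * cnj (sph N k y)) = (\<Sum>k\<le>N - 1. sph N k x * cnj (sph N k y))" by simp
  also have "\<dots> = (\<Sum>k\<le>N - 1. of_nat N * (of_nat ((N - 1) choose k) * (smono (N - 1) k x * cnj (smono (N - 1) k y))))"
  proof (rule sum.cong[OF refl])
    fix k
    have "sph N k x * cnj (sph N k y) = (complex_of_real (sqrt (real N * real ((N - 1) choose k))) * complex_of_real (sqrt (real N * real ((N - 1) choose k)))) * (smono (N - 1) k x * cnj (smono (N - 1) k y))"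
      unfolding sph_def complex_cnj_mult complex_cnj_complex_of_real by (simp only: mult_ac)
    then show "sph N k x * cnj (sph N k y) = of_nat N * (of_nat ((N - 1) choose k) * (smono (N - 1) k x * cnj (smono (N - 1) k y)))"
      unfolding s by (simp only: mult.assoc)
  qed
  finally show ?thesis unfolding spinor_binomial sum_distrib_left .
qed

lemma onsys_sph: 
  assumes N: "N \<ge> 1" shows "onsys N (sph N)"
proof
  fix k assume k: "k < N"
  have "sph N k \<in> borel_measurable borel" unfolding sph_def[abs_def] by measurable
  then have "sph N k \<in> borel_measurable (restrict_space borel S2)" by (rule measurable_restrict_space1)
  then show "sph N k \<in> borel_measurable sigma_S2" by (simp cong: measurable_cong_sets)
  show "\<exists>B. \<forall>x\<in>S2. cmod (sph N k x) \<le> B"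
  proof (intro exI ballI)
    fix x assume x: "x \<in> S2"
    show "cmod (sph N k x) \<le> sqrt (real N * real ((N - 1) choose k)) * 1"
      unfolding sph_def norm_mult norm_of_real by (intro mult_mono smono_le_1 x) auto
  qed
next
  fix j k assume jk: "j < N" "k < N"
  define c where "c k = complex_of_real (sqrt (real N * real ((N - 1) choose k)))" for k
  have "(LINT x|sigma_S2. sph N j x * cnj (sph N k x)) = (LINT x|sigma_S2. (c j * c k) * (smono (N - 1) j x * cnj (smono (N - 1) k x)))"
    unfolding sph_def c_def by (intro Bochner_Integration.integral_cong refl) (simp only: complex_cnj_mult complex_cnj_complex_of_real mult_ac)
  also have "\<dots> = (c j * c k) * (LINT x|sigma_S2. smono (N - 1) j x * cnj (smono (N - 1) k x))" by (rule integral_mult_right_zero)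
  also have "\<dots> = (if j = k then 1 else 0)"
  proof (cases "j = k")
    case True
    have "c j * c j = of_nat N * of_nat ((N - 1) choose j)"
      unfolding c_def by (simp add: of_real_mult[symmetric] del: of_real_mult) simp
    moreover have "(N - 1) choose j > 0" using jk by simp
    ultimately show ?thesis using True N jk smono_norm[of j "N - 1"] by simp
  next
    case False
    then show ?thesis using smono_orthogonal[of j "N - 1" k] jk by simp
  qed
  finally show "(LINT x|sigma_S2. sph N j x * cnj (sph N k x)) = (if j = k then 1 else 0)" .
next
  fix x assume x: "x \<in> S2"
  show "(\<Sum>k<N. sph N k x * cnj (sph N k x)) = of_nat N" unfolding sph_kernel[OF N] spinor_unit[OF x] by simp
qed

lemma sph_kernel_sq:
  assumes N: "N \<ge> 1" and x: "x \<in> S2" and y: "y \<in> S2"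
  shows "(\<Sum>k<N. sph N k x * cnj (sph N k y)) * cnj (\<Sum>k<N. sph N k x * cnj (sph N k y)) = complex_of_real ((real N)\<^sup>2 * qk x y ^ (N - 1))"
  unfolding sph_kernel[OF N] of_real_mult of_real_power qk_spinor[OF x y] by (simp add: power2_eq_square power_mult_distrib mult_ac)

section \<open>The homogeneous Vandermonde determinant and the partition function\<close>

lemma prod_index_power: "(\<Prod>k<N. \<Prod>j<k. b j) = (\<Prod>j<N. b j ^ (N - 1 - j))" for b :: "nat \<Rightarrow> 'a::comm_monoid_mult"
proof (induction N)
  case (Suc N)
  have "(\<Prod>k<Suc N. \<Prod>j<k. b j) = (\<Prod>j<N. b j ^ (N - 1 - j) * b j)" by (simp add: Suc prod.distrib)
  also have "\<dots> = (\<Prod>j<N. b j ^ (Suc N - 1 - j))"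
  proof (rule prod.cong[OF refl])
    fix j assume "j \<in> {..<N}"
    then have "Suc N - 1 - j = Suc (N - 1 - j)" by auto
    then show "b j ^ (N - 1 - j) * b j = b j ^ (Suc N - 1 - j)" by (simp only: power_Suc2)
  qed
  finally show ?case by simp
qed simp

text \<open>A product of \<open>k\<close> linear forms is a form of degree \<open>k\<close> in
  \<open>(s, t)\<close>. The coefficient of \<open>s^k\<close> and the vanishing of the higher ones
  are recorded because they make the coefficient matrix triangular with known diagonal.\<close>

lemma prod_linear_form_coeffs:
  fixes a b :: "nat \<Rightarrow> complex"
  shows "\<exists>c. c k = (\<Prod>j<k. b j) \<and> (\<forall>m>k. c m = 0) \<and> (\<forall>s t. (\<Prod>j<k. s * b j - t * a j) = (\<Sum>m\<le>k. c m * (s ^ m * t ^ (k - m))))"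
proof (induction k)
  case 0
  show ?case by (rule exI[of _ "\<lambda>m. if m = 0 then 1 else 0"]) simp
next
  case (Suc k)
  then obtain c where c: "c k = (\<Prod>j<k. b j)" "\<And>m. m > k \<Longrightarrow> c m = 0"
    "\<And>s t. (\<Prod>j<k. s * b j - t * a j) = (\<Sum>m\<le>k. c m * (s ^ m * t ^ (k - m)))" by blast
  define d where "d m = (if m = 0 then 0 else b k * c (m - 1)) - a k * c m" for m
  have "(\<Prod>j<Suc k. s * b j - t * a j) = (\<Sum>m\<le>Suc k. d m * (s ^ m * t ^ (Suc k - m)))" for s t
  proof -
    have 1: "(\<Sum>m\<le>Suc k. (if m = 0 then 0 else b k * c (m - 1)) * (s ^ m * t ^ (Suc k - m))) = (\<Sum>m\<le>k. s * b k * (c m * (s ^ m * t ^ (k - m))))"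
      unfolding sum.atMost_Suc_shift by (simp add: mult_ac)
    have 2: "(\<Sum>m\<le>Suc k. a k * c m * (s ^ m * t ^ (Suc k - m))) = (\<Sum>m\<le>k. t * a k * (c m * (s ^ m * t ^ (k - m))))"
    proof -
      have "(\<Sum>m\<le>Suc k. a k * c m * (s ^ m * t ^ (Suc k - m))) = (\<Sum>m\<le>k. a k * c m * (s ^ m * t ^ (Suc k - m)))" by (simp add: c(2))
      also have "\<dots> = (\<Sum>m\<le>k. t * a k * (c m * (s ^ m * t ^ (k - m))))"
        by (intro sum.cong refl) (simp add: Suc_diff_le mult_ac)
      finally show ?thesis .
    qed
    have "(\<Prod>j<Suc k. s * b j - t * a j) = (\<Sum>m\<le>k. c m * (s ^ m * t ^ (k - m))) * (s * b k - t * a k)" by (simp add: c(3))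
    also have "\<dots> = (\<Sum>m\<le>k. s * b k * (c m * (s ^ m * t ^ (k - m)))) - (\<Sum>m\<le>k. t * a k * (c m * (s ^ m * t ^ (k - m))))"
      unfolding sum_distrib_left[symmetric] left_diff_distrib[symmetric] by (rule mult.commute)
    also have "\<dots> = (\<Sum>m\<le>Suc k. d m * (s ^ m * t ^ (Suc k - m)))"
      unfolding 1[symmetric] 2[symmetric] sum_subtractf[symmetric] d_def left_diff_distrib ..
    finally show ?thesis .
  qed
  moreover have "d (Suc k) = (\<Prod>j<Suc k. b j)" by (simp add: d_def c mult.commute)
  moreover have "d m = 0" if "m > Suc k" for m using that c(2)[of m] c(2)[of "m - 1"] by (simp add: d_def)
  ultimately show ?case by blast
qed

definition vdm :: "nat \<Rightarrow> (nat \<Rightarrow> complex) \<Rightarrow> (nat \<Rightarrow> complex) \<Rightarrow> complex Matrix.mat" where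
  "vdm N a b = Matrix.mat N N (\<lambda>(i, m). a i ^ m * b i ^ (N - 1 - m))"

lemma prod_list_diag: "A \<in> carrier_mat N N \<Longrightarrow> prod_list (diag_mat A) = (\<Prod>k<N. A $$ (k, k))"
  by (simp add: diag_mat_def prod.distinct_set_conv_list[symmetric] atLeast0LessThan)

text \<open>Multiplying by the coefficient matrix of the forms \<open>\<Prod>j<k. s * b j - t * a j\<close> makes the
  Vandermonde matrix triangular.\<close>

lemma det_vdm_nonzero:
  assumes b: "\<And>i. i < N \<Longrightarrow> b i \<noteq> 0"
  shows "Determinant.det (vdm N a b) = (\<Prod>k<N. \<Prod>j<k. a k * b j - b k * a j)"
proof -
  define c where "c k = (SOME c. c k = (\<Prod>j<k. b j) \<and> (\<forall>m>k. c m = 0) \<and>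
    (\<forall>s t. (\<Prod>j<k. s * b j - t * a j) = (\<Sum>m\<le>k. c m * (s ^ m * t ^ (k - m)))))" for k
  have cc: "c k k = (\<Prod>j<k. b j) \<and> (\<forall>m>k. c k m = 0) \<and>
    (\<forall>s t. (\<Prod>j<k. s * b j - t * a j) = (\<Sum>m\<le>k. c k m * (s ^ m * t ^ (k - m))))" for k
    unfolding c_def by (rule someI_ex[OF prod_linear_form_coeffs])
  have c: "c k k = (\<Prod>j<k. b j)" "m > k \<Longrightarrow> c k m = 0"
    "(\<Prod>j<k. s * b j - t * a j) = (\<Sum>m\<le>k. c k m * (s ^ m * t ^ (k - m)))" for k m s t
    using cc[of k] by simp_all
  define C where "C = Matrix.mat N N (\<lambda>(m, k). c k m)"
  define L where "L = Matrix.mat N N (\<lambda>(i, k). (\<Prod>j<k. a i * b j - b i * a j) * b i ^ (N - 1 - k))"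
  have carr: "vdm N a b \<in> carrier_mat N N" "C \<in> carrier_mat N N" "L \<in> carrier_mat N N" by (simp_all add: vdm_def C_def L_def)
  have L: "vdm N a b * C = L"
  proof (rule eq_matI)
    fix i k assume "i < dim_row L" "k < dim_col L"
    then have ik: "i < N" "k < N" by (simp_all add: L_def)
    have "(vdm N a b * C) $$ (i, k) = (\<Sum>m<N. (a i ^ m * b i ^ (N - 1 - m)) * c k m)"
      using ik by (simp add: vdm_def C_def scalar_prod_def atLeast0LessThan)
    also have "\<dots> = (\<Sum>m\<le>k. (a i ^ m * b i ^ (N - 1 - m)) * c k m)"
      by (rule sum.mono_neutral_right) (use ik c(2) in auto)
    also have "\<dots> = (\<Sum>m\<le>k. c k m * (a i ^ m * b i ^ (k - m)) * b i ^ (N - 1 - k))"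
    proof (rule sum.cong[OF refl])
      fix m assume "m \<in> {..k}"
      then have "N - 1 - m = (k - m) + (N - 1 - k)" using ik by auto
      then show "(a i ^ m * b i ^ (N - 1 - m)) * c k m = c k m * (a i ^ m * b i ^ (k - m)) * b i ^ (N - 1 - k)"
        by (simp only: power_add mult_ac)
    qed
    also have "\<dots> = L $$ (i, k)" using ik by (simp add: L_def c(3) sum_distrib_right)
    finally show "(vdm N a b * C) $$ (i, k) = L $$ (i, k)" .
  qed (simp_all add: vdm_def C_def L_def)
  have dC: "Determinant.det C = (\<Prod>k<N. \<Prod>j<k. b j)"
  proof -
    have "Determinant.det C = prod_list (diag_mat C)"
      by (rule det_upper_triangular[OF _ carr(2)]) (auto simp: C_def c(2) upper_triangular_def)
    then show ?thesis by (simp add: prod_list_diag[OF carr(2)]) (simp add: C_def c(1))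
  qed
  have dL: "Determinant.det L = (\<Prod>k<N. \<Prod>j<k. a k * b j - b k * a j) * (\<Prod>k<N. b k ^ (N - 1 - k))"
  proof -
    have z: "(\<Prod>l<j. a i * b l - b i * a l) = 0" if "i < j" for i j
      by (rule prod_zero, simp, rule bexI[of _ i], use that in \<open>simp_all add: mult.commute\<close>)
    have "Determinant.det L = prod_list (diag_mat L)"
      by (rule det_lower_triangular[OF _ carr(3)]) (simp add: L_def z)
    then show ?thesis by (simp add: prod_list_diag[OF carr(3)]) (simp add: L_def prod.distrib)
  qed
  have "Determinant.det (vdm N a b) * (\<Prod>k<N. b k ^ (N - 1 - k)) = (\<Prod>k<N. \<Prod>j<k. a k * b j - b k * a j) * (\<Prod>k<N. b k ^ (N - 1 - k))"
    using det_mult[OF carr(1,2)] unfolding L dC dL prod_index_power by (rule sym)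
  moreover have "(\<Prod>k<N. b k ^ (N - 1 - k)) \<noteq> 0" using b by auto
  ultimately show ?thesis by (rule mult_right_cancel[THEN iffD1, rotated])
qed

text \<open>Both sides are continuous in \<open>b\<close>. Adding one small
  \<open>e \<noteq> 0\<close> to all \<open>b i\<close> makes them nonzero, as
  \<open>det_vdm_nonzero\<close> requires in order to cancel powers of \<open>b\<close>.\<close>

lemma det_vdm: "Determinant.det (vdm N a b) = (\<Prod>k<N. \<Prod>j<k. a k * b j - b k * a j)"
proof -
  have 1: "((\<lambda>e. Determinant.det (vdm N a (\<lambda>i. b i + e))) \<longlongrightarrow> Determinant.det (vdm N a b)) (at 0)"
  proof -
    have d: "Determinant.det (vdm N a b) = (\<Sum>p\<in>{p. p permutes {0..<N}}. signof p * (\<Prod>i=0..<N. a i ^ p i * b i ^ (N - 1 - p i)))" for b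
    proof -
      have "Determinant.det (vdm N a b) = (\<Sum>p\<in>{p. p permutes {0..<N}}. signof p * (\<Prod>i=0..<N. vdm N a b $$ (i, p i)))"
        by (rule det_def'[of _ N]) (simp add: vdm_def)
      also have "\<dots> = (\<Sum>p\<in>{p. p permutes {0..<N}}. signof p * (\<Prod>i=0..<N. a i ^ p i * b i ^ (N - 1 - p i)))"
      proof (intro sum.cong refl arg_cong2[where f=times] prod.cong)
        fix p i assume "p \<in> {p. p permutes {0..<N}}" "i \<in> {0..<N}"
        then have "p i < N" "i < N" using permutes_in_image[of p "{0..<N}" i] by auto
        then show "vdm N a b $$ (i, p i) = a i ^ p i * b i ^ (N - 1 - p i)" by (simp add: vdm_def)
      qed
      finally show ?thesis .
    qed
    have "((\<lambda>e. Determinant.det (vdm N a (\<lambda>i. b i + e))) \<longlongrightarrow> Determinant.det (vdm N a (\<lambda>i. b i + 0))) (at 0)"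
      unfolding d by (intro tendsto_intros)
    then show ?thesis by simp
  qed
  have 2: "((\<lambda>e. \<Prod>k<N. \<Prod>j<k. a k * (b j + e) - (b k + e) * a j) \<longlongrightarrow> (\<Prod>k<N. \<Prod>j<k. a k * (b j + 0) - (b k + 0) * a j)) (at 0)"
    by (intro tendsto_intros)
  have nz: "\<forall>\<^sub>F e in at 0. b i + e \<noteq> 0" for i
  proof (cases "b i = 0")
    case True
    then show ?thesis by (simp add: eventually_at_filter)
  next
    case False
    have "((\<lambda>e. b i + e) \<longlongrightarrow> b i + 0) (at 0)" by (intro tendsto_intros)
    then show ?thesis using False by (intro tendsto_imp_eventually_ne) auto
  qed
  have "\<forall>\<^sub>F e in at 0. \<forall>i\<in>{..<N}. b i + e \<noteq> 0" by (intro eventually_ball_finite ballI nz) auto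
  then have "\<forall>\<^sub>F e in at 0. Determinant.det (vdm N a (\<lambda>i. b i + e)) = (\<Prod>k<N. \<Prod>j<k. a k * (b j + e) - (b k + e) * a j)"
    by eventually_elim (rule det_vdm_nonzero, simp)
  from Lim_transform_eventually[OF 1 this]
  have "((\<lambda>e. \<Prod>k<N. \<Prod>j<k. a k * (b j + e) - (b k + e) * a j) \<longlongrightarrow> Determinant.det (vdm N a b)) (at 0)" .
  from tendsto_unique[OF _ this 2] show ?thesis by simp
qed

text \<open>Ratio of the Vandermonde density to the squared modulus of the determinant of the
  \<open>sph\<close>: a factor 4 for each pair, from \<open>1 - qk x y = |x - y|^2 / 4\<close>,
  divided by the normalizations of the monomials.\<close>

definition vdm_const :: "nat \<Rightarrow> real" where
  "vdm_const N = (\<Prod>k<N. 4 ^ k) / (\<Prod>k<N. real N * real ((N - 1) choose k))"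

lemma vdm_const_pos: "vdm_const N > 0"
proof -
  have "(\<Prod>k<N. real N * real ((N - 1) choose k)) > 0" by (intro prod_pos) auto
  then show ?thesis unfolding vdm_const_def by (intro divide_pos_pos prod_pos) auto
qed

lemma det_smat_sph:
  assumes N: "N \<ge> 1"
  shows "(cmod (Determinant.det (onsys.smat N (sph N) x)))\<^sup>2
    = (\<Prod>k<N. real N * real ((N - 1) choose k)) * (cmod (Determinant.det (vdm N (\<lambda>i. sa (x (Suc i))) (\<lambda>i. sb (x (Suc i))))))\<^sup>2"
proof -
  interpret onsys N "sph N" by (rule onsys_sph[OF N])
  define c where "c k = complex_of_real (sqrt (real N * real ((N - 1) choose k)))" for k
  define V where "V = vdm N (\<lambda>i. sa (x (Suc i))) (\<lambda>i. sb (x (Suc i)))"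
  define D where "D = Matrix.mat N N (\<lambda>(i, j). if i = j then c i else 0)"
  have carr: "V \<in> carrier_mat N N" "D \<in> carrier_mat N N" by (simp_all add: V_def vdm_def D_def)
  have "smat x = V * D"
  proof (rule eq_matI)
    fix i k assume "i < dim_row (V * D)" "k < dim_col (V * D)"
    then have ik: "i < N" "k < N" by (simp_all add: V_def vdm_def D_def)
    have "(V * D) $$ (i, k) = (\<Sum>m<N. (sa (x (Suc i)) ^ m * sb (x (Suc i)) ^ (N - 1 - m)) * (if m = k then c m else 0))"
      using ik by (simp add: V_def vdm_def D_def scalar_prod_def atLeast0LessThan)
    also have "\<dots> = (\<Sum>m<N. if m = k then (sa (x (Suc i)) ^ m * sb (x (Suc i)) ^ (N - 1 - m)) * c m else 0)"
      by (intro sum.cong refl) simp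
    also have "\<dots> = smat x $$ (i, k)" using ik by (simp add: smat_def sph_def smono_def c_def mult_ac)
    finally show "smat x $$ (i, k) = (V * D) $$ (i, k)" by simp
  qed (simp_all add: smat_def V_def vdm_def D_def)
  then have "Determinant.det (smat x) = Determinant.det V * Determinant.det D" by (simp only: det_mult[OF carr])
  moreover have "Determinant.det D = (\<Prod>k<N. c k)"
  proof -
    have "Determinant.det D = prod_list (diag_mat D)"
      by (rule det_upper_triangular[OF _ carr(2)]) (auto simp: D_def upper_triangular_def)
    then show ?thesis by (simp add: prod_list_diag[OF carr(2)]) (simp add: D_def)
  qed
  moreover have "(cmod (\<Prod>k<N. c k))\<^sup>2 = (\<Prod>k<N. real N * real ((N - 1) choose k))"
    unfolding prod_norm[symmetric] prod_power_distrib by (intro prod.cong refl) (simp add: c_def)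
  ultimately show ?thesis unfolding V_def[symmetric] by (simp add: norm_mult power_mult_distrib)
qed

lemma vandermonde_sq_det:
  assumes N: "N \<ge> 1" and x: "\<And>i. i \<in> {1..N} \<Longrightarrow> x i \<in> S2"
  shows "vandermonde_sq N x = vdm_const N * (cmod (Determinant.det (onsys.smat N (sph N) x)))\<^sup>2"
proof -
  have e: "(norm (x i - x j))\<^sup>2 = 4 * (cmod (sa (x j) * sb (x i) - sb (x j) * sa (x i)))\<^sup>2" if "i \<in> {1..N}" "j \<in> {1..N}" for i j
  proof -
    have "(norm (x i - x j))\<^sup>2 = 4 * (1 - qk (x j) (x i))"
      using qk_eq_dist[OF x[OF that(1)] x[OF that(2)]] by (simp add: qk_commute)
    then show ?thesis unfolding one_minus_qk_spinor[OF x[OF that(2)] x[OF that(1)]] .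
  qed
  have "vandermonde_sq N x = (\<Prod>j\<in>{1..N}. \<Prod>i\<in>{1..<j}. 4 * (cmod (sa (x j) * sb (x i) - sb (x j) * sa (x i)))\<^sup>2)"
    unfolding vandermonde_sq_def by (intro prod.cong refl e) auto
  also have "\<dots> = (\<Prod>k<N. \<Prod>i\<in>{1..<Suc k}. 4 * (cmod (sa (x (Suc k)) * sb (x i) - sb (x (Suc k)) * sa (x i)))\<^sup>2)"
    by (rule prod.reindex_bij_witness[of _ Suc "\<lambda>i. i - 1"]) auto
  also have "\<dots> = (\<Prod>k<N. \<Prod>j<k. 4 * (cmod (sa (x (Suc k)) * sb (x (Suc j)) - sb (x (Suc k)) * sa (x (Suc j))))\<^sup>2)"
    by (rule prod.cong[OF refl], rule prod.reindex_bij_witness[of _ Suc "\<lambda>i. i - 1"]) auto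
  also have "\<dots> = (\<Prod>k<N. 4 ^ k) * (cmod (Determinant.det (vdm N (\<lambda>i. sa (x (Suc i))) (\<lambda>i. sb (x (Suc i))))))\<^sup>2"
    unfolding det_vdm by (simp add: prod.distrib prod_norm[symmetric] prod_power_distrib)
  finally have "vandermonde_sq N x = (\<Prod>k<N. 4 ^ k) * (cmod (Determinant.det (vdm N (\<lambda>i. sa (x (Suc i))) (\<lambda>i. sb (x (Suc i))))))\<^sup>2" .
  moreover have "(\<Prod>k<N. real N * real ((N - 1) choose k)) > 0" by (intro prod_pos) (use N in auto)
  moreover have "A * B = A / Q * (Q * B)" if "Q > 0" for A B Q :: real using that by simp
  ultimately show ?thesis unfolding det_smat_sph[OF N] vdm_const_def by metis
qed

lemma space_sphere_config: "x \<in> space (sphere_config N) \<Longrightarrow> i \<in> {1..N} \<Longrightarrow> x i \<in> S2"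
  unfolding sphere_config_def space_PiM by (drule PiE_mem, assumption) (simp only: space_sigma_S2)

lemma spherical_Z_eq: 
  assumes N: "N \<ge> 1" shows "spherical_Z N = vdm_const N * fact N"
proof -
  interpret onsys N "sph N" by (rule onsys_sph[OF N])
  have "spherical_Z N = (LINT x|sphere_config N. vdm_const N * (cmod (Determinant.det (smat x)))\<^sup>2)"
    unfolding spherical_Z_def by (rule Bochner_Integration.integral_cong[OF refl], rule vandermonde_sq_det[OF N], rule space_sphere_config)
  then show ?thesis by (simp add: integral_det)
qed

lemma measurable_component_S2: "i \<in> {1..N} \<Longrightarrow> (\<lambda>x. x i) \<in> measurable (sphere_config N) (restrict_space borel S2)"
proof -
  assume "i \<in> {1..N}"
  then have "(\<lambda>x. x i) \<in> measurable (sphere_config N) sigma_S2" unfolding sphere_config_def by (rule measurable_component_singleton)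
  then show ?thesis by (simp cong: measurable_cong_sets)
qed

lemma measurable_component_borel: "i \<in> {1..N} \<Longrightarrow> (\<lambda>x. x i) \<in> borel_measurable (sphere_config N)"
  using measurable_component_S2 by (simp add: measurable_restrict_space2_iff)

lemma measurable_vandermonde: "vandermonde_sq N \<in> borel_measurable (sphere_config N)"
proof -
  have [measurable]: "(\<lambda>x. x i) \<in> borel_measurable (sphere_config N)" if "i \<in> {1..N}" for i by (rule measurable_component_borel[OF that])
  show ?thesis unfolding vandermonde_sq_def[abs_def] by (intro borel_measurable_prod borel_measurable_power borel_measurable_norm borel_measurable_diff measurable_component_borel) auto
qed

lemma sets_ensemble: "sets (spherical_ensemble N) = sets (sphere_config N)" "space (spherical_ensemble N) = space (sphere_config N)"
  by (simp_all add: spherical_ensemble_def)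

lemma nn_integral_ensemble:
  assumes f: "f \<in> borel_measurable (sphere_config N)"
  shows "(\<integral>\<^sup>+x. f x \<partial>spherical_ensemble N) = (\<integral>\<^sup>+x. ennreal (vandermonde_sq N x / spherical_Z N) * f x \<partial>sphere_config N)"
proof -
  note [measurable] = measurable_vandermonde f
  show ?thesis unfolding spherical_ensemble_def by (subst nn_integral_density) auto
qed

lemma ensemble_density:
  assumes N: "N \<ge> 1" and x: "x \<in> space (sphere_config N)"
  shows "vandermonde_sq N x / spherical_Z N = (cmod (Determinant.det (onsys.smat N (sph N) x)))\<^sup>2 / fact N"
  using vandermonde_sq_det[OF N space_sphere_config[OF x]] vdm_const_pos[of N] by (simp add: spherical_Z_eq[OF N])

lemma prob_space_ensemble: 
  assumes N: "N \<ge> 1" shows "prob_space (spherical_ensemble N)"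
proof
  interpret onsys N "sph N" by (rule onsys_sph[OF N])
  have "emeasure (spherical_ensemble N) (space (spherical_ensemble N)) = (\<integral>\<^sup>+x. 1 \<partial>spherical_ensemble N)" by simp
  also have "\<dots> = (\<integral>\<^sup>+x. ennreal (vandermonde_sq N x / spherical_Z N) * 1 \<partial>sphere_config N)" by (rule nn_integral_ensemble) simp
  also have "\<dots> = (\<integral>\<^sup>+x. ennreal ((cmod (Determinant.det (smat x)))\<^sup>2 / fact N) \<partial>sphere_config N)"
    by (intro nn_integral_cong) (simp add: ensemble_density[OF N])
  also have "\<dots> = ennreal (LINT x|sphere_config N. (cmod (Determinant.det (smat x)))\<^sup>2 / fact N)"
    by (intro nn_integral_eq_integral integrable_divide_zero integrable_det) auto
  also have "\<dots> = 1" by (simp add: integral_det)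
  finally show "emeasure (spherical_ensemble N) (space (spherical_ensemble N)) = 1" .
qed

lemma measurable_dev:
  assumes u: "continuous_on S2 u" shows "(\<lambda>x. dev N x u) \<in> borel_measurable (sphere_config N)"
  unfolding dev_def
  by (intro borel_measurable_diff borel_measurable_sum borel_measurable_const measurable_compose[OF measurable_component_S2 S2_cont_measurable[OF u]])

theorem exp_moment:
  assumes N: "N \<ge> 1" and u: "continuous_on S2 u"
  shows "(\<integral>\<^sup>+x. ennreal (exp (dev N x u)) \<partial>spherical_ensemble N)
    \<le> ennreal (exp ((LINT x|sigma_S2. (LINT y|sigma_S2. exp (u x) * exp (- u y) * ((real N)\<^sup>2 * qk x y ^ (N - 1)))) - real N))"
proof -
  interpret onsys N "sph N" by (rule onsys_sph[OF N])
  define T where "T = (LINT x|sigma_S2. (LINT y|sigma_S2. exp (u x) * exp (- u y) * ((real N)\<^sup>2 * qk x y ^ (N - 1))))"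
  note E = exp_moment_det[OF u sph_kernel_sq[OF N]]
  note [measurable] = measurable_dev[OF u]
  have "(\<integral>\<^sup>+x. ennreal (exp (dev N x u)) \<partial>spherical_ensemble N)
    = (\<integral>\<^sup>+x. ennreal (vandermonde_sq N x / spherical_Z N) * ennreal (exp (dev N x u)) \<partial>sphere_config N)"
    by (rule nn_integral_ensemble) measurable
  also have "\<dots> = (\<integral>\<^sup>+x. ennreal (exp (dev N x u) * (cmod (Determinant.det (smat x)))\<^sup>2 / fact N) \<partial>sphere_config N)"
    by (intro nn_integral_cong) (simp add: ensemble_density[OF N] ennreal_mult[symmetric] mult.commute)
  also have "\<dots> = ennreal (LINT x|sphere_config N. exp (dev N x u) * (cmod (Determinant.det (smat x)))\<^sup>2 / fact N)"
    by (intro nn_integral_eq_integral integrable_divide_zero E) auto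
  also have "\<dots> \<le> ennreal (exp (T - real N))"
  proof (rule ennreal_leI)
    have "(LINT x|sphere_config N. exp (dev N x u) * (cmod (Determinant.det (smat x)))\<^sup>2) \<le> fact N * exp (T - real N)"
      unfolding T_def by (rule E)
    then show "(LINT x|sphere_config N. exp (dev N x u) * (cmod (Determinant.det (smat x)))\<^sup>2 / fact N) \<le> exp (T - real N)"
      by (simp add: field_simps)
  qed
  finally show ?thesis unfolding T_def .
qed

section \<open>The pointwise bound of the density\<close>

text \<open>The trapezoidal rule on \<open>[1, 1 + x]\<close> overestimates the integral of the
  convex function \<open>1 / t\<close>. The derivative of the difference is a square.\<close>

lemma ln_one_plus_le_trapezoid:
  assumes "x \<ge> 0" shows "ln (1 + x) \<le> (x + x / (1 + x)) / (2::real)"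
proof -
  define f where "f t = (t + t / (1 + t)) / 2 - ln (1 + t)" for t :: real
  have "f 0 \<le> f x"
  proof (rule DERIV_nonneg_imp_nondecreasing[OF assms])
    fix t :: real assume t: "0 \<le> t" "t \<le> x"
    have "(f has_real_derivative (1 + 1 / (1 + t)\<^sup>2) / 2 - 1 / (1 + t)) (at t)"
      unfolding f_def using t by (auto intro!: derivative_eq_intros simp: power2_eq_square field_simps)
    moreover have "(1 + 1 / (1 + t)\<^sup>2) / 2 - 1 / (1 + t) = (1 - 1 / (1 + t))\<^sup>2 / 2"
    proof -
      define w where "w = 1 / (1 + t)"
      have "1 / (1 + t)\<^sup>2 = w\<^sup>2" by (simp add: w_def power_divide)
      then show ?thesis unfolding w_def[symmetric] by (simp add: power2_eq_square algebra_simps diff_divide_distrib add_divide_distrib)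
    qed
    ultimately show "\<exists>y. DERIV f t :> y \<and> 0 \<le> y" by (metis zero_le_divide_iff zero_le_power2 zero_le_numeral)
  qed
  then show ?thesis by (simp add: f_def)
qed

text \<open>The correction \<open>1 / n\<close> gives equality at \<open>n = 1\<close>; its decrease
  \<open>1 / (n * (n + 1))\<close> in the induction step covers the error
  \<open>1 / (4 * n * (n + 1))\<close> of the trapezoidal rule.\<close>

lemma stirling_lower:
  assumes "n \<ge> 1"
  shows "real n * ln (real n) - real n + ln (real n) / 2 + 1 / real n \<le> ln (fact n)"
  using assms
proof (induction n rule: dec_induct)
  case base show ?case by simp
next
  case (step n)
  then have n: "real n \<ge> 1" by simp
  have "(real n + 1/2) * ln (1 + 1 / real n) \<le> (real n + 1/2) * ((1 / real n + (1 / real n) / (1 + 1 / real n)) / 2)"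
    using n by (intro mult_left_mono ln_one_plus_le_trapezoid) auto
  also have "\<dots> = 1 + 1 / (4 * (real n * (real n + 1)))"
  proof -
    have "(1 / r) / (1 + 1 / r) = 1 / (r + 1)" "1 / r + 1 / (r + 1) = (2 * r + 1) / (r * (r + 1))" "r * (r + 1) > 0" if "r \<ge> 1" for r :: real
      using that by (simp_all add: field_simps add_pos_pos)
    note e = this[OF n]
    define p where "p = real n * (real n + 1)"
    have p: "p > 0" unfolding p_def by (rule e(3))
    have "(real n + 1/2) * ((2 * real n + 1) / p / 2) = ((real n + 1/2) * (2 * real n + 1)) / (2 * p)" by simp
    also have "(real n + 1/2) * (2 * real n + 1) = 2 * p + 1/2" by (simp add: p_def algebra_simps)
    also have "(2 * p + 1/2) / (2 * p) = 1 + 1 / (4 * p)" using p by (simp add: field_simps)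
    finally show ?thesis unfolding e p_def[symmetric] .
  qed
  also have "\<dots> \<le> 1 + 1 / (real n * (real n + 1))" using n by (intro add_left_mono divide_left_mono) auto
  also have "\<dots> = 1 + (1 / real n - 1 / (real n + 1))" using n by (simp add: field_simps)
  finally have k: "(real n + 1/2) * ln (1 + 1 / real n) \<le> 1 + (1 / real n - 1 / (real n + 1))" .
  have "1 + 1 / real n = (real n + 1) / real n" using n by (simp add: field_simps)
  then have l: "ln (1 + 1 / real n) = ln (real n + 1) - ln (real n)" using n by (simp add: ln_div)
  have "ln (fact (Suc n)) = ln (real n + 1) + ln (fact n :: real)" by (simp add: ln_mult_pos add.commute)
  then show ?case using step.IH k unfolding l by (simp add: algebra_simps) 
qed

lemma power_self_le_fact:
  assumes "n \<ge> 1" shows "real n ^ n / fact n \<le> exp (real n - ln (real n) / 2)"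
proof -
  have n: "real n > 0" using assms by simp
  have "real n ^ n = exp (real n * ln (real n))" using n by (simp add: exp_of_nat_mult)
  moreover have "fact n = exp (ln (fact n :: real))" by simp
  ultimately have "real n ^ n / fact n = exp (real n * ln (real n) - ln (fact n))" by (simp add: exp_diff)
  also have "\<dots> \<le> exp (real n - ln (real n) / 2)"
  proof -
    have "1 / real n \<ge> 0" by simp
    then have "real n * ln (real n) - ln (fact n) \<le> real n - ln (real n) / 2" using stirling_lower[OF assms] by linarith
    then show ?thesis by simp
  qed
  finally show ?thesis .
qed

text \<open>From \<open>(N choose k) * (N - k) = N * (N - 1 choose k)\<close>: the factors
  \<open>N - k\<close> multiply to \<open>N!\<close>.\<close>

lemma prod_binomial_Suc:
  "(\<Prod>k<Suc N. real (N choose k)) = (\<Prod>k<N. real ((N - 1) choose k)) * (real N ^ N / fact N)"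
proof -
  have f: "(\<Prod>k<N. real (N - k)) = fact N"
  proof -
    have "(\<Prod>k<N. real (N - k)) = (\<Prod>k\<in>{1..N}. real k)"
      by (rule prod.reindex_bij_witness[of _ "\<lambda>k. N - k" "\<lambda>k. N - k"]) auto
    then show ?thesis by (simp add: fact_prod)
  qed
  have "real (N choose k) * real (N - k) = real N * real ((N - 1) choose k)" for k
    using binomial_absorb_comp[of N k] by (metis of_nat_mult mult.commute)
  then have "(\<Prod>k<N. real (N choose k) * real (N - k)) = (\<Prod>k<N. real N * real ((N - 1) choose k))" by (intro prod.cong refl)
  then have "(\<Prod>k<N. real (N choose k)) * fact N = real N ^ N * (\<Prod>k<N. real ((N - 1) choose k))"
    by (simp only: prod.distrib f prod_constant card_lessThan)
  then show ?thesis by (simp add: field_simps)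
qed

text \<open>Each step multiplies by \<open>N^N / N!\<close>, at most
  \<open>exp (N - ln N / 2)\<close>. The first term sums to \<open>N^2 / 2\<close>, and the half
  logarithms to the term \<open>- N * ln N / 2\<close>, which must be kept because it has to cancel
  in \<open>ensemble_density_le\<close>.\<close>

lemma prod_binomial_le:
  assumes "N \<ge> 1"
  shows "(\<Prod>k<N. real ((N - 1) choose k)) \<le> exp ((real N)\<^sup>2 / 2 - real N * ln (real N) / 2 + real N / 2)"
  using assms
proof (induction N rule: dec_induct)
  case base show ?case by simp
next
  case (step N)
  then have N: "real N \<ge> 1" by simp
  have "(\<Prod>k<Suc N. real ((Suc N - 1) choose k)) = (\<Prod>k<N. real ((N - 1) choose k)) * (real N ^ N / fact N)"
    using prod_binomial_Suc[of N] by simp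
  also have "\<dots> \<le> exp ((real N)\<^sup>2 / 2 - real N * ln (real N) / 2 + real N / 2) * exp (real N - ln (real N) / 2)"
    using step N by (intro mult_mono power_self_le_fact) auto
  also have "\<dots> = exp ((real N)\<^sup>2 / 2 - (real N + 1) * ln (real N) / 2 + real N / 2 + real N)"
    by (simp add: exp_add[symmetric] field_simps)
  also have "\<dots> \<le> exp ((real (Suc N))\<^sup>2 / 2 - real (Suc N) * ln (real (Suc N)) / 2 + real (Suc N) / 2)"
  proof -
    have "1 + 1 / real N = (real N + 1) / real N" using N by (simp add: field_simps)
    then have "ln (real N + 1) - ln (real N) = ln (1 + 1 / real N)" using N by (simp only:) (simp add: ln_div)
    also have "\<dots> \<le> 1 / real N" by (rule ln_add_one_self_le_self) simp
    finally have "(real N + 1) * (ln (real N + 1) - ln (real N)) \<le> (real N + 1) * (1 / real N)" using N by (intro mult_left_mono) auto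
    also have "\<dots> \<le> 2" using N by (simp add: field_simps)
    finally have "(real N + 1) * ln (real N + 1) \<le> (real N + 1) * ln (real N) + 2" by (simp add: right_diff_distrib)
    then show ?thesis by (simp add: power2_eq_square field_simps)
  qed
  finally show ?case .
qed

text \<open>At most \<open>1 / n\<close>, as the logarithmic series allows, but with sum only \<open>2 + ln N\<close>.\<close>

definition aw :: "nat \<Rightarrow> nat \<Rightarrow> real" where
  "aw N n = (if n \<le> N then 1 / real n else real N / (real n)\<^sup>2)"

lemma aw_nonneg: "aw N n \<ge> 0" by (simp add: aw_def)

lemma aw_0[simp]: "aw N 0 = 0" by (simp add: aw_def)

lemma aw_le: "aw N n \<le> 1 / real n"
proof (cases "n \<le> N")
  case False
  then have "real N / (real n * real n) \<le> real n / (real n * real n)" by (intro divide_right_mono) auto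
  then show ?thesis using False by (simp add: aw_def power2_eq_square)
qed (simp add: aw_def)

lemma aw_le_sq: "aw N n \<le> real N / (real n)\<^sup>2"
proof (cases "n \<le> N \<and> n > 0")
  case True
  then have "real n / (real n * real n) \<le> real N / (real n * real n)" by (intro divide_right_mono) auto
  then show ?thesis using True by (simp add: aw_def power2_eq_square)
qed (auto simp: aw_def)

lemma sum_inverse_sq_tail: 
  assumes "N \<ge> 1" "M \<ge> N" shows "(\<Sum>n\<in>{N<..M}. 1 / (real n)\<^sup>2) \<le> 1 / real N - 1 / real M"
  using assms(2)
proof (induction M rule: dec_induct)
  case base show ?case by simp
next
  case (step M)
  have M: "real M > 0" using step assms by simp
  have "{N<..Suc M} = insert (Suc M) {N<..M}" using step by auto
  then have "(\<Sum>n\<in>{N<..Suc M}. 1 / (real n)\<^sup>2) \<le> 1 / (real (Suc M))\<^sup>2 + (1 / real N - 1 / real M)" using step.IH by simp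
  moreover have "1 / (real (Suc M))\<^sup>2 \<le> 1 / real M - 1 / real (Suc M)"
  proof -
    have "1 / (real (Suc M))\<^sup>2 \<le> 1 / (real M * real (Suc M))"
      unfolding power2_eq_square using M by (intro divide_left_mono mult_right_mono) auto
    also have "\<dots> = 1 / real M - 1 / real (Suc M)" using M by (simp add: field_simps)
    finally show ?thesis .
  qed
  ultimately show ?case by linarith
qed

lemma harmonic_le: 
  assumes "N \<ge> 1" shows "(\<Sum>n\<in>{1..N}. 1 / real n) \<le> 1 + ln (real N)"
  using assms
proof (induction N rule: dec_induct)
  case base show ?case by simp
next
  case (step N)
  have N: "real N > 0" using step by simp
  have "ln (real N / (real N + 1)) \<le> real N / (real N + 1) - 1" using N by (intro ln_le_minus_one) auto
  then have "1 / (real N + 1) \<le> ln (real N + 1) - ln (real N)" using N by (simp add: ln_div field_simps)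
  then show ?case using step by (simp add: add.commute)
qed

lemma sum_aw_le: 
  assumes "N \<ge> 1" "M \<ge> N" shows "(\<Sum>n\<in>{1..M}. aw N n) \<le> 2 + ln (real N)"
proof -
  have N: "real N > 0" using assms by simp
  have "{1..M} = {1..N} \<union> {N<..M}" using assms by auto
  then have "(\<Sum>n\<in>{1..M}. aw N n) = (\<Sum>n\<in>{1..N}. aw N n) + (\<Sum>n\<in>{N<..M}. aw N n)"
    by (simp only:) (rule sum.union_disjoint, auto)
  also have "\<dots> = (\<Sum>n\<in>{1..N}. 1 / real n) + (\<Sum>n\<in>{N<..M}. real N * (1 / (real n)\<^sup>2))"
    by (intro arg_cong2[where f="(+)"] sum.cong) (auto simp: aw_def)
  also have "\<dots> \<le> (1 + ln (real N)) + real N * (1 / real N - 1 / real M)"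
    unfolding sum_distrib_left[symmetric] by (intro add_mono mult_left_mono harmonic_le sum_inverse_sq_tail assms) auto
  also have "\<dots> \<le> (1 + ln (real N)) + real N * (1 / real N)" by (intro add_left_mono mult_left_mono) auto
  finally show ?thesis using N by simp
qed

lemma sum_aw_ge:
  assumes "N \<ge> 1" "M \<ge> N" shows "(\<Sum>n\<in>{1..M}. aw N n / (real n + 1)) \<ge> 1 - 1 / real N"
proof -
  have t: "(\<Sum>n\<in>{1..N}. 1 / (real n * (real n + 1))) = 1 - 1 / (real N + 1)" for N
  proof (induction N)
    case (Suc N)
    have "1 / (real (Suc N) * (real (Suc N) + 1)) = 1 / real (Suc N) - 1 / (real (Suc N) + 1)" by (simp add: divide_simps)
    then show ?case using Suc by simp
  qed simp
  have "1 - 1 / real N \<le> 1 - 1 / (real N + 1)" using assms by (simp add: field_simps)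
  also have "\<dots> = (\<Sum>n\<in>{1..N}. aw N n / (real n + 1))"
    unfolding t[symmetric] by (intro sum.cong refl) (simp add: aw_def)
  also have "\<dots> \<le> (\<Sum>n\<in>{1..M}. aw N n / (real n + 1))"
    by (rule sum_mono2) (use assms in \<open>auto simp: aw_nonneg\<close>)
  finally show ?thesis .
qed

text \<open>The weights are at most \<open>1 / n\<close>, so the sum is bounded by the series of
  \<open>- ln (1 - q)\<close>.\<close>

lemma one_minus_le_exp_series:
  fixes q :: real assumes q: "0 \<le> q" "q \<le> 1"
  shows "1 - q \<le> exp (- (\<Sum>n\<in>{1..M}. aw N n * q ^ n))"
proof (cases "q = 1")
  case True then show ?thesis by simp
next
  case False
  then have q1: "q < 1" using q by simp
  have "(\<Sum>n\<in>{1..M}. aw N n * q ^ n) \<le> (\<Sum>n\<in>{1..M}. q ^ n / real n)"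
    using aw_le q(1) by (intro sum_mono) (metis mult_right_mono mult.commute times_divide_eq_right mult.right_neutral zero_le_power)
  also have "\<dots> \<le> - ln (1 - q)"
  proof -
    have "(\<lambda>n. - ((- (- q)) ^ n) / real n) sums ln (1 + (- q))" using q q1 by (intro ln_series') auto
    then have s: "(\<lambda>n. q ^ n / real n) sums (- ln (1 - q))" using sums_minus by fastforce
    have "(\<Sum>n\<in>{1..M}. q ^ n / real n) \<le> (\<Sum>n. q ^ n / real n)"
      by (rule sum_le_suminf) (use s q in \<open>auto simp: sums_iff\<close>)
    then show ?thesis using s by (simp add: sums_iff)
  qed
  finally have "ln (1 - q) \<le> - (\<Sum>n\<in>{1..M}. aw N n * q ^ n)" by simp
  then show ?thesis using q1 by (simp add: ln_le_cancel_iff[symmetric] del: ln_le_cancel_iff) 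
qed

lemma sum_symmetric_pairs:
  fixes f :: "nat \<Rightarrow> nat \<Rightarrow> real" assumes "\<And>i j. f i j = f j i"
  shows "(\<Sum>i\<in>{1..N}. \<Sum>j\<in>{1..N}. f i j) = 2 * (\<Sum>j\<in>{1..N}. \<Sum>i\<in>{1..<j}. f i j) + (\<Sum>i\<in>{1..N}. f i i)"
proof (induction N)
  case (Suc N)
  have e: "{1..<Suc N} = {1..N}" by auto
  have "(\<Sum>i\<in>{1..Suc N}. \<Sum>j\<in>{1..Suc N}. f i j) = (\<Sum>i\<in>{1..N}. \<Sum>j\<in>{1..N}. f i j) + (\<Sum>i\<in>{1..N}. f i (Suc N)) + (\<Sum>j\<in>{1..N}. f (Suc N) j) + f (Suc N) (Suc N)"
    by (simp add: sum.distrib)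
  also have "(\<Sum>j\<in>{1..N}. f (Suc N) j) = (\<Sum>i\<in>{1..N}. f i (Suc N))" by (intro sum.cong refl assms)
  finally show ?case using Suc e by simp
qed simp

text \<open>Summed over pairs, the logarithmic bound gives half the weighted sum of the
  \<open>QN\<close>, the mean-field energy \<open>N^2 / 2\<close> up to \<open>N / 2\<close>, and a
  diagonal of at most \<open>N + N * ln N / 2\<close>. The terms of order \<open>N^2\<close> and
  \<open>N * ln N\<close> cancel against the partition function and leave \<open>3 * N\<close>. With
  the full weights \<open>1 / n\<close> the diagonal would grow with \<open>M\<close>.\<close>

lemma ensemble_density_le:
  assumes N: "N \<ge> 1" and x: "x \<in> space (sphere_config N)" and M: "M \<ge> N"
  shows "vandermonde_sq N x / spherical_Z N \<le> exp (3 * real N - (\<Sum>n\<in>{1..M}. aw N n * QN N x n) / 2)"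
proof -
  have xS: "x i \<in> S2" if "i \<in> {1..N}" for i by (rule space_sphere_config[OF x that])
  have N0: "real N \<ge> 1" using N by simp
  define P where "P = (\<Prod>k<N. (4::real) ^ k)"
  define B where "B = (\<Prod>k<N. real N * real ((N - 1) choose k))"
  define E where "E j i = exp (- (\<Sum>n\<in>{1..M}. aw N n * qk (x i) (x j) ^ n))" for i j
  define Y where "Y = (\<Sum>n\<in>{1..M}. aw N n * QN N x n)"
  have P0: "P > 0" unfolding P_def by (rule prod_pos) auto
  have B0: "B > 0" unfolding B_def by (rule prod_pos) (use N in auto)
  have "vandermonde_sq N x = (\<Prod>j\<in>{1..N}. \<Prod>i\<in>{1..<j}. 4 * (1 - qk (x i) (x j)))"
    unfolding vandermonde_sq_def
  proof (intro prod.cong refl)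
    fix i j assume "j \<in> {1..N}" "i \<in> {1..<j}"
    then have ij: "i \<in> {1..N}" "j \<in> {1..N}" by auto
    show "(norm (x i - x j))\<^sup>2 = 4 * (1 - qk (x i) (x j))" using qk_eq_dist[OF xS[OF ij(1)] xS[OF ij(2)]] by simp
  qed
  also have "\<dots> \<le> (\<Prod>j\<in>{1..N}. \<Prod>i\<in>{1..<j}. 4 * E j i)"
  proof -
    have r: "0 \<le> 1 - qk (x i) (x j)" "1 - qk (x i) (x j) \<le> E j i" if "j \<in> {1..N}" "i \<in> {1..<j}" for i j
    proof -
      have ij: "i \<in> {1..N}" "j \<in> {1..N}" using that by auto
      note b = qk_nonneg[OF xS[OF ij(1)] xS[OF ij(2)]] qk_le_1[OF xS[OF ij(1)] xS[OF ij(2)]]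
      show "0 \<le> 1 - qk (x i) (x j)" using b by simp
      show "1 - qk (x i) (x j) \<le> E j i" unfolding E_def by (rule one_minus_le_exp_series[OF b])
    qed
    show ?thesis by (intro prod_mono conjI prod_nonneg mult_left_mono mult_nonneg_nonneg r) simp_all
  qed
  also have "\<dots> = P * exp (- (\<Sum>j\<in>{1..N}. \<Sum>i\<in>{1..<j}. (\<Sum>n\<in>{1..M}. aw N n * qk (x i) (x j) ^ n)))"
  proof -
    have "(\<Prod>j\<in>{1..N}. (4::real) ^ (j - 1)) = P"
      unfolding P_def by (rule prod.reindex_bij_witness[of _ Suc "\<lambda>i. i - 1"]) auto
    then show ?thesis by (simp add: prod.distrib E_def exp_sum[symmetric] sum_negf)
  qed
  also have "(\<Sum>j\<in>{1..N}. \<Sum>i\<in>{1..<j}. (\<Sum>n\<in>{1..M}. aw N n * qk (x i) (x j) ^ n))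
    = (\<Sum>n\<in>{1..M}. aw N n * ((QN N x n + (real N)\<^sup>2 / (real n + 1) - real N) / 2))"
  proof -
    have q: "(\<Sum>j\<in>{1..N}. \<Sum>i\<in>{1..<j}. qk (x i) (x j) ^ n) = (QN N x n + (real N)\<^sup>2 / (real n + 1) - real N) / 2" for n
    proof -
      have "(\<Sum>i\<in>{1..N}. \<Sum>j\<in>{1..N}. qk (x i) (x j) ^ n) = 2 * (\<Sum>j\<in>{1..N}. \<Sum>i\<in>{1..<j}. qk (x i) (x j) ^ n) + (\<Sum>i\<in>{1..N}. qk (x i) (x i) ^ n)"
        by (rule sum_symmetric_pairs) (simp only: qk_commute)
      moreover have "(\<Sum>i\<in>{1..N}. qk (x i) (x i) ^ n) = (\<Sum>i\<in>{1..N}. 1)"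
        by (rule sum.cong[OF refl]) (simp only: qk_self[OF xS] power_one)
      ultimately show ?thesis by (simp add: QN_def)
    qed
    have "(\<Sum>j\<in>{1..N}. \<Sum>i\<in>{1..<j}. (\<Sum>n\<in>{1..M}. aw N n * qk (x i) (x j) ^ n))
      = (\<Sum>j\<in>{1..N}. \<Sum>n\<in>{1..M}. \<Sum>i\<in>{1..<j}. aw N n * qk (x i) (x j) ^ n)"
      by (rule sum.cong[OF refl], rule sum.swap)
    also have "\<dots> = (\<Sum>n\<in>{1..M}. \<Sum>j\<in>{1..N}. \<Sum>i\<in>{1..<j}. aw N n * qk (x i) (x j) ^ n)" by (rule sum.swap)
    also have "\<dots> = (\<Sum>n\<in>{1..M}. aw N n * ((QN N x n + (real N)\<^sup>2 / (real n + 1) - real N) / 2))"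
      by (simp only: sum_distrib_left[symmetric] q)
    finally show ?thesis .
  qed
  also have "\<dots> = Y / 2 + ((real N)\<^sup>2 / 2) * (\<Sum>n\<in>{1..M}. aw N n / (real n + 1)) - (real N / 2) * (\<Sum>n\<in>{1..M}. aw N n)"
    unfolding Y_def sum_distrib_left sum_divide_distrib sum.distrib[symmetric] sum_subtractf[symmetric]
    by (intro sum.cong refl) (simp add: field_simps)
  finally have v: "vandermonde_sq N x \<le> P * exp (- (Y / 2 + ((real N)\<^sup>2 / 2) * (\<Sum>n\<in>{1..M}. aw N n / (real n + 1)) - (real N / 2) * (\<Sum>n\<in>{1..M}. aw N n)))" .
  also have "\<dots> \<le> P * exp (- (Y / 2) - (real N)\<^sup>2 / 2 + real N / 2 + (real N + real N * ln (real N) / 2))"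
  proof -
    have "((real N)\<^sup>2 / 2) * (1 - 1 / real N) \<le> ((real N)\<^sup>2 / 2) * (\<Sum>n\<in>{1..M}. aw N n / (real n + 1))"
      by (intro mult_left_mono sum_aw_ge N M) simp
    moreover have "((real N)\<^sup>2 / 2) * (1 - 1 / real N) = (real N)\<^sup>2 / 2 - real N / 2" using N0 by (simp add: power2_eq_square field_simps)
    moreover have "(real N / 2) * (\<Sum>n\<in>{1..M}. aw N n) \<le> (real N / 2) * (2 + ln (real N))"
      by (intro mult_left_mono sum_aw_le N M) simp
    moreover have "(real N / 2) * (2 + ln (real N)) = real N + real N * ln (real N) / 2" by (simp add: field_simps)
    ultimately show ?thesis using P0 by (intro mult_left_mono) auto
  qed
  finally have v: "vandermonde_sq N x \<le> P * exp (- (Y / 2) - (real N)\<^sup>2 / 2 + real N / 2 + (real N + real N * ln (real N) / 2))" .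
  have Z: "spherical_Z N = P / B * fact N" by (simp add: spherical_Z_eq[OF N] vdm_const_def P_def B_def)
  have Z0: "spherical_Z N > 0" unfolding Z using P0 B0 by simp
  have BB: "B / fact N \<le> exp ((real N)\<^sup>2 / 2 - real N * ln (real N) / 2 + real N / 2 + real N)"
  proof -
    have "B / fact N = (\<Prod>k<N. real ((N - 1) choose k)) * (real N ^ N / fact N)" by (simp add: B_def prod.distrib)
    also have "\<dots> \<le> exp ((real N)\<^sup>2 / 2 - real N * ln (real N) / 2 + real N / 2) * exp (real N - ln (real N) / 2)"
      by (intro mult_mono prod_binomial_le power_self_le_fact N) auto
    also have "\<dots> \<le> exp ((real N)\<^sup>2 / 2 - real N * ln (real N) / 2 + real N / 2) * exp (real N)"
      using N0 by (intro mult_left_mono) auto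
    finally show ?thesis by (simp only: exp_add)
  qed
  have "vandermonde_sq N x / spherical_Z N \<le> P * exp (- (Y / 2) - (real N)\<^sup>2 / 2 + real N / 2 + (real N + real N * ln (real N) / 2)) / spherical_Z N"
    using v Z0 by (intro divide_right_mono) auto
  also have "\<dots> = exp (- (Y / 2) - (real N)\<^sup>2 / 2 + real N / 2 + (real N + real N * ln (real N) / 2)) * (B / fact N)"
    unfolding Z using P0 B0 by (simp add: field_simps)
  also have "\<dots> \<le> exp (- (Y / 2) - (real N)\<^sup>2 / 2 + real N / 2 + (real N + real N * ln (real N) / 2)) * exp ((real N)\<^sup>2 / 2 - real N * ln (real N) / 2 + real N / 2 + real N)"
    by (intro mult_left_mono BB) simp
  also have "\<dots> = exp (3 * real N - Y / 2)" by (simp add: exp_add[symmetric])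
  finally show ?thesis unfolding Y_def .
qed

definition Yn :: "nat \<Rightarrow> (nat \<Rightarrow> real^3) \<Rightarrow> real" where
  "Yn N x = (\<Sum>n. aw N n * QN N x n)"

lemma QN_le:
  assumes "\<And>i. i \<in> {1..N} \<Longrightarrow> x i \<in> S2" shows "QN N x n \<le> (real N)\<^sup>2"
proof -
  have "(\<Sum>i\<in>{1..N}. \<Sum>j\<in>{1..N}. qk (x i) (x j) ^ n) \<le> (\<Sum>i\<in>{1..N}. \<Sum>j\<in>{1..N}. 1)"
    by (intro sum_mono power_le_one qk_nonneg qk_le_1 assms)
  moreover have "(\<Sum>i\<in>{1..N}. \<Sum>j\<in>{1..N}. 1::real) = (real N)\<^sup>2" by (simp add: power2_eq_square)
  moreover have "(real N)\<^sup>2 / (real n + 1) \<ge> 0" by simp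
  ultimately show ?thesis unfolding QN_def by linarith
qed

lemma summable_Yn:
  assumes xS: "\<And>i. i \<in> {1..N} \<Longrightarrow> x i \<in> S2" shows "summable (\<lambda>n. aw N n * QN N x n)"
proof (rule summable_comparison_test)
  have "norm (aw N n * QN N x n) \<le> (real N * (real N)\<^sup>2) * inverse (real n ^ 2)" for n
  proof -
    have "aw N n * QN N x n \<le> real N / (real n)\<^sup>2 * (real N)\<^sup>2"
      by (intro mult_mono aw_le_sq QN_le xS QN_nonneg) auto
    moreover have "aw N n * QN N x n \<ge> 0" by (intro mult_nonneg_nonneg aw_nonneg QN_nonneg xS)
    ultimately show ?thesis by (simp add: field_simps)
  qed
  then show "\<exists>m. \<forall>n\<ge>m. norm (aw N n * QN N x n) \<le> (real N * (real N)\<^sup>2) * inverse (real n ^ 2)" by blast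
qed (rule summable_inverse_sq)

lemma sum_le_Yn:
  assumes xS: "\<And>i. i \<in> {1..N} \<Longrightarrow> x i \<in> S2" and J: "finite J" 
  shows "(\<Sum>n\<in>J. aw N n * QN N x n) \<le> Yn N x"
  unfolding Yn_def by (rule sum_le_suminf[OF summable_Yn[OF xS] J]) (assumption | rule mult_nonneg_nonneg aw_nonneg QN_nonneg xS)+

lemma ensemble_density_le_Yn:
  assumes N: "N \<ge> 1" and x: "x \<in> space (sphere_config N)"
  shows "vandermonde_sq N x / spherical_Z N \<le> exp (3 * real N - Yn N x / 2)"
proof -
  have "(\<lambda>M. \<Sum>n<M. aw N n * QN N x n) \<longlonglongrightarrow> Yn N x"
    unfolding Yn_def by (rule summable_LIMSEQ[OF summable_Yn]) (rule space_sphere_config[OF x])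
  then have "(\<lambda>M. \<Sum>n<Suc M. aw N n * QN N x n) \<longlonglongrightarrow> Yn N x" by (rule LIMSEQ_Suc)
  then have l: "(\<lambda>M. exp (3 * real N - (\<Sum>n<Suc M. aw N n * QN N x n) / 2)) \<longlonglongrightarrow> exp (3 * real N - Yn N x / 2)"
    by (intro tendsto_intros) auto
  have d: "vandermonde_sq N x / spherical_Z N \<le> exp (3 * real N - (\<Sum>n<Suc M. aw N n * QN N x n) / 2)" if "M \<ge> N" for M
  proof -
    have "{..<Suc M} = insert 0 {1..M}" by auto
    then have "(\<Sum>n<Suc M. aw N n * QN N x n) = (\<Sum>n\<in>{1..M}. aw N n * QN N x n)" by simp
    then show ?thesis using ensemble_density_le[OF N x that] by simp
  qed
  show ?thesis by (rule LIMSEQ_le_const[OF l]) (rule exI[of _ N], intro allI impI, erule d)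
qed

lemma measurable_QN: "(\<lambda>x. QN N x n) \<in> borel_measurable (sphere_config N)"
  unfolding QN_def qk_def
  by (intro borel_measurable_diff borel_measurable_sum borel_measurable_power borel_measurable_divide borel_measurable_add borel_measurable_inner borel_measurable_const measurable_component_borel)

lemma measurable_Yn: "Yn N \<in> borel_measurable (sphere_config N)"
  unfolding Yn_def[abs_def] by (intro borel_measurable_suminf borel_measurable_times measurable_QN borel_measurable_const)

lemma prob_space_config: "prob_space (sphere_config N)"
  unfolding sphere_config_def by (rule prob_space_PiM) (rule prob_space_sigma_S2)

text \<open>The density bound is pointwise and \<open>sphere_config N\<close> is a probability
  measure, so it passes to the event without a volume factor.\<close>

lemma Yn_tail:
  assumes N: "N \<ge> 1"
  shows "emeasure (spherical_ensemble N) {x \<in> space (sphere_config N). Yn N x > y} \<le> ennreal (exp (3 * real N - y / 2))"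
proof -
  interpret C: prob_space "sphere_config N" by (rule prob_space_config)
  define A where "A = {x \<in> space (sphere_config N). Yn N x > y}"
  note [measurable] = measurable_Yn
  have A: "A \<in> sets (sphere_config N)" unfolding A_def by measurable
  have "emeasure (spherical_ensemble N) A = (\<integral>\<^sup>+x. indicator A x \<partial>spherical_ensemble N)"
    using A by (simp add: sets_ensemble)
  also have "\<dots> = (\<integral>\<^sup>+x. ennreal (vandermonde_sq N x / spherical_Z N) * indicator A x \<partial>sphere_config N)"
    by (rule nn_integral_ensemble) (use A in measurable)
  also have "\<dots> \<le> (\<integral>\<^sup>+x. ennreal (exp (3 * real N - y / 2)) \<partial>sphere_config N)"
  proof (rule nn_integral_mono)
    fix x assume x: "x \<in> space (sphere_config N)"
    show "ennreal (vandermonde_sq N x / spherical_Z N) * indicator A x \<le> ennreal (exp (3 * real N - y / 2))"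
    proof (cases "x \<in> A")
      case True
      have "vandermonde_sq N x / spherical_Z N \<le> exp (3 * real N - Yn N x / 2)" by (rule ensemble_density_le_Yn[OF N x])
      also have "\<dots> \<le> exp (3 * real N - y / 2)" using True by (simp add: A_def)
      finally show ?thesis using True by (simp add: ennreal_leI)
    qed simp
  qed
  also have "\<dots> = ennreal (exp (3 * real N - y / 2))" by (simp add: C.emeasure_space_1)
  finally show ?thesis unfolding A_def .
qed

section \<open>Tails of the Sobolev norm\<close>

definition X2 :: "(nat \<Rightarrow> real) \<Rightarrow> nat \<Rightarrow> (nat \<Rightarrow> real^3) \<Rightarrow> real" where
  "X2 b N x = (\<Sum>n\<in>{1..N}. b n * QN N x n)"

text \<open>A multiple of this function is the Cameron--Martin shift in \<open>gaussian_tail\<close>.\<close>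

definition vv :: "(nat \<Rightarrow> real) \<Rightarrow> nat \<Rightarrow> (nat \<Rightarrow> real^3) \<Rightarrow> real^3 \<Rightarrow> real" where
  "vv b N x y = (\<Sum>n\<in>{1..N}. b n * (\<Sum>f\<in>featset n. dev N x (feat n f) * feat n f y))"

lemma continuous_vv: "continuous_on A (vv b N x)"
  unfolding vv_def by (intro continuous_intros continuous_feat)

lemma integral_vv:
  assumes h: "continuous_on S2 h" and xS: "\<And>i. i \<in> {1..N} \<Longrightarrow> x i \<in> S2"
  shows "(LINT y|sigma_S2. vv b N x y * h y) = dev N x (\<lambda>y. \<Sum>n\<in>{1..N}. (b n / (real n + 1)) * avg n h y)"
proof -
  have c: "continuous_on S2 (\<lambda>y. \<Sum>f\<in>featset n. dev N x (feat n f) * feat n f y)" for n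
    by (intro continuous_intros continuous_feat)
  have "(LINT y|sigma_S2. vv b N x y * h y) = (\<Sum>n\<in>{1..N}. b n * (LINT y|sigma_S2. (\<Sum>f\<in>featset n. dev N x (feat n f) * feat n f y) * h y))"
    unfolding vv_def by (rule integral_sum_mult[OF h c])
  also have "\<dots> = (\<Sum>n\<in>{1..N}. (b n / (real n + 1)) * dev N x (avg n h))"
  proof (rule sum.cong[OF refl])
    fix n
    have "(LINT y|sigma_S2. (\<Sum>f\<in>featset n. dev N x (feat n f) * feat n f y) * h y) = (\<Sum>f\<in>featset n. dev N x (feat n f) * (LINT y|sigma_S2. feat n f y * h y))"
      by (rule integral_sum_mult[OF h continuous_feat])
    also have "\<dots> = (\<Sum>f\<in>featset n. acoef n h f * dev N x (feat n f))"
      unfolding acoef_def by (simp only: mult.commute)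
    also have "\<dots> = dev N x (avg n h) / (real n + 1)"
    proof -
      have "dev N x (avg n h) = (real n + 1) * (\<Sum>f\<in>featset n. acoef n h f * dev N x (feat n f))" by (rule dev_avg[OF _ h]) (erule xS)
      then show ?thesis by (simp add: field_simps)
    qed
    finally show "b n * (LINT y|sigma_S2. (\<Sum>f\<in>featset n. dev N x (feat n f) * feat n f y) * h y) = (b n / (real n + 1)) * dev N x (avg n h)" by simp
  qed
  also have "\<dots> = dev N x (\<lambda>y. \<Sum>n\<in>{1..N}. (b n / (real n + 1)) * avg n h y)"
    by (rule dev_sum[symmetric]) (rule continuous_avg[OF h])
  finally show ?thesis .
qed

lemma lam_mc:
  assumes "n \<ge> 1" shows "lam l * mc n l = real n * (real n + 1) * (mc n l - mc (n - 1) l)"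
proof -
  obtain k where k: "n = Suc k" using assms by (cases n) auto
  have "mc k l * ((real k + 1) * (real k + 2)) = mc (Suc k) l * ((real k + 1) * (real k + 2) - lam l)" by (rule mc_rec)
  then show ?thesis unfolding k by (simp add: algebra_simps)
qed

lemma mc_bounds: "0 \<le> mc n l" "mc n l \<le> 1"
proof -
  have "0 \<le> mc n l \<and> mc n l \<le> 1"
  proof (cases "l \<le> n")
    case True then show ?thesis using mc_pos[of l n] mc_le_1[of l n] by simp
  next
    case False then show ?thesis using mc_zero[of n l] by simp
  qed
  then show "0 \<le> mc n l" "mc n l \<le> 1" by blast+
qed

text \<open>By \<open>lam_mc\<close> and \<open>b n * n \<le> 1\<close> the terms are at most the
  increments \<open>mc n l - mc (n - 1) l\<close>, whose sum telescopes. In operator terms, the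
  Laplacian composed with the kernel operator has norm at most 1.\<close>

lemma sum_mc_weights:
  assumes b: "\<And>n. n \<ge> 1 \<Longrightarrow> b n * real n \<le> 1"
  shows "(\<Sum>n\<in>{1..N}. b n / (real n + 1) * (lam l * mc n l)) \<le> 1"
proof -
  have "(\<Sum>n\<in>{1..N}. b n / (real n + 1) * (lam l * mc n l)) \<le> (\<Sum>n\<in>{1..N}. mc n l - mc (n - 1) l)"
  proof (rule sum_mono)
    fix n assume n: "n \<in> {1..N}"
    define D where "D = mc n l - mc (n - 1) l"
    have n1: "real n \<ge> 1" using n by simp
    have e: "lam l * mc n l = real n * (real n + 1) * D" unfolding D_def by (rule lam_mc) (use n in simp)
    have "0 \<le> lam l * mc n l" by (intro mult_nonneg_nonneg lam_nonneg mc_bounds)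
    then have "0 \<le> (real n * (real n + 1)) * D" unfolding e .
    moreover have "real n * (real n + 1) > 0" using n1 by simp
    ultimately have D: "D \<ge> 0" by (metis mult_pos_neg not_less)
    have "b n / (real n + 1) * (lam l * mc n l) = (b n * real n) * D" unfolding e using n1 by (simp add: field_simps)
    also have "\<dots> \<le> 1 * D" using b[of n] n D by (intro mult_right_mono) auto
    finally show "b n / (real n + 1) * (lam l * mc n l) \<le> mc n l - mc (n - 1) l" by (simp add: D_def)
  qed
  also have "\<dots> = mc N l - mc 0 l"
    by (induction N) simp_all
  also have "\<dots> \<le> 1" using mc_bounds(1)[of 0 l] mc_bounds(2)[of N l] by linarith
  finally show ?thesis .
qed

text \<open>Tested against \<open>h\<close>, the truncated Laplacian of \<open>v\<close>, the shift
  returns its own energy \<open>F\<close>, and this pairing is also a deviation. Cauchy-Schwarz and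
  \<open>sum_mc_weights\<close> give \<open>F^2 \<le> X2 * F\<close>.\<close>

lemma vv_energy:
  assumes xS: "\<And>i. i \<in> {1..N} \<Longrightarrow> x i \<in> S2"
    and b0: "\<And>n. b n \<ge> 0" and b: "\<And>n. n \<ge> 1 \<Longrightarrow> b n * real n \<le> 1"
  shows "(\<Sum>l\<le>K. lam l * l2 (proj l (vv b N x))) \<le> X2 b N x"
proof -
  define v where "v = vv b N x"
  have cv: "continuous_on S2 v" unfolding v_def by (rule continuous_vv)
  define h where "h y = (\<Sum>l\<le>K. lam l * proj l v y)" for y
  have ch: "continuous_on S2 h" unfolding h_def[abs_def] by (intro continuous_intros continuous_proj[OF cv])
  define F where "F = (\<Sum>l\<le>K. lam l * l2 (proj l v))"
  have F0: "F \<ge> 0" unfolding F_def by (intro sum_nonneg mult_nonneg_nonneg lam_nonneg l2_nonneg)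
  have X0: "X2 b N x \<ge> 0" unfolding X2_def by (intro sum_nonneg mult_nonneg_nonneg b0 QN_nonneg xS)
  have vh: "(LINT y|sigma_S2. v y * h y) = F"
  proof -
    have "(LINT y|sigma_S2. v y * h y) = (LINT y|sigma_S2. (\<Sum>l\<le>K. lam l * proj l v y) * v y)" unfolding h_def by (simp only: mult.commute)
    also have "\<dots> = (\<Sum>l\<le>K. lam l * (LINT y|sigma_S2. proj l v y * v y))" by (rule integral_sum_mult[OF cv continuous_proj[OF cv]])
    also have "\<dots> = F" unfolding F_def l2_proj[OF cv] by (simp only: mult.commute)
    finally show ?thesis .
  qed
  have ah: "(LINT y|sigma_S2. avg n h y * h y) = (\<Sum>l\<le>K. lam l * (lam l * mc n l) * l2 (proj l v))" for n
  proof -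
    have a: "avg n h y = (\<Sum>l\<le>K. (lam l * mc n l) * proj l v y)" if y: "y \<in> S2" for y
    proof -
      have "avg n h y = (\<Sum>l\<le>K. lam l * avg n (proj l v) y)" unfolding h_def[abs_def] by (rule avg_sum) (rule continuous_proj[OF cv])
      then show ?thesis by (simp only: avg_of_proj[OF cv y] mult.assoc)
    qed
    have "(LINT y|sigma_S2. avg n h y * h y) = (LINT y|sigma_S2. (\<Sum>l\<le>K. (lam l * mc n l) * proj l v y) * h y)"
      by (rule integral_sigma_cong) (simp only: a)
    also have "\<dots> = (\<Sum>l\<le>K. (lam l * mc n l) * (LINT y|sigma_S2. proj l v y * h y))" by (rule integral_sum_mult[OF ch continuous_proj[OF cv]])
    also have "\<dots> = (\<Sum>l\<le>K. (lam l * mc n l) * (lam l * l2 (proj l v)))"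
    proof (rule sum.cong[OF refl])
      fix l assume l: "l \<in> {..K}"
      have "(LINT y|sigma_S2. proj l v y * h y) = (LINT y|sigma_S2. (\<Sum>k\<le>K. lam k * proj k v y) * proj l v y)" unfolding h_def by (simp only: mult.commute)
      also have "\<dots> = (\<Sum>k\<le>K. lam k * (LINT y|sigma_S2. proj k v y * proj l v y))" by (rule integral_sum_mult) (rule continuous_proj[OF cv])+
      also have "\<dots> = (\<Sum>k\<le>K. if k = l then lam l * l2 (proj l v) else 0)"
        by (rule sum.cong[OF refl]) (simp add: proj_inner[OF cv] l2_proj[OF cv])
      also have "\<dots> = lam l * l2 (proj l v)" using l by simp
      finally show "(lam l * mc n l) * (LINT y|sigma_S2. proj l v y * h y) = (lam l * mc n l) * (lam l * l2 (proj l v))" by simp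
    qed
    finally show ?thesis by (simp only: mult_ac)
  qed
  have "F\<^sup>2 = (dev N x (\<lambda>y. \<Sum>n\<in>{1..N}. (b n / (real n + 1)) * avg n h y))\<^sup>2"
  proof -
    have "F = dev N x (\<lambda>y. \<Sum>n\<in>{1..N}. (b n / (real n + 1)) * avg n h y)"
      unfolding vh[symmetric] v_def by (rule integral_vv[OF ch]) (erule xS)
    then show ?thesis by (simp only:)
  qed
  also have "\<dots> \<le> (\<Sum>n\<in>{1..N}. b n * QN N x n) * (LINT y|sigma_S2. (\<Sum>n\<in>{1..N}. (b n / (real n + 1)) * avg n h y) * h y)"
    by (rule dev_kernel_le[OF _ ch]) (erule xS, simp, rule b0)
  also have "(LINT y|sigma_S2. (\<Sum>n\<in>{1..N}. (b n / (real n + 1)) * avg n h y) * h y) = (\<Sum>n\<in>{1..N}. (b n / (real n + 1)) * (LINT y|sigma_S2. avg n h y * h y))"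
    by (rule integral_sum_mult[OF ch continuous_avg[OF ch]])
  also have "\<dots> = (\<Sum>l\<le>K. (lam l * l2 (proj l v)) * (\<Sum>n\<in>{1..N}. b n / (real n + 1) * (lam l * mc n l)))"
    unfolding ah sum_distrib_left by (subst sum.swap) (intro sum.cong refl, simp only: mult_ac)
  also have "(\<Sum>n\<in>{1..N}. b n * QN N x n) * \<dots> \<le> X2 b N x * (\<Sum>l\<le>K. (lam l * l2 (proj l v)) * 1)"
    unfolding X2_def[symmetric] by (intro mult_left_mono sum_mono X0 sum_mc_weights b mult_nonneg_nonneg lam_nonneg l2_nonneg)
  finally have "F * F \<le> X2 b N x * F" by (simp add: F_def power2_eq_square)
  then have "F \<le> X2 b N x"
    using F0 X0 by (cases "F = 0") auto
  then show ?thesis unfolding F_def v_def .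
qed

text \<open>The averages are positive and fix constants.\<close>

lemma avg_abs_le:
  assumes u: "continuous_on S2 u" and B: "\<And>y. y \<in> S2 \<Longrightarrow> \<bar>u y\<bar> \<le> B" and x: "x \<in> S2"
  shows "\<bar>avg n u x\<bar> \<le> B"
proof -
  have nn: "avg n h x \<ge> 0" if "\<And>y. y \<in> S2 \<Longrightarrow> h y \<ge> 0" for h
  proof -
    have "0 \<le> (LINT y|sigma_S2. qk x y ^ n * h y)"
    proof (rule Bochner_Integration.integral_nonneg_AE, rule AE_I2)
      fix y assume "y \<in> space sigma_S2"
      then have y: "y \<in> S2" by (simp only: space_sigma_S2)
      show "0 \<le> qk x y ^ n * h y" by (intro mult_nonneg_nonneg zero_le_power qk_nonneg x y that)
    qed
    then show ?thesis unfolding avg_def by (intro mult_nonneg_nonneg) auto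
  qed
  have c: "avg n (\<lambda>_. B) x = B" using avg_one[OF x, of n] by (simp add: avg_def)
  have "0 \<le> avg n (\<lambda>y. B - u y) x"
  proof (rule nn)
    fix y assume "y \<in> S2" from B[OF this] show "0 \<le> B - u y" by (simp add: abs_le_iff)
  qed
  then have 1: "avg n u x \<le> B" using avg_diff[OF continuous_on_const u, of n B x] c by simp
  have "0 \<le> avg n (\<lambda>y. u y - (- B)) x"
  proof (rule nn)
    fix y assume "y \<in> S2" from B[OF this] show "0 \<le> u y - (- B)" by (simp add: abs_le_iff)
  qed
  moreover have "avg n (\<lambda>_. - B) x = - B" using avg_one[OF x, of n] by (simp add: avg_def)
  ultimately have "- B \<le> avg n u x" using avg_diff[OF u continuous_on_const, of n "- B" x] by simp
  with 1 show ?thesis by simp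
qed

lemma integral_avg_tendsto:
  assumes u: "continuous_on S2 u"
  shows "(\<lambda>n. LINT y|sigma_S2. avg n u y * u y) \<longlonglongrightarrow> (LINT y|sigma_S2. u y * u y)"
proof -
  obtain B where B: "B > 0" "\<And>x. x \<in> S2 \<Longrightarrow> norm (u x) \<le> B" using S2_cont_bounded[OF u] by blast
  show ?thesis
  proof (rule integral_dominated_convergence[where w="\<lambda>_. B * B"])
    show "(\<lambda>y. u y * u y) \<in> borel_measurable sigma_S2" by (intro S2_cont_measurable_sigma continuous_intros u)
    show "(\<lambda>y. avg n u y * u y) \<in> borel_measurable sigma_S2" for n by (intro S2_cont_measurable_sigma continuous_intros continuous_avg u)
    show "AE y in sigma_S2. (\<lambda>n. avg n u y * u y) \<longlonglongrightarrow> u y * u y"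
    proof (rule AE_I2)
      fix y assume "y \<in> space sigma_S2"
      then have y: "y \<in> S2" by (simp only: space_sigma_S2)
      show "(\<lambda>n. avg n u y * u y) \<longlonglongrightarrow> u y * u y" by (intro tendsto_intros avg_tendsto[OF u y])
    qed
    show "AE y in sigma_S2. norm (avg n u y * u y) \<le> B * B" for n
    proof (rule AE_I2)
      fix y assume "y \<in> space sigma_S2"
      then have y: "y \<in> S2" by (simp only: space_sigma_S2)
      have "\<bar>avg n u y\<bar> \<le> B" using avg_abs_le[OF u _ y, of B n] B(2) by simp
      then show "norm (avg n u y * u y) \<le> B * B" unfolding norm_mult using B(1) B(2)[OF y] by (intro mult_mono) auto
    qed
  qed simp
qed

text \<open>On degree \<open>l\<close> the difference of the two forms is \<open>1 - mc m l\<close>,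
  at most \<open>lam l / (m + 1)\<close>, so the energy controls it. Finite spectral sums suffice
  because the squared norm is the limit of the forms of \<open>avg k\<close>.\<close>

lemma vv_variance:
  assumes xS: "\<And>i. i \<in> {1..N} \<Longrightarrow> x i \<in> S2"
    and b0: "\<And>n. b n \<ge> 0" and b: "\<And>n. n \<ge> 1 \<Longrightarrow> b n * real n \<le> 1"
  defines "v \<equiv> vv b N x"
  shows "(LINT y|sigma_S2. v y * v y) - (LINT y|sigma_S2. avg m v y * v y) \<le> X2 b N x / (real m + 1)"
proof -
  have cv: "continuous_on S2 v" unfolding v_def by (rule continuous_vv)
  have E: "(LINT y|sigma_S2. avg k v y * v y) = (\<Sum>l\<le>k. mc k l * l2 (proj l v))" for k
  proof -
    have "(LINT y|sigma_S2. avg k v y * v y) = (LINT y|sigma_S2. (\<Sum>l\<le>k. mc k l * proj l v y) * v y)" by (simp only: avg_proj)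
    also have "\<dots> = (\<Sum>l\<le>k. mc k l * (LINT y|sigma_S2. proj l v y * v y))" by (rule integral_sum_mult[OF cv continuous_proj[OF cv]])
    finally show ?thesis unfolding l2_proj[OF cv] by (simp only: mult.commute)
  qed
  have "(LINT y|sigma_S2. avg k v y * v y) - (LINT y|sigma_S2. avg m v y * v y) \<le> X2 b N x / (real m + 1)" if k: "k \<ge> m" for k
  proof -
    have "(\<Sum>l\<le>m. mc m l * l2 (proj l v)) = (\<Sum>l\<le>k. mc m l * l2 (proj l v))"
      by (rule sum.mono_neutral_left) (use k in \<open>auto simp: mc_zero\<close>)
    then have "(LINT y|sigma_S2. avg k v y * v y) - (LINT y|sigma_S2. avg m v y * v y) = (\<Sum>l\<le>k. (mc k l - mc m l) * l2 (proj l v))"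
      unfolding E by (simp only: left_diff_distrib sum_subtractf)
    also have "\<dots> \<le> (\<Sum>l\<le>k. lam l / (real m + 1) * l2 (proj l v))"
    proof (intro sum_mono mult_right_mono l2_nonneg)
      fix l
      show "mc k l - mc m l \<le> lam l / (real m + 1)"
      proof (cases "l \<le> m")
        case True
        then show ?thesis using mc_lower[OF True] mc_bounds(2)[of k l] by linarith
      next
        case False
        then have "real m + 1 \<le> real l" by simp
        also have "\<dots> \<le> lam l" unfolding lam_def by (simp add: mult_le_cancel_left1)
        finally have "1 \<le> lam l / (real m + 1)" by simp
        then show ?thesis using mc_bounds(1)[of m l] mc_bounds(2)[of k l] by linarith
      qed
    qed
    also have "\<dots> = (\<Sum>l\<le>k. lam l * l2 (proj l v)) / (real m + 1)" by (simp add: sum_divide_distrib)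
    also have "\<dots> \<le> X2 b N x / (real m + 1)" unfolding v_def by (intro divide_right_mono vv_energy xS b0 b) auto
    finally show ?thesis .
  qed
  then have ev: "\<exists>k0. \<forall>k\<ge>k0. (LINT y|sigma_S2. avg k v y * v y) - (LINT y|sigma_S2. avg m v y * v y) \<le> X2 b N x / (real m + 1)" by blast
  have "(\<lambda>k. (LINT y|sigma_S2. avg k v y * v y) - (LINT y|sigma_S2. avg m v y * v y)) \<longlonglongrightarrow> (LINT y|sigma_S2. v y * v y) - (LINT y|sigma_S2. avg m v y * v y)"
    by (intro tendsto_intros integral_avg_tendsto[OF cv])
  then show ?thesis by (rule LIMSEQ_le_const2[OF _ ev])
qed

text \<open>On the sphere the tensor powers are unit vectors, with inner product
  \<open>qk y z ^ n\<close>.\<close>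

lemma feat_diff_sq:
  assumes y: "y \<in> S2" and z: "z \<in> S2"
  shows "(\<Sum>f\<in>featset n. (feat n f y - feat n f z)\<^sup>2) = 2 * (1 - qk y z ^ n)"
proof -
  have "(\<Sum>f\<in>featset n. (feat n f y - feat n f z)\<^sup>2) = (\<Sum>f\<in>featset n. feat n f y * feat n f y) + (\<Sum>f\<in>featset n. feat n f z * feat n f z) - 2 * (\<Sum>f\<in>featset n. feat n f y * feat n f z)"
    unfolding sum_distrib_left sum.distrib[symmetric] sum_subtractf[symmetric] by (intro sum.cong refl) (simp add: power2_eq_square algebra_simps)
  also have "\<dots> = qk y y ^ n + qk z z ^ n - 2 * qk y z ^ n" by (simp only: qk_power_feat)
  finally show ?thesis by (simp add: qk_self[OF y] qk_self[OF z])
qed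

lemma one_minus_power_le: "0 \<le> q \<Longrightarrow> q \<le> 1 \<Longrightarrow> 1 - q ^ n \<le> real n * (1 - q)" for q :: real
proof (induction n)
  case (Suc n)
  have "1 - q ^ Suc n = (1 - q ^ n) + q ^ n * (1 - q)" by (simp add: algebra_simps)
  also have "\<dots> \<le> real n * (1 - q) + 1 * (1 - q)" using Suc by (intro add_mono mult_right_mono power_le_one) auto
  finally show ?case by (simp add: algebra_simps)
qed simp

lemma sum_inverse_sq_le: "(\<Sum>n\<in>{1..N}. 1 / (real n)\<^sup>2) \<le> 2"
proof (cases "N \<ge> 1")
  case True
  have "{1..N} = insert 1 {1<..N}" using True by auto
  then have "(\<Sum>n\<in>{1..N}. 1 / (real n)\<^sup>2) = 1 + (\<Sum>n\<in>{1<..N}. 1 / (real n)\<^sup>2)" by simp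
  also have "\<dots> \<le> 1 + (1 / real 1 - 1 / real N)" by (intro add_left_mono sum_inverse_sq_tail True) simp
  also have "\<dots> \<le> 2" by simp
  finally show ?thesis .
qed simp

text \<open>In Cauchy-Schwarz the deviations get the weight \<open>1 / n\<close>, which is
  \<open>aw N n\<close> for \<open>n \<le> N\<close> and so produces \<open>Yn\<close>. The other
  factor is \<open>\<Sum>n. n * (b n)^2 * 2 * (1 - q^n)\<close>, at most
  \<open>2 * (1 - q) * \<Sum>n. 1 / n^2\<close>.\<close>

lemma vv_lipschitz:
  assumes xS: "\<And>i. i \<in> {1..N} \<Longrightarrow> x i \<in> S2"
    and b0: "\<And>n. b n \<ge> 0" and b: "\<And>n. n \<ge> 1 \<Longrightarrow> b n \<le> 1 / (real n)\<^sup>2"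
    and y: "y \<in> S2" and z: "z \<in> S2"
  shows "(vv b N x y - vv b N x z)\<^sup>2 \<le> 4 * (1 - qk y z) * Yn N x"
proof -
  define I where "I = Sigma {1..N} featset"
  define A where "A p = (case p of (n, f) \<Rightarrow> dev N x (feat n f) / sqrt (real n))" for p
  define B where "B p = (case p of (n, f) \<Rightarrow> sqrt (real n) * b n * (feat n f y - feat n f z))" for p
  have q: "0 \<le> qk y z" "qk y z \<le> 1" by (rule qk_nonneg[OF y z], rule qk_le_1[OF y z])
  have sq: "sqrt (real n) * sqrt (real n) = real n" for n by simp
  have "vv b N x y - vv b N x z = (\<Sum>n\<in>{1..N}. \<Sum>f\<in>featset n. A (n, f) * B (n, f))"
    unfolding vv_def sum_subtractf[symmetric] right_diff_distrib[symmetric] sum_distrib_left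
    by (intro sum.cong refl) (auto simp: A_def B_def field_simps)
  also have "\<dots> = (\<Sum>p\<in>I. A p * B p)" unfolding I_def using finite_featset by (subst sum.Sigma) auto
  finally have e: "vv b N x y - vv b N x z = (\<Sum>p\<in>I. A p * B p)" .
  have "(\<Sum>p\<in>I. (A p)\<^sup>2) = (\<Sum>n\<in>{1..N}. \<Sum>f\<in>featset n. (A (n, f))\<^sup>2)" unfolding I_def using finite_featset by (subst sum.Sigma) auto
  also have "\<dots> = (\<Sum>n\<in>{1..N}. aw N n * QN N x n)"
  proof (rule sum.cong[OF refl])
    fix n assume n: "n \<in> {1..N}"
    have "QN N x n = (\<Sum>f\<in>featset n. (dev N x (feat n f))\<^sup>2)" by (rule QN_feat) (erule xS)
    then show "(\<Sum>f\<in>featset n. (A (n, f))\<^sup>2) = aw N n * QN N x n"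
      using n by (simp add: A_def aw_def power_divide sum_divide_distrib)
  qed
  also have "\<dots> \<le> Yn N x" by (rule sum_le_Yn) (erule xS, simp)
  finally have A: "(\<Sum>p\<in>I. (A p)\<^sup>2) \<le> Yn N x" .
  have "(\<Sum>p\<in>I. (B p)\<^sup>2) = (\<Sum>n\<in>{1..N}. \<Sum>f\<in>featset n. (B (n, f))\<^sup>2)" unfolding I_def using finite_featset by (subst sum.Sigma) auto
  also have "\<dots> = (\<Sum>n\<in>{1..N}. real n * (b n)\<^sup>2 * (2 * (1 - qk y z ^ n)))"
    by (rule sum.cong[OF refl]) (simp add: B_def power_mult_distrib sum_distrib_left[symmetric] feat_diff_sq[OF y z])
  also have "\<dots> \<le> (\<Sum>n\<in>{1..N}. (2 * (1 - qk y z)) * (1 / (real n)\<^sup>2))"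
  proof (rule sum_mono)
    fix n assume "n \<in> {1..N}"
    then have n: "real n \<ge> 1" "n \<ge> 1" by auto
    have "real n * (b n)\<^sup>2 * (2 * (1 - qk y z ^ n)) \<le> real n * (1 / (real n)\<^sup>2)\<^sup>2 * (2 * (real n * (1 - qk y z)))"
      using n q b[OF n(2)] b0[of n] one_minus_power_le[OF q, of n] power_le_one[OF q, of n]
      by (intro mult_mono mult_left_mono power_mono mult_nonneg_nonneg) auto
    also have "\<dots> = (2 * (1 - qk y z)) * (1 / (real n)\<^sup>2)" using n by (simp add: power2_eq_square field_simps)
    finally show "real n * (b n)\<^sup>2 * (2 * (1 - qk y z ^ n)) \<le> (2 * (1 - qk y z)) * (1 / (real n)\<^sup>2)" .
  qed
  also have "\<dots> \<le> (2 * (1 - qk y z)) * 2" unfolding sum_distrib_left[symmetric] using q by (intro mult_left_mono sum_inverse_sq_le) auto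
  finally have B: "(\<Sum>p\<in>I. (B p)\<^sup>2) \<le> 4 * (1 - qk y z)" by simp
  have "(\<Sum>p\<in>I. A p * B p)\<^sup>2 \<le> (\<Sum>p\<in>I. (A p)\<^sup>2) * (\<Sum>p\<in>I. (B p)\<^sup>2)" by (rule Cauchy_Schwarz_ineq_sum)
  also have "\<dots> \<le> Yn N x * (4 * (1 - qk y z))"
  proof (rule mult_mono[OF A B])
    have "0 \<le> (\<Sum>p\<in>I. (A p)\<^sup>2)" by (intro sum_nonneg) auto
    then show "0 \<le> Yn N x" using A by linarith
  qed (intro sum_nonneg zero_le_power2)
  finally show ?thesis unfolding e by (simp only: mult_ac)
qed

definition kk :: "nat \<Rightarrow> real^3 \<Rightarrow> real^3 \<Rightarrow> real" where
  "kk N x y = (real N)\<^sup>2 * qk x y ^ (N - 1)"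

text \<open>The double integral of the exponential moment bound, as a nonnegative integral, so that
  Tonelli's theorem applies when \<open>u\<close> is random.\<close>

definition nT :: "nat \<Rightarrow> (real^3 \<Rightarrow> real) \<Rightarrow> ennreal" where
  "nT N u = (\<integral>\<^sup>+x. (\<integral>\<^sup>+y. ennreal (exp (u x - u y) * kk N x y) \<partial>sigma_S2) \<partial>sigma_S2)"

lemma kk_nonneg: "x \<in> S2 \<Longrightarrow> y \<in> S2 \<Longrightarrow> kk N x y \<ge> 0"
  unfolding kk_def by (intro mult_nonneg_nonneg zero_le_power qk_nonneg) auto

lemma nn_integral_sigma_cong: "(\<And>x. x \<in> S2 \<Longrightarrow> f x = g x) \<Longrightarrow> (\<integral>\<^sup>+x. f x \<partial>sigma_S2) = (\<integral>\<^sup>+x. g x \<partial>sigma_S2)"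
  by (rule nn_integral_cong) (simp only: space_sigma_S2)

lemma nn_integral_sigma_mono: "(\<And>x. x \<in> S2 \<Longrightarrow> f x \<le> g x) \<Longrightarrow> (\<integral>\<^sup>+x. f x \<partial>sigma_S2) \<le> (\<integral>\<^sup>+x. g x \<partial>sigma_S2)"
  by (rule nn_integral_mono) (simp only: space_sigma_S2)

lemma nn_integral_cont:
  fixes f :: "real^3 \<Rightarrow> real"
  assumes f: "continuous_on S2 f" and nn: "\<And>x. x \<in> S2 \<Longrightarrow> f x \<ge> 0"
  shows "(\<integral>\<^sup>+x. ennreal (f x) \<partial>sigma_S2) = ennreal (LINT x|sigma_S2. f x)"
proof (rule nn_integral_eq_integral[OF S2_cont_integrable[OF f]], rule AE_I2)
  fix x assume "x \<in> space sigma_S2"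
  then show "0 \<le> f x" using nn by (simp only: space_sigma_S2)
qed

lemma nT_real:
  assumes u: "continuous_on S2 u"
  shows "nT N u = ennreal (LINT x|sigma_S2. (LINT y|sigma_S2. exp (u x) * exp (- u y) * ((real N)\<^sup>2 * qk x y ^ (N - 1))))"
proof -
  have ce: "continuous_on S2 (\<lambda>y. exp (- u y))" "continuous_on S2 (\<lambda>x. exp (u x))" by (intro continuous_intros u)+
  define c where "c = (real N)\<^sup>2 / (real (N - 1) + 1)"
  have i: "(LINT y|sigma_S2. exp (u x) * exp (- u y) * ((real N)\<^sup>2 * qk x y ^ (N - 1))) = exp (u x) * (c * avg (N - 1) (\<lambda>y. exp (- u y)) x)" for x
  proof -
    have "(LINT y|sigma_S2. exp (u x) * exp (- u y) * ((real N)\<^sup>2 * qk x y ^ (N - 1))) = (LINT y|sigma_S2. (exp (u x) * (real N)\<^sup>2) * (qk x y ^ (N - 1) * exp (- u y)))"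
      by (intro Bochner_Integration.integral_cong refl) (simp only: mult_ac)
    also have "\<dots> = (exp (u x) * (real N)\<^sup>2) * (LINT y|sigma_S2. qk x y ^ (N - 1) * exp (- u y))" by (rule integral_mult_right_zero)
    finally show ?thesis unfolding avg_def c_def by (simp add: field_simps)
  qed
  have nn: "0 \<le> (LINT y|sigma_S2. exp (u x) * exp (- u y) * ((real N)\<^sup>2 * qk x y ^ (N - 1)))" if x: "x \<in> S2" for x
  proof (rule Bochner_Integration.integral_nonneg_AE, rule AE_I2)
    fix y assume "y \<in> space sigma_S2"
    then have y: "y \<in> S2" by (simp only: space_sigma_S2)
    show "0 \<le> exp (u x) * exp (- u y) * ((real N)\<^sup>2 * qk x y ^ (N - 1))"
      by (intro mult_nonneg_nonneg zero_le_power qk_nonneg x y) auto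
  qed
  have "nT N u = (\<integral>\<^sup>+x. ennreal (LINT y|sigma_S2. exp (u x) * exp (- u y) * ((real N)\<^sup>2 * qk x y ^ (N - 1))) \<partial>sigma_S2)"
    unfolding nT_def
  proof (rule nn_integral_sigma_cong)
    fix x assume x: "x \<in> S2"
    have "(\<integral>\<^sup>+y. ennreal (exp (u x - u y) * kk N x y) \<partial>sigma_S2) = (\<integral>\<^sup>+y. ennreal (exp (u x) * exp (- u y) * ((real N)\<^sup>2 * qk x y ^ (N - 1))) \<partial>sigma_S2)"
      by (intro nn_integral_cong) (simp add: kk_def exp_diff exp_minus divide_inverse)
    also have "\<dots> = ennreal (LINT y|sigma_S2. exp (u x) * exp (- u y) * ((real N)\<^sup>2 * qk x y ^ (N - 1)))"
    proof (rule nn_integral_cont)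
      fix y assume y: "y \<in> S2"
      show "0 \<le> exp (u x) * exp (- u y) * ((real N)\<^sup>2 * qk x y ^ (N - 1))"
        by (intro mult_nonneg_nonneg zero_le_power qk_nonneg x y) auto
    qed (intro continuous_intros u)
    finally show "(\<integral>\<^sup>+y. ennreal (exp (u x - u y) * kk N x y) \<partial>sigma_S2) = ennreal (LINT y|sigma_S2. exp (u x) * exp (- u y) * ((real N)\<^sup>2 * qk x y ^ (N - 1)))" .
  qed
  also have "\<dots> = ennreal (LINT x|sigma_S2. (LINT y|sigma_S2. exp (u x) * exp (- u y) * ((real N)\<^sup>2 * qk x y ^ (N - 1))))"
    by (rule nn_integral_cont[OF _ nn]) (unfold i, intro continuous_intros u continuous_avg ce)
  finally show ?thesis .
qed

lemma exp_moment_nT: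
  assumes N: "N \<ge> 1" and u: "continuous_on S2 u"
  shows "(\<integral>\<^sup>+x. ennreal (exp (dev N x u)) \<partial>spherical_ensemble N) \<le> ennreal (exp (enn2real (nT N u) - real N))"
    "nT N u = ennreal (enn2real (nT N u))"
proof -
  have 0: "0 \<le> (LINT x|sigma_S2. (LINT y|sigma_S2. exp (u x) * exp (- u y) * ((real N)\<^sup>2 * qk x y ^ (N - 1))))"
  proof (intro Bochner_Integration.integral_nonneg_AE AE_I2)
    fix x y assume "x \<in> space sigma_S2" "y \<in> space sigma_S2"
    then have xy: "x \<in> S2" "y \<in> S2" by (simp_all only: space_sigma_S2)
    show "0 \<le> exp (u x) * exp (- u y) * ((real N)\<^sup>2 * qk x y ^ (N - 1))" by (intro mult_nonneg_nonneg zero_le_power qk_nonneg xy) auto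
  qed
  show "(\<integral>\<^sup>+x. ennreal (exp (dev N x u)) \<partial>spherical_ensemble N) \<le> ennreal (exp (enn2real (nT N u) - real N))"
    using exp_moment[OF N u] 0 by (simp only: nT_real[OF u] enn2real_ennreal)
  show "nT N u = ennreal (enn2real (nT N u))" using 0 by (simp only: nT_real[OF u] enn2real_ennreal)
qed

section \<open>Gaussian averages of the exponential moment bound\<close>

lemma normal_density_tilt:
  assumes s: "s > 0"
  shows "exp (a * t) * normal_density \<mu> s t = exp (a * \<mu> + s\<^sup>2 * a\<^sup>2 / 2) * normal_density (\<mu> + s\<^sup>2 * a) s t"
proof -
  have e: "a * t + (- (t - \<mu>)\<^sup>2 / (2 * s\<^sup>2)) = (a * \<mu> + s\<^sup>2 * a\<^sup>2 / 2) + (- (t - (\<mu> + s\<^sup>2 * a))\<^sup>2 / (2 * s\<^sup>2))"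
    using s by (simp add: field_simps power2_eq_square)
  have "exp (a * t) * normal_density \<mu> s t = 1 / sqrt (2 * pi * s\<^sup>2) * (exp (a * t) * exp (- (t - \<mu>)\<^sup>2 / (2 * s\<^sup>2)))"
    unfolding normal_density_def by (simp only: mult_ac)
  also have "\<dots> = 1 / sqrt (2 * pi * s\<^sup>2) * (exp (a * \<mu> + s\<^sup>2 * a\<^sup>2 / 2) * exp (- (t - (\<mu> + s\<^sup>2 * a))\<^sup>2 / (2 * s\<^sup>2)))"
    by (simp only: exp_add[symmetric] e)
  finally show ?thesis unfolding normal_density_def by (simp only: mult_ac)
qed

definition gdens :: "real \<Rightarrow> 'j set \<Rightarrow> ('j \<Rightarrow> real) \<Rightarrow> ('j \<Rightarrow> real) \<Rightarrow> real" where
  "gdens s J m g = (\<Prod>j\<in>J. normal_density (m j) s (g j))"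

definition gbase :: "'j set \<Rightarrow> ('j \<Rightarrow> real) measure" where
  "gbase J = (\<Pi>\<^sub>M j\<in>J. lborel)"

lemma gdens_nonneg: "gdens s J m g \<ge> 0" unfolding gdens_def by (intro prod_nonneg) simp

lemma gdens_tilt:
  assumes "s > 0" "finite J"
  shows "exp (\<Sum>j\<in>J. a j * g j) * gdens s J m g = exp (\<Sum>j\<in>J. a j * m j + s\<^sup>2 * (a j)\<^sup>2 / 2) * gdens s J (\<lambda>j. m j + s\<^sup>2 * a j) g"
  unfolding gdens_def exp_sum[OF assms(2)] prod.distrib[symmetric] by (intro prod.cong refl normal_density_tilt assms)

lemma measurable_gbase: "j \<in> J \<Longrightarrow> (\<lambda>g. g j) \<in> borel_measurable (gbase J)"
proof -
  assume "j \<in> J"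
  then have "(\<lambda>g. g j) \<in> measurable (gbase J) lborel" unfolding gbase_def by (rule measurable_component_singleton)
  then show ?thesis by simp
qed

lemma measurable_gdens: "gdens s J m \<in> borel_measurable (gbase J)"
  unfolding gdens_def[abs_def]
  by (intro borel_measurable_prod measurable_compose[OF measurable_gbase borel_measurable_normal_density])

lemma sigma_finite_gbase: "finite J \<Longrightarrow> sigma_finite_measure (gbase J)"
proof -
  assume J: "finite J"
  interpret product_sigma_finite "\<lambda>_. lborel :: real measure" by standard
  show ?thesis unfolding gbase_def by (rule sigma_finite[OF J])
qed

lemma gdens_total:
  assumes s: "s > 0" and J: "finite J"
  shows "(\<integral>\<^sup>+g. ennreal (gdens s J m g) \<partial>gbase J) = 1"
proof -
  interpret product_sigma_finite "\<lambda>_. lborel :: real measure" by standard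
  have "(\<integral>\<^sup>+g. ennreal (gdens s J m g) \<partial>gbase J) = (\<integral>\<^sup>+g. (\<Prod>j\<in>J. ennreal (normal_density (m j) s (g j))) \<partial>(\<Pi>\<^sub>M j\<in>J. lborel))"
    unfolding gdens_def gbase_def by (intro nn_integral_cong) (simp add: prod_ennreal)
  also have "\<dots> = (\<Prod>j\<in>J. \<integral>\<^sup>+t. ennreal (normal_density (m j) s t) \<partial>lborel)"
    by (rule product_nn_integral_prod[OF J]) simp
  also have "\<dots> = (\<Prod>j\<in>J. 1)"
    by (intro prod.cong refl) (subst nn_integral_eq_integral, use s in auto)
  finally show ?thesis by simp
qed

lemma gdens_mgf:
  assumes s: "s > 0" and J: "finite J"
  shows "(\<integral>\<^sup>+g. ennreal (exp (\<Sum>j\<in>J. a j * g j)) * ennreal (gdens s J m g) \<partial>gbase J) = ennreal (exp (\<Sum>j\<in>J. a j * m j + s\<^sup>2 * (a j)\<^sup>2 / 2))"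
proof -
  have [measurable]: "gdens s J m \<in> borel_measurable (gbase J)" for m by (rule measurable_gdens)
  have "(\<integral>\<^sup>+g. ennreal (exp (\<Sum>j\<in>J. a j * g j)) * ennreal (gdens s J m g) \<partial>gbase J)
    = (\<integral>\<^sup>+g. ennreal (exp (\<Sum>j\<in>J. a j * m j + s\<^sup>2 * (a j)\<^sup>2 / 2)) * ennreal (gdens s J (\<lambda>j. m j + s\<^sup>2 * a j) g) \<partial>gbase J)"
  proof (rule nn_integral_cong)
    fix g
    show "ennreal (exp (\<Sum>j\<in>J. a j * g j)) * ennreal (gdens s J m g) = ennreal (exp (\<Sum>j\<in>J. a j * m j + s\<^sup>2 * (a j)\<^sup>2 / 2)) * ennreal (gdens s J (\<lambda>j. m j + s\<^sup>2 * a j) g)"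
      by (subst (1 2) ennreal_mult[symmetric]) (simp_all only: gdens_tilt[OF s J] exp_ge_zero gdens_nonneg)
  qed
  also have "\<dots> = ennreal (exp (\<Sum>j\<in>J. a j * m j + s\<^sup>2 * (a j)\<^sup>2 / 2)) * 1"
    by (subst nn_integral_cmult) (simp_all add: gdens_total[OF s J])
  finally show ?thesis by simp
qed

text \<open>Jensen's inequality for \<open>exp (- T)\<close> by way of the tangent at
  \<open>\<tau>\<close>; in this form an upper bound of the mean of \<open>T\<close> can take the
  place of the mean.\<close>

lemma gdens_jensen:
  assumes s: "s > 0" and J: "finite J" and T: "T \<in> borel_measurable (gbase J)" and T0: "\<And>g. T g \<ge> 0"
    and le: "(\<integral>\<^sup>+g. ennreal (T g) * ennreal (gdens s J m g) \<partial>gbase J) \<le> ennreal \<tau>" and \<tau>: "\<tau> \<ge> 0"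
  shows "ennreal (exp (- \<tau>)) \<le> (\<integral>\<^sup>+g. ennreal (exp (- T g)) * ennreal (gdens s J m g) \<partial>gbase J)"
proof -
  note [measurable] = measurable_gdens[of s J m] T
  define a where "a = (\<integral>\<^sup>+g. ennreal (exp (- T g)) * ennreal (gdens s J m g) \<partial>gbase J)"
  have "ennreal (exp (- \<tau>) * (1 + \<tau>)) * 1 = (\<integral>\<^sup>+g. ennreal (exp (- \<tau>) * (1 + \<tau>)) * ennreal (gdens s J m g) \<partial>gbase J)"
    by (subst nn_integral_cmult) (simp_all only: gdens_total[OF s J], measurable)
  also have "\<dots> \<le> (\<integral>\<^sup>+g. ennreal (exp (- T g)) * ennreal (gdens s J m g) + ennreal (exp (- \<tau>)) * (ennreal (T g) * ennreal (gdens s J m g)) \<partial>gbase J)"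
  proof (rule nn_integral_mono)
    fix g
    have "exp (- \<tau>) * (1 + (\<tau> - T g)) \<le> exp (- \<tau>) * exp (\<tau> - T g)" by (intro mult_left_mono exp_ge_add_one_self) auto
    also have "\<dots> = exp (- T g)" by (simp add: exp_add[symmetric])
    finally have "exp (- \<tau>) * (1 + \<tau>) \<le> exp (- T g) + exp (- \<tau>) * T g" by (simp add: algebra_simps)
    then have "exp (- \<tau>) * (1 + \<tau>) * gdens s J m g \<le> (exp (- T g) + exp (- \<tau>) * T g) * gdens s J m g" by (intro mult_right_mono gdens_nonneg)
    then have "exp (- \<tau>) * (1 + \<tau>) * gdens s J m g \<le> exp (- T g) * gdens s J m g + exp (- \<tau>) * (T g * gdens s J m g)" by (simp add: algebra_simps)
    then show "ennreal (exp (- \<tau>) * (1 + \<tau>)) * ennreal (gdens s J m g) \<le> ennreal (exp (- T g)) * ennreal (gdens s J m g) + ennreal (exp (- \<tau>)) * (ennreal (T g) * ennreal (gdens s J m g))"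
      using \<tau> T0[of g] gdens_nonneg[of s J m g] by (simp add: ennreal_mult[symmetric] ennreal_plus[symmetric] ennreal_leI del: ennreal_plus)
  qed
  also have "\<dots> = a + ennreal (exp (- \<tau>)) * (\<integral>\<^sup>+g. ennreal (T g) * ennreal (gdens s J m g) \<partial>gbase J)"
    unfolding a_def by (subst nn_integral_add) (measurable, subst nn_integral_cmult, measurable)
  also have "\<dots> \<le> a + ennreal (exp (- \<tau>)) * ennreal \<tau>" by (intro add_left_mono mult_left_mono le) simp
  finally have "ennreal (exp (- \<tau>) * \<tau>) + ennreal (exp (- \<tau>)) \<le> ennreal (exp (- \<tau>) * \<tau>) + a"
    using \<tau> by (simp add: ennreal_mult[symmetric] ennreal_plus[symmetric] algebra_simps del: ennreal_plus)
  then have "ennreal (exp (- \<tau>)) \<le> a" by (simp add: ennreal_add_left_cancel_le)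
  then show ?thesis unfolding a_def .
qed

context
  fixes J :: "'j set" and \<phi> :: "'j \<Rightarrow> real^3 \<Rightarrow> real" and s :: real and N :: nat
  assumes J: "finite J" and \<phi>: "\<And>j. continuous_on S2 (\<phi> j)" and s: "s > 0" and N: "N \<ge> 1"
begin

definition ug :: "('j \<Rightarrow> real) \<Rightarrow> real^3 \<Rightarrow> real" where "ug g y = (\<Sum>j\<in>J. g j * \<phi> j y)"

lemma continuous_ug: "continuous_on S2 (ug g)"
  unfolding ug_def by (intro continuous_intros \<phi>)

lemma measurable_ug3:
  "(\<lambda>w. ennreal (exp (ug (fst (fst w)) (snd (fst w)) - ug (fst (fst w)) (snd w)) * kk N (snd (fst w)) (snd w))) \<in> borel_measurable ((gbase J \<Otimes>\<^sub>M sigma_S2) \<Otimes>\<^sub>M sigma_S2)"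
proof -
  have g: "(\<lambda>w. fst (fst w) j) \<in> borel_measurable ((gbase J \<Otimes>\<^sub>M sigma_S2) \<Otimes>\<^sub>M sigma_S2)" if "j \<in> J" for j
    by (rule measurable_compose[OF _ measurable_gbase[OF that]]) measurable
  have x: "(\<lambda>w. h (snd (fst w))) \<in> borel_measurable ((gbase J \<Otimes>\<^sub>M sigma_S2) \<Otimes>\<^sub>M sigma_S2)" if "continuous_on S2 h" for h :: "real^3 \<Rightarrow> real"
    by (rule measurable_compose[OF _ S2_cont_measurable_sigma[OF that]]) measurable
  have y: "(\<lambda>w. h (snd w)) \<in> borel_measurable ((gbase J \<Otimes>\<^sub>M sigma_S2) \<Otimes>\<^sub>M sigma_S2)" if "continuous_on S2 h" for h :: "real^3 \<Rightarrow> real"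
    by (rule measurable_compose[OF _ S2_cont_measurable_sigma[OF that]]) measurable
  show ?thesis unfolding ug_def kk_def qk_power_feat
    by (intro measurable_compose[OF _ measurable_ennreal] borel_measurable_times measurable_compose[OF _ borel_measurable_exp] borel_measurable_diff borel_measurable_sum borel_measurable_const g x y \<phi> continuous_feat)
qed

lemma measurable_nT_ug: "(\<lambda>g. nT N (ug g)) \<in> borel_measurable (gbase J)"
proof -
  have "(\<lambda>p. \<integral>\<^sup>+y. ennreal (exp (ug (fst p) (snd p) - ug (fst p) y) * kk N (snd p) y) \<partial>sigma_S2) \<in> borel_measurable (gbase J \<Otimes>\<^sub>M sigma_S2)"
    by (rule sigma.borel_measurable_nn_integral) (use measurable_ug3 in \<open>simp add: case_prod_beta\<close>)
  then show ?thesis unfolding nT_def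
    by (intro sigma.borel_measurable_nn_integral) (simp add: case_prod_beta)
qed

text \<open>For fixed \<open>x\<close> and \<open>y\<close> the increment of the field is a linear
  form in independent Gaussian coefficients, so after Tonelli's theorem its exponential moment is
  explicit.\<close>

lemma nT_gauss:
  "(\<integral>\<^sup>+g. nT N (ug g) * ennreal (gdens s J m g) \<partial>gbase J)
   = (\<integral>\<^sup>+x. (\<integral>\<^sup>+y. ennreal (exp (\<Sum>j\<in>J. (\<phi> j x - \<phi> j y) * m j + s\<^sup>2 * (\<phi> j x - \<phi> j y)\<^sup>2 / 2) * kk N x y) \<partial>sigma_S2) \<partial>sigma_S2)"
proof -
  interpret L: sigma_finite_measure "gbase J" by (rule sigma_finite_gbase[OF J])
  interpret P: pair_sigma_finite "gbase J" sigma_S2 by standard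
  note [measurable] = measurable_gdens[of s J m]
  define F where "F g x y = ennreal (exp (ug g x - ug g y) * kk N x y)" for g x y
  note m3 = measurable_ug3[folded F_def]
  have m2: "(\<lambda>p. \<integral>\<^sup>+y. F (fst p) (snd p) y \<partial>sigma_S2) \<in> borel_measurable (gbase J \<Otimes>\<^sub>M sigma_S2)"
    by (rule sigma.borel_measurable_nn_integral) (use m3 in \<open>simp add: case_prod_beta\<close>)
  have mx: "(\<lambda>p. F (fst p) x (snd p)) \<in> borel_measurable (gbase J \<Otimes>\<^sub>M sigma_S2)" if x: "x \<in> S2" for x
  proof -
    have "(\<lambda>p. ((fst p, x), snd p)) \<in> measurable (gbase J \<Otimes>\<^sub>M sigma_S2) ((gbase J \<Otimes>\<^sub>M sigma_S2) \<Otimes>\<^sub>M sigma_S2)"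
      using x by (intro measurable_Pair measurable_fst measurable_snd measurable_const) (simp only: space_sigma_S2)
    from measurable_compose[OF this m3] show ?thesis by simp
  qed
  have mxx: "(\<lambda>g. \<integral>\<^sup>+y. F g x y \<partial>sigma_S2) \<in> borel_measurable (gbase J)" if x: "x \<in> S2" for x
    by (rule sigma.borel_measurable_nn_integral) (use mx[OF x] in \<open>simp add: case_prod_beta\<close>)
  have mg: "(\<lambda>p. ennreal (gdens s J m (fst p))) \<in> borel_measurable (gbase J \<Otimes>\<^sub>M sigma_S2)" by measurable
  have sx: "(\<lambda>x. \<integral>\<^sup>+y. F g x y \<partial>sigma_S2) \<in> borel_measurable sigma_S2" if "g \<in> space (gbase J)" for g
    using measurable_compose[OF measurable_Pair1'[OF that] m2] by simp
  have "(\<integral>\<^sup>+g. nT N (ug g) * ennreal (gdens s J m g) \<partial>gbase J) = (\<integral>\<^sup>+g. (\<integral>\<^sup>+x. (\<integral>\<^sup>+y. F g x y \<partial>sigma_S2) * ennreal (gdens s J m g) \<partial>sigma_S2) \<partial>gbase J)"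
    unfolding nT_def F_def[symmetric] by (intro nn_integral_cong nn_integral_multc[symmetric] sx)
  also have "\<dots> = (\<integral>\<^sup>+x. (\<integral>\<^sup>+g. (\<integral>\<^sup>+y. F g x y \<partial>sigma_S2) * ennreal (gdens s J m g) \<partial>gbase J) \<partial>sigma_S2)"
    by (rule P.Fubini'[symmetric]) (use borel_measurable_times_ennreal[OF m2 mg] in \<open>simp add: case_prod_beta\<close>)
  also have "\<dots> = (\<integral>\<^sup>+x. (\<integral>\<^sup>+y. ennreal (exp (\<Sum>j\<in>J. (\<phi> j x - \<phi> j y) * m j + s\<^sup>2 * (\<phi> j x - \<phi> j y)\<^sup>2 / 2) * kk N x y) \<partial>sigma_S2) \<partial>sigma_S2)"
  proof (rule nn_integral_sigma_cong)
    fix x assume x: "x \<in> S2"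
    have sy: "(\<lambda>y. F g x y) \<in> borel_measurable sigma_S2" if "g \<in> space (gbase J)" for g
      using measurable_compose[OF measurable_Pair1'[OF that] mx[OF x]] by simp
    have "(\<integral>\<^sup>+g. (\<integral>\<^sup>+y. F g x y \<partial>sigma_S2) * ennreal (gdens s J m g) \<partial>gbase J) = (\<integral>\<^sup>+g. (\<integral>\<^sup>+y. F g x y * ennreal (gdens s J m g) \<partial>sigma_S2) \<partial>gbase J)"
      by (intro nn_integral_cong nn_integral_multc[symmetric] sy)
    also have "\<dots> = (\<integral>\<^sup>+y. (\<integral>\<^sup>+g. F g x y * ennreal (gdens s J m g) \<partial>gbase J) \<partial>sigma_S2)"
      by (rule P.Fubini'[symmetric]) (use borel_measurable_times_ennreal[OF mx[OF x] mg] in \<open>simp add: case_prod_beta\<close>)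
    also have "\<dots> = (\<integral>\<^sup>+y. ennreal (exp (\<Sum>j\<in>J. (\<phi> j x - \<phi> j y) * m j + s\<^sup>2 * (\<phi> j x - \<phi> j y)\<^sup>2 / 2) * kk N x y) \<partial>sigma_S2)"
    proof (rule nn_integral_sigma_cong)
      fix y assume y: "y \<in> S2"
      have [measurable]: "(\<lambda>g. g j) \<in> borel_measurable (gbase J)" if "j \<in> J" for j by (rule measurable_gbase[OF that])
      have "(\<integral>\<^sup>+g. F g x y * ennreal (gdens s J m g) \<partial>gbase J) = (\<integral>\<^sup>+g. ennreal (kk N x y) * (ennreal (exp (\<Sum>j\<in>J. (\<phi> j x - \<phi> j y) * g j)) * ennreal (gdens s J m g)) \<partial>gbase J)"
      proof (rule nn_integral_cong)
        fix g
        have "ug g x - ug g y = (\<Sum>j\<in>J. (\<phi> j x - \<phi> j y) * g j)" unfolding ug_def sum_subtractf[symmetric] by (intro sum.cong refl) (simp add: algebra_simps)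
        then show "F g x y * ennreal (gdens s J m g) = ennreal (kk N x y) * (ennreal (exp (\<Sum>j\<in>J. (\<phi> j x - \<phi> j y) * g j)) * ennreal (gdens s J m g))"
          unfolding F_def using kk_nonneg[OF x y] by (simp add: ennreal_mult mult_ac)
      qed
      also have "\<dots> = ennreal (kk N x y) * (\<integral>\<^sup>+g. ennreal (exp (\<Sum>j\<in>J. (\<phi> j x - \<phi> j y) * g j)) * ennreal (gdens s J m g) \<partial>gbase J)"
        by (rule nn_integral_cmult) (intro borel_measurable_times borel_measurable_times_ennreal measurable_compose[OF _ measurable_ennreal] measurable_compose[OF _ borel_measurable_exp] borel_measurable_sum borel_measurable_const measurable_gbase measurable_gdens)
      also have "\<dots> = ennreal (kk N x y) * ennreal (exp (\<Sum>j\<in>J. (\<phi> j x - \<phi> j y) * m j + s\<^sup>2 * (\<phi> j x - \<phi> j y)\<^sup>2 / 2))" by (simp only: gdens_mgf[OF s J])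
      also have "\<dots> = ennreal (exp (\<Sum>j\<in>J. (\<phi> j x - \<phi> j y) * m j + s\<^sup>2 * (\<phi> j x - \<phi> j y)\<^sup>2 / 2) * kk N x y)"
        using kk_nonneg[OF x y] by (simp add: ennreal_mult mult.commute)
      finally show "(\<integral>\<^sup>+g. F g x y * ennreal (gdens s J m g) \<partial>gbase J) = ennreal (exp (\<Sum>j\<in>J. (\<phi> j x - \<phi> j y) * m j + s\<^sup>2 * (\<phi> j x - \<phi> j y)\<^sup>2 / 2) * kk N x y)" .
    qed
    finally show "(\<integral>\<^sup>+g. (\<integral>\<^sup>+y. F g x y \<partial>sigma_S2) * ennreal (gdens s J m g) \<partial>gbase J) = (\<integral>\<^sup>+y. ennreal (exp (\<Sum>j\<in>J. (\<phi> j x - \<phi> j y) * m j + s\<^sup>2 * (\<phi> j x - \<phi> j y)\<^sup>2 / 2) * kk N x y) \<partial>sigma_S2)" .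
  qed
  finally show ?thesis .
qed

text \<open>The Gaussian mixture of the exponential moment bounds, tilted by the Cameron--Martin shift
  \<open>s\<^sup>2 * dev N x (\<phi> j)\<close> and bounded from below by Jensen's inequality.\<close>

lemma gaussian_tail:
  assumes A: "A \<in> sets (sphere_config N)"
    and B: "\<And>x. x \<in> A \<Longrightarrow> B x \<ge> 0"
    and T: "\<And>x. x \<in> A \<Longrightarrow> (\<integral>\<^sup>+y. (\<integral>\<^sup>+z. ennreal (exp (\<Sum>j\<in>J. (\<phi> j y - \<phi> j z) * (s\<^sup>2 * dev N x (\<phi> j)) + s\<^sup>2 * (\<phi> j y - \<phi> j z)\<^sup>2 / 2) * kk N y z) \<partial>sigma_S2) \<partial>sigma_S2) \<le> ennreal (B x)"
    and L: "\<And>x. x \<in> A \<Longrightarrow> L \<le> s\<^sup>2 / 2 * (\<Sum>j\<in>J. (dev N x (\<phi> j))\<^sup>2) + real N - B x"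
  shows "emeasure (spherical_ensemble N) A \<le> ennreal (exp (- L))"
proof -
  interpret L: sigma_finite_measure "gbase J" by (rule sigma_finite_gbase[OF J])
  interpret E: prob_space "spherical_ensemble N" by (rule prob_space_ensemble[OF N])
  interpret P: pair_sigma_finite "gbase J" "spherical_ensemble N" by standard
  define T0 where "T0 g = enn2real (nT N (ug g))" for g
  have Tm: "T0 \<in> borel_measurable (gbase J)" unfolding T0_def[abs_def] using measurable_nT_ug by measurable
  have nTT: "nT N (ug g) = ennreal (T0 g)" for g unfolding T0_def by (rule exp_moment_nT(2)[OF N continuous_ug])
  have Tn: "T0 g \<ge> 0" for g by (simp add: T0_def)
  have devug: "dev N x (ug g) = (\<Sum>j\<in>J. dev N x (\<phi> j) * g j)" for x g
    unfolding ug_def[abs_def] by (subst dev_sum[OF \<phi>]) (simp only: mult.commute)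
  define h where "h g x = ennreal (exp (\<Sum>j\<in>J. dev N x (\<phi> j) * g j)) * (ennreal (exp (real N - T0 g)) * ennreal (gdens s J (\<lambda>_. 0) g))" for g x
  \<comment> \<open>On \<open>A\<close> the Gaussian mixture is at least \<open>exp L\<close>, by
    tilting to the mean \<open>m\<close> and Jensen's inequality. Its expectation under the ensemble
    is at most 1 by the moment bound, so Markov's inequality concludes.\<close>
  have lower: "ennreal (exp L) \<le> (\<integral>\<^sup>+g. h g x \<partial>gbase J)" if x: "x \<in> A" for x
  proof -
    define \<xi> where "\<xi> j = dev N x (\<phi> j)" for j
    define m where "m j = 0 + s\<^sup>2 * \<xi> j" for j
    define c where "c = (\<Sum>j\<in>J. \<xi> j * 0 + s\<^sup>2 * (\<xi> j)\<^sup>2 / 2)"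
    have c: "c = s\<^sup>2 / 2 * (\<Sum>j\<in>J. (\<xi> j)\<^sup>2)" unfolding c_def sum_distrib_left by (intro sum.cong refl) simp
    have "L \<le> c + (real N - B x)" using L[OF x] by (simp add: c \<xi>_def)
    then have "ennreal (exp L) \<le> ennreal (exp (c + real N) * exp (- B x))" by (intro ennreal_leI) (simp add: exp_add[symmetric])
    also have "\<dots> = ennreal (exp (c + real N)) * ennreal (exp (- B x))" by (rule ennreal_mult) auto
    also have "\<dots> \<le> ennreal (exp (c + real N)) * (\<integral>\<^sup>+g. ennreal (exp (- T0 g)) * ennreal (gdens s J m g) \<partial>gbase J)"
    proof (intro mult_left_mono gdens_jensen[OF s J Tm Tn _ B[OF x]])
      show "(\<integral>\<^sup>+g. ennreal (T0 g) * ennreal (gdens s J m g) \<partial>gbase J) \<le> ennreal (B x)"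
        unfolding nTT[symmetric] nT_gauss using T[OF x] by (simp add: m_def \<xi>_def)
    qed simp
    also have "\<dots> = (\<integral>\<^sup>+g. ennreal (exp (c + real N)) * (ennreal (exp (- T0 g)) * ennreal (gdens s J m g)) \<partial>gbase J)"
    proof (rule nn_integral_cmult[symmetric])
      note [measurable] = Tm measurable_gdens
      show "(\<lambda>g. ennreal (exp (- T0 g)) * ennreal (gdens s J m g)) \<in> borel_measurable (gbase J)" by measurable
    qed
    also have "\<dots> = (\<integral>\<^sup>+g. h g x \<partial>gbase J)"
    proof (rule nn_integral_cong)
      fix g
      have t: "exp (\<Sum>j\<in>J. \<xi> j * g j) * gdens s J (\<lambda>_. 0) g = exp c * gdens s J m g"
        unfolding c_def m_def by (rule gdens_tilt[OF s J])
      have "exp (c + real N) * (exp (- T0 g) * gdens s J m g) = exp (real N - T0 g) * (exp c * gdens s J m g)"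
        by (simp add: exp_add exp_diff exp_minus divide_inverse)
      also have "\<dots> = exp (\<Sum>j\<in>J. \<xi> j * g j) * (exp (real N - T0 g) * gdens s J (\<lambda>_. 0) g)" unfolding t[symmetric] by (simp only: mult_ac)
      finally have e: "exp (c + real N) * (exp (- T0 g) * gdens s J m g) = exp (\<Sum>j\<in>J. \<xi> j * g j) * (exp (real N - T0 g) * gdens s J (\<lambda>_. 0) g)" .
      show "ennreal (exp (c + real N)) * (ennreal (exp (- T0 g)) * ennreal (gdens s J m g)) = h g x"
        unfolding h_def \<xi>_def[symmetric] using arg_cong[OF e, of ennreal] by (simp add: ennreal_mult gdens_nonneg)
    qed
    finally show ?thesis .
  qed
  have hm: "case_prod h \<in> borel_measurable (gbase J \<Otimes>\<^sub>M spherical_ensemble N)"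
  proof -
    have d: "(\<lambda>p. dev N (snd p) (\<phi> j)) \<in> borel_measurable (gbase J \<Otimes>\<^sub>M spherical_ensemble N)" for j
    proof (rule measurable_compose[OF measurable_snd])
      show "(\<lambda>x. dev N x (\<phi> j)) \<in> borel_measurable (spherical_ensemble N)"
        using measurable_dev[OF \<phi>] by (simp cong: measurable_cong_sets add: sets_ensemble)
    qed
    have g: "(\<lambda>p. fst p j) \<in> borel_measurable (gbase J \<Otimes>\<^sub>M spherical_ensemble N)" if "j \<in> J" for j
      by (rule measurable_compose[OF measurable_fst measurable_gbase[OF that]])
    have "(\<lambda>p. h (fst p) (snd p)) \<in> borel_measurable (gbase J \<Otimes>\<^sub>M spherical_ensemble N)"
      unfolding h_def
      by (intro borel_measurable_times borel_measurable_times_ennreal measurable_compose[OF _ measurable_ennreal] measurable_compose[OF _ borel_measurable_exp] borel_measurable_sum borel_measurable_diff borel_measurable_const d g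
          measurable_compose[OF measurable_fst Tm] measurable_compose[OF measurable_fst measurable_gdens])
    then show ?thesis by (simp add: case_prod_beta')
  qed
  have As: "A \<in> sets (spherical_ensemble N)" using A by (simp add: sets_ensemble)
  have "ennreal (exp L) * emeasure (spherical_ensemble N) A = (\<integral>\<^sup>+x. ennreal (exp L) * indicator A x \<partial>spherical_ensemble N)"
    by (rule nn_integral_cmult_indicator[symmetric]) (rule As)
  also have "\<dots> \<le> (\<integral>\<^sup>+x. (\<integral>\<^sup>+g. h g x \<partial>gbase J) \<partial>spherical_ensemble N)"
    by (rule nn_integral_mono) (auto simp: indicator_def lower)
  also have "\<dots> = (\<integral>\<^sup>+g. (\<integral>\<^sup>+x. h g x \<partial>spherical_ensemble N) \<partial>gbase J)" by (rule P.Fubini'[OF hm])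
  also have "\<dots> \<le> (\<integral>\<^sup>+g. ennreal (gdens s J (\<lambda>_. 0) g) \<partial>gbase J)"
  proof (rule nn_integral_mono)
    fix g
    have "(\<integral>\<^sup>+x. h g x \<partial>spherical_ensemble N) = (\<integral>\<^sup>+x. ennreal (exp (dev N x (ug g))) \<partial>spherical_ensemble N) * (ennreal (exp (real N - T0 g)) * ennreal (gdens s J (\<lambda>_. 0) g))"
      unfolding h_def devug[symmetric]
    proof (rule nn_integral_multc)
      have "(\<lambda>x. dev N x (ug g)) \<in> borel_measurable (spherical_ensemble N)"
        using measurable_dev[OF continuous_ug] by (simp cong: measurable_cong_sets add: sets_ensemble)
      then show "(\<lambda>x. ennreal (exp (dev N x (ug g)))) \<in> borel_measurable (spherical_ensemble N)"
        by (intro measurable_compose[OF _ measurable_ennreal] measurable_compose[OF _ borel_measurable_exp])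
    qed
    also have "\<dots> \<le> ennreal (exp (T0 g - real N)) * (ennreal (exp (real N - T0 g)) * ennreal (gdens s J (\<lambda>_. 0) g))"
      unfolding T0_def by (intro mult_right_mono exp_moment_nT(1)[OF N continuous_ug]) simp
    also have "\<dots> = ennreal (gdens s J (\<lambda>_. 0) g)"
      by (simp add: ennreal_mult[symmetric] gdens_nonneg mult.assoc[symmetric] exp_add[symmetric])
    finally show "(\<integral>\<^sup>+x. h g x \<partial>spherical_ensemble N) \<le> ennreal (gdens s J (\<lambda>_. 0) g)" .
  qed
  also have "\<dots> = 1" by (rule gdens_total[OF s J])
  finally have 1: "ennreal (exp L) * emeasure (spherical_ensemble N) A \<le> 1" .
  have "emeasure (spherical_ensemble N) A = ennreal (exp (- L)) * (ennreal (exp L) * emeasure (spherical_ensemble N) A)"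
    unfolding mult.assoc[symmetric] by (simp add: ennreal_mult[symmetric] exp_add[symmetric])
  also have "\<dots> \<le> ennreal (exp (- L)) * 1" by (intro mult_left_mono 1) simp
  finally show ?thesis by simp
qed

end

section \<open>The tilted double integral and the low frequencies\<close>

lemma exp_plus_exp_minus_le: "exp w + exp (- w) \<le> 2 + w\<^sup>2 * exp \<bar>w\<bar>" for w :: real
proof -
  define a where "a = \<bar>w\<bar> / 2"
  have a: "a \<ge> 0" by (simp add: a_def)
  have "exp w + exp (- w) = exp (2 * a) + exp (- (2 * a))" by (cases "w \<ge> 0") (simp_all add: a_def)
  also have "\<dots> = 2 + (exp a - exp (- a))\<^sup>2"
    by (simp add: power2_eq_square algebra_simps exp_add[symmetric])
  also have "\<dots> \<le> 2 + (2 * a * exp a)\<^sup>2"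
  proof (intro add_left_mono power_mono)
    have "1 + (- (2 * a)) \<le> exp (- (2 * a))" by (rule exp_ge_add_one_self)
    then have "exp a * (1 - exp (- (2 * a))) \<le> exp a * (2 * a)" by (intro mult_left_mono) auto
    moreover have "exp a * exp (- (2 * a)) = exp (- a)" by (simp add: exp_add[symmetric])
    ultimately show "exp a - exp (- a) \<le> 2 * a * exp a" by (simp add: algebra_simps)
    show "0 \<le> exp a - exp (- a)" using a by simp
  qed
  also have "(2 * a * exp a)\<^sup>2 = w\<^sup>2 * exp \<bar>w\<bar>"
  proof -
    have "(2 * a * exp a)\<^sup>2 = (2 * a)\<^sup>2 * exp (2 * a)" by (simp only: power_mult_distrib exp_double)
    then show ?thesis by (simp add: a_def)
  qed
  finally show ?thesis .
qed

text \<open>Because \<open>w^2 \<le> N * (1 - q)\<close>, the growth of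
  \<open>exp \<bar>w\<bar>\<close> is absorbed by half of the powers of \<open>q\<close>, up to the
  constant \<open>exp 1 \<le> 3\<close>; the other half survives as \<open>q ^ m\<close>. The second
  factor 3 in the 9 bounds \<open>exp (c * V)\<close>.\<close>

lemma tilt_pointwise:
  assumes q: "0 \<le> q" "q \<le> 1" and V: "0 \<le> V" "c * V \<le> 1" "c \<ge> 0" and w: "w\<^sup>2 \<le> real N * (1 - q)"
    and m: "m = (N - 1) div 2" and N: "N \<ge> 1"
  shows "(exp w + exp (- w)) * exp (c * V) * q ^ (N - 1) \<le> 2 * q ^ (N - 1) + 4 * c * V * q ^ (N - 1) + 9 * w\<^sup>2 * q ^ m"
proof -
  define r where "r = sqrt (real N * (1 - q))"
  have m2: "2 * m \<le> N - 1" using div_times_less_eq_dividend[of "N - 1" 2] unfolding m by (simp add: mult.commute)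
  have r: "r \<ge> 0" "r\<^sup>2 = real N * (1 - q)" using q by (simp_all add: r_def)
  have wr: "\<bar>w\<bar> \<le> r" unfolding r_def using real_sqrt_le_mono[OF w] by simp
  have eV: "exp (c * V) \<le> 1 + 2 * (c * V)"
  proof -
    have cV: "0 \<le> c * V" using V by simp
    have "exp (c * V) \<le> 1 + c * V + (c * V)\<^sup>2" by (rule exp_bound[OF cV V(2)])
    also have "(c * V)\<^sup>2 \<le> c * V * 1" unfolding power2_eq_square by (intro mult_left_mono V cV)
    finally show ?thesis by linarith
  qed
  have eV3: "exp (c * V) \<le> 3" using eV V(2) by linarith
  have q0: "q ^ k \<ge> 0" for k using q by simp
  have key: "exp \<bar>w\<bar> * q ^ (N - 1) \<le> 3 * q ^ m"
  proof -
    \<comment> \<open>\<open>q \<le> exp (- (1 - q))\<close>, and \<open>N - 1 - m\<close> is at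
      least half of \<open>N - 1\<close>; replacing \<open>N - 1\<close> by \<open>N\<close> costs
      \<open>exp (1/2)\<close>. The final exponent \<open>r - r\<^sup>2 / 2 + 1/2\<close> is largest
      at \<open>r = 1\<close>.\<close>
    have "q ^ (N - 1 - m) \<le> exp (- (1 - q)) ^ (N - 1 - m)"
      using exp_ge_add_one_self[of "- (1 - q)"] q by (intro power_mono) auto
    also have "\<dots> = exp (real (N - 1 - m) * (- (1 - q)))" by (rule exp_of_nat_mult[symmetric])
    also have "\<dots> \<le> exp (- (r\<^sup>2 / 2) + 1 / 2)"
    proof -
      have "2 * (N - 1 - m) \<ge> N - 1" using m2 by linarith
      then have "real N - 1 \<le> 2 * real (N - 1 - m)" using N by linarith
      moreover define k D where "k = real (N - 1 - m)" and "D = 1 - q"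
      ultimately have "(real N - 1) * D \<le> 2 * k * D" using q by (intro mult_right_mono) auto
      then have "real N * D \<le> 2 * (k * D) + D" by (simp add: algebra_simps)
      moreover have "D \<le> 1" using q by (simp add: D_def)
      ultimately have "- (k * D) \<le> - (real N * D / 2) + 1 / 2" by linarith
      then show ?thesis unfolding r(2) k_def D_def exp_le_cancel_iff mult_minus_right .
    qed
    finally have "exp \<bar>w\<bar> * q ^ (N - 1 - m) \<le> exp r * exp (- (r\<^sup>2 / 2) + 1 / 2)" using wr q0 by (intro mult_mono) auto
    also have "\<dots> = exp (r - r\<^sup>2 / 2 + 1 / 2)" by (simp add: exp_add[symmetric])
    also have "\<dots> \<le> exp 1"
    proof -
      have "0 \<le> (r - 1)\<^sup>2" by simp
      then have "r - r\<^sup>2 / 2 + 1 / 2 \<le> 1" by (simp add: power2_eq_square algebra_simps)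
      then show ?thesis by simp
    qed
    also have "\<dots> \<le> 3" by (rule exp_le)
    finally have "exp \<bar>w\<bar> * q ^ (N - 1 - m) * q ^ m \<le> 3 * q ^ m" using q0 by (intro mult_right_mono) auto
    moreover have "N - 1 = (N - 1 - m) + m" using m2 by linarith
    then have "q ^ (N - 1) = q ^ (N - 1 - m) * q ^ m" by (metis power_add)
    ultimately show ?thesis by (simp only: mult.assoc)
  qed
  have "(exp w + exp (- w)) * exp (c * V) \<le> (2 + w\<^sup>2 * exp \<bar>w\<bar>) * exp (c * V)"
    by (intro mult_right_mono exp_plus_exp_minus_le) simp
  also have "\<dots> = 2 * exp (c * V) + (w\<^sup>2 * exp \<bar>w\<bar>) * exp (c * V)" by (rule distrib_right)
  also have "\<dots> \<le> 2 * (1 + 2 * (c * V)) + (w\<^sup>2 * exp \<bar>w\<bar>) * 3" using eV eV3 by (intro add_mono mult_left_mono) auto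
  finally have "(exp w + exp (- w)) * exp (c * V) * q ^ (N - 1) \<le> (2 * (1 + 2 * (c * V)) + (w\<^sup>2 * exp \<bar>w\<bar>) * 3) * q ^ (N - 1)"
    by (intro mult_right_mono q0)
  also have "\<dots> = 2 * q ^ (N - 1) + 4 * c * V * q ^ (N - 1) + (3 * w\<^sup>2) * (exp \<bar>w\<bar> * q ^ (N - 1))" by (simp add: algebra_simps)
  also have "\<dots> \<le> 2 * q ^ (N - 1) + 4 * c * V * q ^ (N - 1) + (3 * w\<^sup>2) * (3 * q ^ m)" by (intro add_left_mono mult_left_mono key) simp
  finally show ?thesis by simp
qed

text \<open>Up to the factor \<open>s\<^sup>2\<close>, the variance of the increment of the Gaussian
  field between \<open>y\<close> and \<open>z\<close>.\<close>

definition VV :: "(nat \<Rightarrow> real) \<Rightarrow> nat \<Rightarrow> real^3 \<Rightarrow> real^3 \<Rightarrow> real" where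
  "VV b N y z = (\<Sum>n\<in>{1..N}. b n * (2 * (1 - qk y z ^ n)))"

text \<open>The integral of \<open>2 * (1 - q^n)\<close> against \<open>N^2 * q^(N - 1)\<close> is
  \<open>2 * n * N / (n + N)\<close>, at most \<open>2 * n\<close>.\<close>

lemma integral_VV:
  assumes y: "y \<in> S2" and N: "N \<ge> 1" and b0: "\<And>n. b n \<ge> 0"
  shows "(real N)\<^sup>2 * (LINT z|sigma_S2. VV b N y z * qk y z ^ (N - 1)) \<le> 2 * (\<Sum>n\<in>{1..N}. real n * b n)"
proof -
  have N0: "real N > 0" using N by simp
  have i: "integrable sigma_S2 (\<lambda>z. qk y z ^ k)" for k by (intro S2_cont_integrable continuous_intros)
  have "(LINT z|sigma_S2. VV b N y z * qk y z ^ (N - 1)) = (LINT z|sigma_S2. (\<Sum>n\<in>{1..N}. 2 * b n * (qk y z ^ (N - 1) - qk y z ^ (n + (N - 1)))))"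
    unfolding VV_def sum_distrib_right by (intro Bochner_Integration.integral_cong sum.cong refl) (simp only: power_add, simp add: algebra_simps)
  also have "\<dots> = (\<Sum>n\<in>{1..N}. (LINT z|sigma_S2. 2 * b n * (qk y z ^ (N - 1) - qk y z ^ (n + (N - 1)))))"
    by (rule Bochner_Integration.integral_sum) (intro integrable_mult_right Bochner_Integration.integrable_diff i)
  also have "\<dots> = (\<Sum>n\<in>{1..N}. 2 * b n * (1 / real N - 1 / (real n + real N)))"
  proof (rule sum.cong[OF refl])
    fix n
    have "(LINT z|sigma_S2. 2 * b n * (qk y z ^ (N - 1) - qk y z ^ (n + (N - 1)))) = 2 * b n * ((LINT z|sigma_S2. qk y z ^ (N - 1)) - (LINT z|sigma_S2. qk y z ^ (n + (N - 1))))"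
      by (simp only: integral_mult_right_zero Bochner_Integration.integral_diff[OF i i])
    also have "\<dots> = 2 * b n * (1 / real N - 1 / (real n + real N))"
      using N by (simp add: integral_qk_power[OF y] of_nat_diff)
    finally show "(LINT z|sigma_S2. 2 * b n * (qk y z ^ (N - 1) - qk y z ^ (n + (N - 1)))) = 2 * b n * (1 / real N - 1 / (real n + real N))" .
  qed
  finally have "(real N)\<^sup>2 * (LINT z|sigma_S2. VV b N y z * qk y z ^ (N - 1)) = (\<Sum>n\<in>{1..N}. 2 * b n * ((real N)\<^sup>2 * (1 / real N - 1 / (real n + real N))))"
    by (simp only: sum_distrib_left mult_ac)
  also have "\<dots> \<le> (\<Sum>n\<in>{1..N}. 2 * b n * real n)"
  proof (intro sum_mono mult_left_mono)
    fix n :: nat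
    have s: "real n + real N > 0" using N0 by simp
    have "1 / real N - 1 / (real n + real N) = real n / (real N * (real n + real N))" using N0 s by (simp add: field_simps)
    then have "(real N)\<^sup>2 * (1 / real N - 1 / (real n + real N)) = real n * (real N / (real n + real N))" using N0 by (simp add: power2_eq_square)
    also have "\<dots> \<le> real n * 1" using s by (intro mult_left_mono) auto
    finally show "(real N)\<^sup>2 * (1 / real N - 1 / (real n + real N)) \<le> real n" by simp
  qed (use b0 in auto)
  finally show ?thesis by (simp add: sum_distrib_left mult_ac)
qed

text \<open>Adding the integrand with \<open>y\<close> and \<open>z\<close> exchanged removes the
  part that is odd in the shift, so \<open>tilt_pointwise\<close> leaves only a quadratic term.
  Integrated against \<open>qk^m\<close>, this term is a difference of two quadratic forms of
  \<open>v\<close>, which \<open>vv_variance\<close> bounds.\<close>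

lemma tilt_integral_le:
  assumes N: "N \<ge> 1" and xS: "\<And>i. i \<in> {1..N} \<Longrightarrow> x i \<in> S2"
    and b0: "\<And>n. b n \<ge> 0" and b: "\<And>n. n \<ge> 1 \<Longrightarrow> b n \<le> 1 / (real n)\<^sup>2"
    and Y: "Yn N x \<le> 12 * real N"
  shows "(\<integral>\<^sup>+y. (\<integral>\<^sup>+z. ennreal (exp (1 / 400 * (vv b N x y - vv b N x z) + 1 / 800 * VV b N y z) * kk N y z) \<partial>sigma_S2) \<partial>sigma_S2)
    \<le> ennreal (real N + 1 / 200 * (\<Sum>n\<in>{1..N}. real n * b n) + 1 / 1600 * X2 b N x)"
proof -
  define v where "v = vv b N x"
  have cv: "continuous_on S2 v" unfolding v_def by (rule continuous_vv)
  define m where "m = (N - 1) div 2"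
  have N0: "real N \<ge> 1" using N by simp
  \<comment> \<open>Halving the exponent to \<open>m\<close> at most doubles the scale, which gives
    the factor 4 in the estimate of \<open>G\<close> below.\<close>
  have mN: "real N \<le> 2 * (real m + 1)" 
  proof -
    define r where "r = (N - 1) mod 2"
    have "m * 2 + r = N - 1" unfolding m_def r_def by (rule div_mult_mod_eq)
    moreover have "r < 2" by (simp add: r_def)
    ultimately have "N \<le> 2 * (m + 1)" by (cases N) auto
    then have "real N \<le> real (2 * (m + 1))" by (simp only: of_nat_le_iff)
    then show ?thesis by simp
  qed
  have bn: "b n * real n \<le> 1" if "n \<ge> 1" for n
  proof -
    have "b n * real n \<le> 1 / (real n)\<^sup>2 * real n" by (intro mult_right_mono b that) simp
    also have "\<dots> \<le> 1" using that by (simp add: power2_eq_square)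
    finally show ?thesis .
  qed
  have X0: "X2 b N x \<ge> 0" unfolding X2_def by (intro sum_nonneg mult_nonneg_nonneg b0 QN_nonneg xS)
  define f where "f y z = ennreal (exp (1 / 400 * (v y - v z) + 1 / 800 * VV b N y z) * kk N y z)" for y z
  define I where "I = (\<integral>\<^sup>+y. (\<integral>\<^sup>+z. f y z \<partial>sigma_S2) \<partial>sigma_S2)"
  have fm: "(\<lambda>p. f (fst p) (snd p)) \<in> borel_measurable (sigma_S2 \<Otimes>\<^sub>M sigma_S2)"
  proof -
    have 1: "(\<lambda>w. h (fst w)) \<in> borel_measurable (sigma_S2 \<Otimes>\<^sub>M sigma_S2)" if "continuous_on S2 h" for h :: "real^3 \<Rightarrow> real"
      by (rule measurable_compose[OF measurable_fst S2_cont_measurable_sigma[OF that]])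
    have 2: "(\<lambda>w. h (snd w)) \<in> borel_measurable (sigma_S2 \<Otimes>\<^sub>M sigma_S2)" if "continuous_on S2 h" for h :: "real^3 \<Rightarrow> real"
      by (rule measurable_compose[OF measurable_snd S2_cont_measurable_sigma[OF that]])
    show ?thesis unfolding f_def VV_def kk_def qk_power_feat
      by (intro measurable_compose[OF _ measurable_ennreal] borel_measurable_times measurable_compose[OF _ borel_measurable_exp] borel_measurable_add borel_measurable_diff borel_measurable_sum borel_measurable_const 1 2 cv continuous_feat)
  qed
  have fm': "(\<lambda>p. f (snd p) (fst p)) \<in> borel_measurable (sigma_S2 \<Otimes>\<^sub>M sigma_S2)"
    using measurable_compose[OF measurable_pair_swap' fm] by (simp add: case_prod_beta)
  interpret P: pair_sigma_finite sigma_S2 sigma_S2 by standard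
  have I': "I = (\<integral>\<^sup>+y. (\<integral>\<^sup>+z. f z y \<partial>sigma_S2) \<partial>sigma_S2)"
    unfolding I_def by (rule P.Fubini'[symmetric]) (use fm in \<open>simp add: case_prod_beta'\<close>)
  have s1: "(\<lambda>z. f y z) \<in> borel_measurable sigma_S2" "(\<lambda>z. f z y) \<in> borel_measurable sigma_S2" if "y \<in> space sigma_S2" for y
    using measurable_compose[OF measurable_Pair1'[OF that] fm] measurable_compose[OF measurable_Pair1'[OF that] fm'] by simp_all
  have s2: "(\<lambda>y. \<integral>\<^sup>+z. f y z \<partial>sigma_S2) \<in> borel_measurable sigma_S2" "(\<lambda>y. \<integral>\<^sup>+z. f z y \<partial>sigma_S2) \<in> borel_measurable sigma_S2"
    by (rule sigma.borel_measurable_nn_integral, use fm in \<open>simp add: case_prod_beta'\<close>)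
      (rule sigma.borel_measurable_nn_integral, use fm' in \<open>simp add: case_prod_beta'\<close>)
  have "I + I = (\<integral>\<^sup>+y. (\<integral>\<^sup>+z. f y z \<partial>sigma_S2) + (\<integral>\<^sup>+z. f z y \<partial>sigma_S2) \<partial>sigma_S2)"
    by (subst nn_integral_add[OF s2]) (simp only: I_def[symmetric] I'[symmetric])
  also have "\<dots> = (\<integral>\<^sup>+y. (\<integral>\<^sup>+z. f y z + f z y \<partial>sigma_S2) \<partial>sigma_S2)"
    by (intro nn_integral_cong nn_integral_add[symmetric] s1)
  finally have II: "I + I = (\<integral>\<^sup>+y. (\<integral>\<^sup>+z. f y z + f z y \<partial>sigma_S2) \<partial>sigma_S2)" .
  \<comment> \<open>The 9 comes from \<open>tilt_pointwise\<close> and \<open>160000 = 400^2\<close>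
    from the factor \<open>1 / 400\<close> of the shift.\<close>
  define a where "a = 9 * (real N)\<^sup>2 / 160000"
  define R where "R y z = 2 * (real N)\<^sup>2 * qk y z ^ (N - 1) + (real N)\<^sup>2 / 200 * (VV b N y z * qk y z ^ (N - 1)) + a * (qk y z ^ m * (v y - v z)\<^sup>2)" for y z
  have VV0: "0 \<le> VV b N y z" "VV b N y z \<le> 4" if y: "y \<in> S2" and z: "z \<in> S2" for y z
  proof -
    have q: "0 \<le> qk y z" "qk y z \<le> 1" by (rule qk_nonneg[OF y z], rule qk_le_1[OF y z])
    show "0 \<le> VV b N y z" unfolding VV_def using q by (intro sum_nonneg mult_nonneg_nonneg b0) (auto intro: power_le_one)
    have "VV b N y z \<le> (\<Sum>n\<in>{1..N}. 2 * (1 / (real n)\<^sup>2))" unfolding VV_def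
    proof (rule sum_mono)
      fix n assume n: "n \<in> {1..N}"
      have "b n * (2 * (1 - qk y z ^ n)) \<le> (1 / (real n)\<^sup>2) * 2" using n q b[of n] b0[of n] power_le_one[OF q, of n] by (intro mult_mono) auto
      then show "b n * (2 * (1 - qk y z ^ n)) \<le> 2 * (1 / (real n)\<^sup>2)" by simp
    qed
    also have "\<dots> \<le> 2 * 2" unfolding sum_distrib_left[symmetric] by (intro mult_left_mono sum_inverse_sq_le) simp
    finally show "VV b N y z \<le> 4" by simp
  qed
  have fR: "f y z + f z y \<le> ennreal (R y z)" if y: "y \<in> S2" and z: "z \<in> S2" for y z
  proof -
    define w where "w = 1 / 400 * (v y - v z)"
    have q: "0 \<le> qk y z" "qk y z \<le> 1" by (rule qk_nonneg[OF y z], rule qk_le_1[OF y z])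
    \<comment> \<open>This is where \<open>Yn N x \<le> 12 * N\<close> is used: the Lipschitz bound
      becomes \<open>48 * N * (1 - qk y z)\<close>, and the division by \<open>400^2\<close> brings
      it below the threshold of \<open>tilt_pointwise\<close>.\<close>
    have w: "w\<^sup>2 \<le> real N * (1 - qk y z)"
    proof -
      have "(v y - v z)\<^sup>2 \<le> 4 * (1 - qk y z) * Yn N x" unfolding v_def by (rule vv_lipschitz[OF _ b0 b y z]) (erule xS)
      also have "\<dots> \<le> 4 * (1 - qk y z) * (12 * real N)" using q by (intro mult_left_mono Y) auto
      also have "\<dots> = 48 * (real N * (1 - qk y z))" by simp
      finally have "(v y - v z)\<^sup>2 \<le> 48 * (real N * (1 - qk y z))" .
      moreover have "w\<^sup>2 = (v y - v z)\<^sup>2 / 160000" by (simp add: w_def power_divide)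
      moreover have "0 \<le> real N * (1 - qk y z)" using q by simp
      ultimately show ?thesis by linarith
    qed
    have sym: "VV b N z y = VV b N y z" "kk N z y = kk N y z" by (simp_all only: VV_def kk_def qk_commute[of z y])
    have "f y z + f z y = ennreal ((exp w + exp (- w)) * exp (1 / 800 * VV b N y z) * kk N y z)"
    proof -
      have "exp (1 / 400 * (v y - v z) + 1 / 800 * VV b N y z) * kk N y z + exp (1 / 400 * (v z - v y) + 1 / 800 * VV b N y z) * kk N y z = (exp w + exp (- w)) * exp (1 / 800 * VV b N y z) * kk N y z"
      proof -
        have "1 / 400 * (v z - v y) = - w" by (simp only: w_def right_diff_distrib minus_diff_eq)
        then show ?thesis by (simp only: w_def[symmetric] exp_add distrib_right)
      qed
      then show ?thesis unfolding f_def sym using kk_nonneg[OF y z] by (simp add: ennreal_plus[symmetric] del: ennreal_plus)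
    qed
    also have "\<dots> \<le> ennreal (R y z)"
    proof (rule ennreal_leI)
      have "(exp w + exp (- w)) * exp (1 / 800 * VV b N y z) * qk y z ^ (N - 1) \<le> 2 * qk y z ^ (N - 1) + 4 * (1 / 800) * VV b N y z * qk y z ^ (N - 1) + 9 * w\<^sup>2 * qk y z ^ m"
        by (rule tilt_pointwise[OF q VV0(1)[OF y z] _ _ w m_def N]) (use VV0(2)[OF y z] in auto)
      then have "(real N)\<^sup>2 * ((exp w + exp (- w)) * exp (1 / 800 * VV b N y z) * qk y z ^ (N - 1)) \<le> (real N)\<^sup>2 * (2 * qk y z ^ (N - 1) + 4 * (1 / 800) * VV b N y z * qk y z ^ (N - 1) + 9 * w\<^sup>2 * qk y z ^ m)"
        by (intro mult_left_mono) auto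
      moreover have "(real N)\<^sup>2 * (2 * qk y z ^ (N - 1) + 4 * (1 / 800) * VV b N y z * qk y z ^ (N - 1) + 9 * w\<^sup>2 * qk y z ^ m) = R y z"
      proof -
        have "w\<^sup>2 = (v y - v z)\<^sup>2 / 160000" by (simp add: w_def power_divide)
        then show ?thesis unfolding R_def a_def by (simp add: distrib_left)
      qed
      moreover have "(exp w + exp (- w)) * exp (1 / 800 * VV b N y z) * kk N y z = (real N)\<^sup>2 * ((exp w + exp (- w)) * exp (1 / 800 * VV b N y z) * qk y z ^ (N - 1))"
        unfolding kk_def by (simp only: mult_ac)
      ultimately show "(exp w + exp (- w)) * exp (1 / 800 * VV b N y z) * kk N y z \<le> R y z" by linarith
    qed
    finally show ?thesis .
  qed
  define G where "G y = a / (real m + 1) * ((v y)\<^sup>2 - 2 * (avg m v y * v y) + avg m (\<lambda>z. (v z)\<^sup>2) y)" for y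
  define K where "K = 2 * real N + 1 / 100 * (\<Sum>n\<in>{1..N}. real n * b n)"
  have cv2: "continuous_on S2 (\<lambda>z. (v z)\<^sup>2)" by (intro continuous_intros cv)
  have a0: "a \<ge> 0" by (simp add: a_def)
  have R0: "R y z \<ge> 0" if y: "y \<in> S2" and z: "z \<in> S2" for y z
    unfolding R_def using qk_nonneg[OF y z] VV0(1)[OF y z] a0 by (intro add_nonneg_nonneg mult_nonneg_nonneg) auto
  have cR: "continuous_on S2 (R y)" for y unfolding R_def VV_def by (intro continuous_intros cv)
  have inner: "(\<integral>\<^sup>+z. f y z + f z y \<partial>sigma_S2) \<le> ennreal (K + G y)" if y: "y \<in> S2" for y
  proof -
    have "(\<integral>\<^sup>+z. f y z + f z y \<partial>sigma_S2) \<le> (\<integral>\<^sup>+z. ennreal (R y z) \<partial>sigma_S2)"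
      by (rule nn_integral_sigma_mono) (rule fR[OF y])
    also have "\<dots> = ennreal (LINT z|sigma_S2. R y z)" by (rule nn_integral_cont[OF cR R0[OF y]])
    also have "\<dots> \<le> ennreal (K + G y)"
    proof (rule ennreal_leI)
      have i1: "integrable sigma_S2 (\<lambda>z. 2 * (real N)\<^sup>2 * qk y z ^ (N - 1))"
        and i2: "integrable sigma_S2 (\<lambda>z. (real N)\<^sup>2 / 200 * (VV b N y z * qk y z ^ (N - 1)))"
        and i3: "integrable sigma_S2 (\<lambda>z. a * (qk y z ^ m * (v y - v z)\<^sup>2))"
        unfolding VV_def by (intro S2_cont_integrable continuous_intros cv)+
      have "(LINT z|sigma_S2. R y z) = 2 * (real N)\<^sup>2 * (LINT z|sigma_S2. qk y z ^ (N - 1)) + (real N)\<^sup>2 / 200 * (LINT z|sigma_S2. VV b N y z * qk y z ^ (N - 1)) + a * (LINT z|sigma_S2. qk y z ^ m * (v y - v z)\<^sup>2)"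
        unfolding R_def Bochner_Integration.integral_add[OF Bochner_Integration.integrable_add[OF i1 i2] i3] Bochner_Integration.integral_add[OF i1 i2] integral_mult_right_zero ..
      moreover have "2 * (real N)\<^sup>2 * (LINT z|sigma_S2. qk y z ^ (N - 1)) = 2 * real N"
        using N0 N by (simp add: integral_qk_power[OF y] of_nat_diff power2_eq_square)
      moreover have "(real N)\<^sup>2 / 200 * (LINT z|sigma_S2. VV b N y z * qk y z ^ (N - 1)) \<le> 1 / 100 * (\<Sum>n\<in>{1..N}. real n * b n)"
        using integral_VV[where b=b, OF y N b0] by simp
      moreover have "a * (LINT z|sigma_S2. qk y z ^ m * (v y - v z)\<^sup>2) = G y"
      proof -
        have j: "integrable sigma_S2 (\<lambda>z. (v y)\<^sup>2 * qk y z ^ m)" "integrable sigma_S2 (\<lambda>z. (2 * v y) * (qk y z ^ m * v z))" "integrable sigma_S2 (\<lambda>z. qk y z ^ m * (v z)\<^sup>2)"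
          by (intro S2_cont_integrable continuous_intros cv)+
        have "(LINT z|sigma_S2. qk y z ^ m * (v y - v z)\<^sup>2) = (LINT z|sigma_S2. ((v y)\<^sup>2 * qk y z ^ m - (2 * v y) * (qk y z ^ m * v z)) + qk y z ^ m * (v z)\<^sup>2)"
          by (intro Bochner_Integration.integral_cong refl) (simp add: power2_eq_square algebra_simps)
        also have "\<dots> = (v y)\<^sup>2 * (LINT z|sigma_S2. qk y z ^ m) - (2 * v y) * (LINT z|sigma_S2. qk y z ^ m * v z) + (LINT z|sigma_S2. qk y z ^ m * (v z)\<^sup>2)"
          unfolding Bochner_Integration.integral_add[OF Bochner_Integration.integrable_diff[OF j(1,2)] j(3)] Bochner_Integration.integral_diff[OF j(1,2)] integral_mult_right_zero ..
        finally have e: "(LINT z|sigma_S2. qk y z ^ m * (v y - v z)\<^sup>2) = (v y)\<^sup>2 * (LINT z|sigma_S2. qk y z ^ m) - (2 * v y) * (LINT z|sigma_S2. qk y z ^ m * v z) + (LINT z|sigma_S2. qk y z ^ m * (v z)\<^sup>2)" .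
        have ai: "(LINT z|sigma_S2. qk y z ^ m * h z) = avg m h y / (real m + 1)" for h by (simp add: avg_def)
        have "a * (p * (1 / M) - 2 * t * (A / M) + B / M) = a / M * (p - 2 * (A * t) + B)" for p t A B M :: real
          by (simp add: add_divide_distrib diff_divide_distrib algebra_simps)
        then show ?thesis unfolding e integral_qk_power[OF y] ai G_def .
      qed
      ultimately show "(LINT z|sigma_S2. R y z) \<le> K + G y" unfolding K_def by linarith
    qed
    finally show ?thesis .
  qed
  have G0: "G y \<ge> 0" if y: "y \<in> S2" for y
  proof -
    have ai: "avg m h y = (real m + 1) * (LINT z|sigma_S2. qk y z ^ m * h z)" for h by (simp add: avg_def)
    have j: "integrable sigma_S2 (\<lambda>z. (v y)\<^sup>2 * qk y z ^ m)" "integrable sigma_S2 (\<lambda>z. (2 * v y) * (qk y z ^ m * v z))" "integrable sigma_S2 (\<lambda>z. qk y z ^ m * (v z)\<^sup>2)"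
      by (intro S2_cont_integrable continuous_intros cv)+
    have "0 \<le> (LINT z|sigma_S2. qk y z ^ m * (v y - v z)\<^sup>2)"
    proof (rule Bochner_Integration.integral_nonneg_AE, rule AE_I2)
      fix z assume "z \<in> space sigma_S2"
      then have z: "z \<in> S2" by (simp only: space_sigma_S2)
      show "0 \<le> qk y z ^ m * (v y - v z)\<^sup>2" using qk_nonneg[OF y z] by simp
    qed
    also have "(LINT z|sigma_S2. qk y z ^ m * (v y - v z)\<^sup>2) = (LINT z|sigma_S2. ((v y)\<^sup>2 * qk y z ^ m - (2 * v y) * (qk y z ^ m * v z)) + qk y z ^ m * (v z)\<^sup>2)"
      by (intro Bochner_Integration.integral_cong refl) (simp add: power2_eq_square algebra_simps)
    also have "\<dots> = (v y)\<^sup>2 * (LINT z|sigma_S2. qk y z ^ m) - (2 * v y) * (LINT z|sigma_S2. qk y z ^ m * v z) + (LINT z|sigma_S2. qk y z ^ m * (v z)\<^sup>2)"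
      unfolding Bochner_Integration.integral_add[OF Bochner_Integration.integrable_diff[OF j(1,2)] j(3)] Bochner_Integration.integral_diff[OF j(1,2)] integral_mult_right_zero ..
    finally have "0 \<le> (real m + 1) * ((v y)\<^sup>2 * (1 / (real m + 1)) - (2 * v y) * (LINT z|sigma_S2. qk y z ^ m * v z) + (LINT z|sigma_S2. qk y z ^ m * (v z)\<^sup>2))"
      unfolding integral_qk_power[OF y] by (intro mult_nonneg_nonneg) auto
    also have "\<dots> = (v y)\<^sup>2 - 2 * (avg m v y * v y) + avg m (\<lambda>z. (v z)\<^sup>2) y" 
    proof -
      have "M * (p * (1 / M) - 2 * t * X + Y) = p - 2 * (M * X * t) + M * Y" if "M \<noteq> 0" for M p t X Y :: real
        using that by (simp add: distrib_left right_diff_distrib)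
      from this[of "real m + 1"] show ?thesis unfolding ai by simp
    qed
    finally show ?thesis unfolding G_def using a0 by (intro mult_nonneg_nonneg) auto
  qed
  have K0: "K \<ge> 0" unfolding K_def by (intro add_nonneg_nonneg mult_nonneg_nonneg sum_nonneg b0) auto
  have cG: "continuous_on S2 (\<lambda>y. K + G y)" unfolding G_def by (intro continuous_intros cv continuous_avg cv2)
  have "I + I \<le> (\<integral>\<^sup>+y. ennreal (K + G y) \<partial>sigma_S2)" unfolding II by (rule nn_integral_sigma_mono) (rule inner)
  also have "\<dots> = ennreal (LINT y|sigma_S2. K + G y)" by (rule nn_integral_cont[OF cG]) (use K0 G0 in \<open>simp add: add_nonneg_nonneg del: mem_sphere\<close>)
  also have "\<dots> \<le> ennreal (2 * (real N + 1 / 200 * (\<Sum>n\<in>{1..N}. real n * b n) + 1 / 1600 * X2 b N x))"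
  proof (rule ennreal_leI)
    have j: "integrable sigma_S2 (\<lambda>y. (v y)\<^sup>2)" "integrable sigma_S2 (\<lambda>y. 2 * (avg m v y * v y))" "integrable sigma_S2 (avg m (\<lambda>z. (v z)\<^sup>2))" "integrable sigma_S2 G"
      unfolding G_def by (intro S2_cont_integrable continuous_intros cv continuous_avg cv2)+
    have "(LINT y|sigma_S2. G y) = a / (real m + 1) * ((LINT y|sigma_S2. (v y)\<^sup>2) - 2 * (LINT y|sigma_S2. avg m v y * v y) + (LINT y|sigma_S2. avg m (\<lambda>z. (v z)\<^sup>2) y))"
      unfolding G_def integral_mult_right_zero Bochner_Integration.integral_add[OF Bochner_Integration.integrable_diff[OF j(1,2)] j(3)] Bochner_Integration.integral_diff[OF j(1,2)] ..
    also have "\<dots> = 2 * a / (real m + 1) * ((LINT y|sigma_S2. v y * v y) - (LINT y|sigma_S2. avg m v y * v y))"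
      unfolding integral_avg[OF cv2] by (simp add: power2_eq_square field_simps)
    also have "\<dots> \<le> 2 * a / (real m + 1) * (X2 b N x / (real m + 1))"
      using a0 unfolding v_def by (intro mult_left_mono vv_variance xS b0 bn) auto
    also have "\<dots> = 9 / 80000 * ((real N)\<^sup>2 / (real m + 1)\<^sup>2) * X2 b N x" by (simp add: a_def power2_eq_square)
    also have "\<dots> \<le> 9 / 80000 * 4 * X2 b N x"
    proof (intro mult_right_mono mult_left_mono X0)
      have "(real N)\<^sup>2 \<le> (2 * (real m + 1))\<^sup>2" using mN by (intro power_mono) auto
      also have "(2 * (real m + 1))\<^sup>2 = 4 * (real m + 1)\<^sup>2" by (simp only: power_mult_distrib) simp
      finally have "(real N)\<^sup>2 \<le> 4 * (real m + 1)\<^sup>2" .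
      moreover have P: "(real m + 1)\<^sup>2 > 0" by (intro zero_less_power) simp
      ultimately show "(real N)\<^sup>2 / (real m + 1)\<^sup>2 \<le> 4" unfolding pos_divide_le_eq[OF P] by simp
    qed simp
    \<comment> \<open>\<open>I + I\<close> was estimated, so the loss is half of this,
      \<open>X2 / 1600\<close>.\<close>
    also have "\<dots> \<le> 1 / 800 * X2 b N x" using X0 by simp
    finally have "(LINT y|sigma_S2. G y) \<le> 1 / 800 * X2 b N x" .
    moreover have "(LINT y|sigma_S2. K + G y) = K + (LINT y|sigma_S2. G y)"
      by (subst Bochner_Integration.integral_add[OF _ j(4)]) (simp_all add: sigma.prob_space[simplified])
    ultimately show "(LINT y|sigma_S2. K + G y) \<le> 2 * (real N + 1 / 200 * (\<Sum>n\<in>{1..N}. real n * b n) + 1 / 1600 * X2 b N x)"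
      unfolding K_def by simp
  qed
  finally have "ennreal (1 / 2) * (I + I) \<le> ennreal (1 / 2) * ennreal (2 * (real N + 1 / 200 * (\<Sum>n\<in>{1..N}. real n * b n) + 1 / 1600 * X2 b N x))"
    by (intro mult_left_mono) auto
  also have "\<dots> = ennreal (real N + 1 / 200 * (\<Sum>n\<in>{1..N}. real n * b n) + 1 / 1600 * X2 b N x)"
  proof -
    have "ennreal (1 / 2) * ennreal (2 * B) = ennreal B" for B :: real
      by (subst ennreal_mult'[symmetric]) simp_all
    then show ?thesis .
  qed
  also have "ennreal (1 / 2) * (I + I) = I"
  proof -
    have "ennreal (1 / 2) * (I + I) = (ennreal (1 / 2) + ennreal (1 / 2)) * I" by (simp only: distrib_left distrib_right)
    also have "ennreal (1 / 2) + ennreal (1 / 2) = 1" by (subst ennreal_plus[symmetric]) simp_all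
    finally show ?thesis by simp
  qed
  finally show ?thesis unfolding I_def f_def v_def .
qed

lemma dev_cmult: "dev N x (\<lambda>y. c * u y) = c * dev N x u"
  unfolding dev_def by (simp add: sum_distrib_left right_diff_distrib)

text \<open>\<open>gaussian_tail\<close> for the features scaled by \<open>sqrt (b n)\<close>: the
  squared deviations add up to \<open>X2\<close>, and with \<open>s\<^sup>2 = 1/400\<close> the
  shifted field is \<open>vv / 400\<close>. The gain \<open>X2 / 800\<close> minus the loss
  \<open>X2 / 1600\<close> is the exponent.\<close>

lemma middle_tail:
  assumes N: "N \<ge> 1" and b0: "\<And>n. b n \<ge> 0" and b: "\<And>n. n \<ge> 1 \<Longrightarrow> b n \<le> 1 / (real n)\<^sup>2"
  shows "emeasure (spherical_ensemble N) {x \<in> space (sphere_config N). Yn N x \<le> 12 * real N \<and> X2 b N x > \<tau>}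
    \<le> ennreal (exp (- (\<tau> / 1600 - (\<Sum>n\<in>{1..N}. real n * b n))))"
proof -
  define A where "A = {x \<in> space (sphere_config N). Yn N x \<le> 12 * real N \<and> X2 b N x > \<tau>}"
  define J where "J = Sigma {1..N} featset"
  define \<phi> where "\<phi> j y = sqrt (b (fst j)) * feat (fst j) (snd j) y" for j y
  define s :: real where "s = 1 / 20"
  have J: "finite J" unfolding J_def using finite_featset by auto
  have c\<phi>: "continuous_on S2 (\<phi> j)" for j unfolding \<phi>_def by (intro continuous_intros continuous_feat)
  have s: "s > 0" "s\<^sup>2 = 1 / 400" by (simp_all add: s_def power2_eq_square)
  have sb: "sqrt (b n) * sqrt (b n) = b n" for n using b0[of n] by simp
  have SJ: "(\<Sum>j\<in>J. F j) = (\<Sum>n\<in>{1..N}. \<Sum>f\<in>featset n. F (n, f))" for F :: "nat \<times> (nat \<Rightarrow> 3 option) \<Rightarrow> real"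
    unfolding J_def using finite_featset by (subst sum.Sigma) auto
  have d\<phi>: "dev N x (\<phi> j) = sqrt (b (fst j)) * dev N x (feat (fst j) (snd j))" for x j unfolding \<phi>_def by (rule dev_cmult)
  have xS: "x i \<in> S2" if "x \<in> A" "i \<in> {1..N}" for x i using that by (intro space_sphere_config[of x N]) (auto simp: A_def)
  have X2e: "(\<Sum>j\<in>J. (dev N x (\<phi> j))\<^sup>2) = X2 b N x" if x: "x \<in> A" for x
    unfolding SJ X2_def
  proof (rule sum.cong[OF refl])
    fix n
    have "QN N x n = (\<Sum>f\<in>featset n. (dev N x (feat n f))\<^sup>2)" by (rule QN_feat) (erule xS[OF x])
    then show "(\<Sum>f\<in>featset n. (dev N x (\<phi> (n, f)))\<^sup>2) = b n * QN N x n"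
      using b0[of n] by (simp add: d\<phi> power_mult_distrib sum_distrib_left)
  qed
  have X0: "X2 b N x \<ge> 0" if x: "x \<in> A" for x unfolding X2e[OF x, symmetric] by (intro sum_nonneg) auto
  have nb: "0 \<le> (\<Sum>n\<in>{1..N}. real n * b n)" by (intro sum_nonneg mult_nonneg_nonneg b0) auto
  have "emeasure (spherical_ensemble N) A \<le> ennreal (exp (- (\<tau> / 1600 - (\<Sum>n\<in>{1..N}. real n * b n))))"
  proof (rule gaussian_tail[where J=J and \<phi>=\<phi> and s=s and B="\<lambda>x. real N + 1 / 200 * (\<Sum>n\<in>{1..N}. real n * b n) + 1 / 1600 * X2 b N x"])
    show "finite J" "0 < s" "1 \<le> N" "\<And>j. continuous_on S2 (\<phi> j)" by (fact J s(1) N c\<phi>)+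
    have [measurable]: "Yn N \<in> borel_measurable (sphere_config N)" "X2 b N \<in> borel_measurable (sphere_config N)"
      unfolding X2_def[abs_def] by (rule measurable_Yn, intro borel_measurable_sum borel_measurable_times borel_measurable_const measurable_QN)
    show "A \<in> sets (sphere_config N)" unfolding A_def by measurable
    fix x assume x: "x \<in> A"
    show "0 \<le> real N + 1 / 200 * (\<Sum>n\<in>{1..N}. real n * b n) + 1 / 1600 * X2 b N x" using nb X0[OF x] by simp
    have "X2 b N x > \<tau>" using x by (simp add: A_def)
    then show "\<tau> / 1600 - (\<Sum>n\<in>{1..N}. real n * b n) \<le> s\<^sup>2 / 2 * (\<Sum>j\<in>J. (dev N x (\<phi> j))\<^sup>2) + real N - (real N + 1 / 200 * (\<Sum>n\<in>{1..N}. real n * b n) + 1 / 1600 * X2 b N x)"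
      unfolding X2e[OF x] s(2) using nb by simp
    have "(\<integral>\<^sup>+y. (\<integral>\<^sup>+z. ennreal (exp (\<Sum>j\<in>J. (\<phi> j y - \<phi> j z) * (s\<^sup>2 * dev N x (\<phi> j)) + s\<^sup>2 * (\<phi> j y - \<phi> j z)\<^sup>2 / 2) * kk N y z) \<partial>sigma_S2) \<partial>sigma_S2)
      = (\<integral>\<^sup>+y. (\<integral>\<^sup>+z. ennreal (exp (1 / 400 * (vv b N x y - vv b N x z) + 1 / 800 * VV b N y z) * kk N y z) \<partial>sigma_S2) \<partial>sigma_S2)"
    proof (intro nn_integral_sigma_cong)
      fix y z :: "real^3" assume y: "y \<in> S2" and z: "z \<in> S2"
      have 1: "(\<Sum>j\<in>J. (\<phi> j y - \<phi> j z) * (s\<^sup>2 * dev N x (\<phi> j))) = 1 / 400 * (vv b N x y - vv b N x z)"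
      proof -
        have "(\<Sum>j\<in>J. (\<phi> j y - \<phi> j z) * (s\<^sup>2 * dev N x (\<phi> j))) = (\<Sum>n\<in>{1..N}. \<Sum>f\<in>featset n. 1 / 400 * (b n * (dev N x (feat n f) * feat n f y) - b n * (dev N x (feat n f) * feat n f z)))"
          unfolding SJ s(2) d\<phi>
        proof (intro sum.cong refl)
          fix n f
          have "(\<phi> (n, f) y - \<phi> (n, f) z) * (1 / 400 * (sqrt (b (fst (n, f))) * dev N x (feat (fst (n, f)) (snd (n, f)))))
            = 1 / 400 * ((sqrt (b n) * sqrt (b n)) * (dev N x (feat n f) * feat n f y) - (sqrt (b n) * sqrt (b n)) * (dev N x (feat n f) * feat n f z))"
            unfolding \<phi>_def fst_conv snd_conv by (simp only: left_diff_distrib right_diff_distrib mult_ac)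
          then show "(\<phi> (n, f) y - \<phi> (n, f) z) * (1 / 400 * (sqrt (b (fst (n, f))) * dev N x (feat (fst (n, f)) (snd (n, f)))))
            = 1 / 400 * (b n * (dev N x (feat n f) * feat n f y) - b n * (dev N x (feat n f) * feat n f z))" unfolding sb .
        qed
        then show ?thesis unfolding vv_def sum_distrib_left sum_subtractf[symmetric] .
      qed
      have 2: "(\<Sum>j\<in>J. s\<^sup>2 * (\<phi> j y - \<phi> j z)\<^sup>2 / 2) = 1 / 800 * VV b N y z"
      proof -
        have "(\<Sum>j\<in>J. s\<^sup>2 * (\<phi> j y - \<phi> j z)\<^sup>2 / 2) = (\<Sum>n\<in>{1..N}. 1 / 800 * (b n * (\<Sum>f\<in>featset n. (feat n f y - feat n f z)\<^sup>2)))"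
          unfolding SJ s(2) sum_distrib_left
        proof (intro sum.cong refl)
          fix n f
          have "(\<phi> (n, f) y - \<phi> (n, f) z)\<^sup>2 = (sqrt (b n) * (feat n f y - feat n f z))\<^sup>2" by (simp add: \<phi>_def right_diff_distrib)
          also have "\<dots> = b n * (feat n f y - feat n f z)\<^sup>2" using b0[of n] by (simp add: power_mult_distrib)
          finally show "1 / 400 * (\<phi> (n, f) y - \<phi> (n, f) z)\<^sup>2 / 2 = 1 / 800 * (b n * (feat n f y - feat n f z)\<^sup>2)" by simp
        qed
        then show ?thesis unfolding VV_def by (simp only: feat_diff_sq[OF y z] sum_distrib_left)
      qed
      show "ennreal (exp (\<Sum>j\<in>J. (\<phi> j y - \<phi> j z) * (s\<^sup>2 * dev N x (\<phi> j)) + s\<^sup>2 * (\<phi> j y - \<phi> j z)\<^sup>2 / 2) * kk N y z) = ennreal (exp (1 / 400 * (vv b N x y - vv b N x z) + 1 / 800 * VV b N y z) * kk N y z)"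
        unfolding sum.distrib 1 2 ..
    qed
    also have "\<dots> \<le> ennreal (real N + 1 / 200 * (\<Sum>n\<in>{1..N}. real n * b n) + 1 / 1600 * X2 b N x)"
      by (rule tilt_integral_le[OF N _ b0 b]) (erule xS[OF x], assumption, use x in \<open>simp add: A_def\<close>)
    finally show "(\<integral>\<^sup>+y. (\<integral>\<^sup>+z. ennreal (exp (\<Sum>j\<in>J. (\<phi> j y - \<phi> j z) * (s\<^sup>2 * dev N x (\<phi> j)) + s\<^sup>2 * (\<phi> j y - \<phi> j z)\<^sup>2 / 2) * kk N y z) \<partial>sigma_S2) \<partial>sigma_S2) \<le> ennreal (real N + 1 / 200 * (\<Sum>n\<in>{1..N}. real n * b n) + 1 / 1600 * X2 b N x)" .
  qed
  then show ?thesis unfolding A_def .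
qed

section \<open>Assembling the tail bound\<close>

lemma sum_powr_le:
  assumes e: "0 < e"
  shows "(\<Sum>n\<in>{1..N}. real n powr (- 1 - e)) \<le> 1 + 1 / e"
proof (cases "N \<ge> 1")
  case True
  \<comment> \<open>The integral test with telescoping: each term is at most the increment of
    \<open>- n powr (- e) / e\<close>. The singularity of the final bound at
    \<open>\<epsilon> = 0\<close> originates here.\<close>
  then have "(\<Sum>n\<in>{1..N}. real n powr (- 1 - e)) \<le> 1 + (1 - real N powr (- e)) / e"
  proof (induction N rule: dec_induct)
    case base show ?case by simp
  next
    case (step N)
    have N: "real N > 0" using step by simp
    define p where "p = (real N + 1) powr (- e)"
    have p: "p > 0" using N by (simp add: p_def)
    have "e * (1 / (real N + 1)) \<le> e * ln ((real N + 1) / real N)"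
    proof (rule mult_left_mono)
      have "ln (real N / (real N + 1)) \<le> real N / (real N + 1) - 1" using N by (intro ln_le_minus_one) auto
      then show "1 / (real N + 1) \<le> ln ((real N + 1) / real N)" using N by (simp add: ln_div field_simps)
    qed (use e in simp)
    then have "1 + e / (real N + 1) \<le> 1 + e * ln ((real N + 1) / real N)" by simp
    also have "\<dots> \<le> exp (e * ln ((real N + 1) / real N))" by (rule exp_ge_add_one_self)
    finally have "p * (1 + e / (real N + 1)) \<le> p * exp (e * ln ((real N + 1) / real N))" using p by (intro mult_left_mono) auto
    also have "\<dots> = real N powr (- e)"
      using N by (simp add: p_def powr_def ln_div exp_add[symmetric] algebra_simps)
    finally have "p * e / (real N + 1) \<le> real N powr (- e) - p" by (simp add: distrib_left)
    moreover have "(real N + 1) powr (- 1 - e) = p / (real N + 1)"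
      using N by (simp add: p_def powr_diff powr_minus divide_inverse mult.commute)
    ultimately have "(real N + 1) powr (- 1 - e) * e \<le> real N powr (- e) - p" by simp
    then have "(real N + 1) powr (- 1 - e) \<le> (real N powr (- e) - p) / e" using e by (simp add: pos_le_divide_eq)
    then have "real (Suc N) powr (- 1 - e) \<le> (1 - real (Suc N) powr (- e)) / e - (1 - real N powr (- e)) / e"
      by (simp add: p_def diff_divide_distrib add.commute)
    then show ?case using step by simp
  qed
  also have "\<dots> \<le> 1 + 1 / e" using e by (intro add_left_mono divide_right_mono) auto
  finally show ?thesis .
qed (use e in simp)

lemma measure_diff_empirical:
  assumes N: "N \<ge> 1" and xS: "\<And>i. i \<in> {1..N} \<Longrightarrow> x i \<in> S2" and u: "continuous_on S2 u"
  shows "measure_diff (empirical_measure N x) sigma_S2 u = dev N x u / real N"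
proof -
  have m: "x \<in> measurable (uniform_count_measure {1..N}) (restrict_space borel S2)"
    unfolding measurable_def using xS by (auto simp: space_restrict_space sets_uniform_count_measure space_uniform_count_measure simp del: mem_sphere)
  have "(LINT y|empirical_measure N x. u y) = (LINT i|uniform_count_measure {1..N}. u (x i))"
    unfolding empirical_measure_def by (rule integral_distr[OF m S2_cont_measurable[OF u]])
  also have "\<dots> = (\<Sum>i\<in>{1..N}. u (x i)) / real N" by (subst integral_uniform_count_measure) simp_all
  finally show ?thesis using N unfolding measure_diff_def dev_def by (simp add: field_simps)
qed

lemma dual_norm_le:
  assumes N: "N \<ge> 1" and x: "x \<in> space (sphere_config N)" and ep: "\<epsilon> > 0"
    and S: "\<And>M. (\<Sum>k\<in>{1..M}. real k powr - (2 + min \<epsilon> 1) * QN N x k) \<le> S"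
  shows "dual_sobolev_norm (2 + \<epsilon>) (measure_diff (empirical_measure N x) sigma_S2) \<le> ennreal (sqrt (64 * S) / real N)"
  unfolding dual_sobolev_norm_def
proof (rule SUP_least, rule ennreal_leI)
  fix u assume "u \<in> {u \<in> smooth_S2. sobolev_form (2 + \<epsilon>) u \<le> 1}"
  then have u: "u \<in> smooth_S2" "sobolev_form (2 + \<epsilon>) u \<le> 1" by auto
  have xS: "x i \<in> S2" if "i \<in> {1..N}" for i by (rule space_sphere_config[OF x that])
  have "(dev N x u)\<^sup>2 \<le> 64 * S" by (rule dev_sobolev_le[OF u(1) ep u(2) _ S]) (erule xS)
  then have "\<bar>dev N x u\<bar> \<le> sqrt (64 * S)" by (metis real_sqrt_abs real_sqrt_le_iff)
  moreover have "measure_diff (empirical_measure N x) sigma_S2 u = dev N x u / real N"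
    by (rule measure_diff_empirical[OF N _ smooth_S2_continuous[OF u(1)]]) (erule xS)
  ultimately show "\<bar>measure_diff (empirical_measure N x) sigma_S2 u\<bar> \<le> sqrt (64 * S) / real N"
    by (simp add: divide_right_mono)
qed

text \<open>The first bound is for large deviations, which \<open>Yn\<close> settles alone. In the
  second, a frequency \<open>k > N\<close> has weight at most \<open>1 / k^2 = aw N k / N\<close>,
  so all of them together cost only \<open>Yn / N\<close>.\<close>

lemma weighted_QN_le:
  assumes N: "N \<ge> 1" and xS: "\<And>i. i \<in> {1..N} \<Longrightarrow> x i \<in> S2"
    and b0: "\<And>n. b n \<ge> 0" and b: "\<And>n. n \<ge> 1 \<Longrightarrow> b n \<le> 1 / (real n)\<^sup>2"
  shows "(\<Sum>k\<in>{1..M}. b k * QN N x k) \<le> Yn N x" "(\<Sum>k\<in>{1..M}. b k * QN N x k) \<le> X2 b N x + Yn N x / real N"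
proof -
  have N0: "real N \<ge> 1" using N by simp
  have Q: "QN N x k \<ge> 0" for k by (rule QN_nonneg) (erule xS)
  have le1: "1 / (real k)\<^sup>2 \<le> aw N k" if "k \<ge> 1" for k
  proof (cases "k \<le> N")
    case True
    have "1 / (real k)\<^sup>2 \<le> 1 / real k" using that by (intro divide_left_mono) (auto simp: power2_eq_square)
    then show ?thesis using True by (simp add: aw_def)
  next
    case False
    then show ?thesis using N0 by (simp add: aw_def divide_right_mono)
  qed
  have "(\<Sum>k\<in>{1..M}. b k * QN N x k) \<le> (\<Sum>k\<in>{1..M}. aw N k * QN N x k)"
  proof (intro sum_mono mult_right_mono Q)
    fix k assume "k \<in> {1..M}"
    then have k: "k \<ge> 1" by simp
    show "b k \<le> aw N k" by (rule order_trans[OF b[OF k] le1[OF k]])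
  qed
  also have "\<dots> \<le> Yn N x" by (rule sum_le_Yn) (erule xS, simp)
  finally show "(\<Sum>k\<in>{1..M}. b k * QN N x k) \<le> Yn N x" .
  have "(\<Sum>k\<in>{1..M}. b k * QN N x k) \<le> (\<Sum>k\<in>{1..N} \<union> {N<..M}. b k * QN N x k)"
    by (rule sum_mono2) (auto intro!: mult_nonneg_nonneg b0 Q)
  also have "\<dots> = X2 b N x + (\<Sum>k\<in>{N<..M}. b k * QN N x k)"
    unfolding X2_def by (rule sum.union_disjoint) auto
  also have "(\<Sum>k\<in>{N<..M}. b k * QN N x k) \<le> (\<Sum>k\<in>{N<..M}. 1 / real N * (aw N k * QN N x k))"
  proof (rule sum_mono)
    fix k assume k: "k \<in> {N<..M}"
    then have k1: "k \<ge> 1" by simp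
    have "b k * QN N x k \<le> 1 / (real k)\<^sup>2 * QN N x k" by (intro mult_right_mono b k1 Q)
    also have "1 / (real k)\<^sup>2 = 1 / real N * aw N k" using k N0 by (simp add: aw_def)
    finally show "b k * QN N x k \<le> 1 / real N * (aw N k * QN N x k)" by (simp only: mult.assoc)
  qed
  also have "\<dots> \<le> 1 / real N * Yn N x"
    unfolding sum_distrib_left[symmetric] by (intro mult_left_mono sum_le_Yn) (erule xS, simp_all)
  finally show "(\<Sum>k\<in>{1..M}. b k * QN N x k) \<le> X2 b N x + Yn N x / real N" by simp
qed

text \<open>Put \<open>T = N^2 * \<delta>^2\<close>. For \<open>T < 1536\<close> the right side
  exceeds 1. For \<open>T \<ge> 768 * N\<close> the tail of \<open>Yn\<close> at
  \<open>T / 64\<close> is enough. Otherwise the event is covered by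
  \<open>Yn > N * T / 128\<close>, \<open>Yn > 12 * N\<close>, and \<open>X2 > T / 128\<close> with
  \<open>Yn \<le> 12 * N\<close>, the last being the case of \<open>middle_tail\<close>.\<close>

lemma ensemble_tail:
  assumes N: "N \<ge> 1" and ep: "\<epsilon> > 0" and de: "\<delta> > 0"
  defines "E \<equiv> {x \<in> space (spherical_ensemble N).
    dual_sobolev_norm (2 + \<epsilon>) (measure_diff (empirical_measure N x) sigma_S2) > ennreal \<delta>}"
  shows "measure (spherical_ensemble N) E \<le> exp (- (1 / 204800) * (real N)\<^sup>2 * \<delta>\<^sup>2 + 1 / \<epsilon> + 4)"
proof -
  interpret E: prob_space "spherical_ensemble N" by (rule prob_space_ensemble[OF N])
  have N0: "real N \<ge> 1" using N by simp
  define e where "e = min \<epsilon> 1"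
  have e: "e > 0" "1 / e \<le> 1 + 1 / \<epsilon>" using ep by (auto simp: e_def min_def field_simps)
  define b where "b n = real n powr - (2 + e)" for n
  have b0: "b n \<ge> 0" for n by (simp add: b_def)
  have b: "b n \<le> 1 / (real n)\<^sup>2" if n: "n \<ge> 1" for n
  proof -
    have "b n \<le> real n powr - 2" unfolding b_def using n e by (intro powr_mono) auto
    also have "\<dots> = 1 / (real n)\<^sup>2" using n by (simp add: powr_minus_divide)
    finally show ?thesis .
  qed
  have bs: "(\<Sum>n\<in>{1..N}. real n * b n) \<le> 1 + 1 / e"
  proof -
    have "(\<Sum>n\<in>{1..N}. real n * b n) = (\<Sum>n\<in>{1..N}. real n powr (- 1 - e))"
    proof (rule sum.cong[OF refl])
      fix n assume "n \<in> {1..N}"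
      then have n: "real n > 0" by simp
      have "real n * b n = real n powr 1 * real n powr - (2 + e)" using n by (simp add: b_def)
      also have "\<dots> = real n powr (1 + - (2 + e))" by (rule powr_add[symmetric])
      finally show "real n * b n = real n powr (- 1 - e)" by (simp add: algebra_simps)
    qed
    then show ?thesis using sum_powr_le[OF e(1), of N] by simp
  qed
  define T where "T = (real N)\<^sup>2 * \<delta>\<^sup>2"
  have T0: "T > 0" using N0 de by (simp add: T_def)
  define A where "A y = {x \<in> space (sphere_config N). Yn N x > y}" for y
  define D where "D \<tau> = {x \<in> space (sphere_config N). Yn N x \<le> 12 * real N \<and> X2 b N x > \<tau>}" for \<tau>
  have sets: "A y \<in> E.events" "D \<tau> \<in> E.events" for y \<tau>
  proof -
    have [measurable]: "Yn N \<in> borel_measurable (sphere_config N)" "X2 b N \<in> borel_measurable (sphere_config N)"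
      unfolding X2_def[abs_def] by (rule measurable_Yn, intro borel_measurable_sum borel_measurable_times borel_measurable_const measurable_QN)
    show "A y \<in> E.events" "D \<tau> \<in> E.events" unfolding A_def D_def sets_ensemble by measurable
  qed
  have PA: "E.prob (A y) \<le> exp (3 * real N - y / 2)" for y
    using Yn_tail[OF N, of y] unfolding A_def[symmetric] E.emeasure_eq_measure by simp
  have PD: "E.prob (D \<tau>) \<le> exp (- (\<tau> / 1600 - (1 + 1 / e)))" for \<tau>
  proof -
    have "E.prob (D \<tau>) \<le> exp (- (\<tau> / 1600 - (\<Sum>n\<in>{1..N}. real n * b n)))"
      using middle_tail[OF N b0 b, of \<tau>] unfolding D_def[symmetric] E.emeasure_eq_measure by simp
    also have "\<dots> \<le> exp (- (\<tau> / 1600 - (1 + 1 / e)))" using bs by simp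
    finally show ?thesis .
  qed
  have xE: "x \<in> space (sphere_config N)" "T / 64 < Yn N x" "T / 64 < X2 b N x + Yn N x / real N" if "x \<in> E" for x
  proof -
    show x: "x \<in> space (sphere_config N)" using that by (simp add: E_def sets_ensemble)
    have xS: "x i \<in> S2" if "i \<in> {1..N}" for i by (rule space_sphere_config[OF x that])
    have key: "T / 64 < S" if S: "\<And>M. (\<Sum>k\<in>{1..M}. b k * QN N x k) \<le> S" for S
    proof -
      have S0: "0 \<le> S" using S[of 0] by simp
      have "ennreal \<delta> < dual_sobolev_norm (2 + \<epsilon>) (measure_diff (empirical_measure N x) sigma_S2)" using \<open>x \<in> E\<close> by (simp add: E_def)
      also have "\<dots> \<le> ennreal (sqrt (64 * S) / real N)" by (rule dual_norm_le[OF N x ep]) (use S in \<open>simp only: b_def e_def\<close>)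
      finally have "\<delta> < sqrt (64 * S) / real N" using de by (simp add: ennreal_less_iff)
      then have "real N * \<delta> < sqrt (64 * S)" using N0 by (simp add: field_simps)
      then have "(real N * \<delta>)\<^sup>2 < (sqrt (64 * S))\<^sup>2" using N0 de by (intro power_strict_mono) auto
      then show ?thesis using S0 by (simp add: T_def power_mult_distrib)
    qed
    show "T / 64 < Yn N x" by (rule key) (rule weighted_QN_le(1)[OF N _ b0 b], erule xS, assumption)
    show "T / 64 < X2 b N x + Yn N x / real N" by (rule key) (rule weighted_QN_le(2)[OF N _ b0 b], erule xS, assumption)
  qed
  \<comment> \<open>The constant 4 collects 1 from \<open>1 / e \<le> 1 + 1 / \<epsilon>\<close>, 1
    from the trace bound \<open>1 + 1 / e\<close>, and 2 from the factor
    \<open>exp 1 * exp 1\<close> that covers the three events.\<close>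
  have goal: "exp (- (T / 204800) + 2 + 1 / e) * exp 1 \<le> exp (- (1 / 204800) * (real N)\<^sup>2 * \<delta>\<^sup>2 + 1 / \<epsilon> + 4)"
    using e(2) by (simp add: exp_add[symmetric] T_def)
  have e0: "1 / e > 0" using e by simp
  have "measure (spherical_ensemble N) E \<le> exp (- (T / 204800) + 2 + 1 / e) * exp 1"
  proof (cases "T < 1536")
    case True
    have "E.prob E \<le> 1" by simp
    also have "\<dots> \<le> exp (- (T / 204800) + 2 + 1 / e) * exp 1"
    proof -
      have "0 \<le> - (T / 204800) + 2 + 1 / e + 1" using True e0 by linarith
      then show ?thesis unfolding exp_add[symmetric] one_le_exp_iff .
    qed
    finally show ?thesis .
  next
    case T1: False
    show ?thesis
    proof (cases "T \<ge> 768 * real N")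
      case True
      \<comment> \<open>Here \<open>3 * N \<le> T / 256\<close>, so the loss in the density bound
        eats at most half of the exponent \<open>T / 128\<close>.\<close>
      have "E \<subseteq> A (T / 64)" using xE(1,2) unfolding A_def by blast
      then have "E.prob E \<le> E.prob (A (T / 64))" by (rule E.finite_measure_mono[OF _ sets(1)])
      also have "\<dots> \<le> exp (3 * real N - T / 64 / 2)" by (rule PA)
      also have "\<dots> \<le> exp (- (T / 204800) + 2 + 1 / e) * exp 1"
        unfolding exp_add[symmetric] exp_le_cancel_iff using True e0 T0 by linarith
      finally show ?thesis .
    next
      case False
      have "E \<subseteq> A (real N * (T / 128)) \<union> (A (12 * real N) \<union> D (T / 128))"
      proof
        fix x assume x: "x \<in> E"
        show "x \<in> A (real N * (T / 128)) \<union> (A (12 * real N) \<union> D (T / 128))"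
        proof (rule ccontr)
          assume "\<not> ?thesis"
          then have "Yn N x \<le> real N * (T / 128)" "X2 b N x \<le> T / 128" using xE(1)[OF x] by (auto simp: A_def D_def)
          moreover from this have "Yn N x / real N \<le> T / 128" using N0 by (simp add: field_simps)
          ultimately show False using xE(3)[OF x] by linarith
        qed
      qed
      then have "E.prob E \<le> E.prob (A (real N * (T / 128)) \<union> (A (12 * real N) \<union> D (T / 128)))"
        by (rule E.finite_measure_mono) (intro sets.Un sets)
      also have "\<dots> \<le> E.prob (A (real N * (T / 128))) + E.prob (A (12 * real N) \<union> D (T / 128))"
        by (intro measure_Un_le sets.Un sets)
      also have "\<dots> \<le> E.prob (A (real N * (T / 128))) + (E.prob (A (12 * real N)) + E.prob (D (T / 128)))"
        by (intro add_left_mono measure_Un_le sets)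
      also have "\<dots> \<le> exp (- (T / 204800) + 1 + 1 / e) + (exp (- (T / 204800) + 1 + 1 / e) + exp (- (T / 204800) + 1 + 1 / e))"
      proof (intro add_mono)
        have "E.prob (A (real N * (T / 128))) \<le> exp (3 * real N - real N * (T / 128) / 2)" by (rule PA)
        also have "3 * real N - real N * (T / 128) / 2 \<le> - (T / 204800) + 1 + 1 / e"
        proof -
          \<comment> \<open>The threshold 1536 makes the decay \<open>N * T / 256\<close> at least
            \<open>6 * N\<close>, twice the loss \<open>3 * N\<close>.\<close>
          have "real N * (T - 1536) \<ge> 1 * (T - 1536)" using T1 N0 by (intro mult_right_mono) auto
          then have "real N * T \<ge> T - 1536 + 1536 * real N" by (simp add: algebra_simps)
          then show ?thesis using T1 e0 N0 by linarith
        qed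
        finally show "E.prob (A (real N * (T / 128))) \<le> exp (- (T / 204800) + 1 + 1 / e)" by simp
        have "E.prob (A (12 * real N)) \<le> exp (3 * real N - 12 * real N / 2)" by (rule PA)
        \<comment> \<open>In this case \<open>T < 768 * N\<close>, which converts the bound
          \<open>exp (- 3 * N)\<close> into one in terms of \<open>T\<close>.\<close>
        also have "3 * real N - 12 * real N / 2 \<le> - (T / 204800) + 1 + 1 / e" using False e0 by linarith
        finally show "E.prob (A (12 * real N)) \<le> exp (- (T / 204800) + 1 + 1 / e)" by simp
        show "E.prob (D (T / 128)) \<le> exp (- (T / 204800) + 1 + 1 / e)" 
        proof -
          have "- (T / 128 / 1600 - (1 + 1 / e)) = - (T / 204800) + 1 + 1 / e" by simp
          then show ?thesis using PD[of "T / 128"] by (simp only:)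
        qed
      qed
      also have "\<dots> = 3 * exp (- (T / 204800) + 1 + 1 / e)" by simp
      also have "\<dots> \<le> (exp 1 * exp 1) * exp (- (T / 204800) + 1 + 1 / e)"
      proof (rule mult_right_mono)
        have "(2::real) \<le> exp 1" using exp_ge_add_one_self[of 1] by simp
        then have "2 * 2 \<le> exp 1 * (exp 1 :: real)" by (intro mult_mono) auto
        then show "3 \<le> exp 1 * (exp 1 :: real)" by simp
      qed simp
      also have "\<dots> = exp (- (T / 204800) + 2 + 1 / e) * exp 1" by (simp add: exp_add[symmetric])
      finally show ?thesis .
    qed
  qed
  then show ?thesis using goal by linarith
qed

theorem theorem1p3:
  shows "\<exists>A1 A2 A3 :: real. A1 > 0 \<and>
    (\<forall>(N::nat) (\<epsilon>::real) (\<delta>::real). N > 0 \<longrightarrow> \<epsilon> > 0 \<longrightarrow> \<delta> > 0 \<longrightarrow>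
      measure (spherical_ensemble N)
        {x \<in> space (spherical_ensemble N).
           dual_sobolev_norm (2 + \<epsilon>) (measure_diff (empirical_measure N x) sigma_S2) > ennreal \<delta>}
      \<le> exp (- A1 * (real N)\<^sup>2 * \<delta>\<^sup>2 + A2 / \<epsilon> + A3))"
proof (rule exI[of _ "1 / 204800"], rule exI[of _ 1], rule exI[of _ 4], intro conjI allI impI)
  fix N :: nat and \<epsilon> \<delta> :: real
  assume "N > 0" "\<epsilon> > 0" "\<delta> > 0"
  then show "measure (spherical_ensemble N)
        {x \<in> space (spherical_ensemble N).
           dual_sobolev_norm (2 + \<epsilon>) (measure_diff (empirical_measure N x) sigma_S2) > ennreal \<delta>}
      \<le> exp (- (1 / 204800) * (real N)\<^sup>2 * \<delta>\<^sup>2 + 1 / \<epsilon> + 4)"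
    by (intro ensemble_tail) auto
qed simp

end
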